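(* Let $(\Omega,\mathcal F,\{\mathcal F_t\}_{t\ge0},\mathbb P)$ be a filtered probability space satisfying the usual conditions and carrying the space-time white noise $W$, and let $T>0$. Assume that $\sigma:\mathbb R\to\mathbb R$ is globally Lipschitz. Then the equation $$\frac{\partial}{\partial t}u(t,x)=\mathcal L u(t,x)+\sigma(u(t,x))\dot W,\qquad u(0,x)=0,$$ admits a unique (up to modification) mild solution $\{u(t,x):(t,x)\in[0,T]\times\mathbb R\}$ satisfying, for every $p\ge2$, $$\sup_{(t,x)\in[0,T]\times\mathbb R}\mathbb E|u(t,x)|^p<\infty .$$
   Context: Fix positive constants $a_1,a_2,\rho_1,\rho_2$ and set $A(x)=a_1\mathbf 1_{\{x\le 0\}}+a_2\mathbf 1_{\{x>0\}}$, $\rho(x)=\rho_1\mathbf 1_{\{x\le 0\}}+\rho_2\mathbf 1_{\{x>0\}}$, $\mathcal L=\frac{1}{2\rho(x)}\frac{d}{dx}\bigl(\rho(x)A(x)\frac{d}{dx}\bigr)$. Set $f(y)=\frac{y}{\sqrt{a_1}}\mathbf 1_{\{y\le0\}}+\frac{y}{\sqrt{a_2}}\mathbf 1_{\{y>0\}}$, $\alpha=1-\frac{\rho_1a_1}{\rho_2a_2}$, $\beta=\frac{\sqrt{a_1}+\sqrt{a_2}(\alpha-1)}{\sqrt{a_1}-\sqrt{a_2}(\alpha-1)}$. The fundamental solution of $\partial_t u=\mathcal L u$ is, for $t>0$ and $x,y\in\mathbb R$, $$G(t,x,y)=\frac{1}{\sqrt{2\pi t}}\left(\frac{\mathbf 1_{\{y\le0\}}}{\sqrt{a_1}}+\frac{\mathbf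 1_{\{y>0\}}}{\sqrt{a_2}}\right)\left\{\exp\left(-\frac{(f(x)-f(y))^2}{2t}\right)+\beta\,\mathrm{sign}(y)\exp\left(-\frac{(|f(x)|+|f(y)|)^2}{2t}\right)\right\},$$ and $G(t,x,y)=0$ for $t\le0$. $W$ is a space-time white noise: a centered Gaussian family $\{W(t,B)\}$, indexed by $t\ge0$ and Borel sets $B\subset\mathbb R$ of finite Lebesgue measure, with $\mathbb E[W(t,B)W(s,C)]=(t\wedge s)\lambda(B\cap C)$, $\lambda$ being Lebesgue measure. $\mathcal F_t$ is the sigma-algebra generated by $\{W(s,B):0\le s\le t\}$ (augmented so that the usual conditions hold). Integrals $\int\int X(s,y)\,W(ds,dy)$ are Walsh stochastic integrals of predictable, square-integrable random fields $X$; all random fields are jointly measurable and adapted. Globally Lipschitz means $|\sigma(x)-\sigma(y)|\le M|x-y|$ for all $x,y\in\mathbb R$ and some $M>0$. A mild solution on $[0,T]\times\mathbb R$ is a (predictable) random field $u$ such that, for all $(t,x)\in[0,T]\times\mathbb R$, almost surely $$u(t,x)=\int_0^t\int_{\mathbb R}\sigma(u(s,y))G(t-s,x,y)\,W(ds,dy).$$ Two random fields $u,v$ are modifications of one another if $\mathbb P(u(t,x)=v(t,x))=1$ for every $(t,x)$. *)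

theory Defs
  imports "HOL-Probability.Probability"
begin

section \<open>The fundamental solution\<close>

text \<open>
  The kernel below is the fundamental solution of \<open>\<partial>\<^sub>t u = L u\<close>, where
  \<open>L = 1 / (2 \<rho>) d/dx (\<rho> A d/dx)\<close>, \<open>A = a1\<close> and \<open>\<rho> = r1\<close> on \<open>x \<le> 0\<close>,
  \<open>A = a2\<close> and \<open>\<rho> = r2\<close> on \<open>x > 0\<close>.
\<close>

definition scale_fun :: "real \<Rightarrow> real \<Rightarrow> real \<Rightarrow> real" where
  "scale_fun a1 a2 y = (if y \<le> 0 then y / sqrt a1 else y / sqrt a2)"

definition skew_alpha :: "real \<Rightarrow> real \<Rightarrow> real \<Rightarrow> real \<Rightarrow> real" where
  "skew_alpha a1 a2 r1 r2 = 1 - (r1 * a1) / (r2 * a2)"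

definition skew_beta :: "real \<Rightarrow> real \<Rightarrow> real \<Rightarrow> real \<Rightarrow> real" where
  "skew_beta a1 a2 r1 r2 =
     (sqrt a1 + sqrt a2 * (skew_alpha a1 a2 r1 r2 - 1)) /
     (sqrt a1 - sqrt a2 * (skew_alpha a1 a2 r1 r2 - 1))"

definition fund_sol ::
    "real \<Rightarrow> real \<Rightarrow> real \<Rightarrow> real \<Rightarrow> real \<Rightarrow> real \<Rightarrow> real \<Rightarrow> real" where
  "fund_sol a1 a2 r1 r2 t x y =
     (if t \<le> 0 then 0
      else 1 / sqrt (2 * pi * t) * (if y \<le> 0 then 1 / sqrt a1 else 1 / sqrt a2) *
        (exp (- ((scale_fun a1 a2 x - scale_fun a1 a2 y)\<^sup>2 / (2 * t))) +
         skew_beta a1 a2 r1 r2 * sgn y *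
           exp (- ((\<bar>scale_fun a1 a2 x\<bar> + \<bar>scale_fun a1 a2 y\<bar>)\<^sup>2 / (2 * t)))))"


section \<open>Space-time white noise and its filtration\<close>

text \<open>Degenerate Gaussians (variance \<open>0\<close>) are included.\<close>

definition centered_gaussian :: "'w measure \<Rightarrow> ('w \<Rightarrow> real) \<Rightarrow> bool" where
  "centered_gaussian M X \<longleftrightarrow>
     X \<in> borel_measurable M \<and>
     ((AE \<omega> in M. X \<omega> = 0) \<or> (\<exists>s>0. distributed M lborel X (normal_density 0 s)))"

text \<open>A family of random variables is Gaussian if all its finite linear combinations are.\<close>

definition centered_gaussian_family ::
    "'w measure \<Rightarrow> 'i set \<Rightarrow> ('i \<Rightarrow> 'w \<Rightarrow> real) \<Rightarrow> bool" where
  "centered_gaussian_family M I X \<longleftrightarrow>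
     (\<forall>J c. finite J \<and> J \<subseteq> I \<longrightarrow> centered_gaussian M (\<lambda>\<omega>. \<Sum>i\<in>J. c i * X i \<omega>))"

definition finite_borel_sets :: "real set set" where
  "finite_borel_sets = {B \<in> sets borel. emeasure lborel B < \<infinity>}"

text \<open>The values \<open>W t B\<close> with \<open>t < 0\<close> or \<open>B \<notin> finite_borel_sets\<close> are irrelevant.\<close>

definition white_noise :: "'w measure \<Rightarrow> (real \<Rightarrow> real set \<Rightarrow> 'w \<Rightarrow> real) \<Rightarrow> bool" where
  "white_noise M W \<longleftrightarrow>
     centered_gaussian_family M ({0..} \<times> finite_borel_sets) (\<lambda>(t, B). W t B) \<and>
     (\<forall>t\<ge>0. \<forall>s\<ge>0. \<forall>B\<in>finite_borel_sets. \<forall>C\<in>finite_borel_sets.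
        (\<integral>\<omega>. W t B \<omega> * W s C \<omega> \<partial>M) = min t s * measure lborel (B \<inter> C))"

definition noise_events ::
    "'w measure \<Rightarrow> (real \<Rightarrow> real set \<Rightarrow> 'w \<Rightarrow> real) \<Rightarrow> real \<Rightarrow> 'w set set" where
  "noise_events M W t =
     {W s B -` C \<inter> space M | s B C. 0 \<le> s \<and> s \<le> t \<and> B \<in> finite_borel_sets \<and> C \<in> sets borel}"

text \<open>
  The usual augmentation of the filtration generated by the noise: adjoin the null sets, then
  pass to right limits.
\<close>

definition augmented_noise_sets ::
    "'w measure \<Rightarrow> (real \<Rightarrow> real set \<Rightarrow> 'w \<Rightarrow> real) \<Rightarrow> real \<Rightarrow> 'w set set" where
  "augmented_noise_sets M W t =
     (\<Inter>r\<in>{t<..}. sigma_sets (space M) (noise_events M W r \<union> null_sets M))"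

text \<open>
  Filtrations are indexed by \<open>t \<ge> 0\<close>. Since the library predicate \<^locale>\<open>filtration\<close> speaks about
  all indices of the type, negative indices are clamped to \<open>0\<close> there.
\<close>

definition usual_conditions :: "'w measure \<Rightarrow> (real \<Rightarrow> 'w measure) \<Rightarrow> bool" where
  "usual_conditions M F \<longleftrightarrow>
     complete_measure M \<and>
     filtration (space M) (\<lambda>t. F (max 0 t)) \<and>
     (\<forall>t\<ge>0. subalgebra M (F t)) \<and>
     null_sets M \<subseteq> sets (F 0) \<and>
     (\<forall>t\<ge>0. sets (F t) = (\<Inter>r\<in>{t<..}. sets (F r)))"


section \<open>The Walsh integral\<close>

definition predictable_algebra ::
    "'w measure \<Rightarrow> (real \<Rightarrow> 'w measure) \<Rightarrow> real \<Rightarrow> (real \<times> real \<times> 'w) measure" where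
  "predictable_algebra M F t = sigma ({0..t} \<times> UNIV \<times> space M)
     ({{0} \<times> B \<times> A | B A. B \<in> sets borel \<and> A \<in> sets (F 0)} \<union>
      {{a<..b} \<times> B \<times> A | a b B A. 0 \<le> a \<and> a < b \<and> b \<le> t \<and> B \<in> sets borel \<and> A \<in> sets (F a)})"

text \<open>
  Predictability on \<open>[0, t] \<times> \<real> \<times> \<Omega>\<close>; values of the field outside this set are irrelevant.
  Predictable fields are in particular jointly measurable and adapted.
\<close>

definition predictable_field ::
    "'w measure \<Rightarrow> (real \<Rightarrow> 'w measure) \<Rightarrow> real \<Rightarrow> (real \<Rightarrow> real \<Rightarrow> 'w \<Rightarrow> real) \<Rightarrow> bool" where
  "predictable_field M F t X \<longleftrightarrow>
     (\<lambda>(s, y, \<omega>). X s y \<omega>) \<in> borel_measurable (predictable_algebra M F t)"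

definition field_measure :: "'w measure \<Rightarrow> real \<Rightarrow> (real \<times> real \<times> 'w) measure" where
  "field_measure M t = restrict_space lborel {0..t} \<Otimes>\<^sub>M lborel \<Otimes>\<^sub>M M"

text \<open>
  An entry \<open>(a, b, B, Z)\<close> stands for the elementary field \<open>Z(\<omega>) 1\<^bsub>(a,b]\<^esub>(s) 1\<^bsub>B\<^esub>(y)\<close>,
  a list of entries for the sum of the corresponding elementary fields.
\<close>

type_synonym 'w simple_field = "(real \<times> real \<times> real set \<times> ('w \<Rightarrow> real)) list"

definition is_simple_field ::
    "'w measure \<Rightarrow> (real \<Rightarrow> 'w measure) \<Rightarrow> real \<Rightarrow> 'w simple_field \<Rightarrow> bool" where
  "is_simple_field M F t es \<longleftrightarrow>
     (\<forall>(a, b, B, Z)\<in>set es. 0 \<le> a \<and> a < b \<and> b \<le> t \<and> B \<in> finite_borel_sets \<and>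
        Z \<in> borel_measurable (F a) \<and> bounded (Z ` space M))"

definition simple_field_val :: "'w simple_field \<Rightarrow> real \<Rightarrow> real \<Rightarrow> 'w \<Rightarrow> real" where
  "simple_field_val es s y \<omega> =
     (\<Sum>(a, b, B, Z)\<leftarrow>es. Z \<omega> * indicator {a<..b} s * indicator B y)"

definition simple_walsh_integral ::
    "(real \<Rightarrow> real set \<Rightarrow> 'w \<Rightarrow> real) \<Rightarrow> 'w simple_field \<Rightarrow> 'w \<Rightarrow> real" where
  "simple_walsh_integral W es \<omega> = (\<Sum>(a, b, B, Z)\<leftarrow>es. Z \<omega> * (W b B \<omega> - W a B \<omega>))"

definition walsh_integrable ::
    "'w measure \<Rightarrow> (real \<Rightarrow> 'w measure) \<Rightarrow> real \<Rightarrow> (real \<Rightarrow> real \<Rightarrow> 'w \<Rightarrow> real) \<Rightarrow> bool" where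
  "walsh_integrable M F t X \<longleftrightarrow>
     predictable_field M F t X \<and>
     (\<integral>\<^sup>+(s, y, \<omega>). ennreal ((X s y \<omega>)\<^sup>2) \<partial>field_measure M t) < \<infinity>"

text \<open>
  \<open>I\<close> is a version of the integral of \<open>X\<close> over \<open>[0, t] \<times> \<real>\<close>: simple fields converge to \<open>X\<close>
  in \<open>L\<^sup>2(ds dy dP)\<close> while their integrals converge to \<open>I\<close> in \<open>L\<^sup>2(dP)\<close>.
\<close>

definition has_walsh_integral ::
    "'w measure \<Rightarrow> (real \<Rightarrow> 'w measure) \<Rightarrow> (real \<Rightarrow> real set \<Rightarrow> 'w \<Rightarrow> real) \<Rightarrow> real \<Rightarrow>
     (real \<Rightarrow> real \<Rightarrow> 'w \<Rightarrow> real) \<Rightarrow> ('w \<Rightarrow> real) \<Rightarrow> bool" where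
  "has_walsh_integral M F W t X I \<longleftrightarrow>
     walsh_integrable M F t X \<and> I \<in> borel_measurable M \<and>
     (\<exists>e. (\<forall>n. is_simple_field M F t (e n)) \<and>
        (\<lambda>n. \<integral>\<^sup>+(s, y, \<omega>). ennreal ((X s y \<omega> - simple_field_val (e n) s y \<omega>)\<^sup>2)
                \<partial>field_measure M t) \<longlonglongrightarrow> 0 \<and>
        (\<lambda>n. \<integral>\<^sup>+\<omega>. ennreal ((I \<omega> - simple_walsh_integral W (e n) \<omega>)\<^sup>2) \<partial>M) \<longlonglongrightarrow> 0)"

text \<open>The integral is determined only up to almost sure equality; this picks one version.\<close>

definition walsh_integral ::
    "'w measure \<Rightarrow> (real \<Rightarrow> 'w measure) \<Rightarrow> (real \<Rightarrow> real set \<Rightarrow> 'w \<Rightarrow> real) \<Rightarrow> real \<Rightarrow>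
     (real \<Rightarrow> real \<Rightarrow> 'w \<Rightarrow> real) \<Rightarrow> 'w \<Rightarrow> real" where
  "walsh_integral M F W t X = (SOME I. has_walsh_integral M F W t X I)"


section \<open>Mild solutions\<close>

definition mild_solution ::
    "'w measure \<Rightarrow> (real \<Rightarrow> 'w measure) \<Rightarrow> (real \<Rightarrow> real set \<Rightarrow> 'w \<Rightarrow> real) \<Rightarrow>
     (real \<Rightarrow> real \<Rightarrow> real \<Rightarrow> real) \<Rightarrow> (real \<Rightarrow> real) \<Rightarrow> real \<Rightarrow> (real \<Rightarrow> real \<Rightarrow> 'w \<Rightarrow> real) \<Rightarrow> bool" where
  "mild_solution M F W G \<sigma> T u \<longleftrightarrow>
     predictable_field M F T u \<and>
     (\<forall>t\<in>{0..T}. \<forall>x.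
        walsh_integrable M F t (\<lambda>s y \<omega>. \<sigma> (u s y \<omega>) * G (t - s) x y) \<and>
        (AE \<omega> in M. u t x \<omega> =
           walsh_integral M F W t (\<lambda>s y \<omega>. \<sigma> (u s y \<omega>) * G (t - s) x y) \<omega>))"

definition bounded_moments ::
    "'w measure \<Rightarrow> real \<Rightarrow> (real \<Rightarrow> real \<Rightarrow> 'w \<Rightarrow> real) \<Rightarrow> bool" where
  "bounded_moments M T u \<longleftrightarrow>
     (\<forall>p\<ge>2. (SUP (t, x)\<in>{0..T} \<times> UNIV. \<integral>\<^sup>+\<omega>. ennreal (\<bar>u t x \<omega>\<bar> powr p) \<partial>M) < \<infinity>)"

definition modification_on ::
    "'w measure \<Rightarrow> real \<Rightarrow> (real \<Rightarrow> real \<Rightarrow> 'w \<Rightarrow> real) \<Rightarrow> (real \<Rightarrow> real \<Rightarrow> 'w \<Rightarrow> real) \<Rightarrow> bool" where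
  "modification_on M T u v \<longleftrightarrow> (\<forall>t\<in>{0..T}. \<forall>x. AE \<omega> in M. u t x \<omega> = v t x \<omega>)"

end

theory Submission imports Defs begin

text \<open>
  Increments of the noise after time \<open>s\<close> are Gaussian and independent of the past up to \<open>s\<close>. Hence
  the even moments of the integral of a simple field can be estimated one Gaussian cell at a time,
  which gives a Burkholder-Davis-Gundy inequality with constant \<open>2 m - 1\<close>. By density of the simple
  fields it extends to all Walsh integrals. The kernel \<open>G\<close> is dominated by Gaussian kernels and so
  satisfies \<open>\<integral>\<integral> exp (\<lambda> s) (G (t - s) x y)\<^sup>2 ds dy \<le> \<epsilon> exp (\<lambda> t)\<close> for large \<open>\<lambda>\<close>, which makes the Picard map
  a contraction in \<open>L\<^sup>2\<close> with weight \<open>exp (\<lambda> t)\<close>, and one that preserves bounds of the form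
  \<open>E (u t x)\<^sup>2\<^sup>m \<le> exp (\<lambda> m t)\<close>. The stochastic convolution is \<open>L\<^sup>2\<close>-continuous, so it has a predictable
  version and the iteration can be repeated.
\<close>


section \<open>Gaussian variables\<close>

context prob_space
begin

text \<open>The noise is given only through Gaussian laws and covariances, the filtration only as a
  usual augmentation. Neither additivity in the set nor independence of the augmented past is
  granted: the former is recovered almost surely from covariances, the latter through characteristic
  functions and a limit from the right. Treating one cell at a time replaces martingale theory and
  Ito's formula; it needs an order of the cells in which each is independent of what was summed
  before it, hence the refinement of simple fields. The scale in which the cell bounds add up is the
  m-th root of the 2m-th moment, that is, the L^m norm of the square. In this scale the bound for a
  simple field is an integral over time and space, which passes to limits. The weight exp (\<lambda>
  t) is chosen separately for each m but never depends on the Picard iterate, so Fatou's lemma hands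
  every moment bound to the limit. Many inequalities are crude by factors of 2 or 4; a large
  \<lambda> absorbs these losses.\<close>

lemma centered_gaussian_measurable:
  "centered_gaussian M X \<Longrightarrow> X \<in> borel_measurable M"
  by (simp add: centered_gaussian_def)

lemma gaussian_distr:
  assumes s: "s > 0" and X: "distributed M lborel X (normal_density 0 s)"
  shows "distr M lborel (\<lambda>\<omega>. X \<omega> / s) = std_normal_distribution"
proof -
  have "distributed M lborel (\<lambda>x. X x / s) std_normal_density"
    using X normal_standard_normal_convert[OF s, of X 0] by simp
  then show ?thesis
    by (rule distributed_distr_eq_density)
qed

text \<open>The factor is the double factorial (2j - 1)!!. Writing the even moments through the
  second moment, and not through a standard deviation, includes the degenerate law: for
  \<open>j = 0\<close> both sides are 1, otherwise both are 0.\<close>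

lemma gaussian_moment:
  assumes X: "centered_gaussian M X"
  shows integrable_gaussian_power: "integrable M (\<lambda>\<omega>. X \<omega> ^ k)"
    and gaussian_moment_odd: "odd k \<Longrightarrow> expectation (\<lambda>\<omega>. X \<omega> ^ k) = 0"
    and gaussian_moment_even: "expectation (\<lambda>\<omega>. X \<omega> ^ (2 * j)) =
      fact (2 * j) / (2 ^ j * fact j) * expectation (\<lambda>\<omega>. (X \<omega>)\<^sup>2) ^ j"
proof -
  have [measurable]: "X \<in> borel_measurable M" using X by (simp add: centered_gaussian_def)
  consider "AE \<omega> in M. X \<omega> = 0" | s where "s > 0" "distributed M lborel X (normal_density 0 s)"
    using X by (auto simp: centered_gaussian_def)
  then have "integrable M (\<lambda>\<omega>. X \<omega> ^ k) \<and> (odd k \<longrightarrow> expectation (\<lambda>\<omega>. X \<omega> ^ k) = 0) \<and>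
    expectation (\<lambda>\<omega>. X \<omega> ^ (2 * j)) =
      fact (2 * j) / (2 ^ j * fact j) * expectation (\<lambda>\<omega>. (X \<omega>)\<^sup>2) ^ j" for k j
  proof cases
    case 1
    have *: "expectation (\<lambda>\<omega>. X \<omega> ^ k) = 0 ^ k" for k
    proof -
      have "expectation (\<lambda>\<omega>. X \<omega> ^ k) = expectation (\<lambda>\<omega>. 0 ^ k)"
        using 1 by (intro integral_cong_AE) auto
      then show ?thesis by (simp add: prob_space)
    qed
    have "integrable M (\<lambda>\<omega>. X \<omega> ^ k)"
    proof (rule integrable_cong_AE_imp[of M "\<lambda>_. 0 ^ k"])
      show "AE x in M. 0 ^ k = X x ^ k" using 1 by auto
    qed auto
    then show ?thesis by (cases "j = 0") (auto simp: * zero_power odd_pos prob_space)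
  next
    case 2
    have D: "distributed M lborel X (\<lambda>x. ennreal (normal_density 0 s x))" using 2 by simp
    have i: "integrable M (\<lambda>\<omega>. X \<omega> ^ k)" for k
      using integrable_normal_moment[OF 2(1), of 0 k]
      by (subst distributed_integrable[OF D, symmetric]) (auto)
    have e: "expectation (\<lambda>\<omega>. X \<omega> ^ k) = (\<integral>x. normal_density 0 s x * x ^ k \<partial>lborel)" for k
      by (subst distributed_integral[OF D, symmetric]) auto
    have ev: "expectation (\<lambda>\<omega>. X \<omega> ^ (2 * j)) = fact (2 * j) / ((2 / s\<^sup>2) ^ j * fact j)" for j
      using integral_normal_moment_even[OF 2(1), of 0 j] by (simp add: e)
    have v: "expectation (\<lambda>\<omega>. (X \<omega>)\<^sup>2) = s\<^sup>2"
      using ev[of 1] 2(1) by (simp add: power2_eq_square)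
    have od: "odd k \<longrightarrow> expectation (\<lambda>\<omega>. X \<omega> ^ k) = 0"
      using integral_normal_moment_odd[OF 2(1), of 0 "k div 2"] by (auto simp: e elim!: oddE)
    show ?thesis
      unfolding v ev using i od 2(1) by (auto simp: power_divide field_simps)
  qed
  then show "integrable M (\<lambda>\<omega>. X \<omega> ^ k)" "odd k \<Longrightarrow> expectation (\<lambda>\<omega>. X \<omega> ^ k) = 0"
    "expectation (\<lambda>\<omega>. X \<omega> ^ (2 * j)) =
      fact (2 * j) / (2 ^ j * fact j) * expectation (\<lambda>\<omega>. (X \<omega>)\<^sup>2) ^ j"
    by blast+
qed

text \<open>Since only the second moment enters, the exponent is additive under sums of uncorrelated
  variables, and the degenerate law is no exception.\<close>

lemma gaussian_char:
  assumes X: "centered_gaussian M X"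
  shows "(CLINT \<omega>|M. iexp (t * X \<omega>)) = complex_of_real (exp (- (t\<^sup>2 * expectation (\<lambda>\<omega>. (X \<omega>)\<^sup>2) / 2)))"
proof -
  have [measurable]: "X \<in> borel_measurable M" using X by (simp add: centered_gaussian_def)
  consider "AE \<omega> in M. X \<omega> = 0" | s where "s > 0" "distributed M lborel X (normal_density 0 s)"
    using X by (auto simp: centered_gaussian_def)
  then show ?thesis
  proof cases
    case 1
    have "(CLINT \<omega>|M. iexp (t * X \<omega>)) = (CLINT \<omega>|M. 1)"
      using 1 by (intro integral_cong_AE) auto
    moreover have "expectation (\<lambda>\<omega>. (X \<omega>)\<^sup>2) = expectation (\<lambda>\<omega>. 0)"
      using 1 by (intro integral_cong_AE) auto
    ultimately show ?thesis by (simp add: prob_space)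
  next
    case 2
    have D: "distributed M lborel X (\<lambda>x. ennreal (normal_density 0 s x))" using 2 by simp
    have v: "expectation (\<lambda>\<omega>. (X \<omega>)\<^sup>2) = s\<^sup>2"
      using integral_normal_moment_even[OF 2(1), of 0 1] 2(1)
      by (subst distributed_integral[OF D, symmetric]) (auto simp: power2_eq_square)
    have "(CLINT \<omega>|M. iexp (t * X \<omega>)) = (CLINT \<omega>|M. iexp ((t * s) * (X \<omega> / s)))"
      using 2(1) by simp
    also have "\<dots> = (CLINT x|distr M lborel (\<lambda>\<omega>. X \<omega> / s). iexp ((t * s) * x))"
      by (subst integral_distr) auto
    also have "\<dots> = char std_normal_distribution (t * s)"
      unfolding gaussian_distr[OF 2] char_def by simp
    finally show ?thesis
      by (simp add: char_std_normal_distribution v power_mult_distrib)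
  qed
qed

text \<open>Levy's uniqueness theorem for the law of \<open>X\<close> under the signed measure with density \<open>K\<close>.\<close>

lemma char_weight_real:
  fixes K X :: "'a \<Rightarrow> real"
  assumes [measurable]: "K \<in> borel_measurable M" "X \<in> borel_measurable M" "C \<in> sets borel"
    and K: "\<And>\<omega>. \<bar>K \<omega>\<bar> \<le> B"
    and ch: "\<And>t. (CLINT \<omega>|M. of_real (K \<omega>) * iexp (t * X \<omega>)) = 0"
  shows "expectation (\<lambda>\<omega>. K \<omega> * indicator C (X \<omega>)) = 0"
proof -
  define P where "P \<omega> = max 0 (K \<omega>)" for \<omega>
  define N where "N \<omega> = max 0 (- K \<omega>)" for \<omega>
  have PN: "K \<omega> = P \<omega> - N \<omega>" for \<omega> by (auto simp: P_def N_def)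
  have nn: "P \<omega> \<ge> 0" "N \<omega> \<ge> 0" for \<omega> by (auto simp: P_def N_def)
  have B0: "B \<ge> 0" using K[of undefined] by linarith
  have bd: "P \<omega> \<le> B" "N \<omega> \<le> B" for \<omega> using K[of \<omega>] by (auto simp: P_def N_def)
  have [measurable]: "P \<in> borel_measurable M" "N \<in> borel_measurable M"
    unfolding P_def[abs_def] N_def[abs_def] by auto
  have iP[simp]: "integrable M P" and iN[simp]: "integrable M N"
    using bd nn by (auto intro!: integrable_const_bound[of _ B])
  have iPc: "integrable M (\<lambda>\<omega>. of_real (P \<omega>) * iexp (t * X \<omega>))"
    and iNc: "integrable M (\<lambda>\<omega>. of_real (N \<omega>) * iexp (t * X \<omega>))" for t
    using bd nn by (auto intro!: integrable_const_bound[of _ B] simp: norm_mult)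
  have eqc: "(CLINT \<omega>|M. of_real (P \<omega>) * iexp (t * X \<omega>)) = (CLINT \<omega>|M. of_real (N \<omega>) * iexp (t * X \<omega>))" for t
  proof -
    have "(CLINT \<omega>|M. of_real (P \<omega>) * iexp (t * X \<omega>)) - (CLINT \<omega>|M. of_real (N \<omega>) * iexp (t * X \<omega>)) =
      (CLINT \<omega>|M. of_real (K \<omega>) * iexp (t * X \<omega>))"
      by (subst Bochner_Integration.integral_diff[symmetric, OF iPc iNc])
        (simp add: PN algebra_simps)
    then show ?thesis using ch[of t] by simp
  qed
  define m where "m = expectation P"
  \<comment> \<open>The case \<open>t = 0\<close> of the hypothesis: positive and negative part of
    \<open>K\<close> have the same mass, so one constant normalizes both to probability
    densities.\<close>
  have mN: "expectation N = m"
    using eqc[of 0] by (simp add: m_def)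
  have m0: "m \<ge> 0" unfolding m_def using nn by simp
  have split: "expectation (\<lambda>\<omega>. K \<omega> * indicator C (X \<omega>)) =
     expectation (\<lambda>\<omega>. P \<omega> * indicator C (X \<omega>)) - expectation (\<lambda>\<omega>. N \<omega> * indicator C (X \<omega>))"
    using bd nn B0
    by (subst Bochner_Integration.integral_diff[symmetric])
      (auto simp: PN algebra_simps intro!: integrable_const_bound[of _ B] split: split_indicator)
  show ?thesis
  proof (cases "m = 0")
    case True
    have "AE \<omega> in M. P \<omega> = 0" "AE \<omega> in M. N \<omega> = 0"
      using True nn mN by (auto simp: integral_nonneg_eq_0_iff_AE[symmetric] m_def)
    then have "AE \<omega> in M. K \<omega> * indicator C (X \<omega>) = 0" by eventually_elim (auto simp: PN)
    then have "expectation (\<lambda>\<omega>. K \<omega> * indicator C (X \<omega>)) = expectation (\<lambda>_. 0)"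
      by (intro integral_cong_AE) auto
    then show ?thesis by simp
  next
    case False
    then have m: "m > 0" using m0 by simp
    define D where "D Q = distr (density M (\<lambda>\<omega>. ennreal (Q \<omega> / m))) borel X" for Q :: "'a \<Rightarrow> real"
    have rd: "real_distribution (D Q)" and cD: "char (D Q) t = (CLINT \<omega>|M. of_real (Q \<omega>) * iexp (t * X \<omega>)) / m"
      and mD: "measure (D Q) C = expectation (\<lambda>\<omega>. Q \<omega> * indicator C (X \<omega>)) / m"
      if [measurable]: "Q \<in> borel_measurable M" and i: "integrable M Q" and n: "\<And>\<omega>. Q \<omega> \<ge> 0" 
       and e: "expectation Q = m" and b: "\<And>\<omega>. Q \<omega> \<le> B" for Q t
    proof -
      have "emeasure (density M (\<lambda>\<omega>. ennreal (Q \<omega> / m))) (space M) = ennreal (expectation (\<lambda>\<omega>. Q \<omega> / m))"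
        using i n m by (subst emeasure_density) (auto simp: nn_integral_eq_integral indicator_def cong: nn_integral_cong_simp)
      also have "\<dots> = 1" using e m by simp
      finally have ps: "prob_space (density M (\<lambda>\<omega>. ennreal (Q \<omega> / m)))"
        by (intro prob_spaceI) simp
      interpret d: prob_space "density M (\<lambda>\<omega>. ennreal (Q \<omega> / m))" by (rule ps)
      have X': "X \<in> measurable (density M (\<lambda>\<omega>. ennreal (Q \<omega> / m))) borel" by simp
      show "real_distribution (D Q)" unfolding D_def
        by (rule d.real_distribution_distr[OF X'])
      show "char (D Q) t = (CLINT \<omega>|M. of_real (Q \<omega>) * iexp (t * X \<omega>)) / m"
        unfolding D_def char_def
        by (subst integral_distr) (auto simp: integral_density n m scaleR_conv_of_real less_imp_le)
      have "measure (D Q) C = (\<integral>x. indicator C x \<partial>D Q)" unfolding D_def by simp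
      also have "\<dots> = expectation (\<lambda>\<omega>. (Q \<omega> / m) * indicator C (X \<omega>))"
        unfolding D_def 
        by (subst integral_distr) (auto simp: integral_density n m less_imp_le)
      finally show "measure (D Q) C = expectation (\<lambda>\<omega>. Q \<omega> * indicator C (X \<omega>)) / m"
        by simp
    qed
    \<comment> \<open>The laws of \<open>X\<close> under the two normalized densities have the same
      characteristic function.\<close>
    have "D P = D N"
      by (intro Levy_uniqueness rd ext) (simp_all add: cD nn bd mN m_def[symmetric] eqc[unfolded of_real_mult] mult.assoc)
    then have "expectation (\<lambda>\<omega>. P \<omega> * indicator C (X \<omega>)) / m = expectation (\<lambda>\<omega>. N \<omega> * indicator C (X \<omega>)) / m"
      by (subst mD[symmetric], auto simp: nn bd m_def[symmetric])
         (subst mD[symmetric], auto simp: nn bd mN)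
    then show ?thesis using m split by simp
  qed
qed

text \<open>Conjugating the hypothesis at \<open>- t\<close> yields the same hypothesis for
  \<open>cnj K\<close>; half sum and half difference then yield it for the real and imaginary parts.
  Complex weights occur because a weight gets multiplied by test functions built from
  \<open>iexp\<close>.\<close>

lemma char_weight:
  fixes K :: "'a \<Rightarrow> complex"
  assumes [measurable]: "K \<in> borel_measurable M" "X \<in> borel_measurable M" "C \<in> sets borel"
    and K: "\<And>\<omega>. norm (K \<omega>) \<le> B"
    and ch: "\<And>t. (CLINT \<omega>|M. K \<omega> * iexp (t * X \<omega>)) = 0"
  shows "(CLINT \<omega>|M. K \<omega> * indicator C (X \<omega>)) = 0"
proof -
  have i: "integrable M (\<lambda>\<omega>. K \<omega> * iexp (t * X \<omega>))" for t
    using K by (auto intro!: integrable_const_bound[of _ B] simp: norm_mult)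
  have [measurable]: "(\<lambda>\<omega>. cnj (K \<omega>)) \<in> borel_measurable M"
    by (intro borel_measurable_continuous_on[where f=cnj] continuous_intros) auto
  have i': "integrable M (\<lambda>\<omega>. cnj (K \<omega>) * iexp (t * X \<omega>))" for t
    using K by (auto intro!: integrable_const_bound[of _ B] simp: norm_mult)
  have cnj0: "(CLINT \<omega>|M. cnj (K \<omega>) * iexp (t * X \<omega>)) = 0" for t
  proof -
    have "(CLINT \<omega>|M. cnj (K \<omega>) * iexp (t * X \<omega>)) = (CLINT \<omega>|M. cnj (K \<omega> * iexp ((- t) * X \<omega>)))"
      by (intro Bochner_Integration.integral_cong) (auto simp: exp_cnj)
    also have "\<dots> = cnj (CLINT \<omega>|M. (K \<omega> * iexp ((- t) * X \<omega>)))"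
      by (rule integral_bounded_linear[OF bounded_linear_cnj i])
    finally show ?thesis using ch[of "-t"] by simp
  qed
  have re: "(CLINT \<omega>|M. of_real (Re (K \<omega>)) * iexp (t * X \<omega>)) = 0" for t
  proof -
    have "(CLINT \<omega>|M. of_real (Re (K \<omega>)) * iexp (t * X \<omega>)) =
      (CLINT \<omega>|M. (1/2) * (K \<omega> * iexp (t * X \<omega>) + cnj (K \<omega>) * iexp (t * X \<omega>)))"
      by (intro Bochner_Integration.integral_cong refl)
         (auto simp: distrib_right[symmetric] complex_add_cnj)
    also have "\<dots> = 0"
      unfolding integral_mult_right_zero Bochner_Integration.integral_add[OF i i'] ch cnj0 by simp
    finally show ?thesis .
  qed
  have im: "(CLINT \<omega>|M. of_real (Im (K \<omega>)) * iexp (t * X \<omega>)) = 0" for t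
  proof -
    have "(CLINT \<omega>|M. of_real (Im (K \<omega>)) * iexp (t * X \<omega>)) =
      (CLINT \<omega>|M. (-\<i>/2) * (K \<omega> * iexp (t * X \<omega>) - cnj (K \<omega>) * iexp (t * X \<omega>)))"
    proof (intro Bochner_Integration.integral_cong refl)
      fix \<omega>
      have "- \<i> / 2 * (K \<omega> - cnj (K \<omega>)) = of_real (Im (K \<omega>))" by (simp add: complex_diff_cnj complex_eq_iff)
      then show "of_real (Im (K \<omega>)) * iexp (t * X \<omega>) =
        - \<i> / 2 * (K \<omega> * iexp (t * X \<omega>) - cnj (K \<omega>) * iexp (t * X \<omega>))"
        by (metis left_diff_distrib mult.assoc)
    qed
    also have "\<dots> = 0"
      unfolding integral_mult_right_zero Bochner_Integration.integral_diff[OF i i'] ch cnj0 by simp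
    finally show ?thesis .
  qed
  have r0: "expectation (\<lambda>\<omega>. Re (K \<omega>) * indicator C (X \<omega>)) = 0"
    by (rule char_weight_real[where B=B, OF _ _ _ _ re]) (auto intro: order_trans[OF abs_Re_le_cmod K])
  have i0: "expectation (\<lambda>\<omega>. Im (K \<omega>) * indicator C (X \<omega>)) = 0"
    by (rule char_weight_real[where B=B, OF _ _ _ _ im]) (auto intro: order_trans[OF abs_Im_le_cmod K])
  have iC: "integrable M (\<lambda>\<omega>. K \<omega> * indicator C (X \<omega>))"
    using K order_trans[OF norm_ge_zero K[of undefined]]
    by (auto intro!: integrable_const_bound[of _ B] simp: norm_mult split: split_indicator)
  have "Re (CLINT \<omega>|M. K \<omega> * indicator C (X \<omega>)) = expectation (\<lambda>\<omega>. Re (K \<omega> * indicator C (X \<omega>)))"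
    by (rule integral_Re[OF iC, symmetric])
  also have "\<dots> = expectation (\<lambda>\<omega>. Re (K \<omega>) * indicator C (X \<omega>))"
    by (intro Bochner_Integration.integral_cong refl) (auto split: split_indicator)
  finally have 1: "Re (CLINT \<omega>|M. K \<omega> * indicator C (X \<omega>)) = 0" using r0 by simp
  have "Im (CLINT \<omega>|M. K \<omega> * indicator C (X \<omega>)) = expectation (\<lambda>\<omega>. Im (K \<omega> * indicator C (X \<omega>)))"
    by (rule integral_Im[OF iC, symmetric])
  also have "\<dots> = expectation (\<lambda>\<omega>. Im (K \<omega>) * indicator C (X \<omega>))"
    by (intro Bochner_Integration.integral_cong refl) (auto split: split_indicator)
  finally have 2: "Im (CLINT \<omega>|M. K \<omega> * indicator C (X \<omega>)) = 0" using i0 by simp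
  from 1 2 show ?thesis by (simp add: complex_eq_iff)
qed

text \<open>
  A weight \<open>K\<close> is orthogonal to a class of test functions \<open>\<phi>\<close> when all \<open>E[K \<phi>]\<close> vanish. The events that
  preserve orthogonality are closed under intersection, so they form a sigma-algebra and no
  \<open>\<pi>\<close>-system argument is needed.
\<close>

definition orthogonal_weight :: "('a \<Rightarrow> complex) set \<Rightarrow> ('a \<Rightarrow> complex) \<Rightarrow> bool" where
  "orthogonal_weight \<Phi> K \<longleftrightarrow> K \<in> borel_measurable M \<and> (\<exists>B. \<forall>\<omega>. norm (K \<omega>) \<le> B) \<and>
     (\<forall>\<phi>\<in>\<Phi>. (CLINT \<omega>|M. K \<omega> * \<phi> \<omega>) = 0)"

definition preserving_event :: "('a \<Rightarrow> complex) set \<Rightarrow> 'a set \<Rightarrow> bool" where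
  "preserving_event \<Phi> A \<longleftrightarrow> A \<in> sets M \<and>
     (\<forall>K. orthogonal_weight \<Phi> K \<longrightarrow> orthogonal_weight \<Phi> (\<lambda>\<omega>. K \<omega> * indicator A \<omega>))"

definition bounded_tests :: "('a \<Rightarrow> complex) set \<Rightarrow> bool" where
  "bounded_tests \<Phi> \<longleftrightarrow> (\<forall>\<phi>\<in>\<Phi>. \<phi> \<in> borel_measurable M \<and> (\<exists>B. \<forall>\<omega>. norm (\<phi> \<omega>) \<le> B))"

lemma bounded_weight_integrable:
  assumes "bounded_tests \<Phi>" "\<phi> \<in> \<Phi>" "K \<in> borel_measurable M" "\<And>\<omega>. norm (K \<omega>) \<le> B"
  shows "integrable M (\<lambda>\<omega>. K \<omega> * \<phi> \<omega>)"
proof -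
  obtain D where [measurable]: "\<phi> \<in> borel_measurable M" and D: "\<And>\<omega>. norm (\<phi> \<omega>) \<le> D"
    using assms(1,2) unfolding bounded_tests_def by blast
  have "norm (K \<omega> * \<phi> \<omega>) \<le> B * D" for \<omega>
    unfolding norm_mult using assms(4)[of \<omega>] D[of \<omega>]
    by (intro mult_mono) (auto intro: order_trans[OF norm_ge_zero])
  then show ?thesis using assms by (intro integrable_const_bound[of _ "B * D"]) auto
qed

lemma preserving_event_Int:
  assumes "preserving_event \<Phi> A" "preserving_event \<Phi> B"
  shows "preserving_event \<Phi> (A \<inter> B)"
  using assms unfolding preserving_event_def
  by (auto simp: indicator_inter_arith mult.assoc[symmetric])

lemma preserving_event_Compl:
  assumes \<Phi>: "bounded_tests \<Phi>" and A: "preserving_event \<Phi> A"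
  shows "preserving_event \<Phi> (space M - A)"
  unfolding preserving_event_def
proof safe
  show [measurable]: "space M - A \<in> sets M" using A by (auto simp: preserving_event_def)
  have [measurable]: "A \<in> sets M" using A by (auto simp: preserving_event_def)
  fix K assume K: "orthogonal_weight \<Phi> K"
  then obtain B where [measurable]: "K \<in> borel_measurable M" and B: "\<And>\<omega>. norm (K \<omega>) \<le> B"
    by (auto simp: orthogonal_weight_def)
  have KA: "orthogonal_weight \<Phi> (\<lambda>\<omega>. K \<omega> * indicator A \<omega>)"
    using A K by (auto simp: preserving_event_def)
  have bA: "norm (K \<omega> * indicator S \<omega>) \<le> B" for \<omega> S
    using B[of \<omega>] by (auto split: split_indicator intro: order_trans[OF norm_ge_zero])
  show "orthogonal_weight \<Phi> (\<lambda>\<omega>. K \<omega> * indicator (space M - A) \<omega>)"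
    unfolding orthogonal_weight_def
  proof (intro conjI ballI exI allI)
    fix \<phi> assume p: "\<phi> \<in> \<Phi>"
    have "(CLINT \<omega>|M. K \<omega> * indicator (space M - A) \<omega> * \<phi> \<omega>) =
      (CLINT \<omega>|M. K \<omega> * \<phi> \<omega> - K \<omega> * indicator A \<omega> * \<phi> \<omega>)"
      by (intro Bochner_Integration.integral_cong) (auto split: split_indicator)
    also have "\<dots> = (CLINT \<omega>|M. K \<omega> * \<phi> \<omega>) - (CLINT \<omega>|M. K \<omega> * indicator A \<omega> * \<phi> \<omega>)"
      using B bA by (intro Bochner_Integration.integral_diff bounded_weight_integrable[OF \<Phi> p]) auto
    also have "\<dots> = 0" using K KA p by (simp add: orthogonal_weight_def)
    finally show "(CLINT \<omega>|M. K \<omega> * indicator (space M - A) \<omega> * \<phi> \<omega>) = 0" .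
  qed (auto intro: bA)
qed

text \<open>Finite unions are reached through complements and intersections; the countable union is
  their limit under the integral, by dominated convergence with the majorant
  \<open>norm (K * \<phi>)\<close>.\<close>

lemma preserving_event_sigma:
  assumes \<Phi>: "bounded_tests \<Phi>" and G: "\<And>A. A \<in> G \<Longrightarrow> preserving_event \<Phi> A"
    and A: "A \<in> sigma_sets (space M) G"
  shows "preserving_event \<Phi> A"
  using A
proof induction
  case (Basic a) then show ?case by (rule G)
next
  case Empty show ?case by (auto simp: preserving_event_def orthogonal_weight_def)
next
  case (Compl a) then show ?case by (intro preserving_event_Compl[OF \<Phi>])
next
  case (Union a)
  have c: "preserving_event \<Phi> (space M - (\<Union>i<n. a i))" for n :: nat
  proof (induction n)
    case 0 then show ?case
      using preserving_event_Compl[OF \<Phi>, of "{}"] by (auto simp: preserving_event_def orthogonal_weight_def)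
  next
    case (Suc n)
    have "space M - (\<Union>i<Suc n. a i) = (space M - (\<Union>i<n. a i)) \<inter> (space M - a n)"
      by (auto simp: less_Suc_eq)
    then show ?case using Suc preserving_event_Compl[OF \<Phi> Union(2)[of n]] by (auto intro: preserving_event_Int)
  qed
  have u: "preserving_event \<Phi> (\<Union>i<n. a i)" for n :: nat
  proof -
    have "(\<Union>i<n. a i) = space M - (space M - (\<Union>i<n. a i))"
      using Union(2) sets.sets_into_space by (fastforce simp: preserving_event_def)
    then show ?thesis using preserving_event_Compl[OF \<Phi> c[of n]] by simp
  qed
  have am[measurable]: "a i \<in> sets M" for i using Union by (auto simp: preserving_event_def)
  show ?case unfolding preserving_event_def
  proof safe
    fix K assume K: "orthogonal_weight \<Phi> K"
    then obtain B where [measurable]: "K \<in> borel_measurable M" and B: "\<And>\<omega>. norm (K \<omega>) \<le> B"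
      by (auto simp: orthogonal_weight_def)
    have bA: "norm (K \<omega> * indicator S \<omega>) \<le> B" for \<omega> S
      using B[of \<omega>] by (auto split: split_indicator intro: order_trans[OF norm_ge_zero])
    show "orthogonal_weight \<Phi> (\<lambda>\<omega>. K \<omega> * indicator (\<Union>i. a i) \<omega>)"
      unfolding orthogonal_weight_def
    proof (intro conjI ballI exI allI)
      fix \<phi> assume p: "\<phi> \<in> \<Phi>"
      have [measurable]: "\<phi> \<in> borel_measurable M" using p \<Phi> by (auto simp: bounded_tests_def)
      have "(\<lambda>n. CLINT \<omega>|M. K \<omega> * indicator (\<Union>i<n. a i) \<omega> * \<phi> \<omega>) \<longlonglongrightarrow>
         (CLINT \<omega>|M. K \<omega> * indicator (\<Union>i. a i) \<omega> * \<phi> \<omega>)"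
      proof (rule integral_dominated_convergence[where w="\<lambda>\<omega>. norm (K \<omega> * \<phi> \<omega>)"])
        show "integrable M (\<lambda>\<omega>. norm (K \<omega> * \<phi> \<omega>))"
          by (intro integrable_norm bounded_weight_integrable[OF \<Phi> p]) (auto intro: B)
        show "AE \<omega> in M. (\<lambda>n. K \<omega> * indicator (\<Union>i<n. a i) \<omega> * \<phi> \<omega>) \<longlonglongrightarrow> K \<omega> * indicator (\<Union>i. a i) \<omega> * \<phi> \<omega>"
        proof (rule AE_I2)
          fix \<omega>
          have "(\<lambda>n. indicator (\<Union>i<n. a i) \<omega> :: complex) \<longlonglongrightarrow> indicator (\<Union>i. a i) \<omega>"
            by (rule LIMSEQ_indicator_UN)
          then show "(\<lambda>n. K \<omega> * indicator (\<Union>i<n. a i) \<omega> * \<phi> \<omega>) \<longlonglongrightarrow> K \<omega> * indicator (\<Union>i. a i) \<omega> * \<phi> \<omega>"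
            by (intro tendsto_intros)
        qed
      qed (auto simp: norm_mult split: split_indicator)
      moreover have "(CLINT \<omega>|M. K \<omega> * indicator (\<Union>i<n. a i) \<omega> * \<phi> \<omega>) = 0" for n :: nat
        using u[of n] K p by (auto simp: preserving_event_def orthogonal_weight_def)
      ultimately show "(CLINT \<omega>|M. K \<omega> * indicator (\<Union>i. a i) \<omega> * \<phi> \<omega>) = 0"
        by (simp add: LIMSEQ_const_iff)
    qed (auto intro: bA)
  qed auto
qed

text \<open>The augmented sigma-algebras have the null sets among their generators, and multiplying
  by the indicator of a null set makes every integral vanish.\<close>

lemma preserving_event_null:
  assumes "bounded_tests \<Phi>" "A \<in> null_sets M" shows "preserving_event \<Phi> A"
  unfolding preserving_event_def
proof safe
  show [measurable]: "A \<in> sets M" using assms by auto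
  fix K assume K: "orthogonal_weight \<Phi> K"
  then obtain B where [measurable]: "K \<in> borel_measurable M" and B: "\<And>\<omega>. norm (K \<omega>) \<le> B"
    by (auto simp: orthogonal_weight_def)
  have bA: "norm (K \<omega> * indicator S \<omega>) \<le> B" for \<omega> S
    using B[of \<omega>] by (auto split: split_indicator intro: order_trans[OF norm_ge_zero])
  have ae: "AE \<omega> in M. \<omega> \<notin> A" using assms by (rule_tac AE_not_in)
  show "orthogonal_weight \<Phi> (\<lambda>\<omega>. K \<omega> * indicator A \<omega>)"
    unfolding orthogonal_weight_def
  proof (intro conjI ballI exI allI)
    fix \<phi> assume p: "\<phi> \<in> \<Phi>"
    have [measurable]: "\<phi> \<in> borel_measurable M" using p assms by (auto simp: bounded_tests_def)
    have "(CLINT \<omega>|M. K \<omega> * indicator A \<omega> * \<phi> \<omega>) = (CLINT \<omega>|M. 0)"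
      using ae by (intro integral_cong_AE) auto
    then show "(CLINT \<omega>|M. K \<omega> * indicator A \<omega> * \<phi> \<omega>) = 0" by simp
  qed (auto intro: bA)
qed

text \<open>Because the tests absorb the factors \<open>iexp (t * Y)\<close>, the product of
  \<open>K\<close> with a test is a weight under which \<open>Y\<close> has vanishing characteristic
  function. By \<open>char_weight\<close> the factor \<open>iexp (t * Y)\<close> may then be
  replaced by the indicator of \<open>Y \<in> C\<close>.\<close>

lemma preserving_event_vimage:
  assumes \<Phi>: "bounded_tests \<Phi>" and [measurable]: "Y \<in> borel_measurable M" "C \<in> sets borel"
    and abs: "\<And>\<phi> t. \<phi> \<in> \<Phi> \<Longrightarrow> (\<lambda>\<omega>. \<phi> \<omega> * iexp (t * Y \<omega>)) \<in> \<Phi>"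
  shows "preserving_event \<Phi> (Y -` C \<inter> space M)"
  unfolding preserving_event_def
proof safe
  fix K assume K: "orthogonal_weight \<Phi> K"
  then obtain B where [measurable]: "K \<in> borel_measurable M" and B: "\<And>\<omega>. norm (K \<omega>) \<le> B"
    by (auto simp: orthogonal_weight_def)
  have bA: "norm (K \<omega> * indicator S \<omega>) \<le> B" for \<omega> S
    using B[of \<omega>] by (auto split: split_indicator intro: order_trans[OF norm_ge_zero])
  show "orthogonal_weight \<Phi> (\<lambda>\<omega>. K \<omega> * indicator (Y -` C \<inter> space M) \<omega>)"
    unfolding orthogonal_weight_def
  proof (intro conjI ballI exI allI)
    fix \<phi> assume p: "\<phi> \<in> \<Phi>"
    obtain D where [measurable]: "\<phi> \<in> borel_measurable M" and D: "\<And>\<omega>. norm (\<phi> \<omega>) \<le> D" 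
      using p \<Phi> unfolding bounded_tests_def by blast
    have "(CLINT \<omega>|M. K \<omega> * \<phi> \<omega> * indicator C (Y \<omega>)) = 0"
    proof (rule char_weight[where B="B * D"])
      show "norm (K \<omega> * \<phi> \<omega>) \<le> B * D" for \<omega>
        unfolding norm_mult using B[of \<omega>] D[of \<omega>] by (intro mult_mono) (auto intro: order_trans[OF norm_ge_zero])
      show "(CLINT \<omega>|M. K \<omega> * \<phi> \<omega> * iexp (t * Y \<omega>)) = 0" for t
        using K abs[OF p, of t] by (auto simp: orthogonal_weight_def mult.assoc)
    qed auto
    also have "(CLINT \<omega>|M. K \<omega> * \<phi> \<omega> * indicator C (Y \<omega>)) = (CLINT \<omega>|M. K \<omega> * indicator (Y -` C \<inter> space M) \<omega> * \<phi> \<omega>)"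
      by (intro Bochner_Integration.integral_cong) (auto split: split_indicator)
    finally show "(CLINT \<omega>|M. K \<omega> * indicator (Y -` C \<inter> space M) \<omega> * \<phi> \<omega>) = 0" .
  qed (auto intro: bA)
qed auto

end


section \<open>Increments of the noise\<close>

text \<open>Linear combinations, as an inductive set because functions into \<open>real\<close> carry no vector space instance.\<close>

inductive_set lin_span :: "('a \<Rightarrow> real) set \<Rightarrow> ('a \<Rightarrow> real) set" for V where
  zero: "(\<lambda>_. 0) \<in> lin_span V"
| add: "X \<in> lin_span V \<Longrightarrow> v \<in> V \<Longrightarrow> (\<lambda>\<omega>. X \<omega> + c * v \<omega>) \<in> lin_span V"

lemma lin_span_base: "v \<in> V \<Longrightarrow> v \<in> lin_span V"
  using lin_span.add[OF lin_span.zero, of v V 1] by simp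

lemma lin_span_scale: "Y \<in> lin_span V \<Longrightarrow> (\<lambda>\<omega>. c * Y \<omega>) \<in> lin_span V"
proof (induction rule: lin_span.induct)
  case zero then show ?case using lin_span.zero by simp
next
  case (add X v d)
  from lin_span.add[OF add(3,2), of "c * d"] show ?case by (simp add: algebra_simps)
qed

lemma lin_span_add:
  assumes "X \<in> lin_span V" "Y \<in> lin_span V" shows "(\<lambda>\<omega>. X \<omega> + Y \<omega>) \<in> lin_span V"
  using assms(2)
proof (induction rule: lin_span.induct)
  case zero then show ?case using assms by simp
next
  case (add Y v d)
  from lin_span.add[OF add(3,2), of d] show ?case by (simp add: algebra_simps)
qed

lemma lin_span_sub:
  assumes "V \<subseteq> lin_span V'" shows "lin_span V \<subseteq> lin_span V'"
proof
  fix X assume "X \<in> lin_span V"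
  then show "X \<in> lin_span V'"
    by induction (use assms in \<open>auto intro!: lin_span.zero lin_span_add lin_span_scale\<close>)
qed

text \<open>Turns L^1 convergence of variables into convergence of their characteristic
  functions.\<close>

lemma iexp_lipschitz: "norm (iexp x - iexp y) \<le> \<bar>x - y\<bar>"
proof -
  have "iexp y * iexp (x - y) = iexp x"
    by (simp add: exp_add[symmetric] distrib_left[symmetric] del: of_real_diff) simp
  then have "norm (iexp x - iexp y) = norm (iexp y * (iexp (x - y) - 1))"
    by (simp only: right_diff_distrib mult_1_right)
  also have "\<dots> = norm (iexp (x - y) - 1)" by (simp add: norm_mult)
  also have "\<dots> \<le> \<bar>x - y\<bar>" using iexp_approx1[of "x - y" 0] by simp
  finally show ?thesis .
qed

lemma (in prob_space) integral_cindicator: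
  "A \<in> sets M \<Longrightarrow> (CLINT \<omega>|M. indicator A \<omega>) = complex_of_real (prob A)"
proof -
  assume A: "A \<in> sets M"
  have "(CLINT \<omega>|M. indicator A \<omega>) = (CLINT \<omega>|M. complex_of_real (indicator A \<omega>))"
    by (intro Bochner_Integration.integral_cong) (auto split: split_indicator)
  also have "\<dots> = complex_of_real (prob A)"
    using A sets.sets_into_space[OF A] by (subst integral_complex_of_real) (simp add: Int_absorb1 Int_absorb2)
  finally show ?thesis .
qed

lemma finite_borel_sets_Int [intro]: "B \<in> finite_borel_sets \<Longrightarrow> C \<in> sets borel \<Longrightarrow> B \<inter> C \<in> finite_borel_sets"
  by (auto simp: finite_borel_sets_def intro: le_less_trans[OF emeasure_mono[of "B \<inter> C" B]])

lemma finite_borel_setsD: "B \<in> finite_borel_sets \<Longrightarrow> B \<in> sets borel"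
  by (auto simp: finite_borel_sets_def)

locale noise_space = prob_space M for M :: "'w measure" +
  fixes F :: "real \<Rightarrow> 'w measure" and W :: "real \<Rightarrow> real set \<Rightarrow> 'w \<Rightarrow> real"
  assumes usual: "usual_conditions M F" and wn: "white_noise M W"
    and sets_F: "\<And>t. t \<ge> 0 \<Longrightarrow> sets (F t) = augmented_noise_sets M W t"
begin

definition noise_vars :: "real set \<Rightarrow> ('w \<Rightarrow> real) set" where
  "noise_vars S = {W s B | s B. s \<in> S \<and> B \<in> finite_borel_sets}"

definition winc :: "real \<Rightarrow> real \<Rightarrow> real set \<Rightarrow> 'w \<Rightarrow> real" where
  "winc a b B \<omega> = W b B \<omega> - W a B \<omega>"

text \<open>The last argument selects the sets in space: \<open>UNIV\<close> gives all increments
  over the time slab, and the sets disjoint from a given one give the noise beside a cell.\<close>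

definition incs :: "real \<Rightarrow> real \<Rightarrow> real set set \<Rightarrow> ('w \<Rightarrow> real) set" where
  "incs a b \<B> = {winc a b B | B. B \<in> finite_borel_sets \<inter> \<B>}"

lemma noise_span_gaussian:
  assumes "X \<in> lin_span (noise_vars {0..})"
  shows "centered_gaussian M X"
proof -
  have fam: "centered_gaussian_family M ({0..} \<times> finite_borel_sets) (\<lambda>(t, B). W t B)"
    using wn by (simp add: white_noise_def)
  have "\<exists>J c. finite J \<and> J \<subseteq> {0..} \<times> finite_borel_sets \<and> X = (\<lambda>\<omega>. \<Sum>i\<in>J. c i * (\<lambda>(t, B). W t B) i \<omega>)"
    using assms
  proof induction
    case zero then show ?case by (intro exI[of _ "{}"]) auto
  next
    case (add X v d)
    then obtain J c where J: "finite J" "J \<subseteq> {0..} \<times> finite_borel_sets"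
      "X = (\<lambda>\<omega>. \<Sum>i\<in>J. c i * (\<lambda>(t, B). W t B) i \<omega>)" by auto
    obtain s B where v: "v = W s B" "s \<ge> 0" "B \<in> finite_borel_sets" using add(2) by (auto simp: noise_vars_def)
    let ?i = "(s, B)"
    \<comment> \<open>If the index of the new term already occurs in \<open>J\<close>, its
      coefficient is added to the old one, since a set of indices holds no repetitions.\<close>
    let ?c = "\<lambda>i. (if i \<in> J then c i else 0) + (if i = ?i then d else 0)"
    have "X \<omega> + d * v \<omega> = (\<Sum>i\<in>insert ?i J. ?c i * (\<lambda>(t, B). W t B) i \<omega>)" for \<omega>
    proof -
      have "(\<Sum>i\<in>insert ?i J. ?c i * (\<lambda>(t, B). W t B) i \<omega>) =
        (\<Sum>i\<in>insert ?i J. if i \<in> J then c i * (\<lambda>(t, B). W t B) i \<omega> else 0) +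
        (\<Sum>i\<in>insert ?i J. if i = ?i then d * (\<lambda>(t, B). W t B) i \<omega> else 0)"
        unfolding sum.distrib[symmetric] by (intro sum.cong) (auto simp: algebra_simps)
      also have "\<dots> = X \<omega> + d * v \<omega>"
        using J(1) v(1) unfolding J(3)
        by (subst sum.delta, simp, subst sum.inter_restrict[symmetric], auto simp: Int_absorb1 subset_insertI)
      finally show ?thesis by simp
    qed
    then show ?case using J v by (intro exI[of _ "insert ?i J"] exI[of _ ?c]) auto
  qed
  then show ?thesis using fam by (auto simp: centered_gaussian_family_def)
qed

lemma W_span: "t \<ge> 0 \<Longrightarrow> B \<in> finite_borel_sets \<Longrightarrow> W t B \<in> lin_span (noise_vars {0..})"
  by (intro lin_span_base) (auto simp: noise_vars_def)

lemma winc_span: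
  assumes "0 \<le> a" "0 \<le> b" "B \<in> finite_borel_sets"
  shows "winc a b B \<in> lin_span (noise_vars {0..})"
  using lin_span_add[OF W_span[OF assms(2,3)] lin_span_scale[OF W_span[OF assms(1,3)], of "-1"]]
  by (simp add: winc_def[abs_def])

lemma incs_span:
  assumes "0 \<le> a" "0 \<le> b" shows "lin_span (incs a b \<B>) \<subseteq> lin_span (noise_vars {0..})"
  by (rule lin_span_sub) (use winc_span assms in \<open>auto simp: incs_def\<close>)

lemma noise_span_mono: "S \<subseteq> {0..} \<Longrightarrow> lin_span (noise_vars S) \<subseteq> lin_span (noise_vars {0..})"
  by (rule lin_span_sub) (use W_span in \<open>auto simp: noise_vars_def\<close>)

lemma noise_span_measurable: "X \<in> lin_span (noise_vars {0..}) \<Longrightarrow> X \<in> borel_measurable M"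
  by (intro centered_gaussian_measurable noise_span_gaussian)

lemma noise_span_integrable_mult:
  assumes "X \<in> lin_span (noise_vars {0..})" "Y \<in> lin_span (noise_vars {0..})"
  shows "integrable M (\<lambda>\<omega>. X \<omega> * Y \<omega>)"
proof -
  have [measurable]: "X \<in> borel_measurable M" "Y \<in> borel_measurable M"
    using assms by (auto intro: noise_span_measurable)
  have "integrable M (\<lambda>\<omega>. (X \<omega>)\<^sup>2 + (Y \<omega>)\<^sup>2)"
    using assms by (auto intro!: integrable_gaussian_power noise_span_gaussian)
  then show ?thesis
  proof (rule Bochner_Integration.integrable_bound)
    show "AE \<omega> in M. norm (X \<omega> * Y \<omega>) \<le> norm ((X \<omega>)\<^sup>2 + (Y \<omega>)\<^sup>2)"
    proof (rule AE_I2)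
      fix \<omega>
      have "2 * \<bar>X \<omega> * Y \<omega>\<bar> \<le> (X \<omega>)\<^sup>2 + (Y \<omega>)\<^sup>2"
        using sum_squares_bound[of "\<bar>X \<omega>\<bar>" "\<bar>Y \<omega>\<bar>"] by (simp add: abs_mult)
      then have "\<bar>X \<omega> * Y \<omega>\<bar> \<le> (X \<omega>)\<^sup>2 + (Y \<omega>)\<^sup>2" by linarith
      then show "norm (X \<omega> * Y \<omega>) \<le> norm ((X \<omega>)\<^sup>2 + (Y \<omega>)\<^sup>2)" by simp
    qed
  qed auto
qed

section \<open>Covariances of increments\<close>

lemma W_cov:
  assumes "s \<ge> 0" "t \<ge> 0" "B \<in> finite_borel_sets" "C \<in> finite_borel_sets"
  shows "expectation (\<lambda>\<omega>. W t B \<omega> * W s C \<omega>) = min t s * measure lborel (B \<inter> C)"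
  using wn assms by (auto simp: white_noise_def)

lemma winc_cov_past:
  assumes "0 \<le> s" "s \<le> a" "a \<le> b" "B \<in> finite_borel_sets" "C \<in> finite_borel_sets"
  shows "expectation (\<lambda>\<omega>. W s C \<omega> * winc a b B \<omega>) = 0"
proof -
  have "expectation (\<lambda>\<omega>. W s C \<omega> * winc a b B \<omega>) =
     expectation (\<lambda>\<omega>. W s C \<omega> * W b B \<omega>) - expectation (\<lambda>\<omega>. W s C \<omega> * W a B \<omega>)"
    unfolding winc_def right_diff_distrib using assms
    by (intro Bochner_Integration.integral_diff noise_span_integrable_mult W_span) auto
  then show ?thesis using assms by (simp add: W_cov min_def)
qed

lemma winc_cov:
  assumes "0 \<le> a" "a \<le> b" "B \<in> finite_borel_sets" "C \<in> finite_borel_sets"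
  shows "expectation (\<lambda>\<omega>. winc a b B \<omega> * winc a b C \<omega>) = (b - a) * measure lborel (B \<inter> C)"
proof -
  have "expectation (\<lambda>\<omega>. winc a b B \<omega> * winc a b C \<omega>) =
     expectation (\<lambda>\<omega>. W b B \<omega> * winc a b C \<omega> - W a B \<omega> * winc a b C \<omega>)"
    by (simp add: winc_def algebra_simps)
  also have "\<dots> = expectation (\<lambda>\<omega>. W b B \<omega> * winc a b C \<omega>) - expectation (\<lambda>\<omega>. W a B \<omega> * winc a b C \<omega>)"
    using assms by (intro Bochner_Integration.integral_diff noise_span_integrable_mult W_span winc_span) auto
  also have "expectation (\<lambda>\<omega>. W a B \<omega> * winc a b C \<omega>) = 0"
    using assms by (intro winc_cov_past) auto
  also have "expectation (\<lambda>\<omega>. W b B \<omega> * winc a b C \<omega>) = 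
     expectation (\<lambda>\<omega>. W b B \<omega> * W b C \<omega>) - expectation (\<lambda>\<omega>. W b B \<omega> * W a C \<omega>)"
    unfolding winc_def right_diff_distrib using assms
    by (intro Bochner_Integration.integral_diff noise_span_integrable_mult W_span) auto
  finally show ?thesis using assms by (simp add: W_cov min_def algebra_simps Int_commute)
qed

lemma span_orthogonal:
  assumes "V \<subseteq> lin_span (noise_vars {0..})" "Y \<in> lin_span (noise_vars {0..})"
    and "\<And>v. v \<in> V \<Longrightarrow> expectation (\<lambda>\<omega>. v \<omega> * Y \<omega>) = 0" and "X \<in> lin_span V"
  shows "expectation (\<lambda>\<omega>. X \<omega> * Y \<omega>) = 0"
  using assms(4)
proof induction
  case zero then show ?case by simp
next
  case (add X v c)
  have "X \<in> lin_span (noise_vars {0..})" using add(1) lin_span_sub[OF assms(1)] by auto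
  then have "expectation (\<lambda>\<omega>. X \<omega> * Y \<omega> + c * (v \<omega> * Y \<omega>)) = expectation (\<lambda>\<omega>. X \<omega> * Y \<omega>) + expectation (\<lambda>\<omega>. c * (v \<omega> * Y \<omega>))"
    using assms add by (intro Bochner_Integration.integral_add integrable_mult_right noise_span_integrable_mult) auto
  then show ?case using add assms(3)[OF add(2)] by (simp add: algebra_simps)
qed

section \<open>From vanishing covariance to independence\<close>

text \<open>The sum of two elements of the span is again Gaussian, with the sum of the variances as
  its variance. This is where joint Gaussianity turns zero covariance into a product
  formula.\<close>

lemma char_uncorrelated:
  assumes X: "X \<in> lin_span (noise_vars {0..})" and Y: "Y \<in> lin_span (noise_vars {0..})"
    and 0: "expectation (\<lambda>\<omega>. X \<omega> * Y \<omega>) = 0"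
  shows "(CLINT \<omega>|M. iexp (X \<omega>) * iexp (Y \<omega>)) = (CLINT \<omega>|M. iexp (X \<omega>)) * (CLINT \<omega>|M. iexp (Y \<omega>))"
proof -
  have XY: "(\<lambda>\<omega>. X \<omega> + Y \<omega>) \<in> lin_span (noise_vars {0..})" using X Y by (rule lin_span_add)
  have "expectation (\<lambda>\<omega>. (X \<omega> + Y \<omega>)\<^sup>2) = expectation (\<lambda>\<omega>. (X \<omega>)\<^sup>2 + (Y \<omega>)\<^sup>2 + 2 * (X \<omega> * Y \<omega>))"
    by (simp add: power2_sum algebra_simps)
  also have "\<dots> = expectation (\<lambda>\<omega>. (X \<omega>)\<^sup>2) + expectation (\<lambda>\<omega>. (Y \<omega>)\<^sup>2) + expectation (\<lambda>\<omega>. 2 * (X \<omega> * Y \<omega>))"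
    using noise_span_integrable_mult[OF X Y] X Y
    by (subst Bochner_Integration.integral_add | simp add: integrable_gaussian_power noise_span_gaussian)+
  finally have v: "expectation (\<lambda>\<omega>. (X \<omega> + Y \<omega>)\<^sup>2) = expectation (\<lambda>\<omega>. (X \<omega>)\<^sup>2) + expectation (\<lambda>\<omega>. (Y \<omega>)\<^sup>2)"
    using 0 by simp
  have "(CLINT \<omega>|M. iexp (X \<omega>) * iexp (Y \<omega>)) = (CLINT \<omega>|M. iexp (X \<omega> + Y \<omega>))"
    by (simp add: exp_add[symmetric] algebra_simps)
  then show ?thesis
    using gaussian_char[OF noise_span_gaussian[OF XY], of 1] gaussian_char[OF noise_span_gaussian[OF X], of 1] 
      gaussian_char[OF noise_span_gaussian[OF Y], of 1] v
    by (simp add: of_real_mult[symmetric] exp_add[symmetric] field_simps del: of_real_mult)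
qed

text \<open>The weight \<open>iexp Y\<close> minus its mean is orthogonal to \<open>iexp X\<close>
  for all \<open>X\<close> in the span of the past, by vanishing covariances. These tests absorb
  factors \<open>iexp (t * W s B)\<close>, so the generating events, and with them the whole
  sigma-algebra, preserve the orthogonality.\<close>

lemma char_indep_past:
  assumes r: "0 \<le> r" "r \<le> b" and A: "A \<in> sigma_sets (space M) (noise_events M W r \<union> null_sets M)"
    and Y: "Y \<in> lin_span (incs r b UNIV)"
  shows "(CLINT \<omega>|M. iexp (Y \<omega>) * indicator A \<omega>) = (CLINT \<omega>|M. iexp (Y \<omega>)) * prob A"
proof -
  define \<Phi> where "\<Phi> = {\<lambda>\<omega>. iexp (X \<omega>) | X. X \<in> lin_span (noise_vars {0..r})}"
  have sp: "X \<in> lin_span (noise_vars {0..})" if "X \<in> lin_span (noise_vars {0..r})" for X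
    using that noise_span_mono[of "{0..r}"] by auto
  have spY: "Y \<in> lin_span (noise_vars {0..})" using incs_span[of r b] r Y by auto
  have [measurable]: "Y \<in> borel_measurable M" by (rule noise_span_measurable[OF spY])
  have \<Phi>: "bounded_tests \<Phi>"
    unfolding bounded_tests_def \<Phi>_def
  proof safe
    fix X assume "X \<in> lin_span (noise_vars {0..r})"
    then have [measurable]: "X \<in> borel_measurable M" using sp noise_span_measurable by auto
    show "(\<lambda>\<omega>. iexp (X \<omega>)) \<in> borel_measurable M" by measurable
    show "\<exists>B. \<forall>\<omega>. cmod (iexp (X \<omega>)) \<le> B" by (intro exI[of _ 1]) auto
  qed
  have "preserving_event \<Phi> A"
  proof (rule preserving_event_sigma[OF \<Phi> _ A])
    fix A assume "A \<in> noise_events M W r \<union> null_sets M"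
    then show "preserving_event \<Phi> A"
    proof
      assume "A \<in> noise_events M W r"
      then obtain s B C where A: "A = W s B -` C \<inter> space M" "0 \<le> s" "s \<le> r" "B \<in> finite_borel_sets" "C \<in> sets borel"
        by (auto simp: noise_events_def)
      have nv: "W s B \<in> noise_vars {0..r}" using A by (auto simp: noise_vars_def)
      show ?thesis unfolding A(1)
      proof (rule preserving_event_vimage[OF \<Phi> _ A(5)])
        show "W s B \<in> borel_measurable M" using A by (intro noise_span_measurable W_span) auto
        fix \<phi> :: "'w \<Rightarrow> complex" and t assume "\<phi> \<in> \<Phi>"
        then obtain X where X: "\<phi> = (\<lambda>\<omega>. iexp (X \<omega>))" "X \<in> lin_span (noise_vars {0..r})" by (auto simp: \<Phi>_def)
        have "(\<lambda>\<omega>. X \<omega> + t * W s B \<omega>) \<in> lin_span (noise_vars {0..r})"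
          by (rule lin_span.add[OF X(2) nv])
        then show "(\<lambda>\<omega>. \<phi> \<omega> * iexp (t * W s B \<omega>)) \<in> \<Phi>"
          unfolding X \<Phi>_def 
          by (intro CollectI exI[of _ "\<lambda>\<omega>. X \<omega> + t * W s B \<omega>"]) (auto simp: exp_add[symmetric] algebra_simps)
      qed
    qed (rule preserving_event_null[OF \<Phi>])
  qed
  moreover have "orthogonal_weight \<Phi> (\<lambda>\<omega>. iexp (Y \<omega>) - (CLINT \<omega>|M. iexp (Y \<omega>)))"
    unfolding orthogonal_weight_def
  proof (intro conjI exI allI ballI)
    show "(\<lambda>\<omega>. iexp (Y \<omega>) - (CLINT \<omega>|M. iexp (Y \<omega>))) \<in> borel_measurable M" by measurable
    show "cmod (iexp (Y \<omega>) - (CLINT \<omega>|M. iexp (Y \<omega>))) \<le> 1 + cmod (CLINT \<omega>|M. iexp (Y \<omega>))" for \<omega>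
      by (rule order_trans[OF norm_triangle_ineq4]) simp
    fix \<phi> assume "\<phi> \<in> \<Phi>"
    then obtain X where X: "\<phi> = (\<lambda>\<omega>. iexp (X \<omega>))" "X \<in> lin_span (noise_vars {0..r})" by (auto simp: \<Phi>_def)
    have [measurable]: "X \<in> borel_measurable M" using X sp noise_span_measurable by auto
    have "expectation (\<lambda>\<omega>. Y \<omega> * X \<omega>) = 0"
    proof (rule span_orthogonal[OF _ sp[OF X(2)] _ Y])
      show "incs r b UNIV \<subseteq> lin_span (noise_vars {0..})" using winc_span r by (auto simp: incs_def)
      fix v assume "v \<in> incs r b UNIV"
      then obtain B where B: "v = winc r b B" "B \<in> finite_borel_sets" by (auto simp: incs_def)
      have "expectation (\<lambda>\<omega>. X \<omega> * v \<omega>) = 0"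
      proof (rule span_orthogonal[OF _ _ _ X(2)])
        show "noise_vars {0..r} \<subseteq> lin_span (noise_vars {0..})" using W_span by (auto simp: noise_vars_def)
        show "v \<in> lin_span (noise_vars {0..})" using B r winc_span by auto
        show "expectation (\<lambda>\<omega>. w \<omega> * v \<omega>) = 0" if "w \<in> noise_vars {0..r}" for w
          using that B r by (auto simp: noise_vars_def intro!: winc_cov_past)
      qed
      then show "expectation (\<lambda>\<omega>. v \<omega> * X \<omega>) = 0" by (simp add: mult.commute)
    qed
    from char_uncorrelated[OF spY sp[OF X(2)] this]
    have *: "(CLINT \<omega>|M. iexp (Y \<omega>) * iexp (X \<omega>)) = (CLINT \<omega>|M. iexp (Y \<omega>)) * (CLINT \<omega>|M. iexp (X \<omega>))" .
    have "(CLINT \<omega>|M. (iexp (Y \<omega>) - (CLINT \<omega>|M. iexp (Y \<omega>))) * \<phi> \<omega>) = 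
      (CLINT \<omega>|M. iexp (Y \<omega>) * iexp (X \<omega>) - (CLINT \<omega>|M. iexp (Y \<omega>)) * iexp (X \<omega>))"
      by (simp add: X left_diff_distrib)
    also have "\<dots> = (CLINT \<omega>|M. iexp (Y \<omega>) * iexp (X \<omega>)) - (CLINT \<omega>|M. (CLINT \<omega>|M. iexp (Y \<omega>)) * iexp (X \<omega>))"
      by (intro Bochner_Integration.integral_diff integrable_mult_right integrable_const_bound[of _ 1]) (auto simp: norm_mult)
    also have "\<dots> = 0" by (simp only: * integral_mult_right_zero) simp
    finally show "(CLINT \<omega>|M. (iexp (Y \<omega>) - (CLINT \<omega>|M. iexp (Y \<omega>))) * \<phi> \<omega>) = 0" .
  qed
  ultimately have "orthogonal_weight \<Phi> (\<lambda>\<omega>. (iexp (Y \<omega>) - (CLINT \<omega>|M. iexp (Y \<omega>))) * indicator A \<omega>)"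
    and [measurable]: "A \<in> sets M"
    by (auto simp: preserving_event_def)
  \<comment> \<open>Testing against \<open>X = 0\<close> leaves the bare integral over
    \<open>A\<close>.\<close>
  moreover have "(\<lambda>_. 1) \<in> \<Phi>" unfolding \<Phi>_def using lin_span.zero by (intro CollectI exI[of _ "\<lambda>_. 0"]) auto
  ultimately have "(CLINT \<omega>|M. (iexp (Y \<omega>) - (CLINT \<omega>|M. iexp (Y \<omega>))) * indicator A \<omega>) = 0"
    by (auto simp: orthogonal_weight_def)
  also have "(CLINT \<omega>|M. (iexp (Y \<omega>) - (CLINT \<omega>|M. iexp (Y \<omega>))) * indicator A \<omega>) = 
     (CLINT \<omega>|M. iexp (Y \<omega>) * indicator A \<omega>) - (CLINT \<omega>|M. (CLINT \<omega>|M. iexp (Y \<omega>)) * indicator A \<omega>)"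
    unfolding left_diff_distrib
    by (intro Bochner_Integration.integral_diff integrable_mult_right integrable_const_bound[of _ 1]) (auto simp: norm_mult split: split_indicator)
  finally show ?thesis by (simp add: integral_cindicator)
qed


section \<open>The augmented filtration\<close>

lemma F_sigma_sets:
  assumes "0 \<le> a" "A \<in> sets (F a)" "a < r"
  shows "A \<in> sigma_sets (space M) (noise_events M W r \<union> null_sets M)"
  using assms sets_F[of a] by (auto simp: augmented_noise_sets_def)

lemma subalgebra_F: "0 \<le> a \<Longrightarrow> subalgebra M (F a)"
  using usual by (auto simp: usual_conditions_def)

lemma space_F: "0 \<le> a \<Longrightarrow> space (F a) = space M"
  using subalgebra_F[of a] by (auto simp: subalgebra_def)

lemma sets_F_subset: "0 \<le> a \<Longrightarrow> sets (F a) \<subseteq> sets M"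
  using subalgebra_F[of a] by (auto simp: subalgebra_def)

lemma sets_F_mono: assumes "0 \<le> a" "a \<le> b" shows "sets (F a) \<subseteq> sets (F b)"
proof -
  interpret filtration "space M" "\<lambda>t. F (max 0 t)" using usual by (auto simp: usual_conditions_def)
  show ?thesis using sets_F_mono[of a b] assms by (simp add: max_def)
qed

lemma null_sets_F: assumes "0 \<le> a" shows "null_sets M \<subseteq> sets (F a)"
proof -
  have "null_sets M \<subseteq> sets (F 0)" using usual unfolding usual_conditions_def by blast
  also have "\<dots> \<subseteq> sets (F a)" using assms by (intro sets_F_mono) auto
  finally show ?thesis .
qed

lemma W_measurable_F:
  assumes "0 \<le> s" "s \<le> a" "B \<in> finite_borel_sets"
  shows "W s B \<in> borel_measurable (F a)"
proof (rule measurableI)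
  fix C :: "real set" assume C: "C \<in> sets borel"
  have a: "0 \<le> a" using assms by simp
  have "W s B -` C \<inter> space M \<in> sigma_sets (space M) (noise_events M W r \<union> null_sets M)" if "a < r" for r
    unfolding noise_events_def using that assms C
    by (intro sigma_sets.Basic UnI1 CollectI exI[of _ s] exI[of _ B] exI[of _ C]) auto
  then show "W s B -` C \<inter> space (F a) \<in> sets (F a)"
    unfolding sets_F[OF a] space_F[OF a] by (auto simp: augmented_noise_sets_def)
qed auto

lemma winc_measurable_F:
  "0 \<le> a \<Longrightarrow> a \<le> b \<Longrightarrow> B \<in> finite_borel_sets \<Longrightarrow> winc a b B \<in> borel_measurable (F b)"
  unfolding winc_def[abs_def] by (intro borel_measurable_diff W_measurable_F) auto

lemma winc_gaussian:
  "0 \<le> a \<Longrightarrow> a \<le> b \<Longrightarrow> B \<in> finite_borel_sets \<Longrightarrow> centered_gaussian M (winc a b B)"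
  by (intro noise_span_gaussian winc_span) auto

lemma winc_square:
  assumes "0 \<le> a" "a \<le> b" "B \<in> finite_borel_sets"
  shows "expectation (\<lambda>\<omega>. (winc a b B \<omega>)\<^sup>2) = (b - a) * measure lborel B"
  using winc_cov[of a b B B] assms by (simp add: power2_eq_square)

text \<open>Cauchy-Schwarz, read off from the nonnegative variance of the absolute value. The bound
  vanishes with the length of the interval, which is what the limit from the right requires.\<close>

lemma winc_L1:
  assumes "0 \<le> a" "a \<le> b" "B \<in> finite_borel_sets"
  shows "expectation (\<lambda>\<omega>. \<bar>winc a b B \<omega>\<bar>) \<le> sqrt ((b - a) * measure lborel B)"
proof -
  have g: "centered_gaussian M (winc a b B)" using assms by (rule winc_gaussian)
  have [measurable]: "winc a b B \<in> borel_measurable M" using g by (rule centered_gaussian_measurable)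
  have i2: "integrable M (\<lambda>\<omega>. (winc a b B \<omega>)\<^sup>2)" by (rule integrable_gaussian_power[OF g])
  have i1: "integrable M (\<lambda>\<omega>. \<bar>winc a b B \<omega>\<bar>)" using integrable_gaussian_power[OF g, of 1] by simp
  have "(expectation (\<lambda>\<omega>. \<bar>winc a b B \<omega>\<bar>))\<^sup>2 \<le> expectation (\<lambda>\<omega>. \<bar>winc a b B \<omega>\<bar>\<^sup>2)"
    using i1 i2 variance_positive[of "\<lambda>\<omega>. \<bar>winc a b B \<omega>\<bar>"] variance_eq[of "\<lambda>\<omega>. \<bar>winc a b B \<omega>\<bar>"] by simp
  then show ?thesis using winc_square[OF assms] by (intro real_le_rsqrt) simp
qed

text \<open>
  The filtration is right-continuous, so an event of \<open>F a\<close> is only known to lie in the noise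
  sigma-algebra up to any later time \<open>r > a\<close>; hence the limit \<open>r \<rightarrow> a\<close>.
\<close>

lemma char_indep_F:
  assumes ab: "0 \<le> a" "a \<le> b" and A: "A \<in> sets (F a)" and Y: "Y \<in> lin_span (incs a b UNIV)"
  shows "(CLINT \<omega>|M. iexp (Y \<omega>) * indicator A \<omega>) = (CLINT \<omega>|M. iexp (Y \<omega>)) * prob A"
proof (cases "a = b")
  \<comment> \<open>There are no times strictly between \<open>a\<close> and \<open>b\<close> here,
    but all increments vanish.\<close>
  case True
  have "Y = (\<lambda>_. 0)" using Y
  proof induction
    case (add X v c)
    then show ?case by (auto simp: incs_def winc_def True)
  qed simp
  moreover have "A \<in> sets M" using A sets_F_subset ab by auto
  ultimately show ?thesis by (simp add: integral_cindicator prob_space)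
next
  case False
  define r where "r n = a + (b - a) / real (Suc n)" for n
  have r: "a < r n" "r n \<le> b" "0 \<le> r n" for n
  proof -
    have "(b - a) / real (Suc n) \<le> (b - a) / 1" using ab by (intro divide_left_mono) auto
    then show "a < r n" "r n \<le> b" "0 \<le> r n" using ab False by (auto simp: r_def)
  qed
  have rl: "r \<longlonglongrightarrow> a"
    unfolding r_def[abs_def] using tendsto_add[OF tendsto_const LIMSEQ_Suc[OF lim_const_over_n[of "b - a"]], of a]
    by simp
  \<comment> \<open>Each increment over (a, b] that occurs in \<open>Y\<close> is replaced by the
    one over (r n, b]. The error is an increment over (a, r n], hence small in L^1.\<close>
  have "\<exists>Z. \<forall>n. Z n \<in> lin_span (incs (r n) b UNIV) \<and>
    (\<lambda>n. expectation (\<lambda>\<omega>. \<bar>Z n \<omega> - Y \<omega>\<bar>)) \<longlonglongrightarrow> 0" using Y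
  proof induction
    case zero then show ?case using lin_span.zero by (intro exI[of _ "\<lambda>n _. 0"]) auto
  next
    case (add X v c)
    then obtain Z where Z: "\<And>n. Z n \<in> lin_span (incs (r n) b UNIV)"
      "(\<lambda>n. expectation (\<lambda>\<omega>. \<bar>Z n \<omega> - X \<omega>\<bar>)) \<longlonglongrightarrow> 0" by auto
    obtain B where B: "v = winc a b B" "B \<in> finite_borel_sets" using add(2) by (auto simp: incs_def)
    have Zs: "Z n \<in> lin_span (noise_vars {0..})" for n using Z(1)[of n] incs_span[of "r n" b] r ab by auto
    have Xs: "X \<in> lin_span (noise_vars {0..})" using add(1) incs_span[of a b] ab by auto
    have i1: "integrable M (\<lambda>\<omega>. \<bar>Z n \<omega> - X \<omega>\<bar>)" for n
      using integrable_gaussian_power[OF noise_span_gaussian[OF Zs[of n]], of 1] 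
        integrable_gaussian_power[OF noise_span_gaussian[OF Xs], of 1] by simp
    have i2: "integrable M (\<lambda>\<omega>. \<bar>c\<bar> * \<bar>winc a (r n) B \<omega>\<bar>)" for n
      using integrable_gaussian_power[OF winc_gaussian, of a "r n" B 1] r[of n] ab B by auto
    let ?Z = "\<lambda>n \<omega>. Z n \<omega> + c * winc (r n) b B \<omega>"
    show ?case
    proof (intro exI[of _ ?Z] allI conjI)
      fix n show "?Z n \<in> lin_span (incs (r n) b UNIV)"
        using Z(1)[of n] B by (intro lin_span.add) (auto simp: incs_def)
    next
      show "(\<lambda>n. expectation (\<lambda>\<omega>. \<bar>?Z n \<omega> - (X \<omega> + c * v \<omega>)\<bar>)) \<longlonglongrightarrow> 0"
      proof (rule tendsto_sandwich[OF _ _ tendsto_const])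
        show "\<forall>\<^sub>F n in sequentially. expectation (\<lambda>\<omega>. \<bar>?Z n \<omega> - (X \<omega> + c * v \<omega>)\<bar>) \<le>
          expectation (\<lambda>\<omega>. \<bar>Z n \<omega> - X \<omega>\<bar>) + \<bar>c\<bar> * sqrt ((r n - a) * measure lborel B)"
        proof (rule always_eventually, rule)
          fix n
          have "expectation (\<lambda>\<omega>. \<bar>?Z n \<omega> - (X \<omega> + c * v \<omega>)\<bar>) \<le>
             expectation (\<lambda>\<omega>. \<bar>Z n \<omega> - X \<omega>\<bar> + \<bar>c\<bar> * \<bar>winc a (r n) B \<omega>\<bar>)"
          proof (rule integral_mono')
            show "integrable M (\<lambda>\<omega>. \<bar>Z n \<omega> - X \<omega>\<bar> + \<bar>c\<bar> * \<bar>winc a (r n) B \<omega>\<bar>)" using i1 i2 by auto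
            fix \<omega>
            have "?Z n \<omega> - (X \<omega> + c * v \<omega>) = (Z n \<omega> - X \<omega>) - c * winc a (r n) B \<omega>"
              by (simp add: B winc_def algebra_simps)
            then show "\<bar>?Z n \<omega> - (X \<omega> + c * v \<omega>)\<bar> \<le> \<bar>Z n \<omega> - X \<omega>\<bar> + \<bar>c\<bar> * \<bar>winc a (r n) B \<omega>\<bar>"
              using abs_triangle_ineq4[of "Z n \<omega> - X \<omega>" "c * winc a (r n) B \<omega>"] by (simp add: abs_mult)
          qed auto
          also have "\<dots> = expectation (\<lambda>\<omega>. \<bar>Z n \<omega> - X \<omega>\<bar>) + \<bar>c\<bar> * expectation (\<lambda>\<omega>. \<bar>winc a (r n) B \<omega>\<bar>)"
            using i1 i2[of n] by (subst Bochner_Integration.integral_add) auto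
          also have "\<dots> \<le> expectation (\<lambda>\<omega>. \<bar>Z n \<omega> - X \<omega>\<bar>) + \<bar>c\<bar> * sqrt ((r n - a) * measure lborel B)"
            using r[of n] ab B by (intro add_left_mono mult_left_mono winc_L1) auto
          finally show "expectation (\<lambda>\<omega>. \<bar>?Z n \<omega> - (X \<omega> + c * v \<omega>)\<bar>) \<le>
            expectation (\<lambda>\<omega>. \<bar>Z n \<omega> - X \<omega>\<bar>) + \<bar>c\<bar> * sqrt ((r n - a) * measure lborel B)" .
        qed
        show "(\<lambda>n. expectation (\<lambda>\<omega>. \<bar>Z n \<omega> - X \<omega>\<bar>) + \<bar>c\<bar> * sqrt ((r n - a) * measure lborel B)) \<longlonglongrightarrow> 0"
          using Z(2) by (auto intro!: tendsto_eq_intros rl)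
      qed auto
    qed
  qed
  then obtain Z where Z: "\<And>n. Z n \<in> lin_span (incs (r n) b UNIV)"
    "(\<lambda>n. expectation (\<lambda>\<omega>. \<bar>Z n \<omega> - Y \<omega>\<bar>)) \<longlonglongrightarrow> 0" by auto
  have Zs: "Z n \<in> lin_span (noise_vars {0..})" for n using Z(1)[of n] incs_span[of "r n" b] r ab by auto
  have Ys: "Y \<in> lin_span (noise_vars {0..})" using Y incs_span[of a b] ab by auto
  have [measurable]: "Z n \<in> borel_measurable M" "Y \<in> borel_measurable M" for n
    using Zs Ys noise_span_measurable by auto
  have i1: "integrable M (\<lambda>\<omega>. \<bar>Z n \<omega> - Y \<omega>\<bar>)" for n
    using integrable_gaussian_power[OF noise_span_gaussian[OF Zs[of n]], of 1] 
        integrable_gaussian_power[OF noise_span_gaussian[OF Ys], of 1] by simp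
  have lim: "(\<lambda>n. CLINT \<omega>|M. iexp (Z n \<omega>) * indicator E \<omega>) \<longlonglongrightarrow> (CLINT \<omega>|M. iexp (Y \<omega>) * indicator E \<omega>)"
    if [measurable]: "E \<in> sets M" for E
  proof (rule LIM_zero_cancel[OF Lim_null_comparison])
    show "\<forall>\<^sub>F n in sequentially. norm ((CLINT \<omega>|M. iexp (Z n \<omega>) * indicator E \<omega>) - (CLINT \<omega>|M. iexp (Y \<omega>) * indicator E \<omega>)) \<le>
      expectation (\<lambda>\<omega>. \<bar>Z n \<omega> - Y \<omega>\<bar>)"
    proof (rule always_eventually, rule)
      fix n
      have "(CLINT \<omega>|M. iexp (Z n \<omega>) * indicator E \<omega>) - (CLINT \<omega>|M. iexp (Y \<omega>) * indicator E \<omega>) =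
        (CLINT \<omega>|M. iexp (Z n \<omega>) * indicator E \<omega> - iexp (Y \<omega>) * indicator E \<omega>)"
        by (intro Bochner_Integration.integral_diff[symmetric] integrable_const_bound[of _ 1])
          (auto simp: norm_mult split: split_indicator)
      also have "norm \<dots> \<le> expectation (\<lambda>\<omega>. norm (iexp (Z n \<omega>) * indicator E \<omega> - iexp (Y \<omega>) * indicator E \<omega>))"
        by (rule integral_norm_bound)
      also have "\<dots> \<le> expectation (\<lambda>\<omega>. \<bar>Z n \<omega> - Y \<omega>\<bar>)"
        using iexp_lipschitz by (intro integral_mono' i1) (auto simp: split: split_indicator)
      finally show "norm ((CLINT \<omega>|M. iexp (Z n \<omega>) * indicator E \<omega>) - (CLINT \<omega>|M. iexp (Y \<omega>) * indicator E \<omega>)) \<le>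
        expectation (\<lambda>\<omega>. \<bar>Z n \<omega> - Y \<omega>\<bar>)" .
    qed
  qed (use Z in auto)
  have A': "A \<in> sets M" using A sets_F_subset ab by auto
  have l1: "(\<lambda>n. CLINT \<omega>|M. iexp (Z n \<omega>) * indicator A \<omega>) \<longlonglongrightarrow> (CLINT \<omega>|M. iexp (Y \<omega>) * indicator A \<omega>)"
    by (rule lim[OF A'])
  have sp: "(CLINT \<omega>|M. X \<omega> * indicator (space M) \<omega>) = (CLINT \<omega>|M. X \<omega>)" for X :: "'w \<Rightarrow> complex"
    by (intro Bochner_Integration.integral_cong) auto
  have l2: "(\<lambda>n. (CLINT \<omega>|M. iexp (Z n \<omega>)) * prob A) \<longlonglongrightarrow> (CLINT \<omega>|M. iexp (Y \<omega>)) * prob A"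
    using lim[OF sets.top, unfolded sp] by (intro tendsto_intros)
  have "(CLINT \<omega>|M. iexp (Z n \<omega>) * indicator A \<omega>) = (CLINT \<omega>|M. iexp (Z n \<omega>)) * prob A" for n
    using r[of n] A ab Z by (intro char_indep_past[where r="r n"] F_sigma_sets[of a]) auto
  with l1 l2 show ?thesis using LIMSEQ_unique by simp
qed

section \<open>Independence of a cell from everything outside of it\<close>

text \<open>The past of \<open>a\<close> together with the simultaneous noise off \<open>B\<close>:
  in an ordered list of cells, all that follows the cell (a, b] x B in the list is measurable with
  respect to it.\<close>

definition outside :: "real \<Rightarrow> real \<Rightarrow> real set \<Rightarrow> 'w measure" where
  "outside a b B = sigma (space M) (sets (F a) \<union>
     {winc a b C -` D \<inter> space M | C D. C \<in> finite_borel_sets \<and> C \<inter> B = {} \<and> D \<in> sets borel})"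

lemma outside_gen:
  assumes "0 \<le> a" "a \<le> b"
  shows "sets (F a) \<union> {winc a b C -` D \<inter> space M | C D. C \<in> finite_borel_sets \<and> C \<inter> B = {} \<and> D \<in> sets borel} \<subseteq> sets M"
proof -
  have "winc a b C -` D \<inter> space M \<in> sets M" if "C \<in> finite_borel_sets" "D \<in> sets borel" for C D
    using centered_gaussian_measurable[OF winc_gaussian[OF assms that(1)]] that(2) by (rule measurable_sets)
  then show ?thesis using sets_F_subset assms by auto
qed

lemma space_outside: "0 \<le> a \<Longrightarrow> a \<le> b \<Longrightarrow> space (outside a b B) = space M"
  using outside_gen[of a b B] sets.sets_into_space[of _ M] unfolding outside_def
  by (intro space_measure_of) blast

lemma sets_outside: "0 \<le> a \<Longrightarrow> a \<le> b \<Longrightarrow> sets (outside a b B) = sigma_sets (space M) (sets (F a) \<union>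
     {winc a b C -` D \<inter> space M | C D. C \<in> finite_borel_sets \<and> C \<inter> B = {} \<and> D \<in> sets borel})"
  using outside_gen[of a b B] sets.sets_into_space[of _ M] unfolding outside_def
  by (intro sets_measure_of) blast

lemma F_measurable_outside:
  assumes "0 \<le> a" "a \<le> b" "Z \<in> borel_measurable (F a)" shows "Z \<in> borel_measurable (outside a b B)"
  using assms by (intro measurableI) (auto simp: space_outside sets_outside space_F[symmetric] intro!: sigma_sets.Basic measurable_sets)

lemma winc_measurable_outside:
  assumes "0 \<le> a" "a \<le> b" "C \<in> finite_borel_sets" "C \<inter> B = {}"
  shows "winc a b C \<in> borel_measurable (outside a b B)"
  using assms by (intro measurableI) (auto simp: space_outside sets_outside intro!: sigma_sets.Basic)

lemma measurable_outside_M: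
  assumes "0 \<le> a" "a \<le> b" "Z \<in> borel_measurable (outside a b B)" shows "Z \<in> borel_measurable M"
proof -
  have "sets (outside a b B) \<subseteq> sets M"
    using assms outside_gen[of a b B] by (simp add: sets_outside sets.sigma_sets_subset)
  then have "subalgebra M (outside a b B)" using assms by (auto simp: subalgebra_def space_outside)
  then show ?thesis using assms(3) by (rule measurable_from_subalg)
qed

text \<open>Events of \<open>F a\<close> are not described by noise variables, so the tests carry
  the indicator of such an event beside the exponential of increments off \<open>B\<close>. They are
  stable under further indicators of this kind and further exponentials, hence all generators of
  \<open>outside\<close> preserve orthogonality. That the centred character of the increment is
  orthogonal to them follows from \<open>char_indep_F\<close>, which splits off the indicator, and
  \<open>char_uncorrelated\<close>, which separates the increments.\<close>

lemma outside_indep: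
  assumes ab: "0 \<le> a" "a \<le> b" and B: "B \<in> finite_borel_sets" and A: "A \<in> sets (outside a b B)" and D: "D \<in> sets borel"
  shows "prob (A \<inter> (winc a b B -` D \<inter> space M)) = prob A * prob (winc a b B -` D \<inter> space M)"
proof -
  define V where "V = incs a b {C. C \<inter> B = {}}"
  define \<Phi> where "\<Phi> = {\<lambda>\<omega>. iexp (X \<omega>) * indicator E \<omega> | X E. X \<in> lin_span V \<and> E \<in> sets (F a)}"
  let ?g = "winc a b B"
  have sV: "lin_span V \<subseteq> lin_span (noise_vars {0..})" unfolding V_def using incs_span ab by auto
  have sV': "lin_span V \<subseteq> lin_span (incs a b UNIV)" unfolding V_def
    by (rule lin_span_sub) (auto simp: incs_def intro!: lin_span_base)
  have Fs: "E \<in> sets M" if "E \<in> sets (F a)" for E using that sets_F_subset ab by auto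
  have Vm: "X \<in> borel_measurable M" if "X \<in> lin_span V" for X using that sV noise_span_measurable by auto
  have [measurable]: "?g \<in> borel_measurable M" using ab B by (intro centered_gaussian_measurable winc_gaussian)
  have \<Phi>: "bounded_tests \<Phi>"
    unfolding bounded_tests_def \<Phi>_def
  proof safe
    fix X E assume "X \<in> lin_span V" "E \<in> sets (F a)"
    then have [measurable]: "X \<in> borel_measurable M" "E \<in> sets M" using Vm Fs by auto
    show "(\<lambda>\<omega>. iexp (X \<omega>) * indicator E \<omega>) \<in> borel_measurable M" by measurable
    show "\<exists>B. \<forall>\<omega>. cmod (iexp (X \<omega>) * indicator E \<omega>) \<le> B" by (intro exI[of _ 1]) (auto simp: norm_mult split: split_indicator)
  qed
  have pres: "preserving_event \<Phi> A"
  proof (rule preserving_event_sigma[OF \<Phi> _ A[unfolded sets_outside[OF ab]]])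
    fix A assume "A \<in> sets (F a) \<union> {winc a b C -` D \<inter> space M | C D. C \<in> finite_borel_sets \<and> C \<inter> B = {} \<and> D \<in> sets borel}"
    then consider "A \<in> sets (F a)" | C D where "A = winc a b C -` D \<inter> space M" "C \<in> finite_borel_sets" "C \<inter> B = {}" "D \<in> sets borel"
      by auto
    then show "preserving_event \<Phi> A"
    proof cases
      case 1
      have [measurable]: "A \<in> sets M" using 1 Fs by auto
      show ?thesis unfolding preserving_event_def
      proof safe
        fix K assume K: "orthogonal_weight \<Phi> K"
        then obtain B where [measurable]: "K \<in> borel_measurable M" and B: "\<And>\<omega>. norm (K \<omega>) \<le> B"
          by (auto simp: orthogonal_weight_def)
        show "orthogonal_weight \<Phi> (\<lambda>\<omega>. K \<omega> * indicator A \<omega>)"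
          unfolding orthogonal_weight_def
        proof (intro conjI exI allI ballI)
          show "cmod (K \<omega> * indicator A \<omega>) \<le> B" for \<omega>
            using B[of \<omega>] by (auto split: split_indicator intro: order_trans[OF norm_ge_zero])
          fix \<phi> assume "\<phi> \<in> \<Phi>"
          then obtain X E where X: "\<phi> = (\<lambda>\<omega>. iexp (X \<omega>) * indicator E \<omega>)" "X \<in> lin_span V" "E \<in> sets (F a)"
            by (auto simp: \<Phi>_def)
          have "(\<lambda>\<omega>. iexp (X \<omega>) * indicator (A \<inter> E) \<omega>) \<in> \<Phi>"
            unfolding \<Phi>_def using X(2,3) 1 by blast
          then have "(CLINT \<omega>|M. K \<omega> * (iexp (X \<omega>) * indicator (A \<inter> E) \<omega>)) = 0"
            using K by (auto simp: orthogonal_weight_def)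
          then show "(CLINT \<omega>|M. K \<omega> * indicator A \<omega> * \<phi> \<omega>) = 0"
            by (simp add: X indicator_inter_arith mult_ac)
        qed simp
      qed simp
    next
      case 2
      show ?thesis unfolding 2(1)
      proof (rule preserving_event_vimage[OF \<Phi> _ 2(4)])
        show "winc a b C \<in> borel_measurable M" using 2 ab by (intro centered_gaussian_measurable winc_gaussian)
        fix \<phi> :: "'w \<Rightarrow> complex" and t assume "\<phi> \<in> \<Phi>"
        then obtain X E where X: "\<phi> = (\<lambda>\<omega>. iexp (X \<omega>) * indicator E \<omega>)" "X \<in> lin_span V" "E \<in> sets (F a)"
            by (auto simp: \<Phi>_def)
        have "(\<lambda>\<omega>. X \<omega> + t * winc a b C \<omega>) \<in> lin_span V"
          by (rule lin_span.add[OF X(2)]) (use 2 in \<open>auto simp: V_def incs_def\<close>)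
        then show "(\<lambda>\<omega>. \<phi> \<omega> * iexp (t * winc a b C \<omega>)) \<in> \<Phi>"
          unfolding X \<Phi>_def using X(3)
          by (intro CollectI exI[of _ "\<lambda>\<omega>. X \<omega> + t * winc a b C \<omega>"] exI[of _ E]) (auto simp: exp_add algebra_simps)
      qed
    qed
  qed
  then have [measurable]: "A \<in> sets M" by (simp add: preserving_event_def)
  have gs: "?g \<in> lin_span (noise_vars {0..})" using ab B by (intro winc_span) auto
  \<comment> \<open>As a weight, the centred indicator of \<open>A\<close> annihilates every
    character of the increment; \<open>char_weight\<close> turns this into the product formula for
    events.\<close>
  have ch: "(CLINT \<omega>|M. (indicator A \<omega> - of_real (prob A)) * iexp (t * ?g \<omega>)) = 0" for t
  proof -
    let ?Y = "\<lambda>\<omega>. t * ?g \<omega>"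
    have Ys: "?Y \<in> lin_span (noise_vars {0..})" using gs by (rule lin_span_scale)
    have Yi: "?Y \<in> lin_span (incs a b UNIV)" using B by (intro lin_span_scale lin_span_base) (auto simp: incs_def)
    define e where "e = (CLINT \<omega>|M. iexp (?Y \<omega>))"
    have "orthogonal_weight \<Phi> (\<lambda>\<omega>. iexp (?Y \<omega>) - e)"
      unfolding orthogonal_weight_def
    proof (intro conjI exI allI ballI)
      show "(\<lambda>\<omega>. iexp (?Y \<omega>) - e) \<in> borel_measurable M" by measurable
      show "cmod (iexp (?Y \<omega>) - e) \<le> 1 + cmod e" for \<omega>
        by (rule order_trans[OF norm_triangle_ineq4]) (simp del: of_real_mult)
      fix \<phi> assume "\<phi> \<in> \<Phi>"
      then obtain X E where X: "\<phi> = (\<lambda>\<omega>. iexp (X \<omega>) * indicator E \<omega>)" "X \<in> lin_span V" "E \<in> sets (F a)"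
        by (auto simp: \<Phi>_def)
      have [measurable]: "X \<in> borel_measurable M" "E \<in> sets M" using X Vm Fs by auto
      have Xi: "X \<in> lin_span (incs a b UNIV)" using X sV' by auto
      have XY: "(\<lambda>\<omega>. X \<omega> + ?Y \<omega>) \<in> lin_span (incs a b UNIV)" using Xi Yi by (rule lin_span_add)
      have "expectation (\<lambda>\<omega>. X \<omega> * ?g \<omega>) = 0"
      proof (rule span_orthogonal[OF _ gs _ X(2)])
        show "V \<subseteq> lin_span (noise_vars {0..})" using sV lin_span_base by blast
        fix v assume "v \<in> V"
        then obtain C where "v = winc a b C" "C \<in> finite_borel_sets" "C \<inter> B = {}" by (auto simp: V_def incs_def)
        then show "expectation (\<lambda>\<omega>. v \<omega> * ?g \<omega>) = 0" using winc_cov[OF ab] B by simp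
      qed
      then have "expectation (\<lambda>\<omega>. t * (X \<omega> * ?g \<omega>)) = 0" by simp
      then have "expectation (\<lambda>\<omega>. X \<omega> * ?Y \<omega>) = 0" by (simp add: mult_ac)
      from char_uncorrelated[OF _ Ys this] X(2) sV
      have c: "(CLINT \<omega>|M. iexp (X \<omega>) * iexp (?Y \<omega>)) = (CLINT \<omega>|M. iexp (X \<omega>)) * e" by (auto simp: e_def)
      have ii: "iexp (X \<omega> + ?Y \<omega>) = iexp (X \<omega>) * iexp (?Y \<omega>)" for \<omega> by (simp add: exp_add distrib_left)
      have "(CLINT \<omega>|M. (iexp (?Y \<omega>) - e) * \<phi> \<omega>) = (CLINT \<omega>|M. iexp (X \<omega> + ?Y \<omega>) * indicator E \<omega> - e * (iexp (X \<omega>) * indicator E \<omega>))"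
        unfolding X ii by (simp add: algebra_simps)
      also have "\<dots> = (CLINT \<omega>|M. iexp (X \<omega> + ?Y \<omega>) * indicator E \<omega>) - (CLINT \<omega>|M. e * (iexp (X \<omega>) * indicator E \<omega>))"
        by (intro Bochner_Integration.integral_diff integrable_mult_right integrable_const_bound[of _ 1]) (auto simp: norm_mult split: split_indicator)
      also have "\<dots> = 0"
        unfolding integral_mult_right_zero char_indep_F[OF ab X(3) Xi] char_indep_F[OF ab X(3) XY]
        unfolding ii c by simp
      finally show "(CLINT \<omega>|M. (iexp (?Y \<omega>) - e) * \<phi> \<omega>) = 0" .
    qed
    then have "orthogonal_weight \<Phi> (\<lambda>\<omega>. (iexp (?Y \<omega>) - e) * indicator A \<omega>)"
      using pres by (auto simp: preserving_event_def)
    then have "\<forall>\<phi>\<in>\<Phi>. (CLINT \<omega>|M. (iexp (?Y \<omega>) - e) * indicator A \<omega> * \<phi> \<omega>) = 0"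
      unfolding orthogonal_weight_def by (elim conjE)
    \<comment> \<open>With \<open>X = 0\<close> and the sure event, the test is the constant 1 on
      \<open>space M\<close>.\<close>
    moreover have "(\<lambda>\<omega>. 1 * indicator (space M) \<omega>) \<in> \<Phi>"
      unfolding \<Phi>_def using lin_span.zero sets.top[of "F a"] space_F ab
      by (intro CollectI exI[of _ "\<lambda>_. 0"] exI[of _ "space M"]) auto
    ultimately have "(CLINT \<omega>|M. (iexp (?Y \<omega>) - e) * indicator A \<omega> * (1 * indicator (space M) \<omega>)) = 0"
      by (rule bspec)
    moreover have "(CLINT \<omega>|M. (iexp (?Y \<omega>) - e) * indicator A \<omega> * (1 * indicator (space M) \<omega>)) =
      (CLINT \<omega>|M. iexp (?Y \<omega>) * indicator A \<omega> - e * indicator A \<omega>)"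
      by (intro Bochner_Integration.integral_cong) (auto simp: algebra_simps)
    moreover have "\<dots> = (CLINT \<omega>|M. iexp (?Y \<omega>) * indicator A \<omega>) - (CLINT \<omega>|M. e * indicator A \<omega>)"
      by (intro Bochner_Integration.integral_diff integrable_mult_right integrable_const_bound[of _ 1]) (auto simp: norm_mult split: split_indicator)
    ultimately have *: "(CLINT \<omega>|M. iexp (?Y \<omega>) * indicator A \<omega>) = e * prob A" by (simp add: integral_cindicator)
    have "(CLINT \<omega>|M. (indicator A \<omega> - of_real (prob A)) * iexp (t * ?g \<omega>)) =
      (CLINT \<omega>|M. iexp (?Y \<omega>) * indicator A \<omega> - of_real (prob A) * iexp (?Y \<omega>))"
      by (intro Bochner_Integration.integral_cong) (auto simp: algebra_simps)
    also have "\<dots> = (CLINT \<omega>|M. iexp (?Y \<omega>) * indicator A \<omega>) - (CLINT \<omega>|M. of_real (prob A) * iexp (?Y \<omega>))"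
      by (intro Bochner_Integration.integral_diff integrable_mult_right integrable_const_bound[of _ 1]) (auto simp: norm_mult split: split_indicator)
    also have "\<dots> = 0" unfolding * integral_mult_right_zero by (simp add: e_def)
    finally show ?thesis .
  qed
  have "(CLINT \<omega>|M. (indicator A \<omega> - of_real (prob A)) * indicator D (?g \<omega>)) = 0"
  proof (rule char_weight[where B=2, OF _ _ D _ ch])
    show "norm (indicator A \<omega> - complex_of_real (prob A)) \<le> 2" for \<omega>
      using order_trans[OF prob_le_1[of A], of 2]
      by (intro order_trans[OF norm_triangle_ineq4]) (auto split: split_indicator)
  qed auto
  also have "(CLINT \<omega>|M. (indicator A \<omega> - of_real (prob A)) * indicator D (?g \<omega>)) =
    (CLINT \<omega>|M. indicator (A \<inter> (?g -` D \<inter> space M)) \<omega> - of_real (prob A) * indicator (?g -` D \<inter> space M) \<omega>)"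
    by (intro Bochner_Integration.integral_cong) (auto split: split_indicator)
  also have "\<dots> = (CLINT \<omega>|M. indicator (A \<inter> (?g -` D \<inter> space M)) \<omega>) - (CLINT \<omega>|M. of_real (prob A) * indicator (?g -` D \<inter> space M) \<omega>)"
    using D by (intro Bochner_Integration.integral_diff integrable_mult_right integrable_const_bound[of _ 1]) (auto simp: norm_mult split: split_indicator)
  finally show ?thesis
    using D by (simp add: integral_cindicator of_real_mult[symmetric] del: of_real_mult)
qed

lemma outside_indep_var:
  assumes ab: "0 \<le> a" "a \<le> b" and B: "B \<in> finite_borel_sets" and S: "S \<in> borel_measurable (outside a b B)"
  shows "indep_var borel S borel (winc a b B)"
proof -
  have [measurable]: "winc a b B \<in> borel_measurable M" using ab B by (intro centered_gaussian_measurable winc_gaussian)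
  have [measurable]: "S \<in> borel_measurable M" using measurable_outside_M[OF ab S] .
  have "indep_set {S -` A \<inter> space M |A. A \<in> sets borel} {winc a b B -` A \<inter> space M |A. A \<in> sets borel}"
  proof (rule indep_setI)
    fix U V assume U: "U \<in> {S -` A \<inter> space M |A. A \<in> sets borel}" and V: "V \<in> {winc a b B -` A \<inter> space M |A. A \<in> sets borel}"
    have "U \<in> sets (outside a b B)" using U measurable_sets[OF S] space_outside[OF ab, of B] by auto
    then show "prob (U \<inter> V) = prob U * prob V" using V outside_indep[OF ab B] by auto
  qed auto
  then show ?thesis unfolding indep_var_eq
  proof (intro conjI indep_set_sigma_sets)
    have "Int_stable {f -` A \<inter> space M |A. A \<in> sets borel}" for f :: "'w \<Rightarrow> real"
      unfolding Int_stable_def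
    proof safe
      fix A A' :: "real set" assume "A \<in> sets borel" "A' \<in> sets borel"
      then show "\<exists>C. f -` A \<inter> space M \<inter> (f -` A' \<inter> space M) = f -` C \<inter> space M \<and> C \<in> sets borel"
        by (intro exI[of _ "A \<inter> A'"]) auto
    qed
    then show "Int_stable {S -` A \<inter> space M |A. A \<in> sets borel}"
      "Int_stable {winc a b B -` A \<inter> space M |A. A \<in> sets borel}" by blast+
  qed auto
qed

end


section \<open>Moments of simple Walsh integrals\<close>

lemma sum_even_terms:
  fixes f :: "nat \<Rightarrow> real"
  assumes "\<And>k. odd k \<Longrightarrow> f k = 0"
  shows "(\<Sum>k\<le>2 * m. f k) = (\<Sum>j\<le>m. f (2 * j))"
  using assms by (induction m) auto

text \<open>The weighted inequality of arithmetic and geometric mean for \<open>s ^ m\<close> and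
  \<open>z ^ m\<close>. The cases with a zero factor are separated because the identity
  \<open>e\<close> between real and natural powers asks for a positive base.\<close>

lemma young_power:
  fixes s z :: real
  assumes "0 \<le> s" "0 \<le> z" "j \<le> m" "0 < m"
  shows "s ^ (m - j) * z ^ j \<le> (real (m - j) / real m) * s ^ m + (real j / real m) * z ^ m"
proof -
  have R: "0 \<le> (real (m - j) / real m) * s ^ m + (real j / real m) * z ^ m" using assms by simp
  consider "s = 0" "j < m" | "z = 0" "0 < j" | "j = 0" | "j = m" | "0 < s" "0 < z"
    using assms by linarith
  then show ?thesis
  proof cases
    case 5
    have e: "(x ^ m) powr (real k / real m) = x ^ k" if "0 < x" for x :: real and k
      using that assms(4) by (simp add: powr_realpow[symmetric] powr_powr)
    have "(s ^ m) powr (real (m - j) / real m) * (z ^ m) powr (real j / real m) \<le>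
       (real (m - j) / real m) * s ^ m + (real j / real m) * z ^ m"
      using 5 assms by (intro Youngs_inequality_0) (auto simp: add_divide_distrib[symmetric] of_nat_diff)
    then show ?thesis using e[OF 5(1)] e[OF 5(2)] by simp
  qed (use R assms in \<open>auto simp: zero_power\<close>)
qed

text \<open>
  The coefficient comparison behind the moment bound: the even moments of \<open>n + g\<close>, \<open>g\<close> Gaussian of
  variance \<open>w\<close>, are dominated by \<open>(n\<^sup>2 + (2 m - 1) w) ^ m\<close>.
\<close>

lemma gaussian_coefficient_le:
  "j \<le> m \<Longrightarrow> real ((2 * m) choose (2 * j)) * (fact (2 * j) / (2 ^ j * fact j)) \<le> real (m choose j) * (2 * real m - 1) ^ j"
proof (induction j)
  case (Suc j)
  let ?c = "\<lambda>j. real ((2 * m) choose (2 * j)) * (fact (2 * j) / (2 ^ j * fact j))"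
  let ?d = "\<lambda>j. real (m choose j) * (2 * real m - 1) ^ j"
  have c: "?c j = fact (2 * m) / (fact (2 * m - 2 * j) * (2 ^ j * fact j))" if "j \<le> m" for j
    using that by (simp add: binomial_fact)
  have f2: "fact (2 * m - 2 * j) = real (2 * m - 2 * j) * real (2 * m - 2 * j - 1) * fact (2 * m - 2 * Suc j)"
    using Suc(2) fact_reduce[of "2 * m - 2 * j", where 'a=real] fact_reduce[of "2 * m - 2 * j - 1", where 'a=real]
    by (simp add: numeral_2_eq_2)
  \<comment> \<open>Ratios of successive terms are compared: the left side grows by (m - j) (2m - 2j
    - 1) / (j + 1), the right side by (m - j) (2m - 1) / (j + 1).\<close>
  have cS: "real (Suc j) * ?c (Suc j) = real (m - j) * real (2 * m - 2 * j - 1) * ?c j"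
  proof -
    have ne: "fact (2 * m - 2 * Suc j) \<noteq> (0::real)" "real (2 * m - 2 * j) \<noteq> 0" "real (2 * m - 2 * j - 1) \<noteq> 0"
      using Suc(2) by auto
    have x: "real (2 * m - 2 * j) = 2 * real (m - j)" by simp
    have gen: "s * (A / (G * (2 * 2 ^ j * (s * q)))) = x * y * (A / ((2 * x * y * G) * (2 ^ j * q)))"
      if "x \<noteq> 0" "y \<noteq> 0" "G \<noteq> 0" "q \<noteq> 0" "s \<noteq> 0" for A x y G q s :: real
      using that by (simp add: field_simps)
    have "fact (Suc j) = real (Suc j) * fact j" by simp
    then show ?thesis
      using ne unfolding c[OF Suc(2)] c[OF Suc_leD[OF Suc(2)]] unfolding f2 x power_Suc
      by (simp only:) (rule gen, auto)
  qed
  have dS: "real (Suc j) * ?d (Suc j) = real (m - j) * (2 * real m - 1) * ?d j"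
  proof -
    have "real (Suc j) * real (m choose Suc j) = real (m - j) * real (m choose j)"
      unfolding of_nat_mult[symmetric] by (simp only: binomial_absorb_comp binomial_absorption)
    then have "real (Suc j) * (real (m choose Suc j) * ((2 * real m - 1) * (2 * real m - 1) ^ j)) =
      (real (m - j) * real (m choose j)) * ((2 * real m - 1) * (2 * real m - 1) ^ j)"
      by (simp only: mult.assoc[symmetric])
    then show ?thesis by (simp only: power_Suc mult_ac)
  qed
  have "real (m - j) * real (2 * m - 2 * j - 1) * ?c j \<le> real (m - j) * (2 * real m - 1) * ?d j"
    using Suc by (intro mult_mono Suc.IH) auto
  then have "real (Suc j) * ?c (Suc j) \<le> real (Suc j) * ?d (Suc j)" unfolding cS dS .
  then show ?case by (simp only: mult_le_cancel_left_pos[OF of_nat_0_less_iff[THEN iffD2, OF zero_less_Suc]])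
qed simp

context prob_space
begin

text \<open>A class that contains the bounded coefficients as well as the Gaussian increments and is
  closed under sums and products, so simple integrals belong to it.\<close>

definition has_moments :: "('a \<Rightarrow> real) \<Rightarrow> bool" where
  "has_moments X \<longleftrightarrow> X \<in> borel_measurable M \<and> (\<forall>n. integrable M (\<lambda>\<omega>. X \<omega> ^ n))"

lemma has_moments_measurable: "has_moments X \<Longrightarrow> X \<in> borel_measurable M"
  and has_moments_integrable: "has_moments X \<Longrightarrow> integrable M (\<lambda>\<omega>. X \<omega> ^ n)"
  by (auto simp: has_moments_def)

lemma has_moments_power_mult:
  assumes "has_moments X" "has_moments Y"
  shows "integrable M (\<lambda>\<omega>. X \<omega> ^ i * Y \<omega> ^ j)"
proof -
  have [measurable]: "X \<in> borel_measurable M" "Y \<in> borel_measurable M" 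
    using assms by (auto intro: has_moments_measurable)
  have "integrable M (\<lambda>\<omega>. X \<omega> ^ (2 * i) + Y \<omega> ^ (2 * j))"
    using assms by (intro Bochner_Integration.integrable_add has_moments_integrable)
  then show ?thesis
  proof (rule Bochner_Integration.integrable_bound)
    show "AE \<omega> in M. norm (X \<omega> ^ i * Y \<omega> ^ j) \<le> norm (X \<omega> ^ (2 * i) + Y \<omega> ^ (2 * j))"
    proof (rule AE_I2)
      fix \<omega>
      have "2 * \<bar>X \<omega> ^ i * Y \<omega> ^ j\<bar> \<le> (X \<omega> ^ i)\<^sup>2 + (Y \<omega> ^ j)\<^sup>2"
        using sum_squares_bound[of "\<bar>X \<omega> ^ i\<bar>" "\<bar>Y \<omega> ^ j\<bar>"] unfolding power2_abs by (simp add: abs_mult)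
      then have "\<bar>X \<omega> ^ i * Y \<omega> ^ j\<bar> \<le> (X \<omega> ^ i)\<^sup>2 + (Y \<omega> ^ j)\<^sup>2" by linarith
      then show "norm (X \<omega> ^ i * Y \<omega> ^ j) \<le> norm (X \<omega> ^ (2 * i) + Y \<omega> ^ (2 * j))"
        by (simp add: power_even_eq)
    qed
  qed auto
qed

lemma has_moments_add:
  assumes "has_moments X" "has_moments Y" shows "has_moments (\<lambda>\<omega>. X \<omega> + Y \<omega>)"
proof -
  have "integrable M (\<lambda>\<omega>. (X \<omega> + Y \<omega>) ^ n)" for n
    unfolding binomial_ring mult.assoc
    by (intro Bochner_Integration.integrable_sum integrable_mult_right has_moments_power_mult assms)
  then show ?thesis using assms[THEN has_moments_measurable] by (auto simp: has_moments_def)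
qed

lemma has_moments_mult:
  assumes "has_moments X" "has_moments Y" shows "has_moments (\<lambda>\<omega>. X \<omega> * Y \<omega>)"
proof -
  have "integrable M (\<lambda>\<omega>. (X \<omega> * Y \<omega>) ^ n)" for n
    unfolding power_mult_distrib by (intro has_moments_power_mult assms)
  then show ?thesis using assms[THEN has_moments_measurable] by (auto simp: has_moments_def)
qed

lemma has_moments_bounded:
  assumes "X \<in> borel_measurable M" "bounded (X ` space M)" shows "has_moments X"
proof -
  obtain C where C: "\<And>\<omega>. \<omega> \<in> space M \<Longrightarrow> \<bar>X \<omega>\<bar> \<le> C" using assms(2) by (auto simp: bounded_iff)
  show ?thesis unfolding has_moments_def
  proof safe
    fix n show "integrable M (\<lambda>\<omega>. X \<omega> ^ n)"
      using assms(1) C by (intro integrable_const_bound[of _ "C ^ n"] AE_I2) (auto simp: power_abs intro!: power_mono)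
  qed (rule assms)
qed

lemma has_moments_gaussian: "centered_gaussian M X \<Longrightarrow> has_moments X"
  by (auto simp: has_moments_def centered_gaussian_measurable integrable_gaussian_power)

text \<open>Hoelder's inequality with exponents m / (m - j) and m / j, obtained by integrating
  \<open>young_power\<close> for the normalized squares of \<open>S\<close> and \<open>Z\<close>.
  The normalization divides by \<open>N\<close> and \<open>h\<close>, hence their strict
  positivity.\<close>

lemma moment_holder:
  assumes S: "has_moments S" and Z: "has_moments Z" and N: "0 < N" "0 < h" and m: "j \<le> m" "0 < m"
    and ES: "expectation (\<lambda>\<omega>. S \<omega> ^ (2 * m)) \<le> N ^ m" and EZ: "expectation (\<lambda>\<omega>. Z \<omega> ^ (2 * m)) \<le> h ^ m"
  shows "expectation (\<lambda>\<omega>. S \<omega> ^ (2 * (m - j)) * Z \<omega> ^ (2 * j)) \<le> N ^ (m - j) * h ^ j"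
proof -
  let ?C = "N ^ (m - j) * h ^ j"
  have "expectation (\<lambda>\<omega>. S \<omega> ^ (2 * (m - j)) * Z \<omega> ^ (2 * j)) \<le>
     expectation (\<lambda>\<omega>. ?C * ((real (m - j) / real m / N ^ m) * S \<omega> ^ (2 * m) + (real j / real m / h ^ m) * Z \<omega> ^ (2 * m)))"
  proof (rule integral_mono)
    fix \<omega>
    have "((S \<omega>)\<^sup>2 / N) ^ (m - j) * ((Z \<omega>)\<^sup>2 / h) ^ j \<le> (real (m - j) / real m) * ((S \<omega>)\<^sup>2 / N) ^ m + (real j / real m) * ((Z \<omega>)\<^sup>2 / h) ^ m"
      using N m by (intro young_power) auto
    then have "?C * (((S \<omega>)\<^sup>2 / N) ^ (m - j) * ((Z \<omega>)\<^sup>2 / h) ^ j) \<le> ?C * ((real (m - j) / real m) * ((S \<omega>)\<^sup>2 / N) ^ m + (real j / real m) * ((Z \<omega>)\<^sup>2 / h) ^ m)"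
      using N by (intro mult_left_mono) auto
    then show "S \<omega> ^ (2 * (m - j)) * Z \<omega> ^ (2 * j) \<le> ?C * ((real (m - j) / real m / N ^ m) * S \<omega> ^ (2 * m) + (real j / real m / h ^ m) * Z \<omega> ^ (2 * m))"
      using N by (simp add: power_divide power_mult)
  qed (use S Z in \<open>auto intro!: has_moments_power_mult integrable_mult_right Bochner_Integration.integrable_add has_moments_integrable\<close>)
  also have "\<dots> = ?C * ((real (m - j) / real m / N ^ m) * expectation (\<lambda>\<omega>. S \<omega> ^ (2 * m)) + (real j / real m / h ^ m) * expectation (\<lambda>\<omega>. Z \<omega> ^ (2 * m)))"
    using has_moments_integrable[OF S, of "2 * m"] has_moments_integrable[OF Z, of "2 * m"] by simp
  also have "\<dots> \<le> ?C * ((real (m - j) / real m / N ^ m) * N ^ m + (real j / real m / h ^ m) * h ^ m)"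
    using N m ES EZ by (intro mult_left_mono add_mono) auto
  also have "\<dots> = ?C"
    using N m by (simp add: add_divide_distrib[symmetric] of_nat_diff)
  finally show ?thesis .
qed

end

context noise_space
begin

text \<open>In the binomial expansion the factors \<open>Z ^ k * S ^ l\<close> are independent of
  the increment, whose odd moments vanish; only even powers remain.\<close>

lemma cell_moment:
  assumes ab: "0 \<le> a" "a \<le> b" and B: "B \<in> finite_borel_sets"
    and S: "S \<in> borel_measurable (outside a b B)" "has_moments S"
    and Z: "Z \<in> borel_measurable (outside a b B)" "has_moments Z"
  shows "expectation (\<lambda>\<omega>. (Z \<omega> * winc a b B \<omega> + S \<omega>) ^ (2 * m)) =
    (\<Sum>j\<le>m. real ((2 * m) choose (2 * j)) * (fact (2 * j) / (2 ^ j * fact j)) * ((b - a) * measure lborel B) ^ j *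
      expectation (\<lambda>\<omega>. S \<omega> ^ (2 * (m - j)) * Z \<omega> ^ (2 * j)))"
proof -
  let ?g = "winc a b B"
  have G: "centered_gaussian M ?g" using ab B by (rule winc_gaussian)
  have g: "has_moments ?g" using G by (rule has_moments_gaussian)
  have ind: "expectation (\<lambda>\<omega>. (Z \<omega> ^ k * S \<omega> ^ l) * ?g \<omega> ^ k) = expectation (\<lambda>\<omega>. Z \<omega> ^ k * S \<omega> ^ l) * expectation (\<lambda>\<omega>. ?g \<omega> ^ k)"
    and int: "integrable M (\<lambda>\<omega>. (Z \<omega> ^ k * S \<omega> ^ l) * ?g \<omega> ^ k)" for k l
  proof -
    have "(\<lambda>\<omega>. Z \<omega> ^ k * S \<omega> ^ l) \<in> borel_measurable (outside a b B)" using S Z by measurable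
    from outside_indep_var[OF ab B this]
    have iv: "indep_var borel (\<lambda>\<omega>. Z \<omega> ^ k * S \<omega> ^ l) borel ?g" .
    have "indep_var borel ((\<lambda>x. x) \<circ> (\<lambda>\<omega>. Z \<omega> ^ k * S \<omega> ^ l)) borel ((\<lambda>x. x ^ k) \<circ> ?g)"
      by (rule indep_var_compose[OF iv]) auto
    then have iv: "indep_var borel (\<lambda>\<omega>. Z \<omega> ^ k * S \<omega> ^ l) borel (\<lambda>\<omega>. ?g \<omega> ^ k)" by (simp add: comp_def)
    note * = iv has_moments_power_mult[OF Z(2) S(2)] has_moments_integrable[OF g]
    show "expectation (\<lambda>\<omega>. (Z \<omega> ^ k * S \<omega> ^ l) * ?g \<omega> ^ k) = expectation (\<lambda>\<omega>. Z \<omega> ^ k * S \<omega> ^ l) * expectation (\<lambda>\<omega>. ?g \<omega> ^ k)"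
      by (rule indep_var_lebesgue_integral[OF *])
    show "integrable M (\<lambda>\<omega>. (Z \<omega> ^ k * S \<omega> ^ l) * ?g \<omega> ^ k)"
      by (rule indep_var_integrable[OF *])
  qed
  have "expectation (\<lambda>\<omega>. (Z \<omega> * ?g \<omega> + S \<omega>) ^ (2 * m)) =
    expectation (\<lambda>\<omega>. \<Sum>k\<le>2 * m. real ((2 * m) choose k) * ((Z \<omega> ^ k * S \<omega> ^ (2 * m - k)) * ?g \<omega> ^ k))"
    unfolding binomial_ring power_mult_distrib by (simp add: mult_ac)
  also have "\<dots> = (\<Sum>k\<le>2 * m. real ((2 * m) choose k) * (expectation (\<lambda>\<omega>. Z \<omega> ^ k * S \<omega> ^ (2 * m - k)) * expectation (\<lambda>\<omega>. ?g \<omega> ^ k)))"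
    by (subst Bochner_Integration.integral_sum) (auto intro!: integrable_mult_right int simp: ind)
  also have "\<dots> = (\<Sum>j\<le>m. real ((2 * m) choose (2 * j)) * (expectation (\<lambda>\<omega>. Z \<omega> ^ (2 * j) * S \<omega> ^ (2 * m - 2 * j)) * expectation (\<lambda>\<omega>. ?g \<omega> ^ (2 * j))))"
    by (rule sum_even_terms) (simp add: gaussian_moment_odd[OF G])
  also have "\<dots> = (\<Sum>j\<le>m. real ((2 * m) choose (2 * j)) * (fact (2 * j) / (2 ^ j * fact j)) * ((b - a) * measure lborel B) ^ j *
      expectation (\<lambda>\<omega>. S \<omega> ^ (2 * (m - j)) * Z \<omega> ^ (2 * j)))"
    unfolding gaussian_moment_even[OF G] winc_square[OF ab B] diff_mult_distrib2[symmetric]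
    by (simp add: mult_ac)
  finally show ?thesis .
qed

text \<open>Bounding the terms of \<open>cell_moment\<close> by
  \<open>gaussian_coefficient_le\<close> and \<open>moment_holder\<close> leaves a binomial
  expansion, which sums up to an m-th power again. The bound therefore has the same form as the
  hypothesis on \<open>S\<close> and can be iterated over cells.\<close>

lemma cell_moment_le:
  assumes ab: "0 \<le> a" "a \<le> b" and B: "B \<in> finite_borel_sets"
    and S: "S \<in> borel_measurable (outside a b B)" "has_moments S"
    and Z: "Z \<in> borel_measurable (outside a b B)" "has_moments Z"
    and N: "0 \<le> N" "0 \<le> h" and m: "0 < m"
    and ES: "expectation (\<lambda>\<omega>. S \<omega> ^ (2 * m)) \<le> N ^ m" and EZ: "expectation (\<lambda>\<omega>. Z \<omega> ^ (2 * m)) \<le> h ^ m"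
  shows "expectation (\<lambda>\<omega>. (Z \<omega> * winc a b B \<omega> + S \<omega>) ^ (2 * m)) \<le>
    (N + (2 * real m - 1) * (h * ((b - a) * measure lborel B))) ^ m"
proof -
  let ?v = "(b - a) * measure lborel B"
  let ?L = "expectation (\<lambda>\<omega>. (Z \<omega> * winc a b B \<omega> + S \<omega>) ^ (2 * m))"
  have v: "0 \<le> ?v" using ab by simp
  \<comment> \<open>Both bounds are raised by \<open>e\<close> since \<open>moment_holder\<close>
    divides by them; \<open>e\<close> tends to 0 at the end.\<close>
  have *: "?L \<le> ((N + e) + (2 * real m - 1) * ((h + e) * ?v)) ^ m" if e: "e > 0" for e
  proof -
    have ES': "expectation (\<lambda>\<omega>. S \<omega> ^ (2 * m)) \<le> (N + e) ^ m"
      using N e by (intro order_trans[OF ES] power_mono) auto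
    have EZ': "expectation (\<lambda>\<omega>. Z \<omega> ^ (2 * m)) \<le> (h + e) ^ m"
      using N e by (intro order_trans[OF EZ] power_mono) auto
    have "?L = (\<Sum>j\<le>m. real ((2 * m) choose (2 * j)) * (fact (2 * j) / (2 ^ j * fact j)) * ?v ^ j *
      expectation (\<lambda>\<omega>. S \<omega> ^ (2 * (m - j)) * Z \<omega> ^ (2 * j)))"
      by (rule cell_moment[OF ab B S Z])
    also have "\<dots> \<le> (\<Sum>j\<le>m. (real (m choose j) * (2 * real m - 1) ^ j) * ?v ^ j * ((N + e) ^ (m - j) * (h + e) ^ j))"
    proof (rule sum_mono)
      fix j assume j: "j \<in> {..m}"
      show "real ((2 * m) choose (2 * j)) * (fact (2 * j) / (2 ^ j * fact j)) * ?v ^ j *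
        expectation (\<lambda>\<omega>. S \<omega> ^ (2 * (m - j)) * Z \<omega> ^ (2 * j)) \<le>
       (real (m choose j) * (2 * real m - 1) ^ j) * ?v ^ j * ((N + e) ^ (m - j) * (h + e) ^ j)"
        by (rule mult_mono[OF mult_right_mono[OF gaussian_coefficient_le] moment_holder[OF S(2) Z(2) _ _ _ m ES' EZ']])
          (use j e N v m in \<open>auto intro!: integral_nonneg_AE mult_nonneg_nonneg simp: zero_le_even_power\<close>)
    qed
    also have "\<dots> = ((2 * real m - 1) * ((h + e) * ?v) + (N + e)) ^ m"
      unfolding binomial_ring power_mult_distrib by (simp add: mult_ac)
    finally show ?thesis by (simp add: add.commute)
  qed
  have "((\<lambda>e. ((N + e) + (2 * real m - 1) * ((h + e) * ?v)) ^ m) \<longlongrightarrow> ((N + 0) + (2 * real m - 1) * ((h + 0) * ?v)) ^ m) (at_right 0)"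
    by (intro tendsto_intros)
  then have "?L \<le> ((N + 0) + (2 * real m - 1) * ((h + 0) * ?v)) ^ m"
    by (rule tendsto_lowerbound) (auto simp: eventually_at_right_less intro!: * eventually_mono[OF eventually_at_right_less])
  then show ?thesis by simp
qed

end

text \<open>
  In a list sorted by this relation, with the latest cell first, the partial integral over the tail
  is measurable with respect to what happens outside of the cell at the head.
\<close>

definition cell_after :: "real \<times> real \<times> real set \<times> ('w \<Rightarrow> real) \<Rightarrow> real \<times> real \<times> real set \<times> ('w \<Rightarrow> real) \<Rightarrow> bool" where
  "cell_after = (\<lambda>(a, b, B, Z) (a', b', B', Z'). b' \<le> a \<or> a' = a \<and> b' = b \<and> B' \<inter> B = {})"

lemma simple_field_val_Cons:
  "simple_field_val ((a, b, B, Z) # es) s y \<omega> = Z \<omega> * indicator {a<..b} s * indicator B y + simple_field_val es s y \<omega>"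
  by (simp add: simple_field_val_def)

lemma simple_field_val_Nil [simp]: "simple_field_val [] s y \<omega> = 0"
  by (simp add: simple_field_val_def)

lemma ordered_field_disjoint:
  assumes "sorted_wrt cell_after ((a, b, B, Z) # es)" "s \<in> {a<..b}" "y \<in> B" "(a', b', B', Z') \<in> set es"
  shows "s \<notin> {a'<..b'} \<or> y \<notin> B'"
  using assms by (fastforce simp: cell_after_def)

lemma ordered_field_tail_zero:
  fixes \<Phi> :: "('w \<Rightarrow> real) \<Rightarrow> 'b :: semiring_1"
  assumes "sorted_wrt cell_after ((a, b, B, Z) # es)" "s \<in> {a<..b}" "y \<in> B"
  shows "(\<Sum>(a, b, B, Z)\<leftarrow>es. \<Phi> Z * indicator {a<..b} s * indicator B y) = 0"
proof -
  have "(case x of (a, b, B, Z) \<Rightarrow> \<Phi> Z * indicator {a<..b} s * indicator B y) = 0" if "x \<in> set es" for x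
  proof -
    obtain a' b' B' Z' where x: "x = (a', b', B', Z')" by (cases x)
    show ?thesis using ordered_field_disjoint[OF assms, of a' b' B' Z'] that x
      by (auto split: split_indicator)
  qed
  then have "map (\<lambda>(a, b, B, Z). \<Phi> Z * indicator {a<..b} s * indicator B y) es = map (\<lambda>_. 0) es"
    by (intro map_cong refl)
  then show ?thesis by (simp only: sum_list_0)
qed

text \<open>At any point at most one cell of an ordered list is active, so every functional
  vanishing at 0 passes through the sum. It serves for the second moment in the isometry, for the
  m-th root of the 2m-th moment, and for truncation.\<close>

lemma ordered_field_apply:
  fixes \<Psi> :: "('w \<Rightarrow> real) \<Rightarrow> 'b :: semiring_1"
  assumes "sorted_wrt cell_after es" and 0: "\<Psi> (\<lambda>_. 0) = 0"
  shows "\<Psi> (simple_field_val es s y) = (\<Sum>(a, b, B, Z)\<leftarrow>es. \<Psi> Z * indicator {a<..b} s * indicator B y)"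
  using assms(1)
proof (induction es)
  case Nil
  have "simple_field_val [] s y = (\<lambda>_. 0)" by (simp add: fun_eq_iff)
  then show ?case using 0 by simp
next
  case (Cons e es)
  obtain a b B Z where e: "e = (a, b, B, Z)" by (cases e)
  show ?case
  proof (cases "s \<in> {a<..b} \<and> y \<in> B")
    case True
    have "simple_field_val es s y = (\<lambda>_. 0)"
      using ordered_field_tail_zero[OF Cons(2)[unfolded e], of s y "\<lambda>Z. Z _"] True
      by (simp add: fun_eq_iff simple_field_val_def)
    then have "simple_field_val (e # es) s y = Z"
      using True by (simp add: fun_eq_iff e simple_field_val_Cons)
    then show ?thesis using True ordered_field_tail_zero[OF Cons(2)[unfolded e], of s y \<Psi>] by (simp add: e)
  next
    case False
    then have "simple_field_val (e # es) s y = simple_field_val es s y"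
      by (auto simp: fun_eq_iff e simple_field_val_Cons)
    then show ?thesis using Cons False by (auto simp: e)
  qed
qed

lemma is_simple_field_Cons:
  "is_simple_field M F t ((a, b, B, Z) # es) \<longleftrightarrow> is_simple_field M F t es \<and>
     0 \<le> a \<and> a < b \<and> b \<le> t \<and> B \<in> finite_borel_sets \<and> Z \<in> borel_measurable (F a) \<and> bounded (Z ` space M)"
  by (auto simp: is_simple_field_def)

lemma simple_walsh_integral_Cons:
  "simple_walsh_integral W ((a, b, B, Z) # es) \<omega> = Z \<omega> * (W b B \<omega> - W a B \<omega>) + simple_walsh_integral W es \<omega>"
  by (simp add: simple_walsh_integral_def)

lemma simple_walsh_integral_Nil [simp]: "simple_walsh_integral W [] \<omega> = 0"
  by (simp add: simple_walsh_integral_def)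

context noise_space
begin

section \<open>Integrals of ordered simple fields\<close>

lemma F_measurable_mono:
  assumes "0 \<le> a" "a \<le> b" "Z \<in> borel_measurable (F a)" shows "Z \<in> borel_measurable (F b)"
proof -
  have "subalgebra (F b) (F a)" using assms sets_F_mono[of a b] by (simp add: subalgebra_def space_F)
  then show ?thesis using assms(3) by (rule measurable_from_subalg)
qed

lemma F_measurable_M:
  assumes "0 \<le> a" "Z \<in> borel_measurable (F a)" shows "Z \<in> borel_measurable M"
  using subalgebra_F[OF assms(1)] assms(2) by (rule measurable_from_subalg)

lemma simple_has_moments:
  "is_simple_field M F t es \<Longrightarrow> has_moments (simple_walsh_integral W es)"
proof (induction es)
  case Nil
  have "simple_walsh_integral W [] = (\<lambda>_. 0)" by (simp add: fun_eq_iff)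
  then show ?case by (auto simp: has_moments_def)
next
  case (Cons e es)
  obtain a b B Z where e: "e = (a, b, B, Z)" by (cases e)
  have *: "simple_walsh_integral W (e # es) = (\<lambda>\<omega>. Z \<omega> * winc a b B \<omega> + simple_walsh_integral W es \<omega>)"
    by (simp add: fun_eq_iff e simple_walsh_integral_Cons winc_def)
  have s: "is_simple_field M F t es" "0 \<le> a" "a < b" "B \<in> finite_borel_sets" "Z \<in> borel_measurable (F a)" "bounded (Z ` space M)"
    using Cons(2) unfolding e is_simple_field_Cons by auto
  have "has_moments Z" using s by (intro has_moments_bounded) (auto intro: F_measurable_M)
  moreover have "has_moments (winc a b B)" using s by (intro has_moments_gaussian winc_gaussian) auto
  ultimately show ?case unfolding * by (rule has_moments_add[OF has_moments_mult Cons.IH[OF s(1)]])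
qed

lemma simple_measurable_F:
  "is_simple_field M F t es \<Longrightarrow> simple_walsh_integral W es \<in> borel_measurable (F t)"
proof (induction es)
  case Nil
  have "simple_walsh_integral W [] = (\<lambda>_. 0)" by (simp add: fun_eq_iff)
  then show ?case by simp
next
  case (Cons e es)
  obtain a b B Z where e: "e = (a, b, B, Z)" by (cases e)
  have *: "simple_walsh_integral W (e # es) = (\<lambda>\<omega>. Z \<omega> * winc a b B \<omega> + simple_walsh_integral W es \<omega>)"
    by (simp add: fun_eq_iff e simple_walsh_integral_Cons winc_def)
  have "Z \<in> borel_measurable (F t)" 
    using Cons(2) F_measurable_mono[of a t Z] unfolding e is_simple_field_Cons by auto
  moreover have "winc a b B \<in> borel_measurable (F t)"
    using Cons(2) F_measurable_mono[of b t "winc a b B"] winc_measurable_F[of a b B] unfolding e is_simple_field_Cons by auto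
  ultimately show ?case unfolding * using Cons unfolding e is_simple_field_Cons
    by (intro borel_measurable_add borel_measurable_times) auto
qed

lemma simple_measurable_outside:
  assumes "is_simple_field M F t es" "0 \<le> a" "a \<le> b" "\<And>e. e \<in> set es \<Longrightarrow> cell_after (a, b, B, Z) e"
  shows "simple_walsh_integral W es \<in> borel_measurable (outside a b B)"
  using assms
proof (induction es)
  case Nil
  have "simple_walsh_integral W [] = (\<lambda>_. 0)" by (simp add: fun_eq_iff)
  then show ?case by simp
next
  case (Cons e es)
  obtain a' b' B' Z' where e: "e = (a', b', B', Z')" by (cases e)
  have *: "simple_walsh_integral W (e # es) = (\<lambda>\<omega>. Z' \<omega> * winc a' b' B' \<omega> + simple_walsh_integral W es \<omega>)"
    by (simp add: fun_eq_iff e simple_walsh_integral_Cons winc_def)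
  have s: "0 \<le> a'" "a' < b'" "B' \<in> finite_borel_sets" "Z' \<in> borel_measurable (F a')"
    using Cons(2) unfolding e is_simple_field_Cons by auto
  consider "b' \<le> a" | "a' = a" "b' = b" "B' \<inter> B = {}"
    using Cons(5)[of e] by (auto simp: e cell_after_def)
  then have "Z' \<in> borel_measurable (outside a b B) \<and> winc a' b' B' \<in> borel_measurable (outside a b B)"
  proof cases
    case 1
    have "Z' \<in> borel_measurable (F a)"
      by (rule F_measurable_mono[OF s(1) _ s(4)]) (use 1 s in simp)
    moreover have "winc a' b' B' \<in> borel_measurable (F b')" using s by (intro winc_measurable_F) auto
    then have "winc a' b' B' \<in> borel_measurable (F a)" 
      by (rule F_measurable_mono[rotated 2]) (use 1 s in simp_all)
    ultimately show ?thesis using Cons(3,4) by (intro conjI F_measurable_outside) 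
  next
    case 2
    have "Z' \<in> borel_measurable (outside a b B)" using s Cons(3,4) unfolding 2(1) by (intro F_measurable_outside) 
    moreover have "winc a' b' B' \<in> borel_measurable (outside a b B)"
      unfolding 2(1,2) by (rule winc_measurable_outside[OF Cons(3,4) s(3) 2(3)])
    ultimately show ?thesis ..
  qed
  moreover have "simple_walsh_integral W es \<in> borel_measurable (outside a b B)"
    using Cons unfolding e is_simple_field_Cons by auto
  ultimately show ?case unfolding * by auto
qed

text \<open>\<open>root m\<close> of the 2m-th moment is the L^m norm of the square of
  \<open>Z\<close>. In this scale the contribution of each cell is simply added, by one use of
  \<open>cell_moment_le\<close> per cell.\<close>

lemma ordered_moment_le:
  assumes m: "0 < m"
  shows "is_simple_field M F t es \<Longrightarrow> sorted_wrt cell_after es \<Longrightarrow>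
    expectation (\<lambda>\<omega>. simple_walsh_integral W es \<omega> ^ (2 * m)) \<le>
     ((2 * real m - 1) * (\<Sum>(a, b, B, Z)\<leftarrow>es. root m (expectation (\<lambda>\<omega>. Z \<omega> ^ (2 * m))) * ((b - a) * measure lborel B))) ^ m"
proof (induction es)
  case (Cons e es)
  obtain a b B Z where e: "e = (a, b, B, Z)" by (cases e)
  have s: "is_simple_field M F t es" "0 \<le> a" "a < b" "B \<in> finite_borel_sets" "Z \<in> borel_measurable (F a)" "bounded (Z ` space M)"
    using Cons(2) unfolding e is_simple_field_Cons by auto
  have nnZ: "0 \<le> expectation (\<lambda>\<omega>. Z' \<omega> ^ (2 * m))" for Z' :: "'w \<Rightarrow> real" by (intro integral_nonneg_AE) (auto simp: zero_le_even_power)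
  let ?R = "\<lambda>es :: 'w simple_field. (\<Sum>(a, b, B, Z)\<leftarrow>es. root m (expectation (\<lambda>\<omega>. Z \<omega> ^ (2 * m))) * ((b - a) * measure lborel B))"
  have Rn: "0 \<le> ?R es" using s(1)
    by (intro sum_list_nonneg)
      (fastforce simp: is_simple_field_def intro!: mult_nonneg_nonneg real_root_ge_zero[OF nnZ])
  have "expectation (\<lambda>\<omega>. (Z \<omega> * winc a b B \<omega> + simple_walsh_integral W es \<omega>) ^ (2 * m)) \<le>
    ((2 * real m - 1) * ?R es + (2 * real m - 1) * (root m (expectation (\<lambda>\<omega>. Z \<omega> ^ (2 * m))) * ((b - a) * measure lborel B))) ^ m"
  proof (rule cell_moment_le)
    show "simple_walsh_integral W es \<in> borel_measurable (outside a b B)"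
      using s Cons(3) by (intro simple_measurable_outside[of t]) (auto simp: e)
    show "Z \<in> borel_measurable (outside a b B)" using s by (intro F_measurable_outside) auto
    show "has_moments Z" using s by (intro has_moments_bounded) (auto intro: F_measurable_M)
    show "has_moments (simple_walsh_integral W es)" using s by (intro simple_has_moments)
    show "expectation (\<lambda>\<omega>. simple_walsh_integral W es \<omega> ^ (2 * m)) \<le> ((2 * real m - 1) * ?R es) ^ m"
      using Cons s by (auto simp: e)
    show "expectation (\<lambda>\<omega>. Z \<omega> ^ (2 * m)) \<le> root m (expectation (\<lambda>\<omega>. Z \<omega> ^ (2 * m))) ^ m"
      using m nnZ by simp
  qed (use s m Rn in \<open>auto intro!: mult_nonneg_nonneg real_root_ge_zero[OF nnZ]\<close>)
  then show ?case by (simp add: e simple_walsh_integral_Cons winc_def distrib_left add.commute)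
qed (use m in \<open>simp add: zero_power\<close>)

text \<open>The exact case \<open>m = 1\<close> of \<open>cell_moment\<close>, where the mixed term
  contains the mean of an increment and drops out.\<close>

lemma ordered_square:
  "is_simple_field M F t es \<Longrightarrow> sorted_wrt cell_after es \<Longrightarrow>
    expectation (\<lambda>\<omega>. (simple_walsh_integral W es \<omega>)\<^sup>2) =
     (\<Sum>(a, b, B, Z)\<leftarrow>es. expectation (\<lambda>\<omega>. (Z \<omega>)\<^sup>2) * ((b - a) * measure lborel B))"
proof (induction es)
  case (Cons e es)
  obtain a b B Z where e: "e = (a, b, B, Z)" by (cases e)
  have s: "is_simple_field M F t es" "0 \<le> a" "a < b" "B \<in> finite_borel_sets" "Z \<in> borel_measurable (F a)" "bounded (Z ` space M)"
    using Cons(2) unfolding e is_simple_field_Cons by auto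
  have "expectation (\<lambda>\<omega>. (Z \<omega> * winc a b B \<omega> + simple_walsh_integral W es \<omega>) ^ (2 * 1)) =
    (\<Sum>j\<le>1. real ((2 * 1) choose (2 * j)) * (fact (2 * j) / (2 ^ j * fact j)) * ((b - a) * measure lborel B) ^ j *
      expectation (\<lambda>\<omega>. simple_walsh_integral W es \<omega> ^ (2 * (1 - j)) * Z \<omega> ^ (2 * j)))"
  proof (rule cell_moment)
    show "simple_walsh_integral W es \<in> borel_measurable (outside a b B)"
      using s Cons(3) by (intro simple_measurable_outside[of t]) (auto simp: e)
    show "Z \<in> borel_measurable (outside a b B)" using s by (intro F_measurable_outside) auto
    show "has_moments Z" using s by (intro has_moments_bounded) (auto intro: F_measurable_M)
    show "has_moments (simple_walsh_integral W es)" using s by (intro simple_has_moments)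
  qed (use s in auto)
  also have "\<dots> = expectation (\<lambda>\<omega>. (simple_walsh_integral W es \<omega>)\<^sup>2) + ((b - a) * measure lborel B) * expectation (\<lambda>\<omega>. (Z \<omega>)\<^sup>2)"
    by (simp add: fact_numeral numeral_2_eq_2)
  finally show ?case using Cons s by (simp add: e simple_walsh_integral_Cons winc_def mult_ac)
qed simp

end

section \<open>Refinement of simple fields\<close>

text \<open>The points lying in the members of \<open>P\<close> and in no other member of the
  family: the atoms of the algebra that the family generates. The empty \<open>P\<close> would give
  the complement of all sets, which has infinite measure, and is left out below.\<close>

definition atom_of :: "real set set \<Rightarrow> real set set \<Rightarrow> real set" where
  "atom_of \<B> P = {y. \<forall>B\<in>\<B>. y \<in> B \<longleftrightarrow> B \<in> P}"

lemma atom_of_disjoint: "P \<subseteq> \<B> \<Longrightarrow> Q \<subseteq> \<B> \<Longrightarrow> P \<noteq> Q \<Longrightarrow> atom_of \<B> P \<inter> atom_of \<B> Q = {}"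
  by (auto simp: atom_of_def)

lemma atom_of_fin:
  assumes "finite \<B>" "\<B> \<subseteq> finite_borel_sets" "P \<subseteq> \<B>" "P \<noteq> {}"
  shows "atom_of \<B> P \<in> finite_borel_sets"
proof -
  obtain B where B: "B \<in> P" using assms by auto
  have b: "X \<in> sets borel" if "X \<in> \<B>" for X using that assms by (auto simp: finite_borel_sets_def)
  have "atom_of \<B> P = B \<inter> ((\<Inter>X\<in>P. X) - (\<Union>X\<in>\<B> - P. X))"
    using assms B by (auto simp: atom_of_def)
  moreover have "(\<Inter>X\<in>P. X) - (\<Union>X\<in>\<B> - P. X) \<in> sets borel"
    using assms finite_subset[OF assms(3,1)] b by (intro sets.Diff sets.finite_INT sets.finite_UN) auto
  ultimately show ?thesis using assms B by auto
qed

lemma atom_of_sum: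
  assumes "finite \<B>" "B \<in> \<B>"
  shows "(\<Sum>P\<in>Pow \<B> - {{}}. if B \<in> P then indicator (atom_of \<B> P) y else 0) = (indicator B y :: real)"
proof -
  define Q where "Q = {B\<in>\<B>. y \<in> B}"
  have "(\<Sum>P\<in>Pow \<B> - {{}}. if B \<in> P then indicator (atom_of \<B> P) y else 0 :: real) =
    (\<Sum>P\<in>Pow \<B> - {{}}. if P = Q then indicator B y else 0)"
  proof (rule sum.cong[OF refl])
    fix P assume "P \<in> Pow \<B> - {{}}"
    then have "y \<in> atom_of \<B> P \<longleftrightarrow> P = Q" by (auto simp: atom_of_def Q_def)
    then show "(if B \<in> P then indicator (atom_of \<B> P) y else 0 :: real) = (if P = Q then indicator B y else 0)"
      using assms by (auto simp: Q_def split: split_indicator)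
  qed
  also have "\<dots> = (if Q \<in> Pow \<B> - {{}} then indicator B y else 0)"
    using assms by (simp add: sum.delta)
  also have "\<dots> = indicator B y" using assms by (auto simp: Q_def split: split_indicator)
  finally show ?thesis .
qed

text \<open>The consecutive grid intervals inside [a, b] are those between the positions
  \<open>p\<close> and \<open>q\<close> of its endpoints.\<close>

lemma telescope_cells:
  fixes f :: "real \<Rightarrow> real"
  assumes ts: "sorted_wrt (<) ts" and a: "a \<in> set ts" "b \<in> set ts" "a < b"
  shows "(\<Sum>k<length ts - 1. if a \<le> ts ! k \<and> ts ! Suc k \<le> b then f (ts ! Suc k) - f (ts ! k) else 0) = f b - f a"
proof -
  obtain p q where p: "p < length ts" "ts ! p = a" and q: "q < length ts" "ts ! q = b"
    using a by (auto simp: in_set_conv_nth)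
  have less: "ts ! i < ts ! j \<longleftrightarrow> i < j" if "i < length ts" "j < length ts" for i j
    using sorted_wrt_nth_less[OF ts] that by (metis linorder_neqE_nat not_less_iff_gr_or_eq)
  have le: "ts ! i \<le> ts ! j \<longleftrightarrow> i \<le> j" if "i < length ts" "j < length ts" for i j
    using less[of j i] that by (simp add: not_less[symmetric])
  have pq: "p < q" using less[of p q] p q a by simp
  have "(\<Sum>k<length ts - 1. if a \<le> ts ! k \<and> ts ! Suc k \<le> b then f (ts ! Suc k) - f (ts ! k) else 0) =
    (\<Sum>k<length ts - 1. if k \<in> {p..<q} then f (ts ! Suc k) - f (ts ! k) else 0)"
  proof (rule sum.cong[OF refl])
    fix k assume "k \<in> {..<length ts - 1}"
    then have "a \<le> ts ! k \<and> ts ! Suc k \<le> b \<longleftrightarrow> k \<in> {p..<q}"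
      using le[of p k] le[of "Suc k" q] p q by auto
    then show "(if a \<le> ts ! k \<and> ts ! Suc k \<le> b then f (ts ! Suc k) - f (ts ! k) else 0) =
      (if k \<in> {p..<q} then f (ts ! Suc k) - f (ts ! k) else 0)" by simp
  qed
  also have "\<dots> = (\<Sum>k\<in>{p..<q}. f (ts ! Suc k) - f (ts ! k))"
    using q by (subst sum.inter_restrict[symmetric]) (auto intro!: sum.cong)
  also have "\<dots> = f b - f a"
    using pq p q by (subst sum_Suc_diff'[of p q "\<lambda>k. f (ts ! k)"]) auto
  finally show ?thesis .
qed

text \<open>Adds up the entries whose rectangle contains the grid cell: the atom of \<open>P\<close>
  lies in \<open>B\<close> exactly when \<open>B \<in> P\<close>, unless the atom is empty.\<close>

definition grid_coeff :: "'w simple_field \<Rightarrow> real \<Rightarrow> real \<Rightarrow> real set set \<Rightarrow> 'w \<Rightarrow> real" where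
  "grid_coeff es c d P \<omega> = (\<Sum>(a, b, B, Z)\<leftarrow>es. if a \<le> c \<and> d \<le> b \<and> B \<in> P then Z \<omega> else 0)"

definition grid_row :: "'w simple_field \<Rightarrow> real set set \<Rightarrow> real set set list \<Rightarrow> real \<Rightarrow> real \<Rightarrow> 'w simple_field" where
  "grid_row es \<B> Ps c d = map (\<lambda>P. (c, d, atom_of \<B> P, grid_coeff es c d P)) Ps"

text \<open>The rows run backwards in time, since \<open>cell_after\<close> puts the latest cell at
  the head.\<close>

definition grid_field :: "'w simple_field \<Rightarrow> real set set \<Rightarrow> real set set list \<Rightarrow> real list \<Rightarrow> nat \<Rightarrow> 'w simple_field" where
  "grid_field es \<B> Ps ts n = concat (map (\<lambda>k. grid_row es \<B> Ps (ts ! k) (ts ! Suc k)) (rev [0..<n]))"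

lemma grid_field_set:
  "set (grid_field es \<B> Ps ts n) = {(ts ! k, ts ! Suc k, atom_of \<B> P, grid_coeff es (ts ! k) (ts ! Suc k) P) | k P. k < n \<and> P \<in> set Ps}"
proof -
  have "set (grid_field es \<B> Ps ts n) =
    (\<Union>k\<in>{..<n}. (\<lambda>P. (ts ! k, ts ! Suc k, atom_of \<B> P, grid_coeff es (ts ! k) (ts ! Suc k) P)) ` set Ps)"
    by (simp add: grid_field_def grid_row_def atLeast0LessThan)
  then show ?thesis by blast
qed

lemma grid_field_ordered:
  assumes ts: "sorted_wrt (<) ts" and Ps: "distinct Ps" "set Ps \<subseteq> Pow \<B>"
  shows "n < length ts \<Longrightarrow> sorted_wrt cell_after (grid_field es \<B> Ps ts n)"
proof (induction n)
  case 0 then show ?case by (simp add: grid_field_def)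
next
  case (Suc n)
  have "sorted_wrt (\<lambda>P Q. P \<noteq> Q) Ps" using Ps(1) by (simp add: distinct_conv_nth sorted_wrt_iff_nth_less)
  then have "sorted_wrt cell_after (grid_row es \<B> Ps (ts ! n) (ts ! Suc n))"
    unfolding grid_row_def sorted_wrt_map
  proof (rule sorted_wrt_mono_rel[rotated])
    fix P Q assume "P \<in> set Ps" "Q \<in> set Ps" "P \<noteq> Q"
    then have "atom_of \<B> Q \<inter> atom_of \<B> P = {}" using Ps(2) by (intro atom_of_disjoint) auto
    then show "cell_after (ts ! n, ts ! Suc n, atom_of \<B> P, grid_coeff es (ts ! n) (ts ! Suc n) P)
      (ts ! n, ts ! Suc n, atom_of \<B> Q, grid_coeff es (ts ! n) (ts ! Suc n) Q)"
      by (simp add: cell_after_def)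
  qed
  moreover have "cell_after x y" if xy: "x \<in> set (grid_row es \<B> Ps (ts ! n) (ts ! Suc n))" "y \<in> set (grid_field es \<B> Ps ts n)" for x y
  proof -
    obtain k where "k < n" "fst (snd y) = ts ! Suc k" using xy(2) by (auto simp: grid_field_set)
    moreover have "fst x = ts ! n" using xy(1) by (auto simp: grid_row_def)
    moreover have "ts ! Suc k \<le> ts ! n" if "k < n" for k
      using that Suc(2) sorted_wrt_nth_less[OF ts, of "Suc k" n] by (cases "Suc k = n") auto
    ultimately show ?thesis by (auto simp: cell_after_def split: prod.splits)
  qed
  moreover have "grid_field es \<B> Ps ts (Suc n) = grid_row es \<B> Ps (ts ! n) (ts ! Suc n) @ grid_field es \<B> Ps ts n"
    by (simp add: grid_field_def)
  ultimately show ?case using Suc by (simp add: sorted_wrt_append)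
qed

text \<open>
  The value and the integral of a simple field have this common shape, with
  \<open>L t B = 1\<^bsub>[s, \<infinity>)\<^esub>(t) 1\<^bsub>B\<^esub>(y)\<close> and \<open>L t B = W t B \<omega>\<close>.
\<close>

lemma grid_field_eval:
  fixes L :: "real \<Rightarrow> real set \<Rightarrow> real" and es :: "'w simple_field"
  assumes ts: "sorted_wrt (<) ts" and Ps: "distinct Ps" "set Ps = Pow \<B> - {{}}"
    and L: "\<And>t B. t \<in> set ts \<Longrightarrow> B \<in> \<B> \<Longrightarrow> L t B = (\<Sum>P\<in>Pow \<B> - {{}}. if B \<in> P then L t (atom_of \<B> P) else 0)"
    and es: "\<And>a b B Z. (a, b, B, Z) \<in> set es \<Longrightarrow> a \<in> set ts \<and> b \<in> set ts \<and> a < b \<and> B \<in> \<B>"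
  shows "(\<Sum>(a, b, B, Z)\<leftarrow>grid_field es \<B> Ps ts (length ts - 1). Z \<omega> * (L b B - L a B)) = (\<Sum>(a, b, B, Z)\<leftarrow>es. Z \<omega> * (L b B - L a B))"
proof -
  let ?n = "length ts - 1"
  have "(\<Sum>(a, b, B, Z)\<leftarrow>grid_field es \<B> Ps ts n. Z \<omega> * (L b B - L a B)) =
    (\<Sum>k<n. \<Sum>P\<in>Pow \<B> - {{}}. grid_coeff es (ts ! k) (ts ! Suc k) P \<omega> * (L (ts ! Suc k) (atom_of \<B> P) - L (ts ! k) (atom_of \<B> P)))" for es :: "'w simple_field" and n
    by (induction n) (auto simp: grid_field_def grid_row_def comp_def sum_list_distinct_conv_sum_set Ps)
  then have "(\<Sum>(a, b, B, Z)\<leftarrow>grid_field es \<B> Ps ts ?n. Z \<omega> * (L b B - L a B)) =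
    (\<Sum>k<?n. \<Sum>P\<in>Pow \<B> - {{}}. grid_coeff es (ts ! k) (ts ! Suc k) P \<omega> * (L (ts ! Suc k) (atom_of \<B> P) - L (ts ! k) (atom_of \<B> P)))" .
  also have "\<dots> = (\<Sum>(a, b, B, Z)\<leftarrow>es. Z \<omega> * (L b B - L a B))"
    using es
  proof (induction es)
    case Nil then show ?case by (simp add: grid_coeff_def)
  next
    case (Cons e es)
    obtain a b B Z where e: "e = (a, b, B, Z)" by (cases e)
    have ab: "a \<in> set ts" "b \<in> set ts" "a < b" "B \<in> \<B>" using Cons(2)[of a b B Z] by (auto simp: e)
    have c: "grid_coeff (e # es) c d P \<omega> = (if a \<le> c \<and> d \<le> b then (if B \<in> P then Z \<omega> else 0) else 0) + grid_coeff es c d P \<omega>" for c d P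
      by (simp add: grid_coeff_def e)
    have "(\<Sum>k<?n. \<Sum>P\<in>Pow \<B> - {{}}. (if a \<le> ts ! k \<and> ts ! Suc k \<le> b then (if B \<in> P then Z \<omega> else 0) else 0) * (L (ts ! Suc k) (atom_of \<B> P) - L (ts ! k) (atom_of \<B> P)))
      = (\<Sum>k<?n. Z \<omega> * (if a \<le> ts ! k \<and> ts ! Suc k \<le> b then L (ts ! Suc k) B - L (ts ! k) B else 0))"
    proof (rule sum.cong[OF refl])
      fix k assume k: "k \<in> {..<?n}"
      have "(\<Sum>P\<in>Pow \<B> - {{}}. (if B \<in> P then Z \<omega> else 0) * (L (ts ! Suc k) (atom_of \<B> P) - L (ts ! k) (atom_of \<B> P))) =
        Z \<omega> * ((\<Sum>P\<in>Pow \<B> - {{}}. if B \<in> P then L (ts ! Suc k) (atom_of \<B> P) else 0) - (\<Sum>P\<in>Pow \<B> - {{}}. if B \<in> P then L (ts ! k) (atom_of \<B> P) else 0))"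
        unfolding sum_subtractf[symmetric] sum_distrib_left by (intro sum.cong) auto
      also have "\<dots> = Z \<omega> * (L (ts ! Suc k) B - L (ts ! k) B)"
        using k ab by (subst (1 2) L[symmetric]) auto
      finally show "(\<Sum>P\<in>Pow \<B> - {{}}. (if a \<le> ts ! k \<and> ts ! Suc k \<le> b then (if B \<in> P then Z \<omega> else 0) else 0) * (L (ts ! Suc k) (atom_of \<B> P) - L (ts ! k) (atom_of \<B> P))) =
        Z \<omega> * (if a \<le> ts ! k \<and> ts ! Suc k \<le> b then L (ts ! Suc k) B - L (ts ! k) B else 0)"
        by auto
    qed
    also have "\<dots> = Z \<omega> * (L b B - L a B)"
      unfolding sum_distrib_left[symmetric] telescope_cells[OF ts ab(1-3), of "\<lambda>t. L t B"] ..
    finally have new: "(\<Sum>k<?n. \<Sum>P\<in>Pow \<B> - {{}}. (if a \<le> ts ! k \<and> ts ! Suc k \<le> b then (if B \<in> P then Z \<omega> else 0) else 0) * (L (ts ! Suc k) (atom_of \<B> P) - L (ts ! k) (atom_of \<B> P)))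
      = Z \<omega> * (L b B - L a B)" .
    have "(\<Sum>k<?n. \<Sum>P\<in>Pow \<B> - {{}}. grid_coeff es (ts ! k) (ts ! Suc k) P \<omega> * (L (ts ! Suc k) (atom_of \<B> P) - L (ts ! k) (atom_of \<B> P))) =
      (\<Sum>(a, b, B, Z)\<leftarrow>es. Z \<omega> * (L b B - L a B))"
      using Cons(2) by (intro Cons.IH) auto
    then show ?case unfolding c distrib_right sum.distrib new by (simp add: e)
  qed
  finally show ?thesis .
qed

context noise_space
begin

text \<open>Additivity of the noise in the set is not assumed; it follows from the covariances. The
  difference \<open>X\<close> of both sides is orthogonal to every \<open>W t C\<close>, and being a
  combination of such variables it is orthogonal to itself.\<close>

lemma W_atoms:
  assumes \<B>: "finite \<B>" "\<B> \<subseteq> finite_borel_sets" and B: "B \<in> \<B>" and t: "0 \<le> t"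
  shows "AE \<omega> in M. W t B \<omega> = (\<Sum>P\<in>Pow \<B> - {{}}. if B \<in> P then W t (atom_of \<B> P) \<omega> else 0)"
proof -
  define V where "V = {W t C | C. C \<in> finite_borel_sets}"
  define X where "X \<omega> = W t B \<omega> - (\<Sum>P\<in>Pow \<B> - {{}}. if B \<in> P then W t (atom_of \<B> P) \<omega> else 0)" for \<omega>
  have VN: "V \<subseteq> lin_span (noise_vars {0..})" using t W_span by (auto simp: V_def)
  have at: "atom_of \<B> P \<in> finite_borel_sets" if "P \<in> Pow \<B> - {{}}" for P using that \<B> by (intro atom_of_fin) auto
  have sumV: "(\<lambda>\<omega>. \<Sum>P\<in>Q. if B \<in> P then W t (atom_of \<B> P) \<omega> else 0) \<in> lin_span V" if "finite Q" "Q \<subseteq> Pow \<B> - {{}}" for Q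
    using that
  proof induction
    case empty then show ?case by (simp add: lin_span.zero)
  next
    case (insert P Q)
    have "(\<lambda>\<omega>. (\<Sum>P\<in>Q. if B \<in> P then W t (atom_of \<B> P) \<omega> else 0) + (if B \<in> P then 1 else 0) * W t (atom_of \<B> P) \<omega>) \<in> lin_span V"
      using insert at[of P] by (intro lin_span.add) (auto simp: V_def)
    then show ?case using insert by (simp add: add.commute if_distrib[of "\<lambda>x. x * _"] cong: if_cong)
  qed
  have XV: "X \<in> lin_span V"
  proof -
    have "W t B \<in> lin_span V" using \<B> B by (intro lin_span_base) (auto simp: V_def)
    moreover have "(\<lambda>\<omega>. -1 * (\<Sum>P\<in>Pow \<B> - {{}}. if B \<in> P then W t (atom_of \<B> P) \<omega> else 0)) \<in> lin_span V"
      using \<B>(1) by (intro lin_span_scale sumV) auto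
    ultimately show ?thesis using lin_span_add by (fastforce simp: X_def[abs_def])
  qed
  then have XN: "X \<in> lin_span (noise_vars {0..})" using lin_span_sub[OF VN] by auto
  have "expectation (\<lambda>\<omega>. X \<omega> * X \<omega>) = 0"
  proof (rule span_orthogonal[OF VN XN _ XV])
    fix v assume "v \<in> V"
    then obtain C where C: "v = W t C" "C \<in> finite_borel_sets" by (auto simp: V_def)
    have m: "measure lborel (A \<inter> C) = (\<integral>y. indicator A y * indicator C y \<partial>lborel)" if "A \<in> sets borel" for A
      using that C by (subst indicator_inter_arith[symmetric]) (auto dest: finite_borel_setsD)
    have ii: "integrable lborel (\<lambda>y. indicator A y * indicator C y :: real)" if "A \<in> sets borel" for A
      using that C finite_borel_sets_Int[OF C(2) that] unfolding indicator_inter_arith[symmetric]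
      by (intro integrable_real_indicator) (auto simp: finite_borel_sets_def Int_commute)
    have iip: "integrable lborel (\<lambda>y. if B \<in> P then indicator (atom_of \<B> P) y * indicator C y else 0 :: real)" if "P \<in> Pow \<B> - {{}}" for P
      using ii[OF finite_borel_setsD[OF at[OF that]]] by (cases "B \<in> P") simp_all
    have meas: "measure lborel (B \<inter> C) = (\<Sum>P\<in>Pow \<B> - {{}}. if B \<in> P then measure lborel (atom_of \<B> P \<inter> C) else 0)"
    proof -
      have "measure lborel (B \<inter> C) = (\<integral>y. (\<Sum>P\<in>Pow \<B> - {{}}. if B \<in> P then indicator (atom_of \<B> P) y else 0) * indicator C y \<partial>lborel)"
        using B \<B> by (subst m) (auto simp: atom_of_sum dest: finite_borel_setsD)
      also have "\<dots> = (\<integral>y. (\<Sum>P\<in>Pow \<B> - {{}}. if B \<in> P then indicator (atom_of \<B> P) y * indicator C y else 0) \<partial>lborel)"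
        unfolding sum_distrib_right by (intro Bochner_Integration.integral_cong refl sum.cong) simp
      also have "\<dots> = (\<Sum>P\<in>Pow \<B> - {{}}. (\<integral>y. (if B \<in> P then indicator (atom_of \<B> P) y * indicator C y else 0) \<partial>lborel))"
        by (rule Bochner_Integration.integral_sum[OF iip])
      also have "\<dots> = (\<Sum>P\<in>Pow \<B> - {{}}. if B \<in> P then measure lborel (atom_of \<B> P \<inter> C) else 0)"
      proof (rule sum.cong[OF refl])
        fix P assume "P \<in> Pow \<B> - {{}}"
        from m[OF finite_borel_setsD[OF at[OF this]]]
        show "(\<integral>y. (if B \<in> P then indicator (atom_of \<B> P) y * indicator C y else 0) \<partial>lborel) =
          (if B \<in> P then measure lborel (atom_of \<B> P \<inter> C) else 0)" by simp
      qed
      finally show ?thesis .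
    qed
    have i: "integrable M (\<lambda>\<omega>. W t C \<omega> * W t D \<omega>)" if "D \<in> finite_borel_sets" for D
      using that C t by (intro noise_span_integrable_mult W_span)
    have "expectation (\<lambda>\<omega>. W t C \<omega> * X \<omega>) = expectation (\<lambda>\<omega>. W t C \<omega> * W t B \<omega> - (\<Sum>P\<in>Pow \<B> - {{}}. if B \<in> P then W t C \<omega> * W t (atom_of \<B> P) \<omega> else 0))"
      unfolding X_def right_diff_distrib sum_distrib_left
      by (intro Bochner_Integration.integral_cong refl arg_cong2[where f="(-)"] sum.cong) simp
    also have "\<dots> = expectation (\<lambda>\<omega>. W t C \<omega> * W t B \<omega>) - (\<Sum>P\<in>Pow \<B> - {{}}. expectation (\<lambda>\<omega>. if B \<in> P then W t C \<omega> * W t (atom_of \<B> P) \<omega> else 0))"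
    proof -
      have ip: "integrable M (\<lambda>\<omega>. if B \<in> P then W t C \<omega> * W t (atom_of \<B> P) \<omega> else 0)" if "P \<in> Pow \<B> - {{}}" for P
        using i[OF at[OF that]] by (cases "B \<in> P") simp_all
      have iB: "integrable M (\<lambda>\<omega>. W t C \<omega> * W t B \<omega>)" using B \<B> by (intro i) auto
      show ?thesis
        by (subst Bochner_Integration.integral_diff[OF iB Bochner_Integration.integrable_sum[OF ip]])
          (simp_all only: Bochner_Integration.integral_sum[OF ip])
    qed
    also have "(\<Sum>P\<in>Pow \<B> - {{}}. expectation (\<lambda>\<omega>. if B \<in> P then W t C \<omega> * W t (atom_of \<B> P) \<omega> else 0)) =
       (\<Sum>P\<in>Pow \<B> - {{}}. if B \<in> P then t * measure lborel (atom_of \<B> P \<inter> C) else 0)"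
    proof (rule sum.cong[OF refl])
      fix P assume "P \<in> Pow \<B> - {{}}"
      from W_cov[OF t t at[OF this] C(2)] W_cov[OF t t C(2) at[OF this]]
      show "expectation (\<lambda>\<omega>. if B \<in> P then W t C \<omega> * W t (atom_of \<B> P) \<omega> else 0) =
        (if B \<in> P then t * measure lborel (atom_of \<B> P \<inter> C) else 0)" by (simp add: Int_commute)
    qed
    also have "\<dots> = t * measure lborel (B \<inter> C)" unfolding meas sum_distrib_left by (intro sum.cong) auto
    finally show "expectation (\<lambda>\<omega>. v \<omega> * X \<omega>) = 0"
      using W_cov[OF t t, of C B] W_cov[OF t t, of B C] C \<B> B by (auto simp: Int_commute)
  qed
  then have "AE \<omega> in M. X \<omega> * X \<omega> = 0"
    using noise_span_integrable_mult[OF XN XN] by (subst (asm) integral_nonneg_eq_0_iff_AE) auto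
  then show ?thesis by eventually_elim (auto simp: X_def)
qed

text \<open>Only entries starting no later than \<open>c\<close> contribute to a cell that starts at
  \<open>c\<close>, so the coefficient is known at time \<open>c\<close>.\<close>

lemma grid_coeff_simple:
  assumes "is_simple_field M F t es" "0 \<le> c"
  shows "grid_coeff es c d P \<in> borel_measurable (F c) \<and> bounded (grid_coeff es c d P ` space M)"
  using assms
proof (induction es)
  case Nil
  have *: "grid_coeff [] c d P = (\<lambda>_. 0)" by (simp add: fun_eq_iff grid_coeff_def)
  show ?case unfolding * by (auto simp: bounded_iff)
next
  case (Cons e es)
  obtain a b B Z where e: "e = (a, b, B, Z)" by (cases e)
  have s: "is_simple_field M F t es" "0 \<le> a" "Z \<in> borel_measurable (F a)" "bounded (Z ` space M)"
    using Cons(2) unfolding e is_simple_field_Cons by auto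
  have IH: "grid_coeff es c d P \<in> borel_measurable (F c)" "bounded (grid_coeff es c d P ` space M)"
    using Cons.IH[OF s(1) Cons(3)] by auto
  show ?case
  proof (cases "a \<le> c \<and> d \<le> b \<and> B \<in> P")
    case True
    then have *: "grid_coeff (e # es) c d P = (\<lambda>\<omega>. Z \<omega> + grid_coeff es c d P \<omega>)"
      by (simp add: fun_eq_iff grid_coeff_def e)
    have "Z \<in> borel_measurable (F c)" using F_measurable_mono[of a c Z] True s by auto
    then show ?thesis unfolding * using IH s by (auto intro: bounded_plus_comp)
  next
    case False
    then have *: "grid_coeff (e # es) c d P = grid_coeff es c d P"
      by (auto simp: fun_eq_iff grid_coeff_def e)
    show ?thesis unfolding * using IH by simp
  qed
qed

text \<open>The grid consists of all endpoints in time and all atoms in space. Values agree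
  everywhere, integrals only almost surely, because the noise is additive only almost surely;
  finitely many times and sets leave a single null set to avoid.\<close>

lemma simple_field_refine:
  assumes es: "is_simple_field M F t es"
  obtains es' where "is_simple_field M F t es'" "sorted_wrt cell_after es'"
    "\<And>s y \<omega>. simple_field_val es' s y \<omega> = simple_field_val es s y \<omega>"
    "AE \<omega> in M. simple_walsh_integral W es' \<omega> = simple_walsh_integral W es \<omega>"
proof -
  define \<B> where "\<B> = (\<lambda>(a, b, B, Z). B) ` set es"
  define T where "T = (\<lambda>(a, b, B, Z). a) ` set es \<union> (\<lambda>(a, b, B, Z). b) ` set es"
  define ts where "ts = sorted_list_of_set T"
  have fin: "finite \<B>" "finite T" by (auto simp: \<B>_def T_def)
  have ts: "sorted_wrt (<) ts" "set ts = T" using fin by (auto simp: ts_def)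
  obtain Ps where Ps: "distinct Ps" "set Ps = Pow \<B> - {{}}"
    using finite_distinct_list[of "Pow \<B> - {{}}"] fin by auto
  have \<B>f: "\<B> \<subseteq> finite_borel_sets" using es by (fastforce simp: \<B>_def is_simple_field_def)
  have T0: "c \<in> {0..t}" if "c \<in> T" for c using that es by (fastforce simp: T_def is_simple_field_def)
  have mem: "a \<in> set ts \<and> b \<in> set ts \<and> a < b \<and> B \<in> \<B>" if "(a, b, B, Z) \<in> set es" for a b B Z
  proof -
    have "a \<in> T" "b \<in> T" "B \<in> \<B>"
      using imageI[OF that, of "\<lambda>(a, b, B, Z). a"] imageI[OF that, of "\<lambda>(a, b, B, Z). b"]
        imageI[OF that, of "\<lambda>(a, b, B, Z). B"] by (simp_all add: T_def \<B>_def)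
    moreover have "a < b" using bspec[OF es[unfolded is_simple_field_def] that] by simp
    ultimately show ?thesis by (simp add: ts)
  qed
  let ?g = "grid_field es \<B> Ps ts (length ts - 1)"
  show ?thesis
  proof (rule that[of ?g])
    show "is_simple_field M F t ?g"
      unfolding is_simple_field_def
    proof safe
      fix a b B Z assume "(a, b, B, Z) \<in> set ?g"
      then obtain k P where k: "k < length ts - 1" "P \<in> Pow \<B> - {{}}" and e: "a = ts ! k" "b = ts ! Suc k" "B = atom_of \<B> P"
        "Z = grid_coeff es a b P" unfolding grid_field_set Ps by auto
      have "a \<in> T" "b \<in> T" using k e ts(2) nth_mem[of k ts] nth_mem[of "Suc k" ts] by auto
      then show "0 \<le> a" "b \<le> t" using T0 by auto
      show "a < b" using k sorted_wrt_nth_less[OF ts(1), of k "Suc k"] e by auto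
      show "B \<in> finite_borel_sets" using k e fin \<B>f by (auto intro!: atom_of_fin)
      show "Z \<in> borel_measurable (F a)" "bounded (Z ` space M)" 
        unfolding e(4) using grid_coeff_simple[OF es \<open>0 \<le> a\<close>] by auto
    qed
    show "sorted_wrt cell_after ?g"
    proof (cases "length ts")
      case 0 then show ?thesis by (simp add: grid_field_def)
    next
      case (Suc n) then show ?thesis by (intro grid_field_ordered ts Ps) (auto simp: Ps)
    qed
    show "simple_field_val ?g s y \<omega> = simple_field_val es s y \<omega>" for s y \<omega>
    proof -
      define L where "L t B = (indicator {s..} t * indicator B y :: real)" for t B
      have eq: "simple_field_val fs s y \<omega> = (\<Sum>(a, b, B, Z)\<leftarrow>fs. Z \<omega> * (L b B - L a B))" if "\<And>a b B Z. (a, b, B, Z) \<in> set fs \<Longrightarrow> a < b" for fs :: "'w simple_field"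
        unfolding simple_field_val_def
      proof (intro arg_cong[where f=sum_list] map_cong refl)
        fix x assume "x \<in> set fs"
        with that show "(case x of (a, b, B, Z) \<Rightarrow> Z \<omega> * indicator {a<..b} s * indicator B y) = (case x of (a, b, B, Z) \<Rightarrow> Z \<omega> * (L b B - L a B))"
          by (cases x) (force simp: L_def split: split_indicator)
      qed
      have L: "L t B = (\<Sum>P\<in>Pow \<B> - {{}}. if B \<in> P then L t (atom_of \<B> P) else 0)" if "B \<in> \<B>" for t B
        unfolding L_def atom_of_sum[OF fin(1) that, symmetric] sum_distrib_left by (intro sum.cong) auto
      have "a < b" if "(a, b, B, Z) \<in> set ?g" for a b B Z
        using that sorted_wrt_nth_less[OF ts(1)] by (auto simp: grid_field_set)
      then have 1: "simple_field_val ?g s y \<omega> = (\<Sum>(a, b, B, Z)\<leftarrow>?g. Z \<omega> * (L b B - L a B))"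
        by (rule eq)
      have 2: "simple_field_val es s y \<omega> = (\<Sum>(a, b, B, Z)\<leftarrow>es. Z \<omega> * (L b B - L a B))"
        by (rule eq) (use mem in blast)
      show ?thesis unfolding 1 2
      proof (rule grid_field_eval[where L=L, OF ts(1) Ps])
        show "L t B = (\<Sum>P\<in>Pow \<B> - {{}}. if B \<in> P then L t (atom_of \<B> P) else 0)" if "B \<in> \<B>" for t B
          by (rule L[OF that])
      qed (rule mem)
    qed
    have "AE \<omega> in M. \<forall>t\<in>T. \<forall>B\<in>\<B>. W t B \<omega> = (\<Sum>P\<in>Pow \<B> - {{}}. if B \<in> P then W t (atom_of \<B> P) \<omega> else 0)"
      using fin T0 \<B>f by (intro AE_finite_allI W_atoms) auto
    then show "AE \<omega> in M. simple_walsh_integral W ?g \<omega> = simple_walsh_integral W es \<omega>"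
    proof eventually_elim
      case (elim \<omega>)
      show ?case unfolding simple_walsh_integral_def
      proof (rule grid_field_eval[where L="\<lambda>t B. W t B \<omega>", OF ts(1) Ps])
        show "W t B \<omega> = (\<Sum>P\<in>Pow \<B> - {{}}. if B \<in> P then W t (atom_of \<B> P) \<omega> else 0)" 
          if "t \<in> set ts" "B \<in> \<B>" for t B using elim that ts by auto
      qed (rule mem)
    qed
  qed
qed

end


section \<open>Square integrals\<close>

text \<open>The squared L^2 norm. With values in \<open>ennreal\<close> it can be estimated before
  square integrability is known.\<close>

definition nsq :: "'b measure \<Rightarrow> ('b \<Rightarrow> real) \<Rightarrow> ennreal" where
  "nsq N f = (\<integral>\<^sup>+x. ennreal ((f x)\<^sup>2) \<partial>N)"

text \<open>Replaces Minkowski's inequality and avoids square roots in \<open>ennreal\<close>, at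
  the price of the numerical factors in later bounds.\<close>

lemma nsq_add:
  assumes [measurable]: "f \<in> borel_measurable N" "g \<in> borel_measurable N"
  shows "nsq N (\<lambda>x. f x + g x) \<le> 2 * nsq N f + 2 * nsq N g"
proof -
  have "nsq N (\<lambda>x. f x + g x) \<le> (\<integral>\<^sup>+x. 2 * ennreal ((f x)\<^sup>2) + 2 * ennreal ((g x)\<^sup>2) \<partial>N)"
    unfolding nsq_def
  proof (rule nn_integral_mono)
    fix x
    have "(f x + g x)\<^sup>2 \<le> 2 * (f x)\<^sup>2 + 2 * (g x)\<^sup>2"
      using sum_squares_bound[of "f x" "g x"] by (simp add: power2_sum)
    then have "ennreal ((f x + g x)\<^sup>2) \<le> ennreal (2 * (f x)\<^sup>2 + 2 * (g x)\<^sup>2)" by (rule ennreal_leI)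
    then show "ennreal ((f x + g x)\<^sup>2) \<le> 2 * ennreal ((f x)\<^sup>2) + 2 * ennreal ((g x)\<^sup>2)"
      by (simp add: ennreal_mult)
  qed
  also have "\<dots> = 2 * nsq N f + 2 * nsq N g"
    unfolding nsq_def by (subst nn_integral_add) (simp_all add: nn_integral_cmult)
  finally show ?thesis .
qed

lemma nsq_uminus: "nsq N (\<lambda>x. - f x) = nsq N f"
  by (simp add: nsq_def)

lemma nsq_commute: "nsq N (\<lambda>x. f x - g x) = nsq N (\<lambda>x. g x - f x)"
  by (simp add: nsq_def power2_commute)

lemma nsq_triangle:
  assumes "f \<in> borel_measurable N" "g \<in> borel_measurable N" "h \<in> borel_measurable N"
  shows "nsq N (\<lambda>x. f x - h x) \<le> 2 * nsq N (\<lambda>x. f x - g x) + 2 * nsq N (\<lambda>x. g x - h x)"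
  using nsq_add[of "\<lambda>x. f x - g x" N "\<lambda>x. g x - h x"] assms by simp

lemma nsq_cmult: "f \<in> borel_measurable N \<Longrightarrow> nsq N (\<lambda>x. c * f x) = ennreal (c\<^sup>2) * nsq N f"
  by (simp add: nsq_def power_mult_distrib ennreal_mult nn_integral_cmult)

lemma nsq_mono: "(\<And>x. x \<in> space N \<Longrightarrow> \<bar>f x\<bar> \<le> \<bar>g x\<bar>) \<Longrightarrow> nsq N f \<le> nsq N g"
  unfolding nsq_def by (intro nn_integral_mono ennreal_leI) (simp add: abs_le_square_iff)

lemma nsq_cong_AE: "AE x in N. f x = g x \<Longrightarrow> nsq N f = nsq N g"
  unfolding nsq_def by (rule nn_integral_cong_AE) auto

lemma nsq_zero_AE:
  assumes "f \<in> borel_measurable N" "nsq N f = 0" shows "AE x in N. f x = 0"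
  using assms unfolding nsq_def by (subst (asm) nn_integral_0_iff_AE) auto

lemma ennreal_double: "0 \<le> x \<Longrightarrow> 2 * ennreal x = ennreal (2 * x)"
  by (simp add: ennreal_mult)

lemma ennreal_tendsto_0I:
  fixes a :: "nat \<Rightarrow> ennreal"
  assumes "\<And>e. e > 0 \<Longrightarrow> \<forall>\<^sub>F n in sequentially. a n \<le> ennreal e"
  shows "a \<longlonglongrightarrow> 0"
proof (rule order_tendstoI)
  fix x :: ennreal assume "0 < x"
  then obtain z where z: "0 < z" "z < x" using dense by blast
  obtain e where "0 \<le> e" "z = ennreal e" using z(2) by (cases z) auto
  then have e: "e > 0" "ennreal e < x" using z by auto
  show "\<forall>\<^sub>F n in sequentially. a n < x"
    using assms[OF e(1)] by eventually_elim (use e in auto)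
qed simp

lemma ennreal_tendsto_0D:
  fixes a :: "nat \<Rightarrow> ennreal"
  assumes "a \<longlonglongrightarrow> 0" "e > 0"
  shows "\<forall>\<^sub>F n in sequentially. a n < ennreal e"
  using order_tendstoD(2)[OF assms(1), of "ennreal e"] assms(2) by simp

lemma nsq_dominated:
  assumes [measurable]: "\<And>n. f n \<in> borel_measurable N" "g \<in> borel_measurable N" "w \<in> borel_measurable N"
    and bound: "\<And>n x. x \<in> space N \<Longrightarrow> \<bar>f n x\<bar> \<le> w x" and w: "nsq N w < \<infinity>"
    and lim: "AE x in N. (\<lambda>n. f n x) \<longlonglongrightarrow> g x"
  shows "(\<lambda>n. nsq N (\<lambda>x. f n x - g x)) \<longlonglongrightarrow> 0"
proof -
  have "(\<lambda>n. \<integral>\<^sup>+x. ennreal ((f n x - g x)\<^sup>2) \<partial>N) \<longlonglongrightarrow> (\<integral>\<^sup>+x. 0 \<partial>N)"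
  proof (rule nn_integral_dominated_convergence[where w="\<lambda>x. 4 * ennreal ((w x)\<^sup>2)"])
    show "AE x in N. ennreal ((f n x - g x)\<^sup>2) \<le> 4 * ennreal ((w x)\<^sup>2)" for n
      using lim AE_space
    proof eventually_elim
      case (elim x)
      have "\<bar>g x\<bar> \<le> w x"
        by (rule tendsto_upperbound[OF tendsto_rabs[OF elim(1)]]) (auto simp: bound elim)
      then have "\<bar>f n x - g x\<bar> \<le> \<bar>2 * w x\<bar>" using bound[OF elim(2), of n] by linarith
      then have "(f n x - g x)\<^sup>2 \<le> (2 * w x)\<^sup>2" by (simp only: abs_le_square_iff)
      then have "ennreal ((f n x - g x)\<^sup>2) \<le> ennreal (4 * (w x)\<^sup>2)" by (intro ennreal_leI) (simp add: power_mult_distrib)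
      then show ?case by (simp add: ennreal_mult)
    qed
    show "(\<integral>\<^sup>+x. 4 * ennreal ((w x)\<^sup>2) \<partial>N) < \<infinity>"
      using w by (simp add: nn_integral_cmult nsq_def ennreal_mult_less_top)
    show "AE x in N. (\<lambda>n. ennreal ((f n x - g x)\<^sup>2)) \<longlonglongrightarrow> 0"
      using lim
    proof eventually_elim
      case (elim x)
      have "(\<lambda>n. (f n x - g x)\<^sup>2) \<longlonglongrightarrow> (g x - g x)\<^sup>2" by (intro tendsto_intros elim)
      then show ?case using tendsto_ennrealI[of "\<lambda>n. (f n x - g x)\<^sup>2" 0] by simp
    qed
  qed auto
  then show ?thesis by (simp add: nsq_def)
qed

text \<open>The squared errors have a finite sum almost everywhere and so tend to 0 pointwise,
  without passing to a subsequence.\<close>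

lemma nsq_suminf_AE_tendsto:
  assumes [measurable]: "\<And>n. f n \<in> borel_measurable N" "g \<in> borel_measurable N"
    and b: "(\<Sum>n. nsq N (\<lambda>x. g x - f n x)) \<noteq> \<infinity>"
  shows "AE x in N. (\<lambda>n. f n x) \<longlonglongrightarrow> g x"
proof -
  have "(\<integral>\<^sup>+x. (\<Sum>n. ennreal ((g x - f n x)\<^sup>2)) \<partial>N) = (\<Sum>n. nsq N (\<lambda>x. g x - f n x))"
    unfolding nsq_def by (rule nn_integral_suminf) auto
  with b have "AE x in N. (\<Sum>n. ennreal ((g x - f n x)\<^sup>2)) \<noteq> \<infinity>"
    by (intro nn_integral_PInf_AE) auto
  then show ?thesis
  proof eventually_elim
    case (elim x)
    have "summable (\<lambda>n. (g x - f n x)\<^sup>2)" by (rule summable_suminf_not_top) (use elim in auto)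
    then have "(\<lambda>n. (g x - f n x)\<^sup>2) \<longlonglongrightarrow> 0" by (rule summable_LIMSEQ_zero)
    then have "(\<lambda>n. sqrt ((g x - f n x)\<^sup>2)) \<longlonglongrightarrow> sqrt 0" by (rule tendsto_real_sqrt)
    then have "(\<lambda>n. g x - f n x) \<longlonglongrightarrow> 0" by (simp add: tendsto_rabs_zero_iff)
    then have "(\<lambda>n. g x - (g x - f n x)) \<longlonglongrightarrow> g x - 0" by (intro tendsto_intros)
    then show ?case by simp
  qed
qed

lemma geometric_suminf_finite:
  fixes a :: "nat \<Rightarrow> ennreal"
  assumes "\<And>n. a n \<le> ennreal ((1/4) ^ n)" shows "(\<Sum>n. a n) \<noteq> \<infinity>"
proof -
  have "(\<Sum>n. a n) \<le> (\<Sum>n. ennreal ((1/4) ^ n))" by (intro suminf_le assms) auto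
  also have "\<dots> = ennreal (\<Sum>n. (1/4) ^ n)"
    by (rule suminf_ennreal_eq) (auto intro: summable_sums summable_geometric)
  also have "\<dots> < \<infinity>" by simp
  finally show ?thesis by simp
qed

lemma nsq_AE_tendsto:
  assumes "\<And>n. f n \<in> borel_measurable N" "g \<in> borel_measurable N"
    and "\<And>n. nsq N (\<lambda>x. g x - f n x) \<le> ennreal ((1/4) ^ n)"
  shows "AE x in N. (\<lambda>n. f n x) \<longlonglongrightarrow> g x"
  by (rule nsq_suminf_AE_tendsto[OF assms(1,2) geometric_suminf_finite[OF assms(3)]])

context prob_space
begin

section \<open>Limits of sequences with geometric increments\<close>

text \<open>The limit is the pointwise \<open>lim\<close> and not a class of functions:
  measurability of the terms for a smaller sigma-algebra, or predictability, is then inherited by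
  it.\<close>

lemma L2_limit:
  fixes f :: "nat \<Rightarrow> 'a \<Rightarrow> real"
  assumes [measurable]: "\<And>n. f n \<in> borel_measurable M" and C: "0 \<le> C"
    and b: "\<And>n. nsq M (\<lambda>x. f (Suc n) x - f n x) \<le> ennreal (C * (1/4) ^ n)"
  shows L2_limit_AE: "AE x in M. convergent (\<lambda>n. f n x)"
    and L2_limit_bound: "nsq M (\<lambda>x. lim (\<lambda>n. f n x) - f n x) \<le> ennreal (4 * C * (1/4) ^ n)"
proof -
  \<comment> \<open>Weighting the increment d by 2^n in |d| \<le> 2^(-n) + 2^n d^2 converts squared
    norms of order 4^(-n) into L^1 norms of order 2^(-n), which are summable.\<close>
  have inc: "(\<integral>\<^sup>+x. ennreal \<bar>f (Suc n) x - f n x\<bar> \<partial>M) \<le> ennreal ((1 + C) * (1/2) ^ n)" for n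
  proof -
    have "(\<integral>\<^sup>+x. ennreal \<bar>f (Suc n) x - f n x\<bar> \<partial>M) \<le>
      (\<integral>\<^sup>+x. ennreal ((1/2) ^ n) + ennreal (2 ^ n) * ennreal ((f (Suc n) x - f n x)\<^sup>2) \<partial>M)"
    proof (rule nn_integral_mono)
      fix x
      let ?d = "\<bar>f (Suc n) x - f n x\<bar>"
      have "0 \<le> (1 - 2 ^ n * ?d)\<^sup>2" by simp
      then have "2 * (2 ^ n * ?d) \<le> 1 + (2 ^ n * ?d)\<^sup>2" by (simp add: power2_diff)
      then have "2 ^ n * ?d \<le> 1 + (2 ^ n * ?d)\<^sup>2" by (smt (verit) zero_le_power2)
      then have "(1/2) ^ n * (2 ^ n * ?d) \<le> (1/2) ^ n * (1 + (2 ^ n * ?d)\<^sup>2)" by (intro mult_left_mono) auto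
      also have "(1/2) ^ n * (2 ^ n * ?d) = ?d" by (simp add: power_divide)
      also have "(1/2) ^ n * (1 + (2 ^ n * ?d)\<^sup>2) = (1/2) ^ n + 2 ^ n * ?d\<^sup>2"
        by (simp add: power_divide distrib_left power_mult_distrib power2_eq_square)
      finally have "ennreal ?d \<le> ennreal ((1/2) ^ n + 2 ^ n * (f (Suc n) x - f n x)\<^sup>2)"
        by (intro ennreal_leI) simp
      then show "ennreal ?d \<le> ennreal ((1/2) ^ n) + ennreal (2 ^ n) * ennreal ((f (Suc n) x - f n x)\<^sup>2)"
        by (simp add: ennreal_mult)
    qed
    also have "\<dots> = ennreal ((1/2) ^ n) + ennreal (2 ^ n) * nsq M (\<lambda>x. f (Suc n) x - f n x)"
      unfolding nsq_def by (subst nn_integral_add) (auto simp: nn_integral_cmult emeasure_space_1)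
    also have "\<dots> \<le> ennreal ((1/2) ^ n) + ennreal (2 ^ n) * ennreal (C * (1/4) ^ n)"
      by (intro add_left_mono mult_left_mono b) auto
    also have "\<dots> = ennreal ((1 + C) * (1/2) ^ n)"
    proof -
      have "2 ^ n * (1/4) ^ n = (1/2 :: real) ^ n" by (simp add: power_mult_distrib[symmetric])
      then show ?thesis using C by (simp add: ennreal_mult[symmetric] ennreal_plus[symmetric] algebra_simps del: ennreal_plus)
    qed
    finally show ?thesis .
  qed
  have "(\<integral>\<^sup>+x. (\<Sum>n. ennreal \<bar>f (Suc n) x - f n x\<bar>) \<partial>M) = (\<Sum>n. \<integral>\<^sup>+x. ennreal \<bar>f (Suc n) x - f n x\<bar> \<partial>M)"
    by (rule nn_integral_suminf) auto
  also have "\<dots> \<le> (\<Sum>n. ennreal ((1 + C) * (1/2) ^ n))" by (intro suminf_le inc) auto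
  also have "\<dots> = ennreal (\<Sum>n. (1 + C) * (1/2) ^ n)"
    using C by (intro suminf_ennreal_eq summable_sums summable_mult summable_geometric) auto
  also have "\<dots> < \<infinity>" by simp
  finally have "AE x in M. (\<Sum>n. ennreal \<bar>f (Suc n) x - f n x\<bar>) \<noteq> \<infinity>"
    by (intro nn_integral_PInf_AE) auto
  then show conv: "AE x in M. convergent (\<lambda>n. f n x)"
  proof eventually_elim
    case (elim x)
    have "summable (\<lambda>n. \<bar>f (Suc n) x - f n x\<bar>)" by (rule summable_suminf_not_top) (use elim in auto)
    then have "summable (\<lambda>n. f (Suc n) x - f n x)" by (rule summable_rabs_cancel)
    then have "(\<lambda>n. \<Sum>k<n. f (Suc k) x - f k x) \<longlonglongrightarrow> (\<Sum>n. f (Suc n) x - f n x)" by (rule summable_LIMSEQ)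
    then have "(\<lambda>n. f n x - f 0 x) \<longlonglongrightarrow> (\<Sum>n. f (Suc n) x - f n x)" by (simp add: sum_lessThan_telescope[of "\<lambda>n. f n x"])
    then have "(\<lambda>n. f 0 x + (f n x - f 0 x)) \<longlonglongrightarrow> f 0 x + (\<Sum>n. f (Suc n) x - f n x)" by (intro tendsto_intros)
    then show ?case by (auto simp: convergent_def)
  qed
  \<comment> \<open>The constant \<open>4 * C\<close> reproduces itself in the induction: 2 (4 C /
    4) + 2 C = 4 C.\<close>
  have far: "nsq M (\<lambda>x. f (n + j) x - f n x) \<le> ennreal (4 * C * (1/4) ^ n)" for n j
  proof (induction j arbitrary: n)
    case 0 then show ?case by (simp add: nsq_def)
  next
    case (Suc j)
    have "nsq M (\<lambda>x. f (n + Suc j) x - f n x) \<le> 2 * nsq M (\<lambda>x. f (n + Suc j) x - f (Suc n) x) + 2 * nsq M (\<lambda>x. f (Suc n) x - f n x)"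
      by (rule nsq_triangle) auto
    also have "\<dots> \<le> 2 * ennreal (4 * C * (1/4) ^ Suc n) + 2 * ennreal (C * (1/4) ^ n)"
      using Suc[of "Suc n"] b[of n] by (intro add_mono mult_left_mono) auto
    also have "\<dots> = ennreal (2 * (4 * C * (1/4) ^ Suc n) + 2 * (C * (1/4) ^ n))"
      using C by (subst (1 2) ennreal_double) (auto simp: ennreal_plus[symmetric] simp del: ennreal_plus)
    also have "\<dots> = ennreal (4 * C * (1/4) ^ n)" by (rule arg_cong[where f=ennreal]) (simp add: algebra_simps)
    finally show ?case .
  qed
  show "nsq M (\<lambda>x. lim (\<lambda>n. f n x) - f n x) \<le> ennreal (4 * C * (1/4) ^ n)" for n
  proof -
    have "nsq M (\<lambda>x. lim (\<lambda>n. f n x) - f n x) = (\<integral>\<^sup>+x. liminf (\<lambda>j. ennreal ((f (n + j) x - f n x)\<^sup>2)) \<partial>M)"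
      unfolding nsq_def
    proof (rule nn_integral_cong_AE)
      show "AE x in M. ennreal ((lim (\<lambda>n. f n x) - f n x)\<^sup>2) = liminf (\<lambda>j. ennreal ((f (n + j) x - f n x)\<^sup>2))"
        using conv
      proof eventually_elim
        case (elim x)
        then have "(\<lambda>j. f j x) \<longlonglongrightarrow> lim (\<lambda>n. f n x)" by (simp add: convergent_LIMSEQ_iff)
        then have "(\<lambda>j. f (n + j) x) \<longlonglongrightarrow> lim (\<lambda>n. f n x)" using LIMSEQ_ignore_initial_segment[of "\<lambda>j. f j x" _ n] by (simp add: add.commute)
        then have "(\<lambda>j. ennreal ((f (n + j) x - f n x)\<^sup>2)) \<longlonglongrightarrow> ennreal ((lim (\<lambda>n. f n x) - f n x)\<^sup>2)"
          by (intro tendsto_intros)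
        then show ?case by (rule lim_imp_Liminf[OF trivial_limit_sequentially, symmetric])
      qed
    qed
    also have "\<dots> \<le> liminf (\<lambda>j. nsq M (\<lambda>x. f (n + j) x - f n x))"
      unfolding nsq_def by (rule nn_integral_liminf) auto
    also have "\<dots> \<le> liminf (\<lambda>j. ennreal (4 * C * (1/4) ^ n))" using far by (intro Liminf_mono always_eventually allI)
    also have "\<dots> = ennreal (4 * C * (1/4) ^ n)" by (simp add: Liminf_const)
    finally show ?thesis .
  qed
qed

end

section \<open>Predictable fields\<close>

definition simple_fun :: "'w simple_field \<Rightarrow> real \<times> real \<times> 'w \<Rightarrow> real" where
  "simple_fun es = (\<lambda>(s, y, \<omega>). simple_field_val es s y \<omega>)"

lemma simple_fun_append: "simple_fun (es @ es') p = simple_fun es p + simple_fun es' p"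
  by (auto simp: simple_fun_def simple_field_val_def split: prod.splits)

lemma simple_walsh_integral_append:
  "simple_walsh_integral W (es @ es') \<omega> = simple_walsh_integral W es \<omega> + simple_walsh_integral W es' \<omega>"
  by (simp add: simple_walsh_integral_def)

lemma is_simple_field_append:
  "is_simple_field M F t (es @ es') \<longleftrightarrow> is_simple_field M F t es \<and> is_simple_field M F t es'"
  by (simp add: is_simple_field_def ball_Un)

definition scale_field :: "real \<Rightarrow> 'w simple_field \<Rightarrow> 'w simple_field" where
  "scale_field c es = map (\<lambda>(a, b, B, Z). (a, b, B, \<lambda>\<omega>. c * Z \<omega>)) es"

lemma simple_fun_scale: "simple_fun (scale_field c es) p = c * simple_fun es p"
proof -
  obtain s y \<omega> where p: "p = (s, y, \<omega>)" by (cases p)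
  show ?thesis unfolding p simple_fun_def scale_field_def by (induction es) (auto simp: simple_field_val_def algebra_simps)
qed

lemma simple_walsh_integral_scale: "simple_walsh_integral W (scale_field c es) \<omega> = c * simple_walsh_integral W es \<omega>"
  unfolding scale_field_def by (induction es) (auto simp: simple_walsh_integral_def algebra_simps)

lemma is_simple_field_scale:
  assumes "is_simple_field M F t es" shows "is_simple_field M F t (scale_field c es)"
  unfolding is_simple_field_def
proof safe
  fix a b B Z assume "(a, b, B, Z) \<in> set (scale_field c es)"
  then obtain Z' where Z: "(a, b, B, Z') \<in> set es" "Z = (\<lambda>\<omega>. c * Z' \<omega>)" by (auto simp: scale_field_def)
  with assms have *: "0 \<le> a" "a < b" "b \<le> t" "B \<in> finite_borel_sets" "Z' \<in> borel_measurable (F a)" "bounded (Z' ` space M)"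
    by (auto simp: is_simple_field_def)
  show "0 \<le> a" "a < b" "b \<le> t" "B \<in> finite_borel_sets" by (rule *)+
  show "Z \<in> borel_measurable (F a)" using * Z by auto
  show "bounded (Z ` space M)" using bounded_scaling[OF *(6), of c] by (simp add: Z image_image)
qed

context noise_space
begin

lemma space_field_measure: "space (field_measure M t) = {0..t} \<times> UNIV \<times> space M"
  by (simp add: field_measure_def space_pair_measure space_restrict_space)

definition pred_rects :: "real \<Rightarrow> (real \<times> real \<times> 'w) set set" where
  "pred_rects t = {{0} \<times> B \<times> A | B A. B \<in> sets borel \<and> A \<in> sets (F 0)} \<union>
      {{a<..b} \<times> B \<times> A | a b B A. 0 \<le> a \<and> a < b \<and> b \<le> t \<and> B \<in> sets borel \<and> A \<in> sets (F a)}"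

lemma pred_rects_subset:
  assumes "0 \<le> t" shows "pred_rects t \<subseteq> Pow ({0..t} \<times> UNIV \<times> space M)"
proof -
  have "A \<subseteq> space M" if "A \<in> sets (F a)" "0 \<le> a" for A a
    using sets.sets_into_space[OF that(1)] space_F[OF that(2)] by simp
  then show ?thesis using assms unfolding pred_rects_def by (fastforce dest: subsetD)
qed

lemma space_pred: "0 \<le> t \<Longrightarrow> space (predictable_algebra M F t) = {0..t} \<times> UNIV \<times> space M"
  unfolding predictable_algebra_def pred_rects_def[symmetric] by (rule space_measure_of[OF pred_rects_subset])

lemma sets_pred: "0 \<le> t \<Longrightarrow> sets (predictable_algebra M F t) = sigma_sets ({0..t} \<times> UNIV \<times> space M) (pred_rects t)"
  unfolding predictable_algebra_def pred_rects_def[symmetric] by (rule sets_measure_of[OF pred_rects_subset])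

lemma pred_rectI:
  "0 \<le> a \<Longrightarrow> a < b \<Longrightarrow> b \<le> t \<Longrightarrow> B \<in> sets borel \<Longrightarrow> A \<in> sets (F a) \<Longrightarrow> {a<..b} \<times> B \<times> A \<in> sets (predictable_algebra M F t)"
  using sets_pred[of t] by (auto simp: pred_rects_def intro!: sigma_sets.Basic)

lemma pred_rect0I:
  "0 \<le> t \<Longrightarrow> B \<in> sets borel \<Longrightarrow> A \<in> sets (F 0) \<Longrightarrow> {0} \<times> B \<times> A \<in> sets (predictable_algebra M F t)"
  using sets_pred[of t] by (auto simp: pred_rects_def intro!: sigma_sets.Basic)

lemma space_M_F: "0 \<le> a \<Longrightarrow> space M \<in> sets (F a)"
  using sets.top[of "F a"] space_F by simp

lemma pred_strip:
  assumes t: "0 \<le> t" and c: "c \<le> t" and B: "B \<in> sets borel"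
  shows "{0..c} \<times> B \<times> space M \<in> sets (predictable_algebra M F t)"
proof -
  consider "c < 0" | "c = 0" | "0 < c" by linarith
  then show ?thesis
  proof cases
    case 2
    then show ?thesis using pred_rect0I[OF t B space_M_F] by simp
  next
    case 3
    then have "{0..c} \<times> B \<times> space M = {0} \<times> B \<times> space M \<union> {0<..c} \<times> B \<times> space M" by auto
    then show ?thesis using pred_rect0I[OF t B space_M_F] pred_rectI[of 0 c t B "space M"] 3 c B space_M_F[of 0] by auto
  qed auto
qed

lemma pred_subset_field:
  assumes t: "0 \<le> t" shows "sets (predictable_algebra M F t) \<subseteq> sets (field_measure M t)"
  unfolding sets_pred[OF t] space_field_measure[symmetric]
proof (rule sets.sigma_sets_subset)
  have FM: "A \<in> sets M" if "A \<in> sets (F a)" "0 \<le> a" for A a using that sets_F_subset by auto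
  have "{a<..b} \<in> sets (restrict_space lborel {0..t})" if "0 \<le> a" "b \<le> t" for a b
    using that by (subst sets_restrict_space_iff) auto
  moreover have "{0} \<in> sets (restrict_space lborel {0..t})" using t by (subst sets_restrict_space_iff) auto
  ultimately show "pred_rects t \<subseteq> sets (field_measure M t)"
    unfolding pred_rects_def field_measure_def using FM by (auto intro!: pair_measureI)
qed

lemma pred_measurable_field:
  assumes "0 \<le> t" "f \<in> borel_measurable (predictable_algebra M F t)"
  shows "f \<in> borel_measurable (field_measure M t)"
proof -
  have "subalgebra (field_measure M t) (predictable_algebra M F t)"
    using pred_subset_field[OF assms(1)] by (simp add: subalgebra_def space_field_measure space_pred assms)
  then show ?thesis using assms(2) by (rule measurable_from_subalg)
qed

lemma pred_time_measurable:
  assumes t: "0 \<le> t" shows "(\<lambda>(s, y, \<omega>). s) \<in> borel_measurable (predictable_algebra M F t)"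
proof (rule borel_measurableI_le)
  fix c
  have "{p \<in> space (predictable_algebra M F t). (case p of (s, y, \<omega>) \<Rightarrow> s) \<le> c} = {0..min c t} \<times> UNIV \<times> space M"
    using t by (auto simp: space_pred)
  also have "\<dots> \<in> sets (predictable_algebra M F t)" using t by (intro pred_strip) auto
  finally show "{p \<in> space (predictable_algebra M F t). (case p of (s, y, \<omega>) \<Rightarrow> s) \<le> c} \<in> sets (predictable_algebra M F t)" .
qed

lemma pred_space_measurable:
  assumes t: "0 \<le> t" shows "(\<lambda>(s, y, \<omega>). y) \<in> borel_measurable (predictable_algebra M F t)"
proof (rule measurableI)
  fix B :: "real set" assume "B \<in> sets borel"
  moreover have "(\<lambda>(s, y, \<omega>). y) -` B \<inter> space (predictable_algebra M F t) = {0..t} \<times> B \<times> space M"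
    using t by (auto simp: space_pred)
  ultimately show "(\<lambda>(s, y, \<omega>). y) -` B \<inter> space (predictable_algebra M F t) \<in> sets (predictable_algebra M F t)"
    using t by (simp add: pred_strip)
qed auto

text \<open>The time and space coordinates are predictable maps; any Borel function of them follows
  by composition. This covers the kernel.\<close>

lemma pred_deterministic:
  assumes t: "0 \<le> t" and g: "(\<lambda>(s, y). g s y) \<in> borel_measurable (borel \<Otimes>\<^sub>M borel)"
  shows "(\<lambda>(s, y, \<omega>). g s y) \<in> borel_measurable (predictable_algebra M F t)"
proof -
  have "(\<lambda>p. ((\<lambda>(s, y, \<omega>). s) p, (\<lambda>(s, y, \<omega>). y) p)) \<in> measurable (predictable_algebra M F t) (borel \<Otimes>\<^sub>M borel)"
    by (rule measurable_Pair[OF pred_time_measurable[OF t] pred_space_measurable[OF t]])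
  from measurable_compose[OF this g] show ?thesis by (simp add: split_beta)
qed

lemma simple_fun_pred:
  assumes t: "0 \<le> t"
  shows "is_simple_field M F t es \<Longrightarrow> simple_fun es \<in> borel_measurable (predictable_algebra M F t)"
proof (induction es)
  case Nil
  have *: "simple_fun [] = (\<lambda>_. 0)" by (auto simp: simple_fun_def fun_eq_iff)
  show ?case unfolding * by simp
next
  case (Cons e es)
  obtain a b B Z where e: "e = (a, b, B, Z)" by (cases e)
  have s: "is_simple_field M F t es" "0 \<le> a" "a < b" "b \<le> t" "B \<in> finite_borel_sets" "Z \<in> borel_measurable (F a)"
    using Cons(2) unfolding e is_simple_field_Cons by auto
  have "(\<lambda>p. if p \<in> {a<..b} \<times> B \<times> space M then Z (snd (snd p)) else 0) \<in> borel_measurable (predictable_algebra M F t)"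
  proof (rule measurableI)
    fix C :: "real set" assume C: "C \<in> sets borel"
    have A: "Z -` C \<inter> space M \<in> sets (F a)" using measurable_sets[OF s(6) C] space_F[OF s(2)] by simp
    have B: "B \<in> sets borel" using s(5) by (rule finite_borel_setsD)
    have sub: "{a<..b} \<times> B \<times> space M \<subseteq> space (predictable_algebra M F t)" using s t by (auto simp: space_pred)
    have r1: "{a<..b} \<times> B \<times> (Z -` C \<inter> space M) \<in> sets (predictable_algebra M F t)" using s A B by (intro pred_rectI)
    have r2: "space (predictable_algebra M F t) - {a<..b} \<times> B \<times> space M \<in> sets (predictable_algebra M F t)"
      using s B space_M_F by (intro sets.compl_sets pred_rectI) auto
    have "(\<lambda>p. if p \<in> {a<..b} \<times> B \<times> space M then Z (snd (snd p)) else 0) -` C \<inter> space (predictable_algebra M F t) =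
      (if 0 \<in> C then {a<..b} \<times> B \<times> (Z -` C \<inter> space M) \<union> (space (predictable_algebra M F t) - {a<..b} \<times> B \<times> space M)
       else {a<..b} \<times> B \<times> (Z -` C \<inter> space M))"
      using sub by (auto split: if_splits)
    then show "(\<lambda>p. if p \<in> {a<..b} \<times> B \<times> space M then Z (snd (snd p)) else 0) -` C \<inter> space (predictable_algebra M F t) \<in> sets (predictable_algebra M F t)"
      using r1 r2 by auto
  qed auto
  then have "(\<lambda>p. (if p \<in> {a<..b} \<times> B \<times> space M then Z (snd (snd p)) else 0) + simple_fun es p) \<in> borel_measurable (predictable_algebra M F t)"
    using Cons.IH[OF s(1)] by (rule borel_measurable_add)
  then show ?case
  proof (rule measurable_cong[THEN iffD1, rotated])
    fix p assume "p \<in> space (predictable_algebra M F t)"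
    then show "(if p \<in> {a<..b} \<times> B \<times> space M then Z (snd (snd p)) else 0) + simple_fun es p = simple_fun (e # es) p"
      using t by (auto simp: space_pred simple_fun_def e simple_field_val_Cons split: prod.splits)
  qed
qed

lemma simple_fun_field:
  "0 \<le> t \<Longrightarrow> is_simple_field M F t es \<Longrightarrow> simple_fun es \<in> borel_measurable (field_measure M t)"
  by (intro pred_measurable_field simple_fun_pred)

lemma sigma_finite_LM: "sigma_finite_measure (lborel \<Otimes>\<^sub>M M)"
proof -
  interpret pair_sigma_finite lborel M ..
  show ?thesis ..
qed

lemma nn_integral_field:
  assumes t: "0 \<le> t" and f: "f \<in> borel_measurable (field_measure M t)"
  shows "(\<integral>\<^sup>+p. f p \<partial>field_measure M t) =
    (\<integral>\<^sup>+s. (\<integral>\<^sup>+y. (\<integral>\<^sup>+\<omega>. f (s, y, \<omega>) \<partial>M) \<partial>lborel) * indicator {0..t} s \<partial>lborel)"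
proof -
  interpret LM: sigma_finite_measure "lborel \<Otimes>\<^sub>M M" by (rule sigma_finite_LM)
  have f': "f \<in> borel_measurable (restrict_space lborel {0..t} \<Otimes>\<^sub>M (lborel \<Otimes>\<^sub>M M))"
    using f by (simp add: field_measure_def)
  have "(\<integral>\<^sup>+p. f p \<partial>field_measure M t) = (\<integral>\<^sup>+s. \<integral>\<^sup>+q. f (s, q) \<partial>(lborel \<Otimes>\<^sub>M M) \<partial>restrict_space lborel {0..t})"
    unfolding field_measure_def by (rule LM.nn_integral_fst[OF f', symmetric])
  also have "\<dots> = (\<integral>\<^sup>+s. (\<integral>\<^sup>+y. (\<integral>\<^sup>+\<omega>. f (s, y, \<omega>) \<partial>M) \<partial>lborel) \<partial>restrict_space lborel {0..t})"
  proof (rule nn_integral_cong)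
    fix s assume s: "s \<in> space (restrict_space lborel {0..t})"
    have "(\<lambda>q. f (s, q)) \<in> borel_measurable (lborel \<Otimes>\<^sub>M M)"
      using measurable_compose[OF measurable_Pair1'[OF s] f'] by simp
    then show "(\<integral>\<^sup>+q. f (s, q) \<partial>(lborel \<Otimes>\<^sub>M M)) = (\<integral>\<^sup>+y. (\<integral>\<^sup>+\<omega>. f (s, y, \<omega>) \<partial>M) \<partial>lborel)"
      by (subst nn_integral_fst[symmetric]) auto
  qed
  also have "\<dots> = (\<integral>\<^sup>+s. (\<integral>\<^sup>+y. (\<integral>\<^sup>+\<omega>. f (s, y, \<omega>) \<partial>M) \<partial>lborel) * indicator {0..t} s \<partial>lborel)"
    by (rule nn_integral_restrict_space) auto
  finally show ?thesis .
qed

lemma field_section_measurable: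
  assumes f: "f \<in> borel_measurable (field_measure M t)" and s: "s \<in> {0..t}"
  shows "(\<lambda>\<omega>. f (s, y, \<omega>)) \<in> borel_measurable M"
proof -
  have "(\<lambda>\<omega>. (s, y, \<omega>)) \<in> measurable M (field_measure M t)"
    unfolding field_measure_def using s
    by (intro measurable_Pair measurable_const) (auto simp: space_restrict_space)
  from measurable_compose[OF this f] show ?thesis .
qed

end

lemma emeasure_finite_borel:
  "B \<in> finite_borel_sets \<Longrightarrow> emeasure lborel B = ennreal (measure lborel B)"
  by (auto simp: finite_borel_sets_def intro!: emeasure_eq_ennreal_measure)

text \<open>The weight \<open>c\<close> is arbitrary so that one computation serves second moments
  as well as m-th roots of 2m-th moments.\<close>

lemma simple_field_nn_integral:
  assumes "is_simple_field M F t es"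
  shows "(\<integral>\<^sup>+s. (\<integral>\<^sup>+y. (\<Sum>(a, b, B, Z)\<leftarrow>es. c Z * indicator {a<..b} s * indicator B y) \<partial>lborel) * indicator {0..t} s \<partial>lborel) =
    (\<Sum>(a, b, B, Z)\<leftarrow>es. c Z * ennreal ((b - a) * measure lborel B))"
proof -
  have inner: "(\<lambda>y. \<Sum>(a, b, B, Z)\<leftarrow>es. c Z * indicator {a<..b} s * indicator B y) \<in> borel_measurable lborel \<and>
    (\<integral>\<^sup>+y. (\<Sum>(a, b, B, Z)\<leftarrow>es. c Z * indicator {a<..b} s * indicator B y) \<partial>lborel) =
    (\<Sum>(a, b, B, Z)\<leftarrow>es. c Z * ennreal (measure lborel B) * indicator {a<..b} s)" for s
    using assms
  proof (induction es)
    case (Cons e es)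
    obtain a b B Z where e: "e = (a, b, B, Z)" by (cases e)
    have B: "B \<in> finite_borel_sets" and es: "is_simple_field M F t es" using Cons(2) unfolding e is_simple_field_Cons by auto
    have [measurable]: "B \<in> sets borel" using B by (rule finite_borel_setsD)
    note IH = Cons.IH[OF es]
    have 1: "(\<lambda>y. c Z * indicator {a<..b} s * indicator B y) \<in> borel_measurable lborel" by measurable
    have 2: "(\<integral>\<^sup>+y. c Z * indicator {a<..b} s * indicator B y \<partial>lborel) = c Z * ennreal (measure lborel B) * indicator {a<..b} s"
      by (subst nn_integral_cmult_indicator) (auto simp: emeasure_finite_borel[OF B] mult_ac)
    show ?case unfolding e
      using borel_measurable_add[OF 1 IH[THEN conjunct1]] 
      by (simp add: nn_integral_add[OF 1 IH[THEN conjunct1]] 2 IH[THEN conjunct2])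
  qed simp
  have "(\<lambda>s. (\<Sum>(a, b, B, Z)\<leftarrow>es. c Z * ennreal (measure lborel B) * indicator {a<..b} s) * indicator {0..t} s) \<in> borel_measurable lborel \<and>
    (\<integral>\<^sup>+s. (\<Sum>(a, b, B, Z)\<leftarrow>es. c Z * ennreal (measure lborel B) * indicator {a<..b} s) * indicator {0..t} s \<partial>lborel) =
    (\<Sum>(a, b, B, Z)\<leftarrow>es. c Z * ennreal ((b - a) * measure lborel B))"
    using assms
  proof (induction es)
    case (Cons e es)
    obtain a b B Z where e: "e = (a, b, B, Z)" by (cases e)
    have es: "is_simple_field M F t es" and ab: "0 \<le> a" "a < b" "b \<le> t" using Cons(2) unfolding e is_simple_field_Cons by auto
    note IH = Cons.IH[OF es]
    have 1: "(\<lambda>s. c Z * ennreal (measure lborel B) * indicator {a<..b} s) \<in> borel_measurable lborel" by measurable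
    have 2: "(\<integral>\<^sup>+s. c Z * ennreal (measure lborel B) * indicator {a<..b} s \<partial>lborel) = c Z * ennreal ((b - a) * measure lborel B)"
      using ab by (subst nn_integral_cmult_indicator) (auto simp: ennreal_mult mult_ac)
    have 3: "c Z * ennreal (measure lborel B) * indicator {a<..b} s * indicator {0..t} s = c Z * ennreal (measure lborel B) * indicator {a<..b} s" for s
      using ab by (auto split: split_indicator)
    show ?case unfolding e
      using borel_measurable_add[OF 1 IH[THEN conjunct1]] 
      by (simp add: distrib_right 3 nn_integral_add[OF 1 IH[THEN conjunct1]] 2 IH[THEN conjunct2])
  qed simp
  then show ?thesis using inner by simp
qed

context noise_space
begin

lemma simple_bounded_moment:
  assumes "is_simple_field M F t es" "(a, b, B, Z) \<in> set es"
  shows "has_moments Z"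
proof -
  have "0 \<le> a" "Z \<in> borel_measurable (F a)" "bounded (Z ` space M)" using assms by (auto simp: is_simple_field_def)
  then show ?thesis by (intro has_moments_bounded) (auto intro: F_measurable_M)
qed

text \<open>After refinement neither side has mixed terms: on the left they vanish by independence
  (\<open>ordered_square\<close>), on the right because no two cells are active at the same
  point.\<close>

lemma simple_isometry:
  assumes t: "0 \<le> t" and es: "is_simple_field M F t es"
  shows "nsq M (simple_walsh_integral W es) = nsq (field_measure M t) (simple_fun es)"
proof -
  obtain es' where es': "is_simple_field M F t es'" "sorted_wrt cell_after es'"
    "\<And>s y \<omega>. simple_field_val es' s y \<omega> = simple_field_val es s y \<omega>"
    "AE \<omega> in M. simple_walsh_integral W es' \<omega> = simple_walsh_integral W es \<omega>"
    using simple_field_refine[OF es] by blast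
  have f: "simple_fun es = simple_fun es'" by (simp add: simple_fun_def es')
  have [measurable]: "simple_fun es' \<in> borel_measurable (field_measure M t)" by (rule simple_fun_field[OF t es'(1)])
  have nn: "(\<integral>\<^sup>+\<omega>. ennreal ((Z \<omega>)\<^sup>2) \<partial>M) = ennreal (expectation (\<lambda>\<omega>. (Z \<omega>)\<^sup>2))" if "has_moments Z" for Z
    using has_moments_integrable[OF that, of 2] by (intro nn_integral_eq_integral) auto
  have "nsq M (simple_walsh_integral W es) = nsq M (simple_walsh_integral W es')"
    by (rule nsq_cong_AE) (use es'(4) in eventually_elim, simp)
  also have "\<dots> = ennreal (expectation (\<lambda>\<omega>. (simple_walsh_integral W es' \<omega>)\<^sup>2))"
    unfolding nsq_def by (rule nn[OF simple_has_moments[OF es'(1)]])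
  also have "\<dots> = ennreal (\<Sum>(a, b, B, Z)\<leftarrow>es'. expectation (\<lambda>\<omega>. (Z \<omega>)\<^sup>2) * ((b - a) * measure lborel B))"
    using ordered_square[OF es'(1,2)] by simp
  also have "\<dots> = (\<Sum>(a, b, B, Z)\<leftarrow>es'. (\<integral>\<^sup>+\<omega>. ennreal ((Z \<omega>)\<^sup>2) \<partial>M) * ennreal ((b - a) * measure lborel B))"
    using es'(1)
  proof (induction es')
    case (Cons e es)
    obtain a b B Z where e: "e = (a, b, B, Z)" by (cases e)
    have es: "is_simple_field M F t es" and ab: "0 \<le> a" "a < b" "b \<le> t" using Cons(2) unfolding e is_simple_field_Cons by auto
    have Z: "has_moments Z" using simple_bounded_moment[OF Cons(2), of a b B Z] by (simp add: e)
    have nonneg: "0 \<le> (\<Sum>(a, b, B, Z)\<leftarrow>es. expectation (\<lambda>\<omega>. (Z \<omega>)\<^sup>2) * ((b - a) * measure lborel B))"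
      using es by (intro sum_list_nonneg) (fastforce simp: is_simple_field_def intro!: mult_nonneg_nonneg)
    show ?case using Cons.IH[OF es] nonneg ab by (simp add: e nn[OF Z] ennreal_mult)
  qed simp
  also have "\<dots> = (\<integral>\<^sup>+s. (\<integral>\<^sup>+y. (\<Sum>(a, b, B, Z)\<leftarrow>es'. (\<integral>\<^sup>+\<omega>. ennreal ((Z \<omega>)\<^sup>2) \<partial>M) * indicator {a<..b} s * indicator B y) \<partial>lborel) * indicator {0..t} s \<partial>lborel)"
    by (rule simple_field_nn_integral[OF es'(1), symmetric])
  also have "\<dots> = (\<integral>\<^sup>+s. (\<integral>\<^sup>+y. (\<integral>\<^sup>+\<omega>. ennreal ((simple_field_val es' s y \<omega>)\<^sup>2) \<partial>M) \<partial>lborel) * indicator {0..t} s \<partial>lborel)"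
    by (subst ordered_field_apply[OF es'(2), where \<Psi>="\<lambda>Z. \<integral>\<^sup>+\<omega>. ennreal ((Z \<omega>)\<^sup>2) \<partial>M"]) auto
  also have "\<dots> = nsq (field_measure M t) (simple_fun es')"
  proof -
    have "(\<lambda>p. ennreal ((simple_fun es' p)\<^sup>2)) \<in> borel_measurable (field_measure M t)" by measurable
    from nn_integral_field[OF t this] show ?thesis by (simp add: nsq_def simple_fun_def)
  qed
  finally show ?thesis by (simp add: f)
qed

section \<open>Approximation by simple fields\<close>

text \<open>The L^2 closure of the simple fields. Measurability is asked for in the product
  sigma-algebra, not in the predictable one, so that a field may be altered on null sets such as the
  slice at time 0.\<close>

definition L2_simple :: "real \<Rightarrow> (real \<times> real \<times> 'w \<Rightarrow> real) \<Rightarrow> bool" where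
  "L2_simple t f \<longleftrightarrow> f \<in> borel_measurable (field_measure M t) \<and>
     (\<forall>\<epsilon>>0. \<exists>es. is_simple_field M F t es \<and> nsq (field_measure M t) (\<lambda>p. f p - simple_fun es p) \<le> ennreal \<epsilon>)"

lemma L2_simple_simple: "0 \<le> t \<Longrightarrow> is_simple_field M F t es \<Longrightarrow> L2_simple t (simple_fun es)"
  unfolding L2_simple_def by (auto intro!: exI[of _ es] simple_fun_field simp: nsq_def)

lemma L2_simple_AE:
  assumes "L2_simple t f" "g \<in> borel_measurable (field_measure M t)" "AE p in field_measure M t. f p = g p"
  shows "L2_simple t g"
  unfolding L2_simple_def
proof safe
  fix e :: real assume "e > 0"
  then obtain es where es: "is_simple_field M F t es" "nsq (field_measure M t) (\<lambda>p. f p - simple_fun es p) \<le> ennreal e"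
    using assms(1) unfolding L2_simple_def by blast
  have "nsq (field_measure M t) (\<lambda>p. g p - simple_fun es p) = nsq (field_measure M t) (\<lambda>p. f p - simple_fun es p)"
    by (rule nsq_cong_AE) (use assms(3) in eventually_elim, simp)
  then show "\<exists>es. is_simple_field M F t es \<and> nsq (field_measure M t) (\<lambda>p. g p - simple_fun es p) \<le> ennreal e"
    using es by auto
qed (rule assms)

lemma L2_simple_lincomb:
  assumes t: "0 \<le> t" and f: "L2_simple t f" and g: "L2_simple t g"
  shows "L2_simple t (\<lambda>p. f p + c * g p)"
  unfolding L2_simple_def
proof safe
  have [measurable]: "f \<in> borel_measurable (field_measure M t)" "g \<in> borel_measurable (field_measure M t)"
    using f g by (auto simp: L2_simple_def)
  show "(\<lambda>p. f p + c * g p) \<in> borel_measurable (field_measure M t)" by measurable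
  fix e :: real assume e: "e > 0"
  have c: "c\<^sup>2 + 1 > 0" by (simp add: add_nonneg_pos)
  have "e / 4 > 0" using e by simp
  then obtain es where es: "is_simple_field M F t es" "nsq (field_measure M t) (\<lambda>p. f p - simple_fun es p) \<le> ennreal (e / 4)"
    using f unfolding L2_simple_def by blast
  \<comment> \<open>The scalar enters as the square of \<open>c\<close>; adding 1 keeps the
    tolerance meaningful for \<open>c = 0\<close>.\<close>
  have "e / (4 * (c\<^sup>2 + 1)) > 0" using e c by simp
  then obtain es' where es': "is_simple_field M F t es'" "nsq (field_measure M t) (\<lambda>p. g p - simple_fun es' p) \<le> ennreal (e / (4 * (c\<^sup>2 + 1)))"
    using g unfolding L2_simple_def by blast
  have [measurable]: "simple_fun es \<in> borel_measurable (field_measure M t)" "simple_fun es' \<in> borel_measurable (field_measure M t)"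
    using es es' t by (auto intro: simple_fun_field)
  have "nsq (field_measure M t) (\<lambda>p. f p + c * g p - simple_fun (es @ scale_field c es') p) =
    nsq (field_measure M t) (\<lambda>p. (f p - simple_fun es p) + c * (g p - simple_fun es' p))"
    by (simp add: simple_fun_append simple_fun_scale algebra_simps)
  also have "\<dots> \<le> 2 * nsq (field_measure M t) (\<lambda>p. f p - simple_fun es p) + 2 * nsq (field_measure M t) (\<lambda>p. c * (g p - simple_fun es' p))"
    by (rule nsq_add) auto
  also have "\<dots> = 2 * nsq (field_measure M t) (\<lambda>p. f p - simple_fun es p) + 2 * (ennreal (c\<^sup>2) * nsq (field_measure M t) (\<lambda>p. g p - simple_fun es' p))"
    by (subst nsq_cmult) auto
  also have "\<dots> \<le> 2 * ennreal (e / 4) + 2 * (ennreal (c\<^sup>2) * ennreal (e / (4 * (c\<^sup>2 + 1))))"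
    using es es' by (intro add_mono mult_left_mono) auto
  also have "\<dots> = ennreal (e / 2 + (c\<^sup>2 / (c\<^sup>2 + 1)) * (e / 2))"
  proof -
    have "2 * ennreal (e / 4) + 2 * (ennreal (c\<^sup>2) * ennreal (e / (4 * (c\<^sup>2 + 1)))) =
      ennreal (2 * (e / 4) + 2 * (c\<^sup>2 * (e / (4 * (c\<^sup>2 + 1)))))"
      using e c by (simp add: ennreal_mult[symmetric] ennreal_double ennreal_plus[symmetric] del: ennreal_plus)
    also have "2 * (e / 4) + 2 * (c\<^sup>2 * (e / (4 * (c\<^sup>2 + 1)))) = e / 2 + (c\<^sup>2 / (c\<^sup>2 + 1)) * (e / 2)"
      using c by (simp add: field_simps)
    finally show ?thesis .
  qed
  also have "\<dots> \<le> ennreal (e / 2 + 1 * (e / 2))"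
    using e c by (intro ennreal_leI add_left_mono mult_right_mono) auto
  also have "\<dots> = ennreal e" by simp
  finally show "\<exists>es. is_simple_field M F t es \<and> nsq (field_measure M t) (\<lambda>p. f p + c * g p - simple_fun es p) \<le> ennreal e"
    using es es' by (intro exI[of _ "es @ scale_field c es'"]) (auto simp: is_simple_field_append is_simple_field_scale)
qed

lemma L2_simple_limit:
  assumes t: "0 \<le> t" and f: "\<And>n. L2_simple t (f n)" and [measurable]: "g \<in> borel_measurable (field_measure M t)"
    and lim: "(\<lambda>n. nsq (field_measure M t) (\<lambda>p. f n p - g p)) \<longlonglongrightarrow> 0"
  shows "L2_simple t g"
  unfolding L2_simple_def
proof safe
  fix e :: real assume e: "e > 0"
  have [measurable]: "f n \<in> borel_measurable (field_measure M t)" for n using f by (auto simp: L2_simple_def)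
  have e4: "e / 4 > 0" using e by simp
  obtain n where n: "nsq (field_measure M t) (\<lambda>p. f n p - g p) < ennreal (e / 4)"
    using eventually_happens'[OF _ ennreal_tendsto_0D[OF lim e4]] by auto
  obtain es where es: "is_simple_field M F t es" "nsq (field_measure M t) (\<lambda>p. f n p - simple_fun es p) \<le> ennreal (e / 4)"
    using f[of n] e4 unfolding L2_simple_def by blast
  have [measurable]: "simple_fun es \<in> borel_measurable (field_measure M t)"
    using es t by (auto intro: simple_fun_field)
  have "nsq (field_measure M t) (\<lambda>p. g p - simple_fun es p) \<le> 2 * nsq (field_measure M t) (\<lambda>p. g p - f n p) + 2 * nsq (field_measure M t) (\<lambda>p. f n p - simple_fun es p)"
    by (rule nsq_triangle) auto
  also have "\<dots> \<le> 2 * ennreal (e / 4) + 2 * ennreal (e / 4)"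
    using n es nsq_commute[of _ g "f n"] by (intro add_mono mult_left_mono) auto
  also have "\<dots> = ennreal e" using e by (simp add: ennreal_double ennreal_plus[symmetric] del: ennreal_plus)
  finally show "\<exists>es. is_simple_field M F t es \<and> nsq (field_measure M t) (\<lambda>p. g p - simple_fun es p) \<le> ennreal e"
    using es by auto
qed (rule assms)


section \<open>Density of the simple fields\<close>

text \<open>A cutoff in space to a set of finite measure: only there are indicators square
  integrable, so only there can complements be taken within the L^2 closure.\<close>

definition window :: "nat \<Rightarrow> real \<Rightarrow> (real \<times> real \<times> 'w) set" where
  "window N t = {0..t} \<times> {- real N..real N} \<times> space M"

lemma window_sets: "0 \<le> t \<Longrightarrow> window N t \<in> sets (predictable_algebra M F t)"
  unfolding window_def by (intro pred_strip) auto

lemma interval_finite_borel: "{- real N..real N} \<in> finite_borel_sets"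
  by (simp add: finite_borel_sets_def)

lemma emeasure_field_rect:
  assumes t: "0 \<le> t" and S: "S \<in> sets borel" "S \<subseteq> {0..t}" and B: "B \<in> sets borel" and A: "A \<in> sets M"
  shows "emeasure (field_measure M t) (S \<times> B \<times> A) = emeasure lborel S * (emeasure lborel B * emeasure M A)"
proof -
  interpret LM: sigma_finite_measure "lborel \<Otimes>\<^sub>M M" by (rule sigma_finite_LM)
  have S': "S \<in> sets (restrict_space lborel {0..t})" using S by (subst sets_restrict_space_iff) auto
  have "emeasure (field_measure M t) (S \<times> B \<times> A) = emeasure (restrict_space lborel {0..t}) S * emeasure (lborel \<Otimes>\<^sub>M M) (B \<times> A)"
    unfolding field_measure_def using S' B A by (intro LM.emeasure_pair_measure_Times pair_measureI) auto
  also have "emeasure (restrict_space lborel {0..t}) S = emeasure lborel S"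
    using S by (intro emeasure_restrict_space) auto
  also have "emeasure (lborel \<Otimes>\<^sub>M M) (B \<times> A) = emeasure lborel B * emeasure M A"
    using B A by (intro emeasure_pair_measure_Times) auto
  finally show ?thesis .
qed

lemma emeasure_window: "0 \<le> t \<Longrightarrow> emeasure (field_measure M t) (window N t) < \<infinity>"
  unfolding window_def by (subst emeasure_field_rect) (auto simp: emeasure_space_1 ennreal_mult_less_top)

lemma window_field: "0 \<le> t \<Longrightarrow> window N t \<in> sets (field_measure M t)"
  using window_sets pred_subset_field by blast

lemma nsq_window:
  assumes t: "0 \<le> t" shows "nsq (field_measure M t) (\<lambda>p. c * indicator (window N t) p) < \<infinity>"
proof -
  have [measurable]: "window N t \<in> sets (field_measure M t)" by (rule window_field[OF t])
  have "nsq (field_measure M t) (\<lambda>p. c * indicator (window N t) p) = (\<integral>\<^sup>+p. ennreal (c\<^sup>2) * indicator (window N t) p \<partial>field_measure M t)"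
    unfolding nsq_def by (intro nn_integral_cong) (auto split: split_indicator)
  also have "\<dots> = ennreal (c\<^sup>2) * emeasure (field_measure M t) (window N t)" by (rule nn_integral_cmult_indicator) simp
  also have "\<dots> < \<infinity>" using emeasure_window[OF t, of N] by (simp add: ennreal_mult_less_top)
  finally show ?thesis .
qed

text \<open>An intersection of two time intervals starts at the later of the two left endpoints,
  where both events are known. Slices at time 0 do not meet the left-open intervals.\<close>

lemma pred_rects_Int_stable: assumes t: "0 \<le> t" shows "Int_stable (pred_rects t)"
  unfolding Int_stable_def
proof (intro ballI)
  fix x y assume x: "x \<in> pred_rects t" and y: "y \<in> pred_rects t"
  have e: "{} \<in> pred_rects t"
    unfolding pred_rects_def by (intro UnI1 CollectI exI[of _ "{}"]) auto
  have cases: "(\<exists>B A. z = {0} \<times> B \<times> A \<and> B \<in> sets borel \<and> A \<in> sets (F 0)) \<or>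
    (\<exists>a b B A. z = {a<..b} \<times> B \<times> A \<and> 0 \<le> a \<and> a < b \<and> b \<le> t \<and> B \<in> sets borel \<and> A \<in> sets (F a))" if "z \<in> pred_rects t" for z
    using that unfolding pred_rects_def by blast
  from cases[OF x] show "x \<inter> y \<in> pred_rects t"
  proof (elim disjE exE conjE)
    fix B A assume x: "x = {0} \<times> B \<times> A" "B \<in> sets borel" "A \<in> sets (F 0)"
    from cases[OF y] show ?thesis
    proof (elim disjE exE conjE)
      fix B' A' assume y: "y = {0} \<times> B' \<times> A'" "B' \<in> sets borel" "A' \<in> sets (F 0)"
      have "x \<inter> y = {0} \<times> (B \<inter> B') \<times> (A \<inter> A')" unfolding x y by auto
      then show ?thesis unfolding pred_rects_def using x y by blast
    next
      fix a b B' A' assume "y = {a<..b} \<times> B' \<times> A'" "0 \<le> a"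
      then have "x \<inter> y = {}" unfolding x by auto
      then show ?thesis using e by simp
    qed
  next
    fix a b B A assume x: "x = {a<..b} \<times> B \<times> A" "0 \<le> a" "a < b" "b \<le> t" "B \<in> sets borel" "A \<in> sets (F a)"
    from cases[OF y] show ?thesis
    proof (elim disjE exE conjE)
      fix B' A' assume "y = {0} \<times> B' \<times> A'"
      then have "x \<inter> y = {}" unfolding x(1) using x(2) by auto
      then show ?thesis using e by simp
    next
      fix a' b' B' A' assume y: "y = {a'<..b'} \<times> B' \<times> A'" "0 \<le> a'" "a' < b'" "b' \<le> t" "B' \<in> sets borel" "A' \<in> sets (F a')"
      have eq: "x \<inter> y = {max a a'<..min b b'} \<times> (B \<inter> B') \<times> (A \<inter> A')" unfolding x(1) y(1) by auto
      show ?thesis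
      proof (cases "max a a' < min b b'")
        case True
        have "A \<in> sets (F (max a a'))" "A' \<in> sets (F (max a a'))"
          using sets_F_mono[of a "max a a'"] sets_F_mono[of a' "max a a'"] x y by auto
        then have "A \<inter> A' \<in> sets (F (max a a'))" by auto
        moreover have "B \<inter> B' \<in> sets borel" using x y by auto
        moreover have "0 \<le> max a a'" "min b b' \<le> t" using x y by auto
        ultimately show ?thesis unfolding eq pred_rects_def using True by blast
      next
        case False
        then have "x \<inter> y = {}" unfolding eq by auto
        then show ?thesis using e by simp
      qed
    qed
  qed
qed

lemma L2_simple_zero: assumes "0 \<le> t" shows "L2_simple t (\<lambda>_. 0)"
proof -
  have "(simple_fun [] :: real \<times> real \<times> 'w \<Rightarrow> real) = (\<lambda>_. 0)" by (auto simp: fun_eq_iff simple_fun_def)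
  then show ?thesis using L2_simple_simple[OF assms, of "[]"] by (simp add: is_simple_field_def)
qed

text \<open>Dynkin's argument on the generating rectangles: proper differences inside the window use
  linearity, and countable disjoint unions are L^2 limits by dominated convergence.\<close>

lemma L2_simple_window:
  assumes t: "0 \<le> t" and D: "D \<in> sets (predictable_algebra M F t)"
  shows "L2_simple t (indicator (D \<inter> window N t))"
proof -
  have rect: "L2_simple t (indicator (({a<..b} \<times> B \<times> A) \<inter> window N t))"
    if ab: "0 \<le> a" "a < b" "b \<le> t" and B: "B \<in> sets borel" and A: "A \<in> sets (F a)" for a b B A
  proof -
    have AM: "A \<subseteq> space M" using sets.sets_into_space[OF A] space_F[OF ab(1)] by simp
    let ?e = "[(a, b, {- real N..real N} \<inter> B, indicator A :: 'w \<Rightarrow> real)]"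
    have "is_simple_field M F t ?e"
      using ab A finite_borel_sets_Int[OF interval_finite_borel[of N] B]
      by (auto simp: is_simple_field_def bounded_iff intro!: exI[of _ 1] split: split_indicator)
    moreover have "simple_fun ?e = indicator (({a<..b} \<times> B \<times> A) \<inter> window N t)"
      using ab AM by (auto simp: fun_eq_iff simple_fun_def simple_field_val_def window_def split: split_indicator)
    ultimately show ?thesis using L2_simple_simple[OF t] by metis
  qed
  \<comment> \<open>Simple fields live on left-open intervals and cannot reproduce the slice at time
    0, but this slice is a null set and is approximated by 0.\<close>
  have zero: "L2_simple t (indicator (({0} \<times> B \<times> A) \<inter> window N t))" if "B \<in> sets borel" "A \<in> sets (F 0)" for B A
  proof (rule L2_simple_AE[OF L2_simple_zero[OF t]])
    have s: "{0} \<times> B \<times> A \<in> sets (field_measure M t)"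
      using pred_rect0I[OF t that] pred_subset_field[OF t] by auto
    then show "indicator (({0} \<times> B \<times> A) \<inter> window N t) \<in> borel_measurable (field_measure M t)"
      using window_field[OF t, of N] by (intro borel_measurable_indicator sets.Int)
    have "emeasure (field_measure M t) ({0} \<times> B \<times> A) = 0"
      using t that sets_F_subset[of 0] by (subst emeasure_field_rect) auto
    then have "AE p in field_measure M t. p \<notin> {0} \<times> B \<times> A" using s by (intro AE_not_in null_setsI)
    then show "AE p in field_measure M t. 0 = (indicator (({0} \<times> B \<times> A) \<inter> window N t) p :: real)"
      by eventually_elim (auto split: split_indicator)
  qed
  have full: "L2_simple t (indicator (window N t))"
  proof -
    have "window N t = ({0} \<times> UNIV \<times> space M) \<inter> window N t \<union> ({0<..t} \<times> UNIV \<times> space M) \<inter> window N t"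
      using t by (auto simp: window_def)
    then have eq: "(indicator (window N t) p :: real) = indicator (({0} \<times> UNIV \<times> space M) \<inter> window N t) p + 1 * indicator (({0<..t} \<times> UNIV \<times> space M) \<inter> window N t) p" for p
      by (auto split: split_indicator simp: window_def)
    have "L2_simple t (indicator (({0<..t} \<times> UNIV \<times> space M) \<inter> window N t))"
    proof (cases "t = 0")
      case True
      then have "indicator (({0<..t} \<times> UNIV \<times> space M) \<inter> window N t) = (\<lambda>_. 0 :: real)" by (auto simp: fun_eq_iff)
      then show ?thesis using L2_simple_zero[OF t] by simp
    next
      case False
      then show ?thesis using t by (intro rect space_M_F) auto
    qed
    from L2_simple_lincomb[OF t zero[of UNIV "space M"] this, of 1]
    show ?thesis unfolding eq[symmetric] using space_M_F[of 0] by simp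
  qed
  from D have "D \<in> sigma_sets ({0..t} \<times> UNIV \<times> space M) (pred_rects t)" by (simp add: sets_pred[OF t])
  then show ?thesis
  proof (rule sigma_sets_induct_disjoint[OF pred_rects_Int_stable[OF t] pred_rects_subset[OF t], where P="\<lambda>D. L2_simple t (indicator (D \<inter> window N t))"])
    fix A assume "A \<in> pred_rects t"
    then show "L2_simple t (indicator (A \<inter> window N t))" unfolding pred_rects_def using rect zero by blast
  next
    show "L2_simple t (indicator ({} \<inter> window N t))" using L2_simple_zero[OF t] by (simp add: indicator_def[abs_def])
  next
    fix A assume compl: "A \<in> sigma_sets ({0..t} \<times> UNIV \<times> space M) (pred_rects t)" "L2_simple t (indicator (A \<inter> window N t))"
    have "(indicator (({0..t} \<times> UNIV \<times> space M - A) \<inter> window N t) :: _ \<Rightarrow> real) =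
      (\<lambda>p. indicator (window N t) p + (-1) * indicator (A \<inter> window N t) p)"
      by (auto simp: fun_eq_iff window_def split: split_indicator)
    then show "L2_simple t (indicator (({0..t} \<times> UNIV \<times> space M - A) \<inter> window N t))"
      using L2_simple_lincomb[OF t full compl(2), of "-1"] by simp
  next
    fix A :: "nat \<Rightarrow> _" assume union: "disjoint_family A" "range A \<subseteq> sigma_sets ({0..t} \<times> UNIV \<times> space M) (pred_rects t)"
      "\<And>i. L2_simple t (indicator (A i \<inter> window N t))"
    have Am: "A i \<in> sets (field_measure M t)" for i
      using union(2) pred_subset_field[OF t] sets_pred[OF t] by blast
    have wm: "window N t \<in> sets (field_measure M t)" by (rule window_field[OF t])
    show "L2_simple t (indicator ((\<Union>i. A i) \<inter> window N t))"
    proof (rule L2_simple_limit[OF t])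
      show "L2_simple t (\<lambda>p. \<Sum>i<n. indicator (A i \<inter> window N t) p)" for n
      proof (induction n)
        case 0 then show ?case using L2_simple_zero[OF t] by simp
      next
        case (Suc n)
        from L2_simple_lincomb[OF t Suc union(3)[of n], of 1] show ?case by simp
      qed
      show "indicator ((\<Union>i. A i) \<inter> window N t) \<in> borel_measurable (field_measure M t)"
        using Am wm by (intro borel_measurable_indicator sets.Int sets.countable_UN) auto
      have sum: "(\<Sum>i<n. indicator (A i \<inter> window N t) p :: real) = indicator ((\<Union>i<n. A i) \<inter> window N t) p" for n p
      proof -
        have "(\<Sum>i<n. indicator (A i \<inter> window N t) p :: real) = (\<Sum>i<n. indicator (A i) p) * indicator (window N t) p"
          by (simp add: indicator_inter_arith sum_distrib_right)
        also have "(\<Sum>i<n. indicator (A i) p :: real) = indicator (\<Union>i<n. A i) p"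
          using union(1) by (intro indicator_UN_disjoint[symmetric]) (auto simp: disjoint_family_on_def)
        finally show ?thesis by (simp add: indicator_inter_arith)
      qed
      show "(\<lambda>n. nsq (field_measure M t) (\<lambda>p. (\<Sum>i<n. indicator (A i \<inter> window N t) p) - indicator ((\<Union>i. A i) \<inter> window N t) p)) \<longlonglongrightarrow> 0"
        unfolding sum
      proof (rule nsq_dominated[where w="\<lambda>p. 1 * indicator (window N t) p"])
        show "nsq (field_measure M t) (\<lambda>p. 1 * indicator (window N t) p) < \<infinity>" by (rule nsq_window[OF t])
        show "AE p in field_measure M t. (\<lambda>n. indicator ((\<Union>i<n. A i) \<inter> window N t) p :: real) \<longlonglongrightarrow> indicator ((\<Union>i. A i) \<inter> window N t) p"
        proof (rule AE_I2)
          fix p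
          have "(\<lambda>n. indicator (\<Union>i<n. A i) p * indicator (window N t) p :: real) \<longlonglongrightarrow> indicator (\<Union>i. A i) p * indicator (window N t) p"
            by (intro tendsto_mult tendsto_const LIMSEQ_indicator_UN)
          then show "(\<lambda>n. indicator ((\<Union>i<n. A i) \<inter> window N t) p :: real) \<longlonglongrightarrow> indicator ((\<Union>i. A i) \<inter> window N t) p"
            by (simp add: indicator_inter_arith)
        qed
      qed (use Am wm in \<open>auto split: split_indicator\<close>)
    qed
  qed
qed

text \<open>More than density is recorded. Boundedness and bounded support permit dominated
  convergence in \<open>moment_approx\<close>, and the pointwise bound by twice the modulus of
  \<open>X\<close> carries over a majorant of the fibre moments.\<close>

lemma L2_simple_approx:
  assumes t: "0 \<le> t" and X: "X \<in> borel_measurable (predictable_algebra M F t)" and X2: "nsq (field_measure M t) X < \<infinity>"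
  obtains V c where "\<And>n. L2_simple t (V n)" "\<And>n p. \<bar>V n p\<bar> \<le> c n" "\<And>n p. p \<in> space (field_measure M t) \<Longrightarrow> \<bar>V n p\<bar> \<le> 2 * \<bar>X p\<bar>"
    "\<And>n p. p \<notin> window n t \<Longrightarrow> V n p = 0" "(\<lambda>n. nsq (field_measure M t) (\<lambda>p. V n p - X p)) \<longlonglongrightarrow> 0"
proof -
  let ?P = "predictable_algebra M F t" and ?N = "field_measure M t"
  have sp: "space ?P = space ?N" by (simp add: space_pred[OF t] space_field_measure)
  obtain S where S': "\<forall>i. simple_function ?P (S i)" "\<forall>p\<in>space ?P. (\<lambda>i. S i p) \<longlonglongrightarrow> X p"
    "\<forall>i. \<forall>p\<in>space ?P. dist (S i p) 0 \<le> 2 * dist (X p) 0"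
    using borel_measurable_implies_sequence_metric[OF X, of 0] by blast
  have S: "simple_function ?P (S i)" "p \<in> space ?P \<Longrightarrow> (\<lambda>i. S i p) \<longlonglongrightarrow> X p"
    "p \<in> space ?P \<Longrightarrow> dist (S i p) 0 \<le> 2 * dist (X p) 0" for i p
    using S' by blast+
  define V where "V n p = S n p * indicator (window n t) p" for n p
  have Vsum: "V n p = (\<Sum>y\<in>S n ` space ?P. y * indicator ((S n -` {y} \<inter> space ?P) \<inter> window n t) p)" for n p
  proof (cases "p \<in> window n t")
    case True
    then have p: "p \<in> space ?P" by (auto simp: window_def space_pred[OF t])
    have "(\<Sum>y\<in>S n ` space ?P. y * indicator ((S n -` {y} \<inter> space ?P) \<inter> window n t) p) = (\<Sum>y\<in>S n ` space ?P. if y = S n p then y else 0)"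
      using True p by (intro sum.cong) (auto split: split_indicator)
    also have "\<dots> = S n p" using S(1)[of n] p by (simp add: simple_function_def)
    finally show ?thesis using True by (simp add: V_def)
  qed (simp add: V_def)
  have VS: "L2_simple t (V n)" for n
  proof -
    have "L2_simple t (\<lambda>p. \<Sum>y\<in>Q. y * indicator ((S n -` {y} \<inter> space ?P) \<inter> window n t) p)" if "finite Q" "Q \<subseteq> S n ` space ?P" for Q
      using that
    proof induction
      case empty then show ?case using L2_simple_zero[OF t] by simp
    next
      case (insert y Q)
      have "S n -` {y} \<inter> space ?P \<in> sets ?P" using S(1)[of n] by (rule simple_functionD(2))
      note * = L2_simple_window[OF t this, of n]
      have "L2_simple t (\<lambda>p. \<Sum>y\<in>Q. y * indicator ((S n -` {y} \<inter> space ?P) \<inter> window n t) p)"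
        by (rule insert.IH) (use insert.prems in blast)
      from L2_simple_lincomb[OF t this *, of y]
      show ?case by (simp only: sum.insert[OF insert.hyps(1,2)] add.commute)
    qed
    from this[OF simple_functionD(1)[OF S(1)] order_refl]
    have "L2_simple t (\<lambda>p. V n p)" by (simp only: Vsum)
    then show ?thesis .
  qed
  have Vc: "\<exists>c. \<forall>p. \<bar>V n p\<bar> \<le> c" for n
  proof -
    have fin: "finite (S n ` space ?P)" by (rule simple_functionD(1)[OF S(1)])
    have "\<bar>V n p\<bar> \<le> (\<Sum>y\<in>S n ` space ?P. \<bar>y\<bar>)" for p
      unfolding Vsum by (rule order_trans[OF sum_abs sum_mono]) (auto split: split_indicator)
    then show ?thesis by blast
  qed
  then obtain c where c: "\<And>n p. \<bar>V n p\<bar> \<le> c n" by metis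
  have V2: "\<bar>V n p\<bar> \<le> 2 * \<bar>X p\<bar>" if "p \<in> space ?N" for n p
    using S(3)[of p n] that unfolding sp by (auto simp: V_def split: split_indicator)
  have Xm: "X \<in> borel_measurable ?N" by (rule pred_measurable_field[OF t X])
  have "(\<lambda>n. nsq ?N (\<lambda>p. V n p - X p)) \<longlonglongrightarrow> 0"
  proof (rule nsq_dominated[where w="\<lambda>p. 2 * \<bar>X p\<bar>"])
    show "V n \<in> borel_measurable ?N" for n using VS[of n] by (simp add: L2_simple_def)
    have "nsq ?N (\<lambda>p. 2 * \<bar>X p\<bar>) = ennreal (2\<^sup>2) * nsq ?N (\<lambda>p. \<bar>X p\<bar>)" using Xm by (intro nsq_cmult) auto
    also have "nsq ?N (\<lambda>p. \<bar>X p\<bar>) = nsq ?N X" by (simp add: nsq_def)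
    finally show "nsq ?N (\<lambda>p. 2 * \<bar>X p\<bar>) < \<infinity>" using X2 by (simp add: ennreal_mult_less_top)
    show "AE p in ?N. (\<lambda>n. V n p) \<longlonglongrightarrow> X p"
    proof (rule AE_I2)
      fix p assume p: "p \<in> space ?N"
      obtain k where k: "\<bar>fst (snd p)\<bar> \<le> real k" using real_arch_simple by blast
      have "p \<in> window n t" if "k \<le> n" for n
        using p k that unfolding space_field_measure window_def
        by (cases p) (auto simp: abs_le_iff intro: order_trans)
      then have "\<forall>\<^sub>F n in sequentially. S n p = V n p"
        unfolding eventually_sequentially by (intro exI[of _ k]) (auto simp: V_def)
      then show "(\<lambda>n. V n p) \<longlonglongrightarrow> X p" using S(2)[of p] p unfolding sp by (blast intro: Lim_transform_eventually)
    qed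
  qed (use Xm V2 in auto)
  then show ?thesis using VS c V2 by (intro that[of V c]) (auto simp: V_def)
qed

lemma L2_simple_pred:
  assumes t: "0 \<le> t" and X: "X \<in> borel_measurable (predictable_algebra M F t)" and X2: "nsq (field_measure M t) X < \<infinity>"
  shows "L2_simple t X"
proof (rule L2_simple_approx[OF assms])
  fix V assume V: "\<And>n. L2_simple t (V n)" "(\<lambda>n. nsq (field_measure M t) (\<lambda>p. V n p - X p)) \<longlonglongrightarrow> 0"
  show ?thesis by (rule L2_simple_limit[OF t V(1) pred_measurable_field[OF t X] V(2)])
qed

end


section \<open>The Walsh integral\<close>

definition uncurried :: "(real \<Rightarrow> real \<Rightarrow> 'w \<Rightarrow> real) \<Rightarrow> real \<times> real \<times> 'w \<Rightarrow> real" where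
  "uncurried X = (\<lambda>(s, y, \<omega>). X s y \<omega>)"

lemma uncurried_apply [simp]: "uncurried X (s, y, \<omega>) = X s y \<omega>"
  by (simp add: uncurried_def)

lemma predictable_field_iff:
  "predictable_field M F t X \<longleftrightarrow> uncurried X \<in> borel_measurable (predictable_algebra M F t)"
  by (simp add: predictable_field_def uncurried_def)

lemma walsh_integrable_iff:
  "walsh_integrable M F t X \<longleftrightarrow> uncurried X \<in> borel_measurable (predictable_algebra M F t) \<and>
     nsq (field_measure M t) (uncurried X) < \<infinity>"
proof -
  have "(\<lambda>(s, y, \<omega>). ennreal ((X s y \<omega>)\<^sup>2)) = (\<lambda>p. ennreal ((uncurried X p)\<^sup>2))"
    by (auto simp: fun_eq_iff uncurried_def)
  then show ?thesis by (simp add: walsh_integrable_def predictable_field_iff nsq_def)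
qed

lemma has_walsh_integral_iff:
  "has_walsh_integral M F W t X I \<longleftrightarrow> walsh_integrable M F t X \<and> I \<in> borel_measurable M \<and>
     (\<exists>e. (\<forall>n. is_simple_field M F t (e n)) \<and>
        (\<lambda>n. nsq (field_measure M t) (\<lambda>p. uncurried X p - simple_fun (e n) p)) \<longlonglongrightarrow> 0 \<and>
        (\<lambda>n. nsq M (\<lambda>\<omega>. I \<omega> - simple_walsh_integral W (e n) \<omega>)) \<longlonglongrightarrow> 0)"
proof -
  have "(\<lambda>(s, y, \<omega>). ennreal ((X s y \<omega> - simple_field_val e s y \<omega>)\<^sup>2)) = (\<lambda>p. ennreal ((uncurried X p - simple_fun e p)\<^sup>2))" for e
    by (auto simp: fun_eq_iff uncurried_def simple_fun_def)
  then show ?thesis by (simp add: has_walsh_integral_def nsq_def)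
qed

lemma tendsto_0_sandwich:
  fixes a b c :: "nat \<Rightarrow> ennreal"
  assumes "\<And>n. a n \<le> 2 * b n + 2 * c n" "b \<longlonglongrightarrow> 0" "c \<longlonglongrightarrow> 0"
  shows "a \<longlonglongrightarrow> 0"
proof (rule ennreal_tendsto_0I)
  fix e :: real assume "e > 0"
  then have e: "e / 4 > 0" by simp
  show "\<forall>\<^sub>F n in sequentially. a n \<le> ennreal e"
    using ennreal_tendsto_0D[OF assms(2) e] ennreal_tendsto_0D[OF assms(3) e]
  proof eventually_elim
    case (elim n)
    have "a n \<le> 2 * ennreal (e / 4) + 2 * ennreal (e / 4)"
      by (rule order_trans[OF assms(1)]) (use elim in \<open>intro add_mono mult_left_mono, auto\<close>)
    also have "\<dots> = ennreal e" using e by (simp add: ennreal_double ennreal_plus[symmetric] del: ennreal_plus)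
    finally show ?case .
  qed
qed

lemma tendsto_0_scaled:
  fixes a b :: "nat \<Rightarrow> ennreal"
  assumes "\<And>n. a n \<le> ennreal c * b n" "b \<longlonglongrightarrow> 0" "0 \<le> c"
  shows "a \<longlonglongrightarrow> 0"
proof (rule ennreal_tendsto_0I)
  fix e :: real assume e: "e > 0"
  then have e': "e / (c + 1) > 0" using assms(3) by simp
  show "\<forall>\<^sub>F n in sequentially. a n \<le> ennreal e"
    using ennreal_tendsto_0D[OF assms(2) e']
  proof eventually_elim
    case (elim n)
    have "a n \<le> ennreal c * ennreal (e / (c + 1))"
      by (rule order_trans[OF assms(1)]) (use elim in \<open>intro mult_left_mono, auto\<close>)
    also have "\<dots> = ennreal (c / (c + 1) * e)" using e assms(3) by (simp add: ennreal_mult[symmetric])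
    also have "\<dots> \<le> ennreal (1 * e)" using e assms(3) by (intro ennreal_leI mult_right_mono) auto
    finally show ?case by simp
  qed
qed

lemma geometric_ennreal_tendsto_0: "(\<lambda>n. ennreal (C * (1/4) ^ n)) \<longlonglongrightarrow> 0"
proof -
  have "(\<lambda>n. C * (1/4) ^ n) \<longlonglongrightarrow> C * 0" by (intro tendsto_intros) auto
  then show ?thesis using tendsto_ennrealI[of "\<lambda>n. C * (1/4) ^ n" 0] by simp
qed

context noise_space
begin

lemma simple_walsh_measurable: "is_simple_field M F t es \<Longrightarrow> simple_walsh_integral W es \<in> borel_measurable M"
  using simple_has_moments has_moments_measurable by blast

text \<open>Concatenation with the list scaled by -1 realizes the difference of the fields and of
  the integrals at once.\<close>

lemma simple_diff_isometry:
  assumes t: "0 \<le> t" and es: "is_simple_field M F t es" "is_simple_field M F t es'"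
  shows "nsq M (\<lambda>\<omega>. simple_walsh_integral W es \<omega> - simple_walsh_integral W es' \<omega>) =
    nsq (field_measure M t) (\<lambda>p. simple_fun es p - simple_fun es' p)"
proof -
  let ?d = "es @ scale_field (-1) es'"
  have "is_simple_field M F t ?d" using es by (simp add: is_simple_field_append is_simple_field_scale)
  from simple_isometry[OF t this] show ?thesis
    by (simp add: simple_fun_append simple_fun_scale simple_walsh_integral_append simple_walsh_integral_scale nsq_def)
qed

text \<open>\<open>F t\<close> contains all null sets, so every version of an
  \<open>F t\<close>-measurable variable is \<open>F t\<close>-measurable. This is what makes an
  arbitrarily chosen version of the integral adapted.\<close>

lemma AE_eq_F_measurable:
  assumes t: "0 \<le> t" and I: "I \<in> borel_measurable M" and J: "J \<in> borel_measurable (F t)" and eq: "AE \<omega> in M. I \<omega> = J \<omega>"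
  shows "(I :: 'w \<Rightarrow> real) \<in> borel_measurable (F t)"
proof (rule measurableI)
  fix C :: "real set" assume C: "C \<in> sets borel"
  have JM: "J \<in> borel_measurable M" by (rule F_measurable_M[OF t J])
  define N where "N = {\<omega> \<in> space M. I \<omega> \<noteq> J \<omega>}"
  have N: "N \<in> null_sets M"
  proof -
    have "N \<in> sets M" unfolding N_def using I JM by measurable
    moreover have "AE \<omega> in M. \<omega> \<notin> N" using eq by eventually_elim (simp add: N_def)
    ultimately show ?thesis by (simp add: AE_iff_null_sets)
  qed
  have N2: "N \<inter> (I -` C \<inter> space M) \<in> null_sets M"
    by (rule null_set_Int2[OF N]) (rule measurable_sets[OF I C])
  have "I -` C \<inter> space (F t) = (J -` C \<inter> space (F t) - N) \<union> (N \<inter> (I -` C \<inter> space M))"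
    unfolding space_F[OF t] by (auto simp: N_def)
  moreover have "N \<in> sets (F t)" "N \<inter> (I -` C \<inter> space M) \<in> sets (F t)" using null_sets_F[OF t] N N2 by auto
  ultimately show "I -` C \<inter> space (F t) \<in> sets (F t)" using measurable_sets[OF J C] by auto
qed auto

text \<open>Approximating with error 4^(-n) makes the integrals of the simple fields converge almost
  surely by \<open>L2_limit\<close>. They are \<open>F t\<close>-measurable, and so is their
  pointwise limit.\<close>

lemma walsh_exists:
  assumes t: "0 \<le> t" and X: "walsh_integrable M F t X"
  shows "\<exists>I. has_walsh_integral M F W t X I \<and> I \<in> borel_measurable (F t)"
proof -
  let ?X = "uncurried X" and ?N = "field_measure M t"
  have Xp: "?X \<in> borel_measurable (predictable_algebra M F t)" and X2: "nsq ?N ?X < \<infinity>"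
    using X by (auto simp: walsh_integrable_iff)
  have [measurable]: "?X \<in> borel_measurable ?N" by (rule pred_measurable_field[OF t Xp])
  have L: "L2_simple t ?X" by (rule L2_simple_pred[OF t Xp X2])
  have "\<exists>es. is_simple_field M F t es \<and> nsq ?N (\<lambda>p. ?X p - simple_fun es p) \<le> ennreal ((1/4) ^ n)" for n :: nat
    using L unfolding L2_simple_def by (metis zero_less_divide_1_iff zero_less_numeral zero_less_power)
  then obtain e where e: "\<And>n. is_simple_field M F t (e n)" "\<And>n. nsq ?N (\<lambda>p. ?X p - simple_fun (e n) p) \<le> ennreal ((1/4) ^ n)"
    by metis
  have [measurable]: "simple_fun (e n) \<in> borel_measurable ?N" for n by (rule simple_fun_field[OF t e(1)])
  let ?f = "\<lambda>n. simple_walsh_integral W (e n)"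
  have fM: "?f n \<in> borel_measurable M" for n by (rule simple_walsh_measurable[OF e(1)])
  have inc: "nsq M (\<lambda>x. ?f (Suc n) x - ?f n x) \<le> ennreal (4 * (1/4) ^ n)" for n
  proof -
    have "nsq M (\<lambda>x. ?f (Suc n) x - ?f n x) = nsq ?N (\<lambda>p. simple_fun (e (Suc n)) p - simple_fun (e n) p)"
      by (rule simple_diff_isometry[OF t e(1) e(1)])
    also have "\<dots> \<le> 2 * nsq ?N (\<lambda>p. simple_fun (e (Suc n)) p - ?X p) + 2 * nsq ?N (\<lambda>p. ?X p - simple_fun (e n) p)"
      by (rule nsq_triangle) auto
    also have "\<dots> \<le> 2 * ennreal ((1/4) ^ Suc n) + 2 * ennreal ((1/4) ^ n)"
      unfolding nsq_commute[of _ "simple_fun _" ?X] by (intro add_mono mult_left_mono e(2)) auto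
    also have "\<dots> = ennreal (2 * (1/4) ^ Suc n + 2 * (1/4) ^ n)" by (subst (1 2) ennreal_double) (auto simp: ennreal_plus[symmetric] simp del: ennreal_plus)
    also have "\<dots> \<le> ennreal (4 * (1/4) ^ n)" by (intro ennreal_leI) simp
    finally show ?thesis .
  qed
  define I where "I \<omega> = lim (\<lambda>n. ?f n \<omega>)" for \<omega>
  have IF: "I \<in> borel_measurable (F t)" unfolding I_def[abs_def]
    by (rule borel_measurable_lim_metric) (rule simple_measurable_F[OF e(1)])
  have b: "nsq M (\<lambda>\<omega>. I \<omega> - ?f n \<omega>) \<le> ennreal (4 * 4 * (1/4) ^ n)" for n
    unfolding I_def by (rule L2_limit_bound[OF fM _ inc]) simp
  have "(\<lambda>n. nsq M (\<lambda>\<omega>. I \<omega> - ?f n \<omega>)) \<longlonglongrightarrow> 0"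
    by (rule tendsto_sandwich[OF always_eventually[OF allI[OF zero_le]] always_eventually[OF allI[OF b]]
          tendsto_const geometric_ennreal_tendsto_0])
  moreover have "(\<lambda>n. nsq ?N (\<lambda>p. ?X p - simple_fun (e n) p)) \<longlonglongrightarrow> 0"
    by (rule tendsto_sandwich[OF always_eventually[OF allI[OF zero_le]] always_eventually[OF allI]
          tendsto_const geometric_ennreal_tendsto_0[of 1]]) (use e(2) in simp)
  ultimately have "has_walsh_integral M F W t X I"
    unfolding has_walsh_integral_iff using X e(1) F_measurable_M[OF t IF] by blast
  then show ?thesis using IF by blast
qed

lemma walsh_diff:
  assumes t: "0 \<le> t" and X: "has_walsh_integral M F W t X I" and Y: "has_walsh_integral M F W t Y J"
  shows "has_walsh_integral M F W t (\<lambda>s y \<omega>. X s y \<omega> - Y s y \<omega>) (\<lambda>\<omega>. I \<omega> - J \<omega>)"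
proof -
  let ?N = "field_measure M t"
  obtain e where e: "\<And>n. is_simple_field M F t (e n)" "(\<lambda>n. nsq ?N (\<lambda>p. uncurried X p - simple_fun (e n) p)) \<longlonglongrightarrow> 0"
     "(\<lambda>n. nsq M (\<lambda>\<omega>. I \<omega> - simple_walsh_integral W (e n) \<omega>)) \<longlonglongrightarrow> 0" using X unfolding has_walsh_integral_iff by blast
  obtain d where d: "\<And>n. is_simple_field M F t (d n)" "(\<lambda>n. nsq ?N (\<lambda>p. uncurried Y p - simple_fun (d n) p)) \<longlonglongrightarrow> 0"
     "(\<lambda>n. nsq M (\<lambda>\<omega>. J \<omega> - simple_walsh_integral W (d n) \<omega>)) \<longlonglongrightarrow> 0" using Y unfolding has_walsh_integral_iff by blast
  have Xp: "uncurried X \<in> borel_measurable (predictable_algebra M F t)" and X2: "nsq ?N (uncurried X) < \<infinity>"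
    and Yp: "uncurried Y \<in> borel_measurable (predictable_algebra M F t)" and Y2: "nsq ?N (uncurried Y) < \<infinity>"
    and [measurable]: "I \<in> borel_measurable M" "J \<in> borel_measurable M"
    using X Y by (auto simp: walsh_integrable_iff has_walsh_integral_iff)
  have [measurable]: "uncurried X \<in> borel_measurable ?N" "uncurried Y \<in> borel_measurable ?N"
    by (rule pred_measurable_field[OF t Xp], rule pred_measurable_field[OF t Yp])
  have [measurable]: "simple_fun (e n) \<in> borel_measurable ?N" "simple_fun (d n) \<in> borel_measurable ?N" for n
    by (rule simple_fun_field[OF t e(1)], rule simple_fun_field[OF t d(1)])
  have [measurable]: "simple_walsh_integral W (e n) \<in> borel_measurable M" "simple_walsh_integral W (d n) \<in> borel_measurable M" for n
    by (rule simple_walsh_measurable[OF e(1)], rule simple_walsh_measurable[OF d(1)])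
  have u: "uncurried (\<lambda>s y \<omega>. X s y \<omega> - Y s y \<omega>) = (\<lambda>p. uncurried X p - uncurried Y p)"
    by (auto simp: uncurried_def fun_eq_iff)
  have tri: "nsq N (\<lambda>p. f p - g p) \<le> 2 * nsq N f + 2 * nsq N g" if "f \<in> borel_measurable N" "g \<in> borel_measurable N" for f g :: "'b \<Rightarrow> real" and N
    using nsq_add[of f N "\<lambda>p. - g p"] that by (simp add: nsq_uminus)
  define c where "c n = e n @ scale_field (-1) (d n)" for n
  have sc: "simple_fun (c n) p = simple_fun (e n) p - simple_fun (d n) p" for n p
    by (simp add: c_def simple_fun_append simple_fun_scale)
  have wc: "simple_walsh_integral W (c n) \<omega> = simple_walsh_integral W (e n) \<omega> - simple_walsh_integral W (d n) \<omega>" for n \<omega>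
    by (simp add: c_def simple_walsh_integral_append simple_walsh_integral_scale)
  have "nsq ?N (\<lambda>p. uncurried X p - uncurried Y p) \<le> 2 * nsq ?N (uncurried X) + 2 * nsq ?N (uncurried Y)" by (rule tri) auto
  also have "\<dots> < \<infinity>" using X2 Y2 by (simp add: ennreal_mult_less_top)
  finally have "walsh_integrable M F t (\<lambda>s y \<omega>. X s y \<omega> - Y s y \<omega>)"
    unfolding walsh_integrable_iff u using Xp Yp by simp
  moreover have "(\<lambda>n. nsq ?N (\<lambda>p. (uncurried X p - uncurried Y p) - simple_fun (c n) p)) \<longlonglongrightarrow> 0"
  proof (rule tendsto_0_sandwich[OF _ e(2) d(2)])
    fix n
    have "(\<lambda>p. (uncurried X p - uncurried Y p) - simple_fun (c n) p) = (\<lambda>p. (uncurried X p - simple_fun (e n) p) - (uncurried Y p - simple_fun (d n) p))"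
      by (simp add: sc fun_eq_iff)
    then show "nsq ?N (\<lambda>p. (uncurried X p - uncurried Y p) - simple_fun (c n) p) \<le>
      2 * nsq ?N (\<lambda>p. uncurried X p - simple_fun (e n) p) + 2 * nsq ?N (\<lambda>p. uncurried Y p - simple_fun (d n) p)"
      by (simp only:) (rule tri, auto)
  qed
  moreover have "(\<lambda>n. nsq M (\<lambda>\<omega>. (I \<omega> - J \<omega>) - simple_walsh_integral W (c n) \<omega>)) \<longlonglongrightarrow> 0"
  proof (rule tendsto_0_sandwich[OF _ e(3) d(3)])
    fix n
    have "(\<lambda>\<omega>. (I \<omega> - J \<omega>) - simple_walsh_integral W (c n) \<omega>) = (\<lambda>\<omega>. (I \<omega> - simple_walsh_integral W (e n) \<omega>) - (J \<omega> - simple_walsh_integral W (d n) \<omega>))"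
      by (simp add: wc fun_eq_iff)
    then show "nsq M (\<lambda>\<omega>. (I \<omega> - J \<omega>) - simple_walsh_integral W (c n) \<omega>) \<le>
      2 * nsq M (\<lambda>\<omega>. I \<omega> - simple_walsh_integral W (e n) \<omega>) + 2 * nsq M (\<lambda>\<omega>. J \<omega> - simple_walsh_integral W (d n) \<omega>)"
      by (simp only:) (rule tri, auto)
  qed
  moreover have "\<forall>n. is_simple_field M F t (c n)" using e d by (simp add: c_def is_simple_field_append is_simple_field_scale)
  ultimately show ?thesis unfolding has_walsh_integral_iff u by auto
qed

text \<open>The constant \<open>4\<close> is not optimal (the isometry would give \<open>1\<close>), but spares a limit of norms.\<close>

lemma walsh_bound:
  assumes t: "0 \<le> t" and X: "has_walsh_integral M F W t X I"
  shows "nsq M I \<le> 4 * nsq (field_measure M t) (uncurried X)"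
proof (rule ennreal_le_epsilon)
  fix r :: real assume r: "r > 0"
  let ?N = "field_measure M t"
  obtain e where e: "\<And>n. is_simple_field M F t (e n)" "(\<lambda>n. nsq ?N (\<lambda>p. uncurried X p - simple_fun (e n) p)) \<longlonglongrightarrow> 0"
     "(\<lambda>n. nsq M (\<lambda>\<omega>. I \<omega> - simple_walsh_integral W (e n) \<omega>)) \<longlonglongrightarrow> 0" using X unfolding has_walsh_integral_iff by blast
  have Xp: "uncurried X \<in> borel_measurable (predictable_algebra M F t)" 
    and [measurable]: "I \<in> borel_measurable M"
    using X by (auto simp: walsh_integrable_iff has_walsh_integral_iff)
  have [measurable]: "uncurried X \<in> borel_measurable ?N" by (rule pred_measurable_field[OF t Xp])
  \<comment> \<open>Eighths suffice: the two errors enter with the weights 2 and 4, and 6/8 <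
    1.\<close>
  have r8: "r / 8 > 0" using r by simp
  obtain n where n: "nsq ?N (\<lambda>p. uncurried X p - simple_fun (e n) p) < ennreal (r / 8)"
    "nsq M (\<lambda>\<omega>. I \<omega> - simple_walsh_integral W (e n) \<omega>) < ennreal (r / 8)"
    using eventually_happens'[OF _ eventually_conj[OF ennreal_tendsto_0D[OF e(2) r8] ennreal_tendsto_0D[OF e(3) r8]]] by auto
  have [measurable]: "simple_fun (e n) \<in> borel_measurable ?N" "simple_walsh_integral W (e n) \<in> borel_measurable M"
    by (rule simple_fun_field[OF t e(1)], rule simple_walsh_measurable[OF e(1)])
  have 1: "nsq M I \<le> 2 * nsq M (\<lambda>\<omega>. I \<omega> - simple_walsh_integral W (e n) \<omega>) + 2 * nsq ?N (simple_fun (e n))"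
    using nsq_add[of "\<lambda>\<omega>. I \<omega> - simple_walsh_integral W (e n) \<omega>" M "simple_walsh_integral W (e n)"]
    by (simp add: simple_isometry[OF t e(1)])
  have 2: "nsq ?N (simple_fun (e n)) \<le> 2 * nsq ?N (\<lambda>p. uncurried X p - simple_fun (e n) p) + 2 * nsq ?N (uncurried X)"
    using nsq_add[of "\<lambda>p. simple_fun (e n) p - uncurried X p" ?N "uncurried X"]
    by (simp add: nsq_commute[of _ "simple_fun (e n)" "uncurried X"])
  have "nsq M I \<le> 2 * nsq M (\<lambda>\<omega>. I \<omega> - simple_walsh_integral W (e n) \<omega>) +
    2 * (2 * nsq ?N (\<lambda>p. uncurried X p - simple_fun (e n) p) + 2 * nsq ?N (uncurried X))"
    by (rule order_trans[OF 1 add_left_mono[OF mult_left_mono[OF 2]]]) simp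
  also have "\<dots> \<le> 2 * ennreal (r / 8) + 2 * (2 * ennreal (r / 8) + 2 * nsq ?N (uncurried X))"
    using n by (intro add_mono mult_left_mono) auto
  also have "\<dots> = 4 * nsq ?N (uncurried X) + (2 * ennreal (r / 8) + 2 * (2 * ennreal (r / 8)))"
    by (simp add: distrib_left mult.assoc[symmetric] add_ac)
  also have "\<dots> \<le> 4 * nsq ?N (uncurried X) + ennreal r"
    using r by (intro add_left_mono) (simp add: ennreal_double ennreal_plus[symmetric] ennreal_leI del: ennreal_plus)
  finally show "nsq M I \<le> 4 * nsq ?N (uncurried X) + ennreal r" .
qed

lemma walsh_diff_bound:
  assumes t: "0 \<le> t" and X: "has_walsh_integral M F W t X I" and Y: "has_walsh_integral M F W t Y J"
  shows "nsq M (\<lambda>\<omega>. I \<omega> - J \<omega>) \<le> 4 * nsq (field_measure M t) (\<lambda>p. uncurried X p - uncurried Y p)"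
proof -
  have "uncurried (\<lambda>s y \<omega>. X s y \<omega> - Y s y \<omega>) = (\<lambda>p. uncurried X p - uncurried Y p)"
    by (auto simp: uncurried_def fun_eq_iff)
  with walsh_bound[OF t walsh_diff[OF assms]] show ?thesis by simp
qed

lemma walsh_measurable: "has_walsh_integral M F W t X I \<Longrightarrow> I \<in> borel_measurable M"
  by (simp add: has_walsh_integral_iff)

lemma walsh_unique:
  assumes t: "0 \<le> t" and I: "has_walsh_integral M F W t X I" and J: "has_walsh_integral M F W t X J"
  shows "AE \<omega> in M. I \<omega> = J \<omega>"
proof -
  have [measurable]: "I \<in> borel_measurable M" "J \<in> borel_measurable M" using I J by (auto intro: walsh_measurable)
  have "nsq M (\<lambda>\<omega>. I \<omega> - J \<omega>) \<le> 0"
    using walsh_diff_bound[OF t I J] by (simp add: nsq_def)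
  then have "AE \<omega> in M. I \<omega> - J \<omega> = 0" by (intro nsq_zero_AE) auto
  then show ?thesis by eventually_elim simp
qed

lemma walsh_integral_has:
  assumes "0 \<le> t" "walsh_integrable M F t X"
  shows "has_walsh_integral M F W t X (walsh_integral M F W t X)"
  unfolding walsh_integral_def using walsh_exists[OF assms] by (metis someI_ex)

lemma walsh_F_measurable:
  assumes t: "0 \<le> t" and I: "has_walsh_integral M F W t X I"
  shows "I \<in> borel_measurable (F t)"
proof -
  have "walsh_integrable M F t X" using I by (simp add: has_walsh_integral_iff)
  then obtain J where J: "has_walsh_integral M F W t X J" "J \<in> borel_measurable (F t)" using walsh_exists[OF t] by blast
  show ?thesis by (rule AE_eq_F_measurable[OF t walsh_measurable[OF I] J(2) walsh_unique[OF t I J(1)]])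
qed

section \<open>Change of the time horizon\<close>

lemma nsq_field_extend:
  assumes t: "0 \<le> t" "t \<le> T" and f: "f \<in> borel_measurable (field_measure M t)" "f \<in> borel_measurable (field_measure M T)"
    and 0: "\<And>s y \<omega>. t < s \<Longrightarrow> f (s, y, \<omega>) = 0"
  shows "nsq (field_measure M T) f = nsq (field_measure M t) f"
proof -
  have T: "0 \<le> T" using t by simp
  have m: "(\<lambda>p. ennreal ((f p)\<^sup>2)) \<in> borel_measurable (field_measure M t)" "(\<lambda>p. ennreal ((f p)\<^sup>2)) \<in> borel_measurable (field_measure M T)"
    using f by auto
  show ?thesis
    unfolding nsq_def nn_integral_field[OF t(1) m(1)] nn_integral_field[OF T m(2)]
  proof (rule nn_integral_cong)
    fix s
    show "(\<integral>\<^sup>+y. \<integral>\<^sup>+\<omega>. ennreal ((f (s, y, \<omega>))\<^sup>2) \<partial>M \<partial>lborel) * indicator {0..T} s =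
      (\<integral>\<^sup>+y. \<integral>\<^sup>+\<omega>. ennreal ((f (s, y, \<omega>))\<^sup>2) \<partial>M \<partial>lborel) * indicator {0..t} s"
      using t by (cases "t < s") (auto simp: 0 split: split_indicator)
  qed
qed

lemma simple_field_mono: "is_simple_field M F t es \<Longrightarrow> t \<le> T \<Longrightarrow> is_simple_field M F T es"
  unfolding is_simple_field_def by fastforce

lemma simple_field_val_late: "is_simple_field M F t es \<Longrightarrow> t < s \<Longrightarrow> simple_field_val es s y \<omega> = 0"
proof (induction es)
  case (Cons e es)
  obtain a b B Z where e: "e = (a, b, B, Z)" by (cases e)
  show ?case using Cons unfolding e is_simple_field_Cons simple_field_val_Cons by (auto split: split_indicator)
qed simp

text \<open>The convolutions at two different times are integrals over different intervals. As the
  kernel vanishes after the respective time, both can be read over [0, T] and subtracted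
  there.\<close>

lemma walsh_extend:
  assumes t: "0 \<le> t" "t \<le> T" and X: "has_walsh_integral M F W t X I"
    and XT: "uncurried X \<in> borel_measurable (predictable_algebra M F T)" and 0: "\<And>s y \<omega>. t < s \<Longrightarrow> X s y \<omega> = 0"
  shows "has_walsh_integral M F W T X I"
proof -
  have T: "0 \<le> T" using t by simp
  obtain e where e: "\<And>n. is_simple_field M F t (e n)" "(\<lambda>n. nsq (field_measure M t) (\<lambda>p. uncurried X p - simple_fun (e n) p)) \<longlonglongrightarrow> 0"
     "(\<lambda>n. nsq M (\<lambda>\<omega>. I \<omega> - simple_walsh_integral W (e n) \<omega>)) \<longlonglongrightarrow> 0" using X unfolding has_walsh_integral_iff by blast
  have Xt: "uncurried X \<in> borel_measurable (predictable_algebra M F t)" "nsq (field_measure M t) (uncurried X) < \<infinity>"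
    using X by (auto simp: has_walsh_integral_iff walsh_integrable_iff)
  have eT: "is_simple_field M F T (e n)" for n by (rule simple_field_mono[OF e(1) t(2)])
  note m = pred_measurable_field[OF t(1) Xt(1)] pred_measurable_field[OF T XT]
  have "nsq (field_measure M T) (uncurried X) = nsq (field_measure M t) (uncurried X)"
    by (rule nsq_field_extend[OF t m]) (simp add: 0)
  moreover have "nsq (field_measure M T) (\<lambda>p. uncurried X p - simple_fun (e n) p) = nsq (field_measure M t) (\<lambda>p. uncurried X p - simple_fun (e n) p)" for n
  proof (rule nsq_field_extend[OF t])
    show "(\<lambda>p. uncurried X p - simple_fun (e n) p) \<in> borel_measurable (field_measure M t)"
      by (rule borel_measurable_diff[OF m(1) simple_fun_field[OF t(1) e(1)]])
    show "(\<lambda>p. uncurried X p - simple_fun (e n) p) \<in> borel_measurable (field_measure M T)"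
      by (rule borel_measurable_diff[OF m(2) simple_fun_field[OF T eT]])
  qed (simp add: 0 simple_fun_def simple_field_val_late[OF e(1)])
  ultimately show ?thesis unfolding has_walsh_integral_iff walsh_integrable_iff using e eT XT Xt X
    by (intro conjI exI[of _ e]) (auto simp: has_walsh_integral_iff)
qed

lemma has_walsh_simple:
  assumes t: "0 \<le> t" and es: "is_simple_field M F t es"
  shows "has_walsh_integral M F W t (simple_field_val es) (simple_walsh_integral W es)"
proof -
  have u: "uncurried (simple_field_val es) = simple_fun es" by (auto simp: uncurried_def simple_fun_def)
  have hm: "has_moments (simple_walsh_integral W es)" by (rule simple_has_moments[OF es])
  have "nsq (field_measure M t) (simple_fun es) = nsq M (simple_walsh_integral W es)" by (rule simple_isometry[OF t es, symmetric])
  also have "\<dots> = ennreal (expectation (\<lambda>\<omega>. (simple_walsh_integral W es \<omega>)\<^sup>2))"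
    unfolding nsq_def using has_moments_integrable[OF hm, of 2] by (intro nn_integral_eq_integral) auto
  also have "\<dots> < \<infinity>" by simp
  finally have "walsh_integrable M F t (simple_field_val es)"
    unfolding walsh_integrable_iff u using simple_fun_pred[OF t es] by simp
  then show ?thesis unfolding has_walsh_integral_iff u 
    using es hm by (auto intro!: exI[of _ "\<lambda>_. es"] has_moments_measurable simp: nsq_def)
qed

end

section \<open>Higher moments of the Walsh integral\<close>

definition strip :: "real \<Rightarrow> (real \<times> real) measure" where
  "strip t = restrict_space lborel {0..t} \<Otimes>\<^sub>M lborel"

lemma space_strip: "space (strip t) = {0..t} \<times> UNIV"
  by (simp add: strip_def space_pair_measure space_restrict_space)

lemma nn_integral_strip:
  assumes g: "g \<in> borel_measurable (strip t)"
  shows "(\<integral>\<^sup>+x. g x \<partial>strip t) = (\<integral>\<^sup>+s. (\<integral>\<^sup>+y. g (s, y) \<partial>lborel) * indicator {0..t} s \<partial>lborel)"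
  unfolding strip_def
  by (subst lborel.nn_integral_fst[symmetric]) (use g in \<open>auto simp: strip_def nn_integral_restrict_space\<close>)

context noise_space
begin

text \<open>Conceived for even \<open>k\<close>, since \<open>ennreal\<close> would cut off negative
  values of an odd power.\<close>

definition fibre_moment :: "nat \<Rightarrow> (real \<times> real \<times> 'w \<Rightarrow> real) \<Rightarrow> real \<times> real \<Rightarrow> ennreal" where
  "fibre_moment k f x = (\<integral>\<^sup>+\<omega>. ennreal (f (fst x, snd x, \<omega>) ^ k) \<partial>M)"

lemma fibre_integral_measurable:
  assumes "f \<in> borel_measurable (field_measure M t)"
  shows "(\<lambda>x. \<integral>\<^sup>+\<omega>. f (fst x, snd x, \<omega>) \<partial>M) \<in> borel_measurable (strip t)"
proof -
  have "(\<lambda>(x, \<omega>). f (fst x, snd x, \<omega>)) \<in> borel_measurable (strip t \<Otimes>\<^sub>M M)"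
  proof -
    have "(\<lambda>p. (fst (fst p), snd (fst p), snd p)) \<in> measurable (strip t \<Otimes>\<^sub>M M) (field_measure M t)"
      unfolding strip_def field_measure_def by measurable
    from measurable_compose[OF this assms] show ?thesis by (simp add: split_beta)
  qed
  from borel_measurable_nn_integral_fst[OF this] show ?thesis by simp
qed

lemma nn_integral_field_strip:
  assumes t: "0 \<le> t" and f: "f \<in> borel_measurable (field_measure M t)"
  shows "(\<integral>\<^sup>+p. f p \<partial>field_measure M t) = (\<integral>\<^sup>+x. (\<integral>\<^sup>+\<omega>. f (fst x, snd x, \<omega>) \<partial>M) \<partial>strip t)"
  unfolding nn_integral_strip[OF fibre_integral_measurable[OF f]] nn_integral_field[OF assms] by simp

lemma fibre_moment_measurable:
  "f \<in> borel_measurable (field_measure M t) \<Longrightarrow> fibre_moment k f \<in> borel_measurable (strip t)"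
  unfolding fibre_moment_def[abs_def] by (rule fibre_integral_measurable) auto

lemma fibre_measurable:
  assumes "f \<in> borel_measurable (field_measure M t)" "x \<in> space (strip t)"
  shows "(\<lambda>\<omega>. f (fst x, snd x, \<omega>)) \<in> borel_measurable M"
  using field_section_measurable[OF assms(1), of "fst x" "snd x"] assms(2) by (auto simp: space_strip)

lemma fibre_root_measurable:
  assumes "f \<in> borel_measurable (field_measure M t)"
  shows "(\<lambda>x. root m (enn2real (fibre_moment k f x))) \<in> borel_measurable (strip t)"
proof -
  have "root m \<in> borel_measurable borel"
    by (intro borel_measurable_continuous_onI continuous_on_real_root continuous_on_id)
  then show ?thesis using fibre_moment_measurable[OF assms, of k] by measurable
qed

section \<open>Approximation with control of higher moments\<close>

text \<open>The coefficients are clipped one by one. On an ordered list this clips the value of the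
  field, because at most one cell is active at a time, and the result is again an ordered simple
  field.\<close>

definition cut_field :: "nat \<Rightarrow> real \<Rightarrow> 'w simple_field \<Rightarrow> 'w simple_field" where
  "cut_field N c es = map (\<lambda>(a, b, B, Z). (a, b, {- real N..real N} \<inter> B, \<lambda>\<omega>. max (- c) (min c (Z \<omega>)))) es"

lemma cut_field_simple:
  assumes "is_simple_field M F t es" "0 \<le> c" shows "is_simple_field M F t (cut_field N c es)"
  unfolding is_simple_field_def
proof safe
  fix a b B Z assume "(a, b, B, Z) \<in> set (cut_field N c es)"
  then obtain B' Z' where Z: "(a, b, B', Z') \<in> set es" "B = {- real N..real N} \<inter> B'" "Z = (\<lambda>\<omega>. max (- c) (min c (Z' \<omega>)))"
    by (auto simp: cut_field_def)
  with assms have *: "0 \<le> a" "a < b" "b \<le> t" "B' \<in> finite_borel_sets" "Z' \<in> borel_measurable (F a)"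
    by (auto simp: is_simple_field_def)
  show "0 \<le> a" "a < b" "b \<le> t" by (rule *)+
  show "B \<in> finite_borel_sets" unfolding Z(2) using finite_borel_sets_Int[OF interval_finite_borel] finite_borel_setsD[OF *(4)] by blast
  show "Z \<in> borel_measurable (F a)" unfolding Z(3) using *(5) by measurable
  show "bounded (Z ` space M)" unfolding Z(3) bounded_iff using assms(2) by (intro exI[of _ c]) auto
qed

lemma cut_field_ordered: "sorted_wrt cell_after es \<Longrightarrow> sorted_wrt cell_after (cut_field N c es)"
  unfolding cut_field_def sorted_wrt_map
  by (erule sorted_wrt_mono_rel[rotated]) (auto simp: cell_after_def)

lemma cut_field_val:
  assumes "sorted_wrt cell_after es" "0 \<le> c"
  shows "simple_field_val (cut_field N c es) s y \<omega> = (if \<bar>y\<bar> \<le> real N then max (- c) (min c (simple_field_val es s y \<omega>)) else 0)"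
proof -
  have "max (- c) (min c (simple_field_val es s y \<omega>)) = (\<Sum>(a, b, B, Z)\<leftarrow>es. max (- c) (min c (Z \<omega>)) * indicator {a<..b} s * indicator B y)"
    using ordered_field_apply[OF assms(1), of "\<lambda>Z. max (- c) (min c (Z \<omega>))" s y] assms(2) by simp
  moreover have "simple_field_val (cut_field N c es) s y \<omega> = 
    indicator {- real N..real N} y * (\<Sum>(a, b, B, Z)\<leftarrow>es. max (- c) (min c (Z \<omega>)) * indicator {a<..b} s * indicator B y)"
    unfolding simple_field_val_def cut_field_def by (induction es) (auto simp: indicator_inter_arith distrib_left mult_ac)
  ultimately show ?thesis by (auto split: split_indicator)
qed

text \<open>Recognizes the sum in \<open>ordered_moment_le\<close> as an integral over the strip. In
  this form the bound no longer refers to a partition and can follow the field to its limit.\<close>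

lemma ordered_fibre_sum:
  assumes t: "0 \<le> t" and es: "is_simple_field M F t es" "sorted_wrt cell_after es" and m: "0 < m"
  shows "(\<integral>\<^sup>+x. ennreal (root m (enn2real (fibre_moment (2 * m) (simple_fun es) x))) \<partial>strip t) =
    ennreal (\<Sum>(a, b, B, Z)\<leftarrow>es. root m (expectation (\<lambda>\<omega>. Z \<omega> ^ (2 * m))) * ((b - a) * measure lborel B))"
proof -
  let ?\<Psi> = "\<lambda>Z. ennreal (root m (enn2real (\<integral>\<^sup>+\<omega>. ennreal (Z \<omega> ^ (2 * m)) \<partial>M)))"
  have sm: "simple_fun es \<in> borel_measurable (field_measure M t)" by (rule simple_fun_field[OF t es(1)])
  have "(\<integral>\<^sup>+x. ennreal (root m (enn2real (fibre_moment (2 * m) (simple_fun es) x))) \<partial>strip t) =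
    (\<integral>\<^sup>+s. (\<integral>\<^sup>+y. ?\<Psi> (simple_field_val es s y) \<partial>lborel) * indicator {0..t} s \<partial>lborel)"
  proof (subst nn_integral_strip)
    show "(\<lambda>x. ennreal (root m (enn2real (fibre_moment (2 * m) (simple_fun es) x)))) \<in> borel_measurable (strip t)"
      using fibre_root_measurable[OF sm, of m "2 * m"] by measurable
  qed (simp add: fibre_moment_def simple_fun_def)
  also have "\<dots> = (\<integral>\<^sup>+s. (\<integral>\<^sup>+y. (\<Sum>(a, b, B, Z)\<leftarrow>es. ?\<Psi> Z * indicator {a<..b} s * indicator B y) \<partial>lborel) * indicator {0..t} s \<partial>lborel)"
    using m by (subst ordered_field_apply[OF es(2), where \<Psi>="?\<Psi>"]) (auto simp: zero_power)
  also have "\<dots> = (\<Sum>(a, b, B, Z)\<leftarrow>es. ?\<Psi> Z * ennreal ((b - a) * measure lborel B))"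
    by (rule simple_field_nn_integral[OF es(1)])
  also have "\<dots> = ennreal (\<Sum>(a, b, B, Z)\<leftarrow>es. root m (expectation (\<lambda>\<omega>. Z \<omega> ^ (2 * m))) * ((b - a) * measure lborel B))"
    using es(1)
  proof (induction es)
    case (Cons e es)
    obtain a b B Z where e: "e = (a, b, B, Z)" by (cases e)
    have es: "is_simple_field M F t es" and ab: "0 \<le> a" "a < b" "b \<le> t" using Cons(2) unfolding e is_simple_field_Cons by auto
    have Z: "has_moments Z" using simple_bounded_moment[OF Cons(2), of a b B Z] by (simp add: e)
    have nnZ: "0 \<le> root m (expectation (\<lambda>\<omega>. Z' \<omega> ^ (2 * m)))" for Z' :: "'w \<Rightarrow> real"
      by (intro real_root_ge_zero integral_nonneg_AE) (auto simp: zero_le_even_power)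
    have nonneg: "0 \<le> (\<Sum>(a, b, B, Z)\<leftarrow>es. root m (expectation (\<lambda>\<omega>. Z \<omega> ^ (2 * m))) * ((b - a) * measure lborel B))"
      using es by (intro sum_list_nonneg) (fastforce simp: is_simple_field_def intro!: mult_nonneg_nonneg nnZ)
    have "enn2real (\<integral>\<^sup>+\<omega>. ennreal (Z \<omega> ^ (2 * m)) \<partial>M) = expectation (\<lambda>\<omega>. Z \<omega> ^ (2 * m))"
      using has_moments_measurable[OF Z] by (subst integral_eq_nn_integral) (auto simp: zero_le_even_power)
    then show ?case using Cons.IH[OF es] nonneg ab nnZ[of Z] by (simp add: e ennreal_mult)
  qed simp
  finally show ?thesis .
qed

text \<open>Ordered simple fields approximating \<open>V\<close> are cut at the bounds which
  \<open>V\<close> itself satisfies. Their fibre norms then converge under a common integrable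
  majorant, so the right side of the moment bound falls below \<open>H + \<epsilon>\<close> for
  large \<open>n\<close>.\<close>

lemma moment_approx:
  fixes h :: "real \<times> real \<Rightarrow> real"
  assumes t: "0 \<le> t" and V: "L2_simple t V" and Vc: "\<And>p. \<bar>V p\<bar> \<le> c" and Vw: "\<And>p. p \<notin> window N t \<Longrightarrow> V p = 0"
    and m: "0 < m" and h0: "\<And>x. 0 \<le> h x"
    and hV: "\<And>x. x \<in> space (strip t) \<Longrightarrow> fibre_moment (2 * m) V x \<le> ennreal (h x ^ m)"
    and hH: "(\<integral>\<^sup>+x. ennreal (h x) \<partial>strip t) \<le> ennreal H" and H: "0 \<le> H" and \<epsilon>: "0 < \<epsilon>"
  shows "\<exists>es. is_simple_field M F t es \<and> nsq (field_measure M t) (\<lambda>p. V p - simple_fun es p) \<le> ennreal \<epsilon> \<and>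
    (\<integral>\<^sup>+\<omega>. ennreal (simple_walsh_integral W es \<omega> ^ (2 * m)) \<partial>M) \<le> ennreal (((2 * real m - 1) * (H + \<epsilon>)) ^ m)"
proof -
  let ?N = "field_measure M t"
  have c: "0 \<le> c" using Vc[of undefined] by linarith
  have [measurable]: "V \<in> borel_measurable ?N" using V by (simp add: L2_simple_def)
  have "\<exists>es. is_simple_field M F t es \<and> sorted_wrt cell_after es \<and> nsq ?N (\<lambda>p. V p - simple_fun es p) \<le> ennreal ((1/4) ^ n)" for n :: nat
  proof -
    obtain es where es: "is_simple_field M F t es" "nsq ?N (\<lambda>p. V p - simple_fun es p) \<le> ennreal ((1/4) ^ n)"
      using V unfolding L2_simple_def by (metis zero_less_divide_1_iff zero_less_numeral zero_less_power)
    show ?thesis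
    proof (rule simple_field_refine[OF es(1)])
      fix es' assume es': "is_simple_field M F t es'" "sorted_wrt cell_after es'"
        "\<And>s y \<omega>. simple_field_val es' s y \<omega> = simple_field_val es s y \<omega>"
      have "simple_fun es' = simple_fun es" by (simp add: simple_fun_def es'(3))
      then show ?thesis using es es' by (intro exI[of _ es']) auto
    qed
  qed
  then obtain e where e: "\<And>n. is_simple_field M F t (e n)" "\<And>n. sorted_wrt cell_after (e n)"
    "\<And>n. nsq ?N (\<lambda>p. V p - simple_fun (e n) p) \<le> ennreal ((1/4) ^ n)" by metis
  define d where "d n = cut_field N c (e n)" for n
  have ds: "is_simple_field M F t (d n)" "sorted_wrt cell_after (d n)" for n
    unfolding d_def by (rule cut_field_simple[OF e(1) c], rule cut_field_ordered[OF e(2)])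
  have dv: "simple_fun (d n) (s, y, \<omega>) = (if \<bar>y\<bar> \<le> real N then max (- c) (min c (simple_fun (e n) (s, y, \<omega>))) else 0)" for n s y \<omega>
    by (simp add: simple_fun_def d_def cut_field_val[OF e(2) c])
  have dc: "\<bar>simple_fun (d n) p\<bar> \<le> c" for n p using c by (cases p) (auto simp: dv)
  have [measurable]: "simple_fun (d n) \<in> borel_measurable ?N" for n by (rule simple_fun_field[OF t ds(1)])
  \<comment> \<open>Cutting is a projection onto a set of values to which \<open>V\<close> belongs,
    hence it does not increase the distance to \<open>V\<close>.\<close>
  have d4: "nsq ?N (\<lambda>p. V p - simple_fun (d n) p) \<le> ennreal ((1/4) ^ n)" for n
  proof (rule order_trans[OF nsq_mono e(3)])
    fix p assume p: "p \<in> space ?N"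
    obtain s y \<omega> where q: "p = (s, y, \<omega>)" by (cases p)
    show "\<bar>V p - simple_fun (d n) p\<bar> \<le> \<bar>V p - simple_fun (e n) p\<bar>"
    proof (cases "\<bar>y\<bar> \<le> real N")
      case True
      then show ?thesis using Vc[of p] by (simp add: q dv)
    next
      case False
      then have "V p = 0" by (intro Vw) (auto simp: q window_def)
      then show ?thesis using False by (simp add: q dv)
    qed
  qed
  let ?q = "\<lambda>f x. root m (enn2real (fibre_moment (2 * m) f x))"
  have bound: "fibre_moment (2 * m) f x \<le> ennreal (c ^ (2 * m))" if "\<And>p. \<bar>f p\<bar> \<le> c" for f :: "real \<times> real \<times> 'w \<Rightarrow> real" and x
  proof -
    have "f p ^ (2 * m) \<le> c ^ (2 * m)" for p
    proof -
      have "f p ^ (2 * m) = \<bar>f p\<bar> ^ (2 * m)" by (simp add: power_even_abs)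
      also have "\<dots> \<le> c ^ (2 * m)" by (rule power_mono[OF that]) simp
      finally show ?thesis .
    qed
    then have "fibre_moment (2 * m) f x \<le> (\<integral>\<^sup>+\<omega>. ennreal (c ^ (2 * m)) \<partial>M)"
      unfolding fibre_moment_def by (intro nn_integral_mono ennreal_leI)
    then show ?thesis by (simp add: emeasure_space_1)
  qed
  \<comment> \<open>The errors remain summable after integration over the strip. For almost every
    point (s, y) the fibres therefore converge almost surely in \<open>\<omega>\<close> along the
    whole sequence.\<close>
  have fsum: "AE x in strip t. (\<Sum>n. nsq M (\<lambda>\<omega>. V (fst x, snd x, \<omega>) - simple_fun (d n) (fst x, snd x, \<omega>))) \<noteq> \<infinity>"
  proof (rule nn_integral_PInf_AE)
    have ms: "(\<lambda>x. nsq M (\<lambda>\<omega>. V (fst x, snd x, \<omega>) - simple_fun (d n) (fst x, snd x, \<omega>))) \<in> borel_measurable (strip t)" for n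
      unfolding nsq_def by (rule fibre_integral_measurable[where f="\<lambda>p. ennreal ((V p - simple_fun (d n) p)\<^sup>2)"]) auto
    then show "(\<lambda>x. \<Sum>n. nsq M (\<lambda>\<omega>. V (fst x, snd x, \<omega>) - simple_fun (d n) (fst x, snd x, \<omega>))) \<in> borel_measurable (strip t)"
      by (rule borel_measurable_suminf_order)
    have "(\<integral>\<^sup>+x. (\<Sum>n. nsq M (\<lambda>\<omega>. V (fst x, snd x, \<omega>) - simple_fun (d n) (fst x, snd x, \<omega>))) \<partial>strip t) =
      (\<Sum>n. nsq ?N (\<lambda>p. V p - simple_fun (d n) p))"
      unfolding nn_integral_suminf[OF ms] unfolding nsq_def
      by (intro suminf_cong nn_integral_field_strip[OF t, symmetric]) auto
    also have "\<dots> \<noteq> \<infinity>" by (rule geometric_suminf_finite[OF d4])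
    finally show "(\<integral>\<^sup>+x. (\<Sum>n. nsq M (\<lambda>\<omega>. V (fst x, snd x, \<omega>) - simple_fun (d n) (fst x, snd x, \<omega>))) \<partial>strip t) \<noteq> \<infinity>" .
  qed
  have lim: "AE x in strip t. (\<lambda>n. ennreal (?q (simple_fun (d n)) x)) \<longlonglongrightarrow> ennreal (?q V x)"
    using fsum AE_space
  proof eventually_elim
    case (elim x)
    have mV: "(\<lambda>\<omega>. V (fst x, snd x, \<omega>)) \<in> borel_measurable M" and md: "(\<lambda>\<omega>. simple_fun (d n) (fst x, snd x, \<omega>)) \<in> borel_measurable M" for n
      using elim(2) by (auto intro!: fibre_measurable)
    have "AE \<omega> in M. (\<lambda>n. simple_fun (d n) (fst x, snd x, \<omega>)) \<longlonglongrightarrow> V (fst x, snd x, \<omega>)"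
      by (rule nsq_suminf_AE_tendsto[OF md mV elim(1)])
    then have "(\<lambda>n. fibre_moment (2 * m) (simple_fun (d n)) x) \<longlonglongrightarrow> fibre_moment (2 * m) V x"
      unfolding fibre_moment_def
    proof (intro nn_integral_dominated_convergence[where w="\<lambda>_. ennreal (c ^ (2 * m))"])
      assume "AE \<omega> in M. (\<lambda>n. simple_fun (d n) (fst x, snd x, \<omega>)) \<longlonglongrightarrow> V (fst x, snd x, \<omega>)"
      then show "AE \<omega> in M. (\<lambda>n. ennreal (simple_fun (d n) (fst x, snd x, \<omega>) ^ (2 * m))) \<longlonglongrightarrow> ennreal (V (fst x, snd x, \<omega>) ^ (2 * m))"
        by eventually_elim (intro tendsto_intros)
      show "AE \<omega> in M. ennreal (simple_fun (d j) (fst x, snd x, \<omega>) ^ (2 * m)) \<le> ennreal (c ^ (2 * m))" for j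
      proof (rule AE_I2, rule ennreal_leI)
        fix \<omega>
        have "simple_fun (d j) (fst x, snd x, \<omega>) ^ (2 * m) = \<bar>simple_fun (d j) (fst x, snd x, \<omega>)\<bar> ^ (2 * m)" by (simp add: power_even_abs)
        also have "\<dots> \<le> c ^ (2 * m)" by (rule power_mono[OF dc]) simp
        finally show "simple_fun (d j) (fst x, snd x, \<omega>) ^ (2 * m) \<le> c ^ (2 * m)" .
      qed
    qed (use mV md in \<open>auto simp: emeasure_space_1\<close>)
    moreover obtain r where r: "fibre_moment (2 * m) V x = ennreal r" "0 \<le> r"
      using bound[of V x, OF Vc] by (cases "fibre_moment (2 * m) V x") (auto simp: top_unique)
    ultimately have "(\<lambda>n. enn2real (fibre_moment (2 * m) (simple_fun (d n)) x)) \<longlonglongrightarrow> r"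
      by (intro tendsto_enn2real) auto
    then have "(\<lambda>n. ?q (simple_fun (d n)) x) \<longlonglongrightarrow> root m r" by (rule tendsto_real_root)
    then show ?case using r by (intro tendsto_ennrealI) simp
  qed
  \<comment> \<open>A field bounded by \<open>c\<close> and supported in the window has fibre norm
    at most the square of \<open>c\<close> there, and 0 outside.\<close>
  let ?w = "\<lambda>x. ennreal (c\<^sup>2) * indicator ({0..t} \<times> {- real N..real N}) x"
  have "(\<lambda>n. \<integral>\<^sup>+x. ennreal (?q (simple_fun (d n)) x) \<partial>strip t) \<longlonglongrightarrow> (\<integral>\<^sup>+x. ennreal (?q V x) \<partial>strip t)"
  proof (rule nn_integral_dominated_convergence[where w="?w", OF _ _ _ _ _ lim])
    have rect: "{0..t} \<times> {- real N..real N} \<in> sets (strip t)"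
      unfolding strip_def by (intro pair_measureI) (auto simp: sets_restrict_space_iff)
    then show "?w \<in> borel_measurable (strip t)" by measurable
    have "(\<integral>\<^sup>+x. ?w x \<partial>strip t) = ennreal (c\<^sup>2) * emeasure (strip t) ({0..t} \<times> {- real N..real N})"
      by (rule nn_integral_cmult_indicator[OF rect])
    also have "emeasure (strip t) ({0..t} \<times> {- real N..real N}) = emeasure (restrict_space lborel {0..t}) {0..t} * emeasure lborel {- real N..real N}"
      unfolding strip_def by (intro lborel.emeasure_pair_measure_Times) (auto simp: sets_restrict_space_iff)
    also have "emeasure (restrict_space lborel {0..t}) {0..t} = emeasure lborel {0..t}" by (rule emeasure_restrict_space) auto
    finally show "(\<integral>\<^sup>+x. ?w x \<partial>strip t) < \<infinity>" using t by (simp add: ennreal_mult_less_top)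
    show "AE x in strip t. ennreal (?q (simple_fun (d j)) x) \<le> ?w x" for j
    proof (rule AE_I2)
      fix x assume x: "x \<in> space (strip t)"
      show "ennreal (?q (simple_fun (d j)) x) \<le> ?w x"
      proof (cases "\<bar>snd x\<bar> \<le> real N")
        case True
        then have xi: "x \<in> {0..t} \<times> {- real N..real N}" using x by (cases x) (auto simp: space_strip)
        have "enn2real (fibre_moment (2 * m) (simple_fun (d j)) x) \<le> enn2real (ennreal (c ^ (2 * m)))"
          by (intro enn2real_mono bound dc) simp
        then have "?q (simple_fun (d j)) x \<le> root m ((c\<^sup>2) ^ m)" using m c by (simp add: power_mult)
        also have "\<dots> = c\<^sup>2" using m by (simp add: real_root_power_cancel)
        finally show ?thesis using xi by (simp add: ennreal_leI)
      next
        case False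
        then have "simple_fun (d j) (fst x, snd x, \<omega>) = 0" for \<omega> by (simp add: dv)
        then show ?thesis using m by (simp add: fibre_moment_def zero_power)
      qed
    qed
  qed (use fibre_root_measurable in measurable)
  moreover have "(\<integral>\<^sup>+x. ennreal (?q V x) \<partial>strip t) < ennreal (H + \<epsilon>)"
  proof -
    have "(\<integral>\<^sup>+x. ennreal (?q V x) \<partial>strip t) \<le> (\<integral>\<^sup>+x. ennreal (h x) \<partial>strip t)"
    proof (rule nn_integral_mono)
      fix x assume x: "x \<in> space (strip t)"
      have "enn2real (fibre_moment (2 * m) V x) \<le> enn2real (ennreal (h x ^ m))" by (intro enn2real_mono hV[OF x]) simp
      then have "?q V x \<le> root m (h x ^ m)" using m h0[of x] by simp
      also have "\<dots> = h x" using m h0 by (simp add: real_root_power_cancel)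
      finally show "ennreal (?q V x) \<le> ennreal (h x)" by (rule ennreal_leI)
    qed
    also have "\<dots> \<le> ennreal H" by (rule hH)
    also have "\<dots> < ennreal (H + \<epsilon>)" using H \<epsilon> by (simp add: ennreal_less_iff)
    finally show ?thesis .
  qed
  ultimately have ev: "\<forall>\<^sub>F n in sequentially. (\<integral>\<^sup>+x. ennreal (?q (simple_fun (d n)) x) \<partial>strip t) < ennreal (H + \<epsilon>)"
    by (rule order_tendstoD(2))
  have "\<forall>\<^sub>F n in sequentially. (1/4 :: real) ^ n < \<epsilon>"
    by (rule order_tendstoD(2)[OF LIMSEQ_power_zero]) (use \<epsilon> in auto)
  then obtain n where n: "(\<integral>\<^sup>+x. ennreal (?q (simple_fun (d n)) x) \<partial>strip t) < ennreal (H + \<epsilon>)" "(1/4 :: real) ^ n < \<epsilon>"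
    using eventually_happens'[OF _ eventually_conj[OF ev]] by auto
  let ?R = "\<Sum>(a, b, B, Z)\<leftarrow>d n. root m (expectation (\<lambda>\<omega>. Z \<omega> ^ (2 * m))) * ((b - a) * measure lborel B)"
  have "ennreal ?R < ennreal (H + \<epsilon>)" using n(1) unfolding ordered_fibre_sum[OF t ds m] .
  then have R: "?R \<le> H + \<epsilon>" by (metis ennreal_leI leD le_cases)
  have "0 \<le> root m (expectation (\<lambda>\<omega>. Z' \<omega> ^ (2 * m)))" for Z' :: "'w \<Rightarrow> real"
    by (intro real_root_ge_zero integral_nonneg_AE) (auto simp: zero_le_even_power)
  then have R0: "0 \<le> ?R"
    using ds(1)[of n] by (intro sum_list_nonneg) (fastforce simp: is_simple_field_def intro!: mult_nonneg_nonneg)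
  have hm: "has_moments (simple_walsh_integral W (d n))" by (rule simple_has_moments[OF ds(1)])
  have "(\<integral>\<^sup>+\<omega>. ennreal (simple_walsh_integral W (d n) \<omega> ^ (2 * m)) \<partial>M) = ennreal (expectation (\<lambda>\<omega>. simple_walsh_integral W (d n) \<omega> ^ (2 * m)))"
    using has_moments_integrable[OF hm] by (intro nn_integral_eq_integral) (auto simp: zero_le_even_power)
  also have "\<dots> \<le> ennreal (((2 * real m - 1) * ?R) ^ m)"
    by (rule ennreal_leI[OF ordered_moment_le[OF m ds]])
  also have "\<dots> \<le> ennreal (((2 * real m - 1) * (H + \<epsilon>)) ^ m)"
    using R R0 m by (intro ennreal_leI power_mono mult_left_mono mult_nonneg_nonneg) auto
  finally have "(\<integral>\<^sup>+\<omega>. ennreal (simple_walsh_integral W (d n) \<omega> ^ (2 * m)) \<partial>M) \<le> ennreal (((2 * real m - 1) * (H + \<epsilon>)) ^ m)" .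
  moreover have "nsq ?N (\<lambda>p. V p - simple_fun (d n) p) \<le> ennreal \<epsilon>"
    using n(2) by (intro order_trans[OF d4] ennreal_leI) simp
  ultimately show ?thesis using ds(1) by blast
qed

text \<open>A Burkholder-Davis-Gundy inequality for even exponents, with \<open>h\<close> dominating the squared fibre norms.\<close>

lemma walsh_moment_bound:
  fixes h :: "real \<times> real \<Rightarrow> real"
  assumes t: "0 \<le> t" and I: "has_walsh_integral M F W t X I" and m: "0 < m" and h0: "\<And>x. 0 \<le> h x"
    and hX: "\<And>x. x \<in> space (strip t) \<Longrightarrow> fibre_moment (2 * m) (uncurried X) x \<le> ennreal (h x ^ m)"
    and h_meas: "h \<in> borel_measurable (strip t)"
    and hH: "(\<integral>\<^sup>+x. ennreal (h x) \<partial>strip t) \<le> ennreal H" and H: "0 \<le> H"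
  shows "(\<integral>\<^sup>+\<omega>. ennreal (I \<omega> ^ (2 * m)) \<partial>M) \<le> ennreal (((2 * real m - 1) * (4 * H)) ^ m)"
proof -
  let ?N = "field_measure M t" and ?X = "uncurried X"
  have Xp: "?X \<in> borel_measurable (predictable_algebra M F t)" and X2: "nsq ?N ?X < \<infinity>" and [measurable]: "I \<in> borel_measurable M"
    using I by (auto simp: has_walsh_integral_iff walsh_integrable_iff)
  have [measurable]: "?X \<in> borel_measurable ?N" by (rule pred_measurable_field[OF t Xp])
  \<comment> \<open>Sixteen times \<open>\<epsilon> n\<close> must stay below (1/4)^n: a factor 4
    comes from the approximation in two stages, another from
    \<open>walsh_diff_bound\<close>.\<close>
  define \<epsilon> where "\<epsilon> n = (1/4 :: real) ^ n / 64" for n :: nat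
  have \<epsilon>: "\<epsilon> n > 0" for n by (simp add: \<epsilon>_def)
  have "\<exists>es. is_simple_field M F t es \<and> nsq ?N (\<lambda>p. ?X p - simple_fun es p) \<le> ennreal (4 * \<epsilon> n) \<and>
    (\<integral>\<^sup>+\<omega>. ennreal (simple_walsh_integral W es \<omega> ^ (2 * m)) \<partial>M) \<le> ennreal (((2 * real m - 1) * (4 * H + \<epsilon> n)) ^ m)" for n
  proof (rule L2_simple_approx[OF t Xp X2])
    fix V c assume V: "\<And>k. L2_simple t (V k)" "\<And>k p. \<bar>V k p\<bar> \<le> c k" "\<And>k p. p \<in> space ?N \<Longrightarrow> \<bar>V k p\<bar> \<le> 2 * \<bar>?X p\<bar>"
      "\<And>k p. p \<notin> window k t \<Longrightarrow> V k p = 0" "(\<lambda>k. nsq ?N (\<lambda>p. V k p - ?X p)) \<longlonglongrightarrow> 0"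
    obtain k where k: "nsq ?N (\<lambda>p. V k p - ?X p) < ennreal (\<epsilon> n)"
      using eventually_happens'[OF _ ennreal_tendsto_0D[OF V(5) \<epsilon>]] by auto
    \<comment> \<open>The approximation obeys |V| \<le> 2 |X| only, so the majorant of the squared
      fibre norms grows from \<open>h\<close> to \<open>4 * h\<close>; this is the factor 4 in front
      of \<open>H\<close>.\<close>
    have "fibre_moment (2 * m) (V k) x \<le> ennreal ((4 * h x) ^ m)" if x: "x \<in> space (strip t)" for x
    proof -
      have "fibre_moment (2 * m) (V k) x \<le> (\<integral>\<^sup>+\<omega>. ennreal (4 ^ m) * ennreal (?X (fst x, snd x, \<omega>) ^ (2 * m)) \<partial>M)"
        unfolding fibre_moment_def
      proof (rule nn_integral_mono)
        fix \<omega> assume w: "\<omega> \<in> space M"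
        let ?p = "(fst x, snd x, \<omega>)"
        have "?p \<in> space ?N" using x w by (auto simp: space_strip space_field_measure)
        have "V k ?p ^ (2 * m) = \<bar>V k ?p\<bar> ^ (2 * m)" by (simp add: power_even_abs)
        also have "\<dots> \<le> (2 * \<bar>?X ?p\<bar>) ^ (2 * m)" using V(3)[OF \<open>?p \<in> space ?N\<close>, of k] by (rule power_mono) simp
        also have "\<dots> = 4 ^ m * ?X ?p ^ (2 * m)"
          by (simp add: power_mult_distrib power_mult power_even_abs)
        finally have "ennreal (V k ?p ^ (2 * m)) \<le> ennreal (4 ^ m * ?X ?p ^ (2 * m))" by (rule ennreal_leI)
        then show "ennreal (V k ?p ^ (2 * m)) \<le> ennreal (4 ^ m) * ennreal (?X ?p ^ (2 * m))"
          by (simp add: ennreal_mult zero_le_even_power)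
      qed
      also have "\<dots> = ennreal (4 ^ m) * fibre_moment (2 * m) ?X x"
        unfolding fibre_moment_def
        by (intro nn_integral_cmult measurable_compose[OF _ measurable_ennreal] borel_measurable_power fibre_measurable[OF _ x]) simp
      also have "\<dots> \<le> ennreal (4 ^ m) * ennreal (h x ^ m)" by (intro mult_left_mono hX[OF x]) simp
      also have "\<dots> = ennreal ((4 * h x) ^ m)" using h0[of x] by (simp add: ennreal_mult[symmetric] power_mult_distrib)
      finally show ?thesis .
    qed
    moreover have "(\<integral>\<^sup>+x. ennreal (4 * h x) \<partial>strip t) \<le> ennreal (4 * H)"
    proof -
      have "(\<integral>\<^sup>+x. ennreal (4 * h x) \<partial>strip t) = (\<integral>\<^sup>+x. ennreal 4 * ennreal (h x) \<partial>strip t)"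
        using h0 by (intro nn_integral_cong) (simp add: ennreal_mult)
      also have "\<dots> \<le> ennreal 4 * ennreal H"
        using hH h_meas by (subst nn_integral_cmult) (auto intro: mult_left_mono)
      finally show ?thesis using H by (simp add: ennreal_mult)
    qed
    ultimately have "\<exists>es. is_simple_field M F t es \<and> nsq ?N (\<lambda>p. V k p - simple_fun es p) \<le> ennreal (\<epsilon> n) \<and>
      (\<integral>\<^sup>+\<omega>. ennreal (simple_walsh_integral W es \<omega> ^ (2 * m)) \<partial>M) \<le> ennreal (((2 * real m - 1) * (4 * H + \<epsilon> n)) ^ m)"
      using h0 H \<epsilon>[of n] by (intro moment_approx[OF t V(1,2) V(4)[of _ k] m, where h="\<lambda>x. 4 * h x"]) simp_all
    then obtain es where es: "is_simple_field M F t es" "nsq ?N (\<lambda>p. V k p - simple_fun es p) \<le> ennreal (\<epsilon> n)"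
      "(\<integral>\<^sup>+\<omega>. ennreal (simple_walsh_integral W es \<omega> ^ (2 * m)) \<partial>M) \<le> ennreal (((2 * real m - 1) * (4 * H + \<epsilon> n)) ^ m)"
      by blast
    have [measurable]: "simple_fun es \<in> borel_measurable ?N" "V k \<in> borel_measurable ?N"
      using simple_fun_field[OF t es(1)] V(1)[of k] by (auto simp: L2_simple_def)
    have "nsq ?N (\<lambda>p. ?X p - simple_fun es p) \<le> 2 * nsq ?N (\<lambda>p. ?X p - V k p) + 2 * nsq ?N (\<lambda>p. V k p - simple_fun es p)"
      by (rule nsq_triangle) auto
    also have "\<dots> \<le> 2 * ennreal (\<epsilon> n) + 2 * ennreal (\<epsilon> n)"
      using k es(2) nsq_commute[of ?N ?X "V k"] by (intro add_mono mult_left_mono) auto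
    also have "\<dots> = ennreal (4 * \<epsilon> n)"
      using \<epsilon>[of n] by (simp add: ennreal_double ennreal_plus[symmetric] del: ennreal_plus)
    finally show ?thesis using es by blast
  qed
  from choice[OF allI[OF this]] obtain e where e': "\<forall>n. is_simple_field M F t (e n) \<and> nsq ?N (\<lambda>p. ?X p - simple_fun (e n) p) \<le> ennreal (4 * \<epsilon> n) \<and>
    (\<integral>\<^sup>+\<omega>. ennreal (simple_walsh_integral W (e n) \<omega> ^ (2 * m)) \<partial>M) \<le> ennreal (((2 * real m - 1) * (4 * H + \<epsilon> n)) ^ m)" ..
  have e: "is_simple_field M F t (e n)" "nsq ?N (\<lambda>p. ?X p - simple_fun (e n) p) \<le> ennreal (4 * \<epsilon> n)"
    "(\<integral>\<^sup>+\<omega>. ennreal (simple_walsh_integral W (e n) \<omega> ^ (2 * m)) \<partial>M) \<le> ennreal (((2 * real m - 1) * (4 * H + \<epsilon> n)) ^ m)" for n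
    by (rule spec[OF e', THEN conjunct1], rule spec[OF e', THEN conjunct2, THEN conjunct1],
        rule spec[OF e', THEN conjunct2, THEN conjunct2])
  have [measurable]: "simple_walsh_integral W (e n) \<in> borel_measurable M" for n by (rule simple_walsh_measurable[OF e(1)])
  have "nsq M (\<lambda>\<omega>. I \<omega> - simple_walsh_integral W (e n) \<omega>) \<le> ennreal ((1/4) ^ n)" for n
  proof -
    have "uncurried (simple_field_val (e n)) = simple_fun (e n)" by (auto simp: uncurried_def simple_fun_def)
    then have "nsq M (\<lambda>\<omega>. I \<omega> - simple_walsh_integral W (e n) \<omega>) \<le> 4 * nsq ?N (\<lambda>p. ?X p - simple_fun (e n) p)"
      using walsh_diff_bound[OF t I has_walsh_simple[OF t e(1)], of n] by simp
    also have "\<dots> \<le> 4 * ennreal (4 * \<epsilon> n)" by (intro mult_left_mono e(2)) simp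
    also have "\<dots> = ennreal (4 * (4 * \<epsilon> n))" using \<epsilon>[of n] by (simp add: ennreal_mult)
    also have "\<dots> \<le> ennreal ((1/4) ^ n)" by (intro ennreal_leI) (simp add: \<epsilon>_def)
    finally show ?thesis .
  qed
  then have ae: "AE \<omega> in M. (\<lambda>n. simple_walsh_integral W (e n) \<omega>) \<longlonglongrightarrow> I \<omega>"
    by (intro nsq_AE_tendsto) auto
  have "(\<integral>\<^sup>+\<omega>. ennreal (I \<omega> ^ (2 * m)) \<partial>M) = (\<integral>\<^sup>+\<omega>. liminf (\<lambda>n. ennreal (simple_walsh_integral W (e n) \<omega> ^ (2 * m))) \<partial>M)"
  proof (rule nn_integral_cong_AE)
    show "AE \<omega> in M. ennreal (I \<omega> ^ (2 * m)) = liminf (\<lambda>n. ennreal (simple_walsh_integral W (e n) \<omega> ^ (2 * m)))"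
      using ae
    proof eventually_elim
      case (elim \<omega>)
      then have "(\<lambda>n. ennreal (simple_walsh_integral W (e n) \<omega> ^ (2 * m))) \<longlonglongrightarrow> ennreal (I \<omega> ^ (2 * m))" by (intro tendsto_intros)
      then show ?case by (rule lim_imp_Liminf[OF trivial_limit_sequentially, symmetric])
    qed
  qed
  also have "\<dots> \<le> liminf (\<lambda>n. \<integral>\<^sup>+\<omega>. ennreal (simple_walsh_integral W (e n) \<omega> ^ (2 * m)) \<partial>M)"
    by (rule nn_integral_liminf) measurable
  also have "\<dots> \<le> liminf (\<lambda>n. ennreal (((2 * real m - 1) * (4 * H + \<epsilon> n)) ^ m))"
    by (intro Liminf_mono always_eventually allI e(3))
  also have "\<dots> = ennreal (((2 * real m - 1) * (4 * H)) ^ m)"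
  proof (rule lim_imp_Liminf[OF trivial_limit_sequentially])
    have "\<epsilon> \<longlonglongrightarrow> 0 / 64" unfolding \<epsilon>_def[abs_def] by (intro tendsto_intros LIMSEQ_power_zero) auto
    then have "(\<lambda>n. ((2 * real m - 1) * (4 * H + \<epsilon> n)) ^ m) \<longlonglongrightarrow> ((2 * real m - 1) * (4 * H + 0 / 64)) ^ m" by (intro tendsto_intros)
    then show "(\<lambda>n. ennreal (((2 * real m - 1) * (4 * H + \<epsilon> n)) ^ m)) \<longlonglongrightarrow> ennreal (((2 * real m - 1) * (4 * H)) ^ m)"
      by (intro tendsto_ennrealI) simp
  qed
  finally show ?thesis .
qed

end


section \<open>Square integrability and continuity of the kernel\<close>

lemma nn_integral_powr:
  assumes "a > -1" "0 \<le> t"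
  shows "(\<integral>\<^sup>+\<tau>. ennreal (\<tau> powr a) * indicator {0..t} \<tau> \<partial>lborel) = ennreal (t powr (a + 1) / (a + 1))"
  using assms by (intro nn_integral_has_integral_lebesgue' has_integral_powr_from_0) auto

lemma nn_integral_reflect:
  assumes [measurable]: "\<phi> \<in> borel_measurable borel"
  shows "(\<integral>\<^sup>+s. \<phi> (t - s) * indicator {0..t} s \<partial>lborel) = (\<integral>\<^sup>+\<tau>. \<phi> \<tau> * indicator {0..t::real} \<tau> \<partial>lborel)"
proof -
  have "(\<integral>\<^sup>+\<tau>. \<phi> \<tau> * indicator {0..t::real} \<tau> \<partial>lborel) = ennreal \<bar>-1\<bar> * (\<integral>\<^sup>+s. \<phi> (t + (-1) * s) * indicator {0..t} (t + (-1) * s) \<partial>lborel)"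
    by (rule nn_integral_real_affine) auto
  also have "\<dots> = (\<integral>\<^sup>+s. \<phi> (t - s) * indicator {0..t} s \<partial>lborel)"
    by (simp, intro nn_integral_cong) (auto split: split_indicator)
  finally show ?thesis ..
qed

lemma nn_integral_gauss:
  assumes k: "0 < k" and \<tau>: "0 < \<tau>"
  shows "(\<integral>\<^sup>+y. ennreal (exp (- (k * (x - y)\<^sup>2 / \<tau>))) \<partial>lborel) = ennreal (sqrt (pi / k) * sqrt \<tau>)"
proof -
  define \<sigma> where "\<sigma> = sqrt (\<tau> / (2 * k))"
  have \<sigma>: "\<sigma> > 0" "2 * \<sigma>\<^sup>2 = \<tau> / k" using k \<tau> by (auto simp: \<sigma>_def)
  have e: "exp (- (k * (x - y)\<^sup>2 / \<tau>)) = sqrt (pi * (\<tau> / k)) * normal_density x \<sigma> y" for y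
  proof -
    have "2 * pi * \<sigma>\<^sup>2 = pi * (2 * \<sigma>\<^sup>2)" by simp
    then have "2 * pi * \<sigma>\<^sup>2 = pi * (\<tau> / k)" unfolding \<sigma>(2) .
    moreover have "(y - x)\<^sup>2 / (2 * \<sigma>\<^sup>2) = k * (x - y)\<^sup>2 / \<tau>"
      unfolding \<sigma>(2) using k \<tau> by (simp add: power2_commute)
    ultimately show ?thesis using k \<tau> unfolding normal_density_def by simp
  qed
  have "(\<integral>\<^sup>+y. ennreal (exp (- (k * (x - y)\<^sup>2 / \<tau>))) \<partial>lborel) = (\<integral>\<^sup>+y. ennreal (sqrt (pi * (\<tau> / k))) * ennreal (normal_density x \<sigma> y) \<partial>lborel)"
    using k \<tau> unfolding e by (simp add: ennreal_mult)
  also have "\<dots> = ennreal (sqrt (pi * (\<tau> / k))) * (\<integral>\<^sup>+y. ennreal (normal_density x \<sigma> y) \<partial>lborel)"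
    by (rule nn_integral_cmult) auto
  also have "(\<integral>\<^sup>+y. ennreal (normal_density x \<sigma> y) \<partial>lborel) = 1"
    using \<sigma>(1) by (subst nn_integral_eq_integral) auto
  finally show ?thesis by (simp add: real_sqrt_mult real_sqrt_divide)
qed

section \<open>A Gaussian majorant of the squared kernel\<close>

text \<open>The singular factor is 1 / (t - s), since the kernel is to be dominated in square.
  Integration over space returns a factor of order (t - s)^(1/2) and leaves an integrable
  singularity in time.\<close>

definition gauss_dom :: "real \<Rightarrow> real \<Rightarrow> real \<Rightarrow> real \<Rightarrow> real \<Rightarrow> real \<Rightarrow> real" where
  "gauss_dom C k t x s y = (if s < t then C / (t - s) * exp (- (k * (x - y)\<^sup>2 / (t - s))) else 0)"

lemma gauss_dom_nonneg: "0 \<le> C \<Longrightarrow> 0 \<le> gauss_dom C k t x s y"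
  by (simp add: gauss_dom_def)

lemma gauss_dom_measurable: "(\<lambda>(s, y). gauss_dom C k t x s y) \<in> borel_measurable (borel \<Otimes>\<^sub>M borel)"
  unfolding gauss_dom_def split_beta by measurable

lemma gauss_dom_integral:
  assumes C: "0 \<le> C" and k: "0 < k" and s: "s \<le> t"
  shows "(\<integral>\<^sup>+y. ennreal (gauss_dom C k t x s y) \<partial>lborel) = ennreal (C * sqrt (pi / k) * (t - s) powr (-1/2))"
proof (cases "s = t")
  \<comment> \<open>At \<open>s = t\<close> both sides are 0, by the convention for a power with
    base 0.\<close>
  case True then show ?thesis by (simp add: gauss_dom_def)
next
  case False
  then have \<tau>: "0 < t - s" using s by simp
  have "(\<integral>\<^sup>+y. ennreal (gauss_dom C k t x s y) \<partial>lborel) = (\<integral>\<^sup>+y. ennreal (C / (t - s)) * ennreal (exp (- (k * (x - y)\<^sup>2 / (t - s)))) \<partial>lborel)"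
    using C \<tau> by (intro nn_integral_cong) (simp add: gauss_dom_def ennreal_mult[symmetric])
  also have "\<dots> = ennreal (C / (t - s)) * ennreal (sqrt (pi / k) * sqrt (t - s))"
    by (subst nn_integral_cmult) (auto simp: nn_integral_gauss[OF k \<tau>])
  also have "\<dots> = ennreal (C / (t - s) * (sqrt (pi / k) * sqrt (t - s)))"
    using C \<tau> k by (intro ennreal_mult[symmetric]) auto
  also have "C / (t - s) * (sqrt (pi / k) * sqrt (t - s)) = C * sqrt (pi / k) * (t - s) powr (-1/2)"
  proof -
    have "sqrt (t - s) / (t - s) = (t - s) powr (-1/2)"
      using \<tau> by (simp add: powr_minus powr_half_sqrt real_div_sqrt field_simps)
    moreover have "C / (t - s) * (sqrt (pi / k) * sqrt (t - s)) = C * sqrt (pi / k) * (sqrt (t - s) / (t - s))" by simp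
    ultimately show ?thesis by (simp only:)
  qed
  finally show ?thesis .
qed

lemma strip_lborel_measurable:
  assumes "(\<lambda>(s, y). g s y) \<in> borel_measurable (borel \<Otimes>\<^sub>M borel)"
  shows "(\<lambda>x. g (fst x) (snd x)) \<in> borel_measurable (strip t)"
proof -
  have "(\<lambda>s. s) \<in> measurable (restrict_space lborel {0..t}) borel"
    by (rule measurable_restrict_space1) simp
  then have "(\<lambda>x. (fst x, snd x)) \<in> measurable (strip t) (borel \<Otimes>\<^sub>M borel)"
    unfolding strip_def by (intro measurable_Pair measurable_compose[OF measurable_fst]) auto
  from measurable_compose[OF this assms] show ?thesis by (simp add: split_beta)
qed

text \<open>The exact value matters, and not only its finiteness: it is continuous in
  \<open>t\<close> and free of \<open>x\<close>, which is the convergence of the integrals of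
  majorants that Pratt's argument asks for.\<close>

lemma gauss_dom_strip_integral:
  assumes C: "0 \<le> C" and k: "0 < k" and t: "0 \<le> t" "t \<le> T"
  shows "(\<integral>\<^sup>+p. ennreal (gauss_dom C k t x (fst p) (snd p)) \<partial>strip T) = ennreal (C * sqrt (pi / k) * (2 * sqrt t))"
proof -
  have m: "(\<lambda>p. ennreal (gauss_dom C k t x (fst p) (snd p))) \<in> borel_measurable (strip T)"
    using strip_lborel_measurable[OF gauss_dom_measurable] by measurable
  have "(\<integral>\<^sup>+p. ennreal (gauss_dom C k t x (fst p) (snd p)) \<partial>strip T) =
    (\<integral>\<^sup>+s. ennreal (C * sqrt (pi / k)) * (ennreal ((t - s) powr (-1/2)) * indicator {0..t} s) \<partial>lborel)"
    unfolding nn_integral_strip[OF m]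
  proof (rule nn_integral_cong)
    fix s
    show "(\<integral>\<^sup>+y. ennreal (gauss_dom C k t x (fst (s, y)) (snd (s, y))) \<partial>lborel) * indicator {0..T} s =
      ennreal (C * sqrt (pi / k)) * (ennreal ((t - s) powr (-1/2)) * indicator {0..t} s)"
    proof (cases "s \<le> t")
      case True
      then show ?thesis using gauss_dom_integral[OF C k True, of x] C t k
        by (auto simp: ennreal_mult split: split_indicator)
    qed (auto simp: gauss_dom_def)
  qed
  also have "\<dots> = ennreal (C * sqrt (pi / k)) * (\<integral>\<^sup>+s. ennreal ((t - s) powr (-1/2)) * indicator {0..t} s \<partial>lborel)"
    by (rule nn_integral_cmult) auto
  also have "(\<integral>\<^sup>+s. ennreal ((t - s) powr (-1/2)) * indicator {0..t} s \<partial>lborel) = ennreal (t powr (-1/2 + 1) / (-1/2 + 1))"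
    by (subst nn_integral_reflect[of "\<lambda>\<tau>. ennreal (\<tau> powr (-1/2))"], simp, rule nn_integral_powr) (use t in auto)
  also have "t powr (-1/2 + 1) / (-1/2 + 1) = 2 * sqrt t" using t by (simp add: powr_half_sqrt)
  finally show ?thesis using C k t by (simp add: ennreal_mult)
qed

lemma exp_neg_le_powr:
  assumes "0 < z" shows "exp (- z) \<le> z powr (-1/4 :: real)"
proof -
  have "z powr (1/4) \<le> exp z"
  proof (cases "z \<le> 1")
    case True
    then have "z powr (1/4) \<le> 1 powr (1/4)" using assms by (intro powr_mono2) auto
    also have "\<dots> \<le> exp z" using assms by simp
    finally show ?thesis .
  next
    case False
    then have "z powr (1/4) \<le> z powr 1" by (intro powr_mono) auto
    also have "z powr 1 = z" using assms by simp
    also have "z \<le> exp z" using exp_ge_add_one_self[of z] by linarith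
    finally show ?thesis .
  qed
  then have "1 / exp z \<le> 1 / z powr (1/4)" using assms by (intro divide_left_mono) auto
  then show ?thesis by (simp add: exp_minus powr_minus inverse_eq_divide)
qed

text \<open>
  The weight \<open>exp (\<lambda> s)\<close> makes the Picard map a contraction; \<open>exp (- z) \<le> z powr (- 1/4)\<close> keeps the
  singularity \<open>(t - s) powr (- 1/2)\<close> integrable while gaining a negative power of \<open>\<lambda>\<close>.
\<close>

lemma gauss_dom_weighted:
  assumes C: "0 \<le> C" and k: "0 < k" and T: "0 < T" and \<delta>: "0 < \<delta>"
  shows "\<exists>l>0. \<forall>t\<in>{0..T}. \<forall>x. (\<integral>\<^sup>+p. ennreal (exp (l * fst p) * gauss_dom C k t x (fst p) (snd p)) \<partial>strip t) \<le> ennreal (\<delta> * exp (l * t))"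
proof -
  \<comment> \<open>\<open>4 * T powr (1/4)\<close> is the integral of the power -3/4 over [0, T].
    With the following choice of \<open>l\<close> the product of \<open>A\<close> and
    \<open>l powr (-1/4)\<close> does not exceed \<open>\<delta>\<close>.\<close>
  define A where "A = C * sqrt (pi / k) * (4 * T powr (1/4))"
  have A: "0 \<le> A" using C k by (auto simp: A_def)
  define l where "l = (A / \<delta> + 1) ^ 4"
  have b: "A / \<delta> + 1 > 0" using A \<delta> by (intro add_nonneg_pos) auto
  have l: "l > 0" using b by (simp add: l_def)
  have l4: "l powr (-1/4) = 1 / (A / \<delta> + 1)"
  proof -
    have "l = (A / \<delta> + 1) powr real 4" by (simp only: l_def powr_realpow[OF b])
    then have "l powr (1/4) = (A / \<delta> + 1) powr (real 4 * (1/4))" by (simp only: powr_powr)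
    then have "l powr (1/4) = A / \<delta> + 1" using b by simp
    then show ?thesis by (simp add: powr_minus inverse_eq_divide)
  qed
  have "A \<le> \<delta> * (A / \<delta> + 1)" using \<delta> by (simp add: distrib_left)
  then have "A / (A / \<delta> + 1) \<le> \<delta>" using b by (simp only: pos_divide_le_eq)
  then have Al: "A * l powr (-1/4) \<le> \<delta>" unfolding l4 by simp
  show ?thesis
  proof (intro exI[of _ l] conjI ballI allI)
    fix t x assume t: "t \<in> {0..T}"
    have m: "(\<lambda>p. ennreal (exp (l * fst p) * gauss_dom C k t x (fst p) (snd p))) \<in> borel_measurable (strip t)"
    proof -
      have "(\<lambda>(s, y). exp (l * s)) \<in> borel_measurable (borel \<Otimes>\<^sub>M (borel :: real measure))" by measurable
      from borel_measurable_times[OF strip_lborel_measurable[OF this] strip_lborel_measurable[OF gauss_dom_measurable]]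
      show ?thesis by (rule measurable_compose[OF _ measurable_ennreal])
    qed
    let ?K = "exp (l * t) * (C * sqrt (pi / k) * l powr (-1/4))"
    have "(\<integral>\<^sup>+p. ennreal (exp (l * fst p) * gauss_dom C k t x (fst p) (snd p)) \<partial>strip t) \<le>
      (\<integral>\<^sup>+s. ennreal ?K * (ennreal ((t - s) powr (-3/4)) * indicator {0..t} s) \<partial>lborel)"
      unfolding nn_integral_strip[OF m]
    proof (rule nn_integral_mono)
      fix s
      show "(\<integral>\<^sup>+y. ennreal (exp (l * fst (s, y)) * gauss_dom C k t x (fst (s, y)) (snd (s, y))) \<partial>lborel) * indicator {0..t} s \<le>
        ennreal ?K * (ennreal ((t - s) powr (-3/4)) * indicator {0..t} s)"
      proof (cases "s \<in> {0..t}")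
        case True
        have gm: "(\<lambda>y. ennreal (gauss_dom C k t x s y)) \<in> borel_measurable lborel" unfolding gauss_dom_def by measurable
        have "(\<integral>\<^sup>+y. ennreal (exp (l * s) * gauss_dom C k t x s y) \<partial>lborel) = ennreal (exp (l * s)) * (\<integral>\<^sup>+y. ennreal (gauss_dom C k t x s y) \<partial>lborel)"
          using C gm by (subst nn_integral_cmult[symmetric]) (auto simp: ennreal_mult gauss_dom_nonneg)
        also have "\<dots> = ennreal (exp (l * s) * (C * sqrt (pi / k) * (t - s) powr (-1/2)))"
          using True C k by (subst gauss_dom_integral) (auto simp: ennreal_mult)
        also have "\<dots> \<le> ennreal (?K * (t - s) powr (-3/4))"
        proof (rule ennreal_leI, cases "s = t")
          case True then show "exp (l * s) * (C * sqrt (pi / k) * (t - s) powr (-1/2)) \<le> ?K * (t - s) powr (-3/4)" by simp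
        next
          case False
          then have \<tau>: "0 < t - s" using \<open>s \<in> {0..t}\<close> by auto
          have "exp (l * s) = exp (l * t) * exp (- (l * (t - s)))" by (simp add: exp_add[symmetric] algebra_simps)
          also have "\<dots> \<le> exp (l * t) * (l * (t - s)) powr (-1/4)" using l \<tau> by (intro mult_left_mono exp_neg_le_powr) auto
          also have "\<dots> = exp (l * t) * (l powr (-1/4) * (t - s) powr (-1/4))" using l \<tau> by (simp add: powr_mult)
          finally have "exp (l * s) * (C * sqrt (pi / k) * (t - s) powr (-1/2)) \<le>
            exp (l * t) * (l powr (-1/4) * (t - s) powr (-1/4)) * (C * sqrt (pi / k) * (t - s) powr (-1/2))"
            using C k by (intro mult_right_mono) auto
          also have "\<dots> = ?K * ((t - s) powr (-1/4) * (t - s) powr (-1/2))" by (simp add: mult_ac)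
          also have "(t - s) powr (-1/4) * (t - s) powr (-1/2) = (t - s) powr (-3/4)" by (simp add: powr_add[symmetric])
          finally show "exp (l * s) * (C * sqrt (pi / k) * (t - s) powr (-1/2)) \<le> ?K * (t - s) powr (-3/4)" .
        qed
        also have "\<dots> = ennreal ?K * ennreal ((t - s) powr (-3/4))" using C k by (intro ennreal_mult) auto
        finally show ?thesis using True by simp
      qed simp
    qed
    also have "\<dots> = ennreal ?K * (\<integral>\<^sup>+s. ennreal ((t - s) powr (-3/4)) * indicator {0..t} s \<partial>lborel)"
      by (rule nn_integral_cmult) auto
    also have "(\<integral>\<^sup>+s. ennreal ((t - s) powr (-3/4)) * indicator {0..t} s \<partial>lborel) = ennreal (t powr (-3/4 + 1) / (-3/4 + 1))"
      by (subst nn_integral_reflect[of "\<lambda>\<tau>. ennreal (\<tau> powr (-3/4))"], simp, rule nn_integral_powr) (use t in auto)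
    also have "ennreal ?K * ennreal (t powr (-3/4 + 1) / (-3/4 + 1)) = ennreal (?K * (4 * t powr (1/4)))"
      using C k by (subst ennreal_mult[symmetric]) (auto simp: mult_ac)
    also have "\<dots> \<le> ennreal (?K * (4 * T powr (1/4)))"
      using C k t by (intro ennreal_leI mult_left_mono powr_mono2) auto
    also have "\<dots> = ennreal (exp (l * t) * (A * l powr (-1/4)))" by (simp add: A_def mult_ac)
    also have "\<dots> \<le> ennreal (exp (l * t) * \<delta>)" by (intro ennreal_leI mult_left_mono Al) simp
    finally show "(\<integral>\<^sup>+p. ennreal (exp (l * fst p) * gauss_dom C k t x (fst p) (snd p)) \<partial>strip t) \<le> ennreal (\<delta> * exp (l * t))"
      by (simp add: mult.commute)
  qed (rule l)
qed

text \<open>Pratt's generalised dominated convergence, for square integrals.\<close>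

lemma nsq_pratt:
  assumes [measurable]: "\<And>n. g n \<in> borel_measurable N" "g' \<in> borel_measurable N" "\<And>n. D n \<in> borel_measurable N" "D' \<in> borel_measurable N"
    and gD: "\<And>n x. (g n x)\<^sup>2 \<le> D n x" "\<And>x. (g' x)\<^sup>2 \<le> D' x"
    and lim: "AE x in N. (\<lambda>n. g n x) \<longlonglongrightarrow> g' x" "AE x in N. (\<lambda>n. D n x) \<longlonglongrightarrow> D' x"
    and I: "\<And>n. (\<integral>\<^sup>+x. ennreal (D n x) \<partial>N) = ennreal (b n)" "\<And>n. 0 \<le> b n" "(\<integral>\<^sup>+x. ennreal (D' x) \<partial>N) = ennreal b'" "0 \<le> b'"
    and bl: "b \<longlonglongrightarrow> b'"
  shows "(\<lambda>n. nsq N (\<lambda>x. g n x - g' x)) \<longlonglongrightarrow> 0"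
proof (rule ennreal_tendsto_0I)
  fix e :: real assume e: "e > 0"
  have D0: "0 \<le> D n x \<and> 0 \<le> D' x" for n x
    using gD(1)[of n x] gD(2)[of x] zero_le_power2[of "g n x"] zero_le_power2[of "g' x"] by linarith
  have sq: "(g n x - g' x)\<^sup>2 \<le> 2 * D n x + 2 * D' x" for n x
  proof -
    have "(g n x - g' x)\<^sup>2 \<le> 2 * (g n x)\<^sup>2 + 2 * (g' x)\<^sup>2"
      using sum_squares_bound[of "g n x" "- g' x"] by (simp add: power2_diff)
    then show ?thesis using gD(1)[of n x] gD(2)[of x] by linarith
  qed
  \<comment> \<open>The nonnegative functions to which Fatou's lemma is applied.\<close>
  let ?h = "\<lambda>n x. ennreal (2 * D n x + 2 * D' x - (g n x - g' x)\<^sup>2)"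
  have sum: "(\<integral>\<^sup>+x. ?h n x \<partial>N) + nsq N (\<lambda>x. g n x - g' x) = ennreal (2 * b n + 2 * b')" for n
  proof -
    have "(\<integral>\<^sup>+x. ?h n x \<partial>N) + nsq N (\<lambda>x. g n x - g' x) = (\<integral>\<^sup>+x. ?h n x + ennreal ((g n x - g' x)\<^sup>2) \<partial>N)"
      unfolding nsq_def by (rule nn_integral_add[symmetric]) measurable
    also have "\<dots> = (\<integral>\<^sup>+x. 2 * ennreal (D n x) + 2 * ennreal (D' x) \<partial>N)"
    proof (rule nn_integral_cong)
      fix x
      have "?h n x + ennreal ((g n x - g' x)\<^sup>2) = ennreal (2 * D n x + 2 * D' x - (g n x - g' x)\<^sup>2 + (g n x - g' x)\<^sup>2)"
        using sq[of n x] by (intro ennreal_plus[symmetric]) auto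
      also have "\<dots> = 2 * ennreal (D n x) + 2 * ennreal (D' x)" using D0[of n x] by (simp add: ennreal_mult)
      finally show "?h n x + ennreal ((g n x - g' x)\<^sup>2) = 2 * ennreal (D n x) + 2 * ennreal (D' x)" .
    qed
    also have "\<dots> = 2 * ennreal (b n) + 2 * ennreal b'" by (simp add: nn_integral_add nn_integral_cmult I)
    also have "\<dots> = ennreal (2 * b n + 2 * b')" using I by (simp add: ennreal_mult)
    finally show ?thesis .
  qed
  have "ennreal (4 * b') = (\<integral>\<^sup>+x. 4 * ennreal (D' x) \<partial>N)" using I by (simp add: nn_integral_cmult ennreal_mult)
  also have "\<dots> = (\<integral>\<^sup>+x. liminf (\<lambda>n. ?h n x) \<partial>N)"
  proof (rule nn_integral_cong_AE)
    show "AE x in N. 4 * ennreal (D' x) = liminf (\<lambda>n. ?h n x)"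
      using lim
    proof eventually_elim
      case (elim x)
      have "(\<lambda>n. 2 * D n x + 2 * D' x - (g n x - g' x)\<^sup>2) \<longlonglongrightarrow> 2 * D' x + 2 * D' x - (g' x - g' x)\<^sup>2"
        by (intro tendsto_intros elim)
      then have "(\<lambda>n. ?h n x) \<longlonglongrightarrow> ennreal (4 * D' x)" by (intro tendsto_ennrealI) simp
      from lim_imp_Liminf[OF trivial_limit_sequentially this] show ?case using D0[of 0 x] by (simp add: ennreal_mult)
    qed
  qed
  also have "\<dots> \<le> liminf (\<lambda>n. \<integral>\<^sup>+x. ?h n x \<partial>N)" by (rule nn_integral_liminf) measurable
  finally have F: "ennreal (4 * b') \<le> liminf (\<lambda>n. \<integral>\<^sup>+x. ?h n x \<partial>N)" .
  \<comment> \<open>Together with \<open>ev2\<close> this leaves for the squared norm less than 2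
    (b' + e/4) + 2 b' - (4 b' - e/2) = e.\<close>
  have ev1: "\<forall>\<^sub>F n in sequentially. ennreal (4 * b' - e / 2) \<le> (\<integral>\<^sup>+x. ?h n x \<partial>N)"
  proof (cases "4 * b' - e / 2 \<le> 0")
    case True then show ?thesis by (simp add: ennreal_neg)
  next
    case False
    then have "ennreal (4 * b' - e / 2) < ennreal (4 * b')" using e by (simp add: ennreal_less_iff)
    then have "ennreal (4 * b' - e / 2) < liminf (\<lambda>n. \<integral>\<^sup>+x. ?h n x \<partial>N)" using F by (rule less_le_trans)
    from less_LiminfD[OF this] show ?thesis by (rule eventually_mono) simp
  qed
  have ev2: "\<forall>\<^sub>F n in sequentially. b n < b' + e / 4" by (rule order_tendstoD(2)[OF bl]) (use e in simp)
  show "\<forall>\<^sub>F n in sequentially. nsq N (\<lambda>x. g n x - g' x) \<le> ennreal e"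
    using ev1 ev2
  proof eventually_elim
    case (elim n)
    have "nsq N (\<lambda>x. g n x - g' x) \<le> ennreal (2 * b n + 2 * b')" unfolding sum[of n, symmetric] by simp
    then obtain r where r: "nsq N (\<lambda>x. g n x - g' x) = ennreal r" "0 \<le> r" by (cases "nsq N (\<lambda>x. g n x - g' x)") (auto simp: top_unique)
    have "ennreal (max 0 (4 * b' - e / 2)) + ennreal r \<le> ennreal (2 * b n + 2 * b')"
      unfolding sum[of n, symmetric] r(1)[symmetric] using elim(1) by (intro add_right_mono) (simp add: max_def ennreal_neg)
    then have "ennreal (max 0 (4 * b' - e / 2) + r) \<le> ennreal (2 * b n + 2 * b')" using r(2) by simp
    then have "max 0 (4 * b' - e / 2) + r \<le> 2 * b n + 2 * b'" using I(2)[of n] I(4) by (subst (asm) ennreal_le_iff) auto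
    then have "r \<le> e" using elim(2) by linarith
    then show ?case using r by (simp add: ennreal_leI)
  qed
qed

section \<open>The fundamental solution\<close>

locale skew_kernel =
  fixes a1 a2 r1 r2 :: real
  assumes pos: "a1 > 0" "a2 > 0" "r1 > 0" "r2 > 0"
begin

abbreviation "G \<equiv> fund_sol a1 a2 r1 r2"

text \<open>The square of the smaller slope of \<open>scale_fun\<close>. The 2 in the denominators
  of the exponents of \<open>G\<close> disappears on squaring.\<close>

definition kernel_rate :: real where
  "kernel_rate = 1 / max a1 a2"

text \<open>The squared prefactor: the larger of the two jump values times the bound
  \<open>1 + \<bar>\<beta>\<bar>\<close> for the coefficients of the direct and the reflected term,
  with \<open>\<beta>\<close> standing for \<open>skew_beta\<close>.\<close>

definition kernel_const :: real where
  "kernel_const = (max (1 / sqrt a1) (1 / sqrt a2) * (1 + \<bar>skew_beta a1 a2 r1 r2\<bar>))\<^sup>2 / (2 * pi)"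

lemma kernel_rate_pos: "0 < kernel_rate" using pos by (simp add: kernel_rate_def)

lemma kernel_const_nonneg: "0 \<le> kernel_const" by (simp add: kernel_const_def)

text \<open>\<open>scale_fun\<close> is piecewise linear and increasing with both slopes at least
  \<open>c\<close>; an interval across the origin is split there.\<close>

lemma scale_fun_expands: "kernel_rate * (x - y)\<^sup>2 \<le> (scale_fun a1 a2 x - scale_fun a1 a2 y)\<^sup>2"
proof -
  define c where "c = 1 / sqrt (max a1 a2)"
  have c: "c \<le> 1 / sqrt a1" "c \<le> 1 / sqrt a2" "0 \<le> c" using pos by (auto simp: c_def intro!: divide_left_mono)
  have *: "c * (v - u) \<le> scale_fun a1 a2 v - scale_fun a1 a2 u" if "u \<le> v" for u v
  proof -
    have s: "scale_fun a1 a2 z = (if z \<le> 0 then 1 / sqrt a1 else 1 / sqrt a2) * z" for z by (simp add: scale_fun_def)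
    consider "v \<le> 0" | "u \<le> 0" "0 < v" | "0 < u" by linarith
    then show ?thesis
    proof cases
      case 1
      then show ?thesis using that mult_right_mono[OF c(1), of "v - u"] by (simp add: s algebra_simps diff_divide_distrib)
    next
      case 2
      have "c * v \<le> 1 / sqrt a2 * v" using 2 c by (intro mult_right_mono) auto
      moreover have "c * (- u) \<le> 1 / sqrt a1 * (- u)" using 2 c by (intro mult_right_mono) auto
      ultimately show ?thesis using 2 by (simp add: s algebra_simps)
    next
      case 3
      then show ?thesis using that mult_right_mono[OF c(2), of "v - u"] by (simp add: s algebra_simps diff_divide_distrib)
    qed
  qed
  have "\<bar>c * (x - y)\<bar> \<le> \<bar>scale_fun a1 a2 x - scale_fun a1 a2 y\<bar>"
  proof (cases "y \<le> x")
    case True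
    then have "0 \<le> c * (x - y)" using c by simp
    then show ?thesis using *[OF True] by linarith
  next
    case False
    then have "0 \<le> c * (y - x)" using c by simp
    then show ?thesis using *[of x y] False by (simp add: right_diff_distrib)
  qed
  then have "(c * (x - y))\<^sup>2 \<le> (scale_fun a1 a2 x - scale_fun a1 a2 y)\<^sup>2" by (simp only: abs_le_square_iff)
  moreover have "c\<^sup>2 = kernel_rate" using pos by (simp add: c_def kernel_rate_def power_divide)
  ultimately show ?thesis by (simp add: power_mult_distrib)
qed

text \<open>The reflected exponential is at most the direct one, because |f(x) - f(y)| \<le> |f(x)|
  + |f(y)| for the scale function f. No sign of the skewness coefficient is involved.\<close>

lemma kernel_square_le: "(G (t - s) x y)\<^sup>2 \<le> gauss_dom kernel_const kernel_rate t x s y"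
proof (cases "s < t")
  case True
  define \<tau> where "\<tau> = t - s"
  have \<tau>: "0 < \<tau>" using True by (simp add: \<tau>_def)
  define L where "L = max (1 / sqrt a1) (1 / sqrt a2)"
  define be where "be = skew_beta a1 a2 r1 r2"
  define d where "d = scale_fun a1 a2 x - scale_fun a1 a2 y"
  define d' where "d' = \<bar>scale_fun a1 a2 x\<bar> + \<bar>scale_fun a1 a2 y\<bar>"
  define E where "E = exp (- (d\<^sup>2 / (2 * \<tau>)))"
  have L: "0 \<le> L" using pos by (simp add: L_def le_max_iff_disj)
  have "\<bar>d\<bar> \<le> \<bar>d'\<bar>" unfolding d_def d'_def by linarith
  then have "d\<^sup>2 \<le> d'\<^sup>2" by (simp only: abs_le_square_iff)
  then have E': "exp (- (d'\<^sup>2 / (2 * \<tau>))) \<le> E" unfolding E_def using \<tau> by (simp add: divide_right_mono)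
  have "\<bar>be * sgn y * exp (- (d'\<^sup>2 / (2 * \<tau>)))\<bar> = \<bar>be\<bar> * (\<bar>sgn y\<bar> * exp (- (d'\<^sup>2 / (2 * \<tau>))))" by (simp add: abs_mult)
  also have "\<dots> \<le> \<bar>be\<bar> * (1 * E)" by (intro mult_left_mono mult_mono E') (auto simp: sgn_if)
  finally have s2: "\<bar>E + be * sgn y * exp (- (d'\<^sup>2 / (2 * \<tau>)))\<bar> \<le> (1 + \<bar>be\<bar>) * E"
    using abs_triangle_ineq[of E "be * sgn y * exp (- (d'\<^sup>2 / (2 * \<tau>)))"] by (simp add: E_def distrib_right)
  have Gf: "G \<tau> x y = 1 / sqrt (2 * pi * \<tau>) * (if y \<le> 0 then 1 / sqrt a1 else 1 / sqrt a2) * (E + be * sgn y * exp (- (d'\<^sup>2 / (2 * \<tau>))))"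
    using \<tau> by (simp add: fund_sol_def E_def be_def d_def d'_def)
  have "\<bar>G \<tau> x y\<bar> = 1 / sqrt (2 * pi * \<tau>) * (if y \<le> 0 then 1 / sqrt a1 else 1 / sqrt a2) * \<bar>E + be * sgn y * exp (- (d'\<^sup>2 / (2 * \<tau>)))\<bar>"
    unfolding Gf abs_mult using \<tau> pos by simp
  also have "\<dots> \<le> 1 / sqrt (2 * pi * \<tau>) * L * ((1 + \<bar>be\<bar>) * E)"
    using \<tau> pos L by (intro mult_mono mult_left_mono s2) (auto simp: L_def)
  finally have "\<bar>G \<tau> x y\<bar> \<le> \<bar>1 / sqrt (2 * pi * \<tau>) * L * ((1 + \<bar>be\<bar>) * E)\<bar>" by linarith
  then have "(G \<tau> x y)\<^sup>2 \<le> (1 / sqrt (2 * pi * \<tau>) * L * ((1 + \<bar>be\<bar>) * E))\<^sup>2" by (simp only: abs_le_square_iff)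
  also have "\<dots> = (L * (1 + \<bar>be\<bar>))\<^sup>2 / (2 * pi) / \<tau> * E\<^sup>2"
    using \<tau> by (simp add: power_mult_distrib power_divide mult_ac)
  also have "\<dots> = kernel_const / \<tau> * E\<^sup>2" by (simp add: kernel_const_def L_def be_def)
  also have "E\<^sup>2 = exp (- (d\<^sup>2 / \<tau>))" unfolding E_def power2_eq_square exp_add[symmetric] using \<tau> by (simp add: field_simps)
  also have "kernel_const / \<tau> * exp (- (d\<^sup>2 / \<tau>)) \<le> kernel_const / \<tau> * exp (- (kernel_rate * (x - y)\<^sup>2 / \<tau>))"
    using \<tau> kernel_const_nonneg scale_fun_expands[of x y] by (intro mult_left_mono) (auto simp: d_def divide_right_mono)
  finally show ?thesis using True by (simp add: gauss_dom_def \<tau>_def)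
qed (simp add: fund_sol_def gauss_dom_def)

lemma kernel_measurable: "(\<lambda>(s, y). G (t - s) x y) \<in> borel_measurable (borel \<Otimes>\<^sub>M borel)"
  unfolding fund_sol_def scale_fun_def split_beta by measurable

lemma kernel_strip_measurable: "(\<lambda>p. G (t - fst p) x (snd p)) \<in> borel_measurable (strip T)"
  by (rule strip_lborel_measurable[OF kernel_measurable])

lemma kernel_weighted:
  assumes "0 < T" "0 < \<delta>"
  shows "\<exists>l>0. \<forall>t\<in>{0..T}. \<forall>x. (\<integral>\<^sup>+p. ennreal (exp (l * fst p) * (G (t - fst p) x (snd p))\<^sup>2) \<partial>strip t) \<le> ennreal (\<delta> * exp (l * t))"
proof -
  obtain l where l: "l > 0" "\<And>t x. t \<in> {0..T} \<Longrightarrow> (\<integral>\<^sup>+p. ennreal (exp (l * fst p) * gauss_dom kernel_const kernel_rate t x (fst p) (snd p)) \<partial>strip t) \<le> ennreal (\<delta> * exp (l * t))"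
    using gauss_dom_weighted[OF kernel_const_nonneg kernel_rate_pos assms] by blast
  show ?thesis
  proof (intro exI[of _ l] conjI ballI allI l(1))
    fix t x assume t: "t \<in> {0..T}"
    show "(\<integral>\<^sup>+p. ennreal (exp (l * fst p) * (G (t - fst p) x (snd p))\<^sup>2) \<partial>strip t) \<le> ennreal (\<delta> * exp (l * t))"
      by (rule order_trans[OF nn_integral_mono l(2)[OF t, of x]]) (intro ennreal_leI mult_left_mono kernel_square_le exp_ge_zero)
  qed
qed

text \<open>The jumps of \<open>G\<close> are in \<open>y\<close>, which is kept fixed; in
  \<open>x\<close> it depends on the continuous \<open>scale_fun\<close> only. The singular time
  \<open>s = t\<close> has to be excluded.\<close>

lemma kernel_tendsto:
  assumes t: "tn \<longlonglongrightarrow> t" and x: "xn \<longlonglongrightarrow> x" and s: "s \<noteq> t"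
  shows "(\<lambda>n. G (tn n - s) (xn n) y) \<longlonglongrightarrow> G (t - s) x y"
proof (cases "t < s")
  case True
  have "\<forall>\<^sub>F n in sequentially. tn n < s" by (rule order_tendstoD(2)[OF t True])
  then have "\<forall>\<^sub>F n in sequentially. G (t - s) x y = G (tn n - s) (xn n) y"
    by eventually_elim (use True in \<open>simp add: fund_sol_def\<close>)
  then show ?thesis by (rule Lim_transform_eventually[OF tendsto_const])
next
  case False
  then have st: "s < t" using s by simp
  have sc: "(\<lambda>n. scale_fun a1 a2 (xn n)) \<longlonglongrightarrow> scale_fun a1 a2 x"
  proof -
    have "scale_fun a1 a2 z = min z 0 / sqrt a1 + max z 0 / sqrt a2" for z by (simp add: scale_fun_def min_def max_def)
    then have "scale_fun a1 a2 = (\<lambda>z. min z 0 / sqrt a1 + max z 0 / sqrt a2)" by (simp add: fun_eq_iff)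
    then show ?thesis by (simp only:) (intro tendsto_intros x, use pos in auto)
  qed
  let ?g = "\<lambda>\<tau> u. 1 / sqrt (2 * pi * \<tau>) * (if y \<le> 0 then 1 / sqrt a1 else 1 / sqrt a2) *
        (exp (- ((u - scale_fun a1 a2 y)\<^sup>2 / (2 * \<tau>))) +
         skew_beta a1 a2 r1 r2 * sgn y * exp (- ((\<bar>u\<bar> + \<bar>scale_fun a1 a2 y\<bar>)\<^sup>2 / (2 * \<tau>))))"
  have lim: "(\<lambda>n. ?g (tn n - s) (scale_fun a1 a2 (xn n))) \<longlonglongrightarrow> ?g (t - s) (scale_fun a1 a2 x)"
    using st by (intro tendsto_intros t sc) auto
  have "\<forall>\<^sub>F n in sequentially. s < tn n" by (rule order_tendstoD(1)[OF t st])
  then have "\<forall>\<^sub>F n in sequentially. ?g (tn n - s) (scale_fun a1 a2 (xn n)) = G (tn n - s) (xn n) y"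
    by eventually_elim (simp add: fund_sol_def)
  from Lim_transform_eventually[OF lim this] show ?thesis using st by (simp add: fund_sol_def)
qed

lemma gauss_dom_tendsto:
  assumes t: "tn \<longlonglongrightarrow> t" and x: "xn \<longlonglongrightarrow> x" and s: "s \<noteq> t"
  shows "(\<lambda>n. gauss_dom C k (tn n) (xn n) s y) \<longlonglongrightarrow> gauss_dom C k t x s y"
proof (cases "t < s")
  case True
  have "\<forall>\<^sub>F n in sequentially. tn n < s" by (rule order_tendstoD(2)[OF t True])
  then have "\<forall>\<^sub>F n in sequentially. gauss_dom C k t x s y = gauss_dom C k (tn n) (xn n) s y"
    by eventually_elim (use True in \<open>simp add: gauss_dom_def\<close>)
  then show ?thesis by (rule Lim_transform_eventually[OF tendsto_const])
next
  case False
  then have st: "s < t" using s by simp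
  have lim: "(\<lambda>n. C / (tn n - s) * exp (- (k * (xn n - y)\<^sup>2 / (tn n - s)))) \<longlonglongrightarrow> C / (t - s) * exp (- (k * (x - y)\<^sup>2 / (t - s)))"
    using st by (intro tendsto_intros t x) auto
  have "\<forall>\<^sub>F n in sequentially. s < tn n" by (rule order_tendstoD(1)[OF t st])
  then have "\<forall>\<^sub>F n in sequentially. C / (tn n - s) * exp (- (k * (xn n - y)\<^sup>2 / (tn n - s))) = gauss_dom C k (tn n) (xn n) s y"
    by eventually_elim (simp add: gauss_dom_def)
  from Lim_transform_eventually[OF lim this] show ?thesis using st by (simp add: gauss_dom_def)
qed

text \<open>The singularity at \<open>s = tn n\<close> moves with \<open>n\<close> and so does the
  majorant; hence \<open>nsq_pratt\<close>, whose requirement on the integrals is met by their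
  explicit form. The line \<open>s = t\<close>, where pointwise convergence is not claimed, is a
  null set.\<close>

lemma kernel_L2_tendsto:
  assumes t: "tn \<longlonglongrightarrow> t" and x: "xn \<longlonglongrightarrow> x" and r: "\<And>n. tn n \<in> {0..T}" "t \<in> {0..T}"
  shows "(\<lambda>n. nsq (strip T) (\<lambda>p. G (tn n - fst p) (xn n) (snd p) - G (t - fst p) x (snd p))) \<longlonglongrightarrow> 0"
proof -
  let ?D = "\<lambda>t x p. gauss_dom kernel_const kernel_rate t x (fst p) (snd p)"
  have "AE s in restrict_space lborel {0..T}. s \<noteq> t"
    using AE_lborel_singleton[of t] by (subst AE_restrict_space_iff) (auto elim: eventually_mono)
  then have ae: "AE p in strip T. fst p \<noteq> t"
  proof -
    have "{t} \<inter> {0..T} \<in> sets (restrict_space lborel {0..T})" by (auto simp: sets_restrict_space_iff)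
    then have N: "({t} \<inter> {0..T}) \<times> UNIV \<in> sets (strip T)" unfolding strip_def by (intro pair_measureI) auto
    have "emeasure (strip T) (({t} \<inter> {0..T}) \<times> UNIV) = emeasure (restrict_space lborel {0..T}) ({t} \<inter> {0..T}) * emeasure lborel (UNIV :: real set)"
      unfolding strip_def by (intro lborel.emeasure_pair_measure_Times) (auto simp: sets_restrict_space_iff)
    also have "emeasure (restrict_space lborel {0..T}) ({t} \<inter> {0..T}) = emeasure lborel ({t} \<inter> {0..T})"
      by (rule emeasure_restrict_space) auto
    also have "\<dots> = 0" using r(2) by (simp add: Int_absorb2)
    finally have "AE p in strip T. p \<notin> ({t} \<inter> {0..T}) \<times> UNIV" using N by (intro AE_not_in null_setsI) auto
    then show ?thesis using AE_space by eventually_elim (auto simp: space_strip)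
  qed
  show ?thesis
  proof (rule nsq_pratt[where D="\<lambda>n. ?D (tn n) (xn n)" and D'="?D t x"])
    show "AE p in strip T. (\<lambda>n. G (tn n - fst p) (xn n) (snd p)) \<longlonglongrightarrow> G (t - fst p) x (snd p)"
      using ae by eventually_elim (rule kernel_tendsto[OF t x])
    show "AE p in strip T. (\<lambda>n. ?D (tn n) (xn n) p) \<longlonglongrightarrow> ?D t x p"
      using ae by eventually_elim (rule gauss_dom_tendsto[OF t x])
    show "(\<integral>\<^sup>+p. ennreal (?D (tn n) (xn n) p) \<partial>strip T) = ennreal (kernel_const * sqrt (pi / kernel_rate) * (2 * sqrt (tn n)))" for n
      using r(1)[of n] by (intro gauss_dom_strip_integral kernel_const_nonneg kernel_rate_pos) auto
    show "(\<integral>\<^sup>+p. ennreal (?D t x p) \<partial>strip T) = ennreal (kernel_const * sqrt (pi / kernel_rate) * (2 * sqrt t))"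
      using r(2) by (intro gauss_dom_strip_integral kernel_const_nonneg kernel_rate_pos) auto
    show "(\<lambda>n. kernel_const * sqrt (pi / kernel_rate) * (2 * sqrt (tn n))) \<longlonglongrightarrow> kernel_const * sqrt (pi / kernel_rate) * (2 * sqrt t)"
      by (intro tendsto_intros t)
  qed (use r kernel_const_nonneg kernel_rate_pos in \<open>auto intro!: kernel_square_le kernel_strip_measurable strip_lborel_measurable[OF gauss_dom_measurable] mult_nonneg_nonneg\<close>)
qed

end


section \<open>Predictable versions\<close>

text \<open>Ceiling minus one and not floor: for positive \<open>t\<close> and \<open>m\<close> this
  is the largest multiple of 1/m strictly below \<open>t\<close>, constant on left-open intervals.
  For \<open>t \<ge> 0\<close> the \<open>max\<close> acts only at \<open>t = 0\<close>.\<close>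

definition grid_time :: "nat \<Rightarrow> real \<Rightarrow> real" where
  "grid_time m t = max 0 ((of_int \<lceil>t * real m\<rceil> - 1) / real m)"

definition grid_space :: "nat \<Rightarrow> real \<Rightarrow> real" where
  "grid_space m x = of_int \<lfloor>x * real m\<rfloor> / real m"

lemma grid_time_bounds:
  assumes "0 < m" "0 \<le> t"
  shows "0 \<le> grid_time m t" "grid_time m t \<le> t" "t - grid_time m t \<le> 1 / real m"
proof -
  have m: "0 < real m" using assms by simp
  have c: "of_int \<lceil>t * real m\<rceil> - 1 < t * real m" "t * real m \<le> of_int \<lceil>t * real m\<rceil>" by linarith+
  have "(of_int \<lceil>t * real m\<rceil> - 1) / real m \<le> t" using c(1) m by (simp add: divide_le_eq)
  moreover have "t - (of_int \<lceil>t * real m\<rceil> - 1) / real m \<le> 1 / real m"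
    using c(2) m by (simp add: field_simps)
  ultimately show "0 \<le> grid_time m t" "grid_time m t \<le> t" "t - grid_time m t \<le> 1 / real m"
    unfolding grid_time_def using assms by (auto simp: max_def)
qed

lemma grid_space_bounds: "0 < m \<Longrightarrow> \<bar>x - grid_space m x\<bar> \<le> 1 / real m"
proof -
  assume "0 < m"
  then have m: "0 < real m" by simp
  have "of_int \<lfloor>x * real m\<rfloor> \<le> x * real m" "x * real m < of_int \<lfloor>x * real m\<rfloor> + 1" by linarith+
  then have "grid_space m x \<le> x" "x \<le> grid_space m x + 1 / real m"
    unfolding grid_space_def using m by (auto simp: divide_le_eq le_divide_eq add_divide_distrib[symmetric])
  then show ?thesis by linarith
qed

context noise_space
begin

text \<open>Intersecting with [0, t] shortens a generating rectangle at its right end only, so the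
  event stays known at the left endpoint; or it leaves nothing.\<close>

lemma pred_restrict:
  assumes t: "0 \<le> t" "t \<le> T" and f: "f \<in> borel_measurable (predictable_algebra M F T)"
  shows "f \<in> borel_measurable (predictable_algebra M F t)"
proof -
  have T: "0 \<le> T" using t by simp
  have "(\<lambda>p. p) \<in> measurable (predictable_algebra M F t) (predictable_algebra M F T)"
    unfolding predictable_algebra_def[of M F T] pred_rects_def[symmetric]
  proof (rule measurable_sigma_sets[OF sets_measure_of[OF pred_rects_subset[OF T]] pred_rects_subset[OF T]])
    show "(\<lambda>p. p) \<in> space (predictable_algebra M F t) \<rightarrow> {0..T} \<times> UNIV \<times> space M"
      using t by (auto simp: space_pred[OF t(1)])
    fix Y assume "Y \<in> pred_rects T"
    then consider B A where "Y = {0} \<times> B \<times> A" "B \<in> sets borel" "A \<in> sets (F 0)"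
      | a b B A where "Y = {a<..b} \<times> B \<times> A" "0 \<le> a" "a < b" "b \<le> T" "B \<in> sets borel" "A \<in> sets (F a)"
      unfolding pred_rects_def by blast
    then show "(\<lambda>p. p) -` Y \<inter> space (predictable_algebra M F t) \<in> sets (predictable_algebra M F t)"
    proof cases
      case 1
      have "A \<subseteq> space M" using sets.sets_into_space[OF 1(3)] space_F[of 0] by simp
      then have "(\<lambda>p. p) -` Y \<inter> space (predictable_algebra M F t) = {0} \<times> B \<times> A"
        using t by (auto simp: space_pred[OF t(1)] 1(1))
      then show ?thesis using pred_rect0I[OF t(1) 1(2,3)] by simp
    next
      case 2
      have A: "A \<subseteq> space M" using sets.sets_into_space[OF 2(6)] space_F[OF 2(2)] by simp
      show ?thesis
      proof (cases "a < min b t")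
        case True
        have "(\<lambda>p. p) -` Y \<inter> space (predictable_algebra M F t) = {a<..min b t} \<times> B \<times> A"
          using t 2(2) A by (auto simp: space_pred[OF t(1)] 2(1))
        then show ?thesis using pred_rectI[OF 2(2) True _ 2(5,6), of t] by simp
      next
        case False
        then have "(\<lambda>p. p) -` Y \<inter> space (predictable_algebra M F t) = {}"
          using 2(3) by (auto simp: space_pred[OF t(1)] 2(1))
        then show ?thesis by simp
      qed
    qed
  qed
  from measurable_compose[OF this f] show ?thesis by simp
qed

text \<open>The common core of \<open>pred_slab\<close> and \<open>pred_start\<close>, with a time
  interval or the origin as \<open>R\<close>.\<close>

lemma pred_rect_times:
  assumes R: "R \<times> UNIV \<times> space M \<subseteq> space (predictable_algebra M F T)"
    and RA: "\<And>A. A \<in> sets (F a) \<Longrightarrow> R \<times> UNIV \<times> A \<in> sets (predictable_algebra M F T)"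
    and a: "0 \<le> a" and Z: "Z \<in> borel_measurable (F a)"
  shows "(\<lambda>(s, y, \<omega>). if s \<in> R then Z \<omega> else 0 :: real) \<in> borel_measurable (predictable_algebra M F T)"
proof (rule measurableI)
  let ?P = "predictable_algebra M F T"
  fix C :: "real set" assume C: "C \<in> sets borel"
  have A: "Z -` C \<inter> space M \<in> sets (F a)" using measurable_sets[OF Z C] space_F[OF a] by simp
  have r2: "space ?P - R \<times> UNIV \<times> space M \<in> sets ?P" by (intro sets.compl_sets RA space_M_F a)
  have sp: "\<omega> \<in> space M" if "(s, y, \<omega>) \<in> space ?P" for s y \<omega>
    using that by (auto simp: predictable_algebra_def space_measure_of_conv)
  have "(\<lambda>(s, y, \<omega>). if s \<in> R then Z \<omega> else 0 :: real) -` C \<inter> space ?P =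
    (if 0 \<in> C then R \<times> UNIV \<times> (Z -` C \<inter> space M) \<union> (space ?P - R \<times> UNIV \<times> space M) else R \<times> UNIV \<times> (Z -` C \<inter> space M))"
    using R sp by (auto split: if_splits)
  then show "(\<lambda>(s, y, \<omega>). if s \<in> R then Z \<omega> else 0 :: real) -` C \<inter> space ?P \<in> sets ?P"
    using RA[OF A] r2 by auto
qed auto

lemma pred_slab:
  assumes T: "0 \<le> T" and a: "0 \<le> a" and Z: "Z \<in> borel_measurable (F a)"
  shows "(\<lambda>(s, y, \<omega>). if s \<in> {a<..b} then Z \<omega> else 0 :: real) \<in> borel_measurable (predictable_algebra M F T)"
proof (cases "a < min b T")
  case True
  have "(\<lambda>(s, y, \<omega>). if s \<in> {a<..min b T} then Z \<omega> else 0 :: real) \<in> borel_measurable (predictable_algebra M F T)"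
    using True a T by (intro pred_rect_times[OF _ _ a Z] pred_rectI) (auto simp: space_pred[OF T])
  then show ?thesis
    by (rule measurable_cong[THEN iffD1, rotated]) (auto simp: space_pred[OF T])
next
  case False
  have "(\<lambda>_. 0 :: real) \<in> borel_measurable (predictable_algebra M F T)" by simp
  then show ?thesis
    by (rule measurable_cong[THEN iffD1, rotated]) (use False in \<open>auto simp: space_pred[OF T]\<close>)
qed

lemma pred_start:
  assumes T: "0 \<le> T" and Z: "Z \<in> borel_measurable (F 0)"
  shows "(\<lambda>(s, y, \<omega>). if s \<in> {0} then Z \<omega> else 0 :: real) \<in> borel_measurable (predictable_algebra M F T)"
  using T by (intro pred_rect_times[OF _ _ order_refl Z] pred_rect0I) (auto simp: space_pred[OF T])

text \<open>Reading the field at a strictly earlier grid time is what turns adaptedness into predictability.\<close>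

lemma pred_grid:
  fixes J :: "real \<Rightarrow> real \<Rightarrow> 'w \<Rightarrow> real"
  assumes T: "0 \<le> T" and m: "0 < m" and J: "\<And>t x. 0 \<le> t \<Longrightarrow> t \<le> T \<Longrightarrow> J t x \<in> borel_measurable (F t)"
  shows "(\<lambda>(s, y, \<omega>). J (grid_time m s) (grid_space m y) \<omega>) \<in> borel_measurable (predictable_algebra M F T)"
proof -
  let ?P = "predictable_algebra M F T"
  let ?a = "\<lambda>k :: int. (of_int k - 1) / real m" and ?b = "\<lambda>k :: int. of_int k / real m"
  have rm: "0 < real m" using m by simp
  \<comment> \<open>One function per cell of the grid, with \<open>fst kj\<close> the index in time
    and \<open>snd kj\<close> the index in space. The last branch is the one for
    \<open>s = 0\<close>; it also provides a measurable default for cells beyond \<open>T\<close>,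
    where nothing is known about \<open>J\<close>.\<close>
  define f where "f kj = (\<lambda>(s :: real, y :: real, \<omega>). 
     if fst kj \<ge> 1 \<and> ?a (fst kj) \<le> T then (if s \<in> {?a (fst kj)<..?b (fst kj)} then J (?a (fst kj)) (of_int (snd kj) / real m) \<omega> else 0)
     else if s \<in> {0} then J 0 (of_int (snd kj) / real m) \<omega> else 0)" for kj :: "int \<times> int"
  have fm: "f kj \<in> borel_measurable ?P" for kj
  proof (cases "fst kj \<ge> 1 \<and> ?a (fst kj) \<le> T")
    case True
    then have a: "0 \<le> ?a (fst kj)" using rm by simp
    have eq: "f kj = (\<lambda>(s, y, \<omega>). if s \<in> {?a (fst kj)<..?b (fst kj)} then J (?a (fst kj)) (of_int (snd kj) / real m) \<omega> else 0)"
      using True by (simp add: f_def)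
    show ?thesis unfolding eq by (rule pred_slab[OF T a J[OF a]]) (use True in simp)
  next
    case False
    have eq: "f kj = (\<lambda>(s, y, \<omega>). if s \<in> {0} then J 0 (of_int (snd kj) / real m) \<omega> else 0)"
      unfolding f_def using False by (simp only: if_False)
    show ?thesis unfolding eq by (rule pred_start[OF T J[OF order_refl T]])
  qed
  define g where "g p = (\<lceil>fst p * real m\<rceil>, \<lfloor>fst (snd p) * real m\<rfloor>)" for p :: "real \<times> real \<times> 'w"
  have "(\<lambda>(s, y, \<omega>). s) = (\<lambda>p :: real \<times> real \<times> 'w. fst p)" "(\<lambda>(s, y, \<omega>). y) = (\<lambda>p :: real \<times> real \<times> 'w. fst (snd p))"
    by (auto simp: fun_eq_iff)
  then have s: "(\<lambda>p. fst p) \<in> borel_measurable ?P" and y: "(\<lambda>p. fst (snd p)) \<in> borel_measurable ?P"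
    using pred_time_measurable[OF T] pred_space_measurable[OF T] by (simp_all only:)
  have "(\<lambda>p. \<lceil>fst p * real m\<rceil>) \<in> measurable ?P (count_space UNIV)" "(\<lambda>p. \<lfloor>fst (snd p) * real m\<rfloor>) \<in> measurable ?P (count_space UNIV)"
    using s y by measurable
  then have "g \<in> measurable ?P (count_space UNIV \<Otimes>\<^sub>M count_space UNIV)" unfolding g_def by (rule measurable_Pair)
  also have "count_space UNIV \<Otimes>\<^sub>M count_space UNIV = (count_space UNIV :: (int \<times> int) measure)"
    by (simp add: pair_measure_countable)
  finally have gm: "g \<in> measurable ?P (count_space UNIV)" .
  have "(\<lambda>p. f (g p) p) \<in> borel_measurable ?P"
    by (rule measurable_compose_countable[OF fm gm])
  then show ?thesis
  proof (rule measurable_cong[THEN iffD1, rotated])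
    fix p assume "p \<in> space ?P"
    then obtain s y \<omega> where p: "p = (s, y, \<omega>)" "0 \<le> s" "s \<le> T" by (auto simp: space_pred[OF T])
    let ?k = "\<lceil>s * real m\<rceil>"
    show "f (g p) p = (case p of (s, y, \<omega>) \<Rightarrow> J (grid_time m s) (grid_space m y) \<omega>)"
    proof (cases "s = 0")
      case True
      then show ?thesis by (simp add: p f_def g_def grid_time_def grid_space_def max_def)
    next
      case False
      then have "0 < s * real m" using p rm by simp
      then have k: "1 \<le> ?k" by linarith
      have "of_int ?k - 1 < s * real m" "s * real m \<le> of_int ?k" by linarith+
      then have in_cell: "s \<in> {?a ?k<..?b ?k}" using rm by (simp add: divide_less_eq le_divide_eq)
      then have "?a ?k \<le> T" using p by simp
      moreover have "grid_time m s = ?a ?k" using k rm by (simp add: grid_time_def)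
      ultimately show ?thesis using k in_cell by (simp add: p f_def g_def grid_space_def)
    qed
  qed
qed

text \<open>The Heine-Cantor argument by contradiction: bad points for ever finer grids accumulate
  at a point of the compact rectangle, to which their grid points converge as well.\<close>

lemma L2_uniform_grid:
  fixes J :: "real \<Rightarrow> real \<Rightarrow> 'w \<Rightarrow> real"
  assumes T: "0 \<le> T" and J: "\<And>t x. 0 \<le> t \<Longrightarrow> t \<le> T \<Longrightarrow> J t x \<in> borel_measurable M" and e: "0 < e"
    and cont: "\<And>tn t xn x. (\<And>n. tn n \<in> {0..T}) \<Longrightarrow> t \<in> {0..T} \<Longrightarrow> tn \<longlonglongrightarrow> t \<Longrightarrow> xn \<longlonglongrightarrow> x \<Longrightarrow>
       (\<lambda>n. nsq M (\<lambda>\<omega>. J (tn n) (xn n) \<omega> - J t x \<omega>)) \<longlonglongrightarrow> 0"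
  shows "\<exists>m>0. \<forall>t\<in>{0..T}. \<forall>x\<in>{- R..R}. nsq M (\<lambda>\<omega>. J t x \<omega> - J (grid_time m t) (grid_space m x) \<omega>) \<le> ennreal e"
proof (rule ccontr)
  assume neg: "\<not> ?thesis"
  have "\<forall>m. \<exists>p. p \<in> {0..T} \<times> {- R..R} \<and>
     \<not> nsq M (\<lambda>\<omega>. J (fst p) (snd p) \<omega> - J (grid_time (Suc m) (fst p)) (grid_space (Suc m) (snd p)) \<omega>) \<le> ennreal e"
  proof
    fix m
    have "\<not> (\<forall>t\<in>{0..T}. \<forall>x\<in>{- R..R}. nsq M (\<lambda>\<omega>. J t x \<omega> - J (grid_time (Suc m) t) (grid_space (Suc m) x) \<omega>) \<le> ennreal e)"
    proof
      assume "\<forall>t\<in>{0..T}. \<forall>x\<in>{- R..R}. nsq M (\<lambda>\<omega>. J t x \<omega> - J (grid_time (Suc m) t) (grid_space (Suc m) x) \<omega>) \<le> ennreal e"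
      then have "\<exists>m>0. \<forall>t\<in>{0..T}. \<forall>x\<in>{- R..R}. nsq M (\<lambda>\<omega>. J t x \<omega> - J (grid_time m t) (grid_space m x) \<omega>) \<le> ennreal e"
        by (intro exI[of _ "Suc m"] conjI zero_less_Suc)
      with neg show False by (rule notE)
    qed
    then obtain t x where "t \<in> {0..T}" "x \<in> {- R..R}"
      "\<not> nsq M (\<lambda>\<omega>. J t x \<omega> - J (grid_time (Suc m) t) (grid_space (Suc m) x) \<omega>) \<le> ennreal e" by blast
    then show "\<exists>p. p \<in> {0..T} \<times> {- R..R} \<and>
       \<not> nsq M (\<lambda>\<omega>. J (fst p) (snd p) \<omega> - J (grid_time (Suc m) (fst p)) (grid_space (Suc m) (snd p)) \<omega>) \<le> ennreal e"
      by (intro exI[of _ "(t, x)"] conjI) (simp_all only: fst_conv snd_conv mem_Times_iff simp_thms)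
  qed
  from choice[OF this] obtain p where p: "\<And>m. p m \<in> {0..T} \<times> {- R..R}"
    "\<And>m. \<not> nsq M (\<lambda>\<omega>. J (fst (p m)) (snd (p m)) \<omega> - J (grid_time (Suc m) (fst (p m))) (grid_space (Suc m) (snd (p m))) \<omega>) \<le> ennreal e"
    by blast
  have "compact ({0..T} \<times> {- R..R})" by (intro compact_Times compact_Icc)
  then have "\<exists>l\<in>{0..T} \<times> {- R..R}. \<exists>r. strict_mono r \<and> (p \<circ> r) \<longlonglongrightarrow> l"
    using p(1) unfolding compact_def by blast
  then obtain q r where q: "q \<in> {0..T} \<times> {- R..R}" and r: "strict_mono r" and pr: "(p \<circ> r) \<longlonglongrightarrow> q" by blast
  have lt: "(\<lambda>n. fst (p (r n))) \<longlonglongrightarrow> fst q" and lx: "(\<lambda>n. snd (p (r n))) \<longlonglongrightarrow> snd q"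
    using tendsto_fst[OF pr] tendsto_snd[OF pr] by (simp_all add: comp_def)
  have inv0: "(\<lambda>n. 1 / real (Suc (r n))) \<longlonglongrightarrow> 0"
    using LIMSEQ_subseq_LIMSEQ[OF LIMSEQ_Suc[OF lim_1_over_n] r] by (simp add: comp_def)
  have P: "0 \<le> fst (p n)" "fst (p n) \<le> T" for n using p(1)[of n] by (auto simp: mem_Times_iff)
  let ?t = "\<lambda>n. grid_time (Suc (r n)) (fst (p (r n)))" and ?x = "\<lambda>n. grid_space (Suc (r n)) (snd (p (r n)))"
  have tT: "?t n \<in> {0..T}" for n using grid_time_bounds[of "Suc (r n)" "fst (p (r n))"] P[of "r n"] by auto
  have "(\<lambda>n. ?t n - fst (p (r n))) \<longlonglongrightarrow> 0"
    using grid_time_bounds[OF zero_less_Suc P(1)] by (intro Lim_null_comparison[OF always_eventually inv0] allI) (simp add: abs_le_iff)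
  from tendsto_add[OF this lt] have lt': "?t \<longlonglongrightarrow> fst q" by simp
  have "(\<lambda>n. ?x n - snd (p (r n))) \<longlonglongrightarrow> 0"
    using grid_space_bounds[OF zero_less_Suc] by (intro Lim_null_comparison[OF always_eventually inv0] allI) (simp add: abs_minus_commute)
  from tendsto_add[OF this lx] have lx': "?x \<longlonglongrightarrow> snd q" by simp
  have qT: "fst q \<in> {0..T}" using q by (auto simp: mem_Times_iff)
  have c1: "(\<lambda>n. nsq M (\<lambda>\<omega>. J (fst (p (r n))) (snd (p (r n))) \<omega> - J (fst q) (snd q) \<omega>)) \<longlonglongrightarrow> 0"
    using P by (intro cont lt lx qT) auto
  have c2: "(\<lambda>n. nsq M (\<lambda>\<omega>. J (?t n) (?x n) \<omega> - J (fst q) (snd q) \<omega>)) \<longlonglongrightarrow> 0"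
    by (intro cont tT lt' lx' qT)
  have "(\<lambda>n. nsq M (\<lambda>\<omega>. J (fst (p (r n))) (snd (p (r n))) \<omega> - J (?t n) (?x n) \<omega>)) \<longlonglongrightarrow> 0"
  proof (rule tendsto_0_sandwich[OF _ c1 c2])
    fix n
    have m: "J (fst (p (r n))) (snd (p (r n))) \<in> borel_measurable M" "J (?t n) (?x n) \<in> borel_measurable M" "J (fst q) (snd q) \<in> borel_measurable M"
      using P[of "r n"] tT[of n] qT by (auto intro!: J)
    show "nsq M (\<lambda>\<omega>. J (fst (p (r n))) (snd (p (r n))) \<omega> - J (?t n) (?x n) \<omega>) \<le>
      2 * nsq M (\<lambda>\<omega>. J (fst (p (r n))) (snd (p (r n))) \<omega> - J (fst q) (snd q) \<omega>) + 2 * nsq M (\<lambda>\<omega>. J (?t n) (?x n) \<omega> - J (fst q) (snd q) \<omega>)"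
      using nsq_triangle[OF m(1,3,2)] nsq_commute[of M "J (?t n) (?x n)" "J (fst q) (snd q)"] by simp
  qed
  from eventually_happens'[OF _ ennreal_tendsto_0D[OF this e]] obtain n where
    "nsq M (\<lambda>\<omega>. J (fst (p (r n))) (snd (p (r n))) \<omega> - J (?t n) (?x n) \<omega>) < ennreal e" by auto
  with p(2)[of "r n"] show False by simp
qed

text \<open>Grids with error 4^(-n) on the growing sets [0, T] x [-n, n] make the grid values
  converge almost surely at each point, and the pointwise \<open>lim\<close> of predictable fields
  is predictable.\<close>

lemma pred_version:
  fixes J :: "real \<Rightarrow> real \<Rightarrow> 'w \<Rightarrow> real"
  assumes T: "0 \<le> T" and J: "\<And>t x. 0 \<le> t \<Longrightarrow> t \<le> T \<Longrightarrow> J t x \<in> borel_measurable (F t)"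
    and cont: "\<And>tn t xn x. (\<And>n. tn n \<in> {0..T}) \<Longrightarrow> t \<in> {0..T} \<Longrightarrow> tn \<longlonglongrightarrow> t \<Longrightarrow> xn \<longlonglongrightarrow> x \<Longrightarrow>
       (\<lambda>n. nsq M (\<lambda>\<omega>. J (tn n) (xn n) \<omega> - J t x \<omega>)) \<longlonglongrightarrow> 0"
  shows "\<exists>u. predictable_field M F T u \<and> (\<forall>t\<in>{0..T}. \<forall>x. AE \<omega> in M. u t x \<omega> = J t x \<omega>)"
proof -
  have JM: "J t x \<in> borel_measurable M" if "0 \<le> t" "t \<le> T" for t x using F_measurable_M[OF that(1) J[OF that]] .
  have "\<forall>n :: nat. \<exists>m. 0 < m \<and> (\<forall>t\<in>{0..T}. \<forall>x\<in>{- real n..real n}. nsq M (\<lambda>\<omega>. J t x \<omega> - J (grid_time m t) (grid_space m x) \<omega>) \<le> ennreal ((1/4) ^ n))"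
  proof
    fix n :: nat
    show "\<exists>m. 0 < m \<and> (\<forall>t\<in>{0..T}. \<forall>x\<in>{- real n..real n}. nsq M (\<lambda>\<omega>. J t x \<omega> - J (grid_time m t) (grid_space m x) \<omega>) \<le> ennreal ((1/4) ^ n))"
      by (rule L2_uniform_grid[OF T JM _ cont]) simp_all
  qed
  from choice[OF this] obtain m where m: "\<And>n. 0 < m n"
    "\<And>n t x. t \<in> {0..T} \<Longrightarrow> x \<in> {- real n..real n} \<Longrightarrow> nsq M (\<lambda>\<omega>. J t x \<omega> - J (grid_time (m n) t) (grid_space (m n) x) \<omega>) \<le> ennreal ((1/4) ^ n)"
    by blast
  define u where "u t x \<omega> = lim (\<lambda>n. J (grid_time (m n) t) (grid_space (m n) x) \<omega>)" for t x \<omega>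
  have "(\<lambda>p. lim (\<lambda>n. (\<lambda>(s, y, \<omega>). J (grid_time (m n) s) (grid_space (m n) y) \<omega>) p)) \<in> borel_measurable (predictable_algebra M F T)"
    by (rule borel_measurable_lim_metric) (rule pred_grid[OF T m(1) J])
  then have "predictable_field M F T u" by (simp add: predictable_field_def u_def split_beta)
  moreover have "AE \<omega> in M. u t x \<omega> = J t x \<omega>" if t: "t \<in> {0..T}" for t x
  proof -
    obtain N where N: "\<bar>x\<bar> \<le> real N" using real_arch_simple by blast
    have gT: "0 \<le> grid_time (m n) t" "grid_time (m n) t \<le> T" for n
      using grid_time_bounds[OF m(1), of t n] t by auto
    \<comment> \<open>The error bounds hold at \<open>x\<close> from the index \<open>N\<close> on
      only, hence the shift.\<close>
    have "AE \<omega> in M. (\<lambda>n. J (grid_time (m (n + N)) t) (grid_space (m (n + N)) x) \<omega>) \<longlonglongrightarrow> J t x \<omega>"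
    proof (rule nsq_AE_tendsto)
      fix n
      have "nsq M (\<lambda>\<omega>. J t x \<omega> - J (grid_time (m (n + N)) t) (grid_space (m (n + N)) x) \<omega>) \<le> ennreal ((1/4) ^ (n + N))"
        using N by (intro m(2) t) auto
      also have "\<dots> \<le> ennreal ((1/4) ^ n)" by (intro ennreal_leI power_decreasing) auto
      finally show "nsq M (\<lambda>\<omega>. J t x \<omega> - J (grid_time (m (n + N)) t) (grid_space (m (n + N)) x) \<omega>) \<le> ennreal ((1/4) ^ n)" .
    qed (use t gT in \<open>auto intro!: JM\<close>)
    then show ?thesis
    proof eventually_elim
      case (elim \<omega>)
      then have "(\<lambda>n. J (grid_time (m n) t) (grid_space (m n) x) \<omega>) \<longlonglongrightarrow> J t x \<omega>" by (rule LIMSEQ_offset)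
      then show ?case unfolding u_def by (rule limI)
    qed
  qed
  ultimately show ?thesis by blast
qed

lemma walsh_cong_AE:
  assumes I: "has_walsh_integral M F W t X I" and J: "J \<in> borel_measurable M" and eq: "AE \<omega> in M. J \<omega> = I \<omega>"
  shows "has_walsh_integral M F W t X J"
proof -
  have "nsq M (\<lambda>\<omega>. J \<omega> - g \<omega>) = nsq M (\<lambda>\<omega>. I \<omega> - g \<omega>)" for g :: "'w \<Rightarrow> real"
    by (rule nsq_cong_AE) (use eq in eventually_elim, simp)
  then show ?thesis using I J by (simp add: has_walsh_integral_iff)
qed

lemma pred_section_measurable:
  assumes "predictable_field M F T u" "t \<in> {0..T}" shows "u t x \<in> borel_measurable M"
proof -
  have "uncurried u \<in> borel_measurable (field_measure M T)"
    using assms by (intro pred_measurable_field) (auto simp: predictable_field_iff)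
  from field_section_measurable[OF this assms(2), of x] show ?thesis by simp
qed

text \<open>Separates the randomness from the kernel by a bound on second moments that is uniform in
  space. It is used with the contraction rate as \<open>l\<close>, and with \<open>l = 0\<close>
  where no weight is wanted.\<close>

lemma field_bound:
  assumes t: "0 \<le> t" and v: "v \<in> borel_measurable (field_measure M t)"
    and g: "(\<lambda>x. g (fst x) (snd x)) \<in> borel_measurable (strip t)" and c: "0 \<le> c"
    and b: "\<And>s y. s \<in> {0..t} \<Longrightarrow> nsq M (\<lambda>\<omega>. v (s, y, \<omega>)) \<le> ennreal (c * exp (l * s))"
  shows "nsq (field_measure M t) (\<lambda>p. v p * g (fst p) (fst (snd p))) \<le>
    ennreal c * (\<integral>\<^sup>+x. ennreal (exp (l * fst x) * (g (fst x) (snd x))\<^sup>2) \<partial>strip t)"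
proof -
  have "(\<lambda>p. (fst p, fst (snd p))) \<in> measurable (field_measure M t) (strip t)"
    unfolding field_measure_def strip_def by measurable
  from measurable_compose[OF this g] have gm: "(\<lambda>p. g (fst p) (fst (snd p))) \<in> borel_measurable (field_measure M t)" by simp
  have m: "(\<lambda>p. ennreal ((v p * g (fst p) (fst (snd p)))\<^sup>2)) \<in> borel_measurable (field_measure M t)"
    using v gm by measurable
  have e: "(\<lambda>x. exp (l * fst x)) \<in> borel_measurable (strip t)"
  proof -
    have "(\<lambda>(s, y). exp (l * s)) \<in> borel_measurable (borel \<Otimes>\<^sub>M (borel :: real measure))" by measurable
    from strip_lborel_measurable[OF this] show ?thesis .
  qed
  have "nsq (field_measure M t) (\<lambda>p. v p * g (fst p) (fst (snd p))) =
    (\<integral>\<^sup>+x. (\<integral>\<^sup>+\<omega>. ennreal ((v (fst x, snd x, \<omega>) * g (fst x) (snd x))\<^sup>2) \<partial>M) \<partial>strip t)"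
    unfolding nsq_def by (subst nn_integral_field_strip[OF t m]) simp
  also have "\<dots> \<le> (\<integral>\<^sup>+x. ennreal c * ennreal (exp (l * fst x) * (g (fst x) (snd x))\<^sup>2) \<partial>strip t)"
  proof (rule nn_integral_mono)
    fix x assume x: "x \<in> space (strip t)"
    then have s: "fst x \<in> {0..t}" by (auto simp: space_strip)
    have "(\<integral>\<^sup>+\<omega>. ennreal ((v (fst x, snd x, \<omega>) * g (fst x) (snd x))\<^sup>2) \<partial>M) = nsq M (\<lambda>\<omega>. g (fst x) (snd x) * v (fst x, snd x, \<omega>))"
      by (simp add: nsq_def mult.commute)
    also have "\<dots> = ennreal ((g (fst x) (snd x))\<^sup>2) * nsq M (\<lambda>\<omega>. v (fst x, snd x, \<omega>))"
      by (rule nsq_cmult[OF fibre_measurable[OF v x]])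
    also have "\<dots> \<le> ennreal ((g (fst x) (snd x))\<^sup>2) * ennreal (c * exp (l * fst x))" by (intro mult_left_mono b[OF s]) simp
    also have "\<dots> = ennreal c * ennreal (exp (l * fst x) * (g (fst x) (snd x))\<^sup>2)"
      using c by (simp add: ennreal_mult[symmetric] mult_ac)
    finally show "(\<integral>\<^sup>+\<omega>. ennreal ((v (fst x, snd x, \<omega>) * g (fst x) (snd x))\<^sup>2) \<partial>M) \<le>
      ennreal c * ennreal (exp (l * fst x) * (g (fst x) (snd x))\<^sup>2)" .
  qed
  also have "\<dots> = ennreal c * (\<integral>\<^sup>+x. ennreal (exp (l * fst x) * (g (fst x) (snd x))\<^sup>2) \<partial>strip t)"
    by (intro nn_integral_cmult measurable_compose[OF _ measurable_ennreal] borel_measurable_times borel_measurable_power e g)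
  finally show ?thesis .
qed

end


section \<open>Picard iteration\<close>

lemma power_sum_le:
  fixes a b :: real
  assumes "0 \<le> a" "0 \<le> b" "0 < m" shows "a ^ m + b ^ m \<le> (a + b) ^ m"
proof -
  obtain k where k: "m = Suc k" using assms(3) by (cases m) auto
  have "a ^ m + b ^ m = a * a ^ k + b * b ^ k" by (simp add: k)
  also have "\<dots> \<le> a * (a + b) ^ k + b * (a + b) ^ k"
    using assms by (intro add_mono mult_left_mono power_mono) auto
  also have "\<dots> = (a + b) ^ m" by (simp add: k distrib_right)
  finally show ?thesis .
qed

text \<open>The modulus of the sum is at most twice the larger modulus. Convexity would give half
  the constant, which makes no difference for the bounds below.\<close>

lemma sum_power_even_le:
  fixes a b :: real
  shows "(a + b) ^ (2 * m) \<le> 4 ^ m * (a ^ (2 * m) + b ^ (2 * m))"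
proof -
  have *: "(a + b) ^ (2 * m) \<le> 4 ^ m * b ^ (2 * m)" if "\<bar>a\<bar> \<le> \<bar>b\<bar>" for a b :: real
  proof -
    have "(a + b) ^ (2 * m) = \<bar>a + b\<bar> ^ (2 * m)" by (simp add: power_even_abs)
    also have "\<dots> \<le> (2 * \<bar>b\<bar>) ^ (2 * m)" using that by (intro power_mono) auto
    also have "\<dots> = 4 ^ m * b ^ (2 * m)" by (simp add: power_mult_distrib power_mult power_even_abs)
    finally show ?thesis .
  qed
  have n: "0 \<le> 4 ^ m * a ^ (2 * m)" "0 \<le> 4 ^ m * b ^ (2 * m)" by (auto intro!: mult_nonneg_nonneg simp: zero_le_even_power)
  show ?thesis
  proof (cases "\<bar>a\<bar> \<le> \<bar>b\<bar>")
    case True then show ?thesis using *[OF True] n unfolding distrib_left by linarith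
  next
    case False
    then have "(b + a) ^ (2 * m) \<le> 4 ^ m * a ^ (2 * m)" by (intro *) simp
    then show ?thesis using n unfolding distrib_left add.commute[of b a] by linarith
  qed
qed

locale walsh_equation = noise_space M F W + skew_kernel a1 a2 r1 r2
  for M :: "'w measure" and F W a1 a2 r1 r2 +
  fixes \<sigma> :: "real \<Rightarrow> real" and T K :: real
  assumes T: "0 < T" and K: "0 < K" and lip: "K-lipschitz_on UNIV \<sigma>"
begin

abbreviation integrand :: "(real \<Rightarrow> real \<Rightarrow> 'w \<Rightarrow> real) \<Rightarrow> real \<Rightarrow> real \<Rightarrow> real \<Rightarrow> real \<Rightarrow> 'w \<Rightarrow> real" where
  "integrand u t x \<equiv> \<lambda>s y \<omega>. \<sigma> (u s y \<omega>) * G (t - s) x y"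

lemma T_nonneg: "0 \<le> T" using T by simp

lemma sigma_diff: "\<bar>\<sigma> a - \<sigma> b\<bar> \<le> K * \<bar>a - b\<bar>"
  using lipschitz_onD[OF lip, of a b] by (simp add: dist_real_def)

lemma sigma_growth: "\<bar>\<sigma> a\<bar> \<le> \<bar>\<sigma> 0\<bar> + K * \<bar>a\<bar>"
  using sigma_diff[of a 0] by simp

lemma sigma_measurable: "\<sigma> \<in> borel_measurable borel"
  by (intro borel_measurable_continuous_onI lipschitz_on_continuous_on[OF lip])

lemma sigma_nsq:
  assumes X: "X \<in> borel_measurable M" and C: "0 \<le> C" "nsq M X \<le> ennreal C"
  shows "nsq M (\<lambda>\<omega>. \<sigma> (X \<omega>)) \<le> ennreal (2 * (\<sigma> 0)\<^sup>2 + 2 * (K\<^sup>2 * C))"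
proof -
  have "nsq M (\<lambda>\<omega>. \<sigma> (X \<omega>)) \<le> nsq M (\<lambda>\<omega>. \<bar>\<sigma> 0\<bar> + K * \<bar>X \<omega>\<bar>)"
  proof (rule nsq_mono)
    fix \<omega>
    have "0 \<le> K * \<bar>X \<omega>\<bar>" using K by simp
    then show "\<bar>\<sigma> (X \<omega>)\<bar> \<le> \<bar>\<bar>\<sigma> 0\<bar> + K * \<bar>X \<omega>\<bar>\<bar>" using sigma_growth[of "X \<omega>"] by linarith
  qed
  also have "\<dots> \<le> 2 * nsq M (\<lambda>\<omega>. \<bar>\<sigma> 0\<bar>) + 2 * nsq M (\<lambda>\<omega>. K * \<bar>X \<omega>\<bar>)"
    using X by (intro nsq_add) auto
  also have "nsq M (\<lambda>\<omega>. K * \<bar>X \<omega>\<bar>) = ennreal (K\<^sup>2) * nsq M (\<lambda>\<omega>. \<bar>X \<omega>\<bar>)" using X by (intro nsq_cmult) auto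
  also have "nsq M (\<lambda>\<omega>. \<bar>X \<omega>\<bar>) = nsq M X" by (simp add: nsq_def)
  also have "nsq M (\<lambda>\<omega>. \<bar>\<sigma> 0\<bar>) = ennreal ((\<sigma> 0)\<^sup>2)" by (simp add: nsq_def emeasure_space_1)
  also have "2 * ennreal ((\<sigma> 0)\<^sup>2) + 2 * (ennreal (K\<^sup>2) * nsq M X) \<le> 2 * ennreal ((\<sigma> 0)\<^sup>2) + 2 * (ennreal (K\<^sup>2) * ennreal C)"
    by (intro add_left_mono mult_left_mono C) auto
  also have "\<dots> = ennreal (2 * (\<sigma> 0)\<^sup>2 + 2 * (K\<^sup>2 * C))" using C by (simp add: ennreal_mult)
  finally show ?thesis .
qed

lemma sigma_diff_nsq:
  assumes "X \<in> borel_measurable M" "Y \<in> borel_measurable M"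
  shows "nsq M (\<lambda>\<omega>. \<sigma> (X \<omega>) - \<sigma> (Y \<omega>)) \<le> ennreal (K\<^sup>2) * nsq M (\<lambda>\<omega>. X \<omega> - Y \<omega>)"
proof -
  have "nsq M (\<lambda>\<omega>. \<sigma> (X \<omega>) - \<sigma> (Y \<omega>)) \<le> nsq M (\<lambda>\<omega>. K * (X \<omega> - Y \<omega>))"
    using sigma_diff K by (intro nsq_mono) (simp add: abs_mult)
  also have "\<dots> = ennreal (K\<^sup>2) * nsq M (\<lambda>\<omega>. X \<omega> - Y \<omega>)" using assms by (intro nsq_cmult) auto
  finally show ?thesis .
qed

lemma integrand_uncurried: "uncurried (integrand u t x) p = \<sigma> (uncurried u p) * G (t - fst p) x (fst (snd p))"
  by (cases p) simp

lemma integrand_predictable: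
  assumes u: "predictable_field M F T u" and t: "0 \<le> t" "t \<le> T"
  shows "uncurried (integrand u t' x) \<in> borel_measurable (predictable_algebra M F t)"
proof -
  have "uncurried u \<in> borel_measurable (predictable_algebra M F t)"
    using u by (intro pred_restrict[OF t]) (simp add: predictable_field_iff)
  from measurable_compose[OF this sigma_measurable]
  have "(\<lambda>p. \<sigma> (uncurried u p)) \<in> borel_measurable (predictable_algebra M F t)" .
  moreover have "(\<lambda>(s, y, \<omega>). G (t' - s) x y) \<in> borel_measurable (predictable_algebra M F t)"
    by (rule pred_deterministic[OF t(1) kernel_measurable])
  ultimately have "(\<lambda>p. \<sigma> (uncurried u p) * (\<lambda>(s, y, \<omega>). G (t' - s) x y) p) \<in> borel_measurable (predictable_algebra M F t)"
    by (rule borel_measurable_times)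
  also have "(\<lambda>p. \<sigma> (uncurried u p) * (\<lambda>(s, y, \<omega>). G (t' - s) x y) p) = uncurried (integrand u t' x)"
    by (auto simp: fun_eq_iff)
  finally show ?thesis .
qed

lemma sigma_field_measurable:
  assumes u: "predictable_field M F T u" and t: "0 \<le> t" "t \<le> T"
  shows "(\<lambda>p. \<sigma> (uncurried u p)) \<in> borel_measurable (field_measure M t)"
proof -
  have "uncurried u \<in> borel_measurable (predictable_algebra M F t)"
    using u by (intro pred_restrict[OF t]) (simp add: predictable_field_iff)
  from measurable_compose[OF pred_measurable_field[OF t(1) this] sigma_measurable] show ?thesis .
qed

text \<open>A positive weight rate only increases the integrand. The factor with rate 0 is kept so
  that the statement matches \<open>field_bound\<close>.\<close>

lemma kernel_square_finite:
  assumes t: "t \<in> {0..T}"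
  shows "(\<integral>\<^sup>+p. ennreal (exp (0 * fst p) * (G (t - fst p) x (snd p))\<^sup>2) \<partial>strip t) < \<infinity>"
proof -
  obtain l where l: "l > 0" "(\<integral>\<^sup>+p. ennreal (exp (l * fst p) * (G (t - fst p) x (snd p))\<^sup>2) \<partial>strip t) \<le> ennreal (1 * exp (l * t))"
    using kernel_weighted[OF T, of 1] t by auto
  have "(\<integral>\<^sup>+p. ennreal (exp (0 * fst p) * (G (t - fst p) x (snd p))\<^sup>2) \<partial>strip t) \<le>
    (\<integral>\<^sup>+p. ennreal (exp (l * fst p) * (G (t - fst p) x (snd p))\<^sup>2) \<partial>strip t)"
    using l(1) by (intro nn_integral_mono ennreal_leI mult_right_mono) (auto simp: space_strip)
  also have "\<dots> < \<infinity>" using l(2) by (rule le_less_trans) simp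
  finally show ?thesis .
qed

lemma integrand_integrable:
  assumes u: "predictable_field M F T u" and C: "0 \<le> C" "\<And>s y. s \<in> {0..T} \<Longrightarrow> nsq M (u s y) \<le> ennreal C" and t: "t \<in> {0..T}"
  shows "walsh_integrable M F t (integrand u t x)"
proof -
  have t': "0 \<le> t" "t \<le> T" using t by auto
  have "nsq (field_measure M t) (uncurried (integrand u t x)) = nsq (field_measure M t) (\<lambda>p. \<sigma> (uncurried u p) * G (t - fst p) x (fst (snd p)))"
    by (simp add: integrand_uncurried[abs_def])
  also have "\<dots> \<le> ennreal (2 * (\<sigma> 0)\<^sup>2 + 2 * (K\<^sup>2 * C)) * (\<integral>\<^sup>+p. ennreal (exp (0 * fst p) * (G (t - fst p) x (snd p))\<^sup>2) \<partial>strip t)"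
  proof (rule field_bound[where g="\<lambda>s y. G (t - s) x y", OF t'(1) sigma_field_measurable[OF u t'] kernel_strip_measurable])
    fix s y assume s: "s \<in> {0..t}"
    then have "s \<in> {0..T}" using t by auto
    from sigma_nsq[OF pred_section_measurable[OF u this] C(1) C(2)[OF this], of y]
    show "nsq M (\<lambda>\<omega>. \<sigma> (uncurried u (s, y, \<omega>))) \<le> ennreal ((2 * (\<sigma> 0)\<^sup>2 + 2 * (K\<^sup>2 * C)) * exp (0 * s))" by simp
  qed (use C in auto)
  also have "\<dots> < \<infinity>" using kernel_square_finite[OF t] by (simp add: ennreal_mult_less_top)
  finally show ?thesis unfolding walsh_integrable_iff using integrand_predictable[OF u t'] by simp
qed

text \<open>Trades the chosen version of the integral for the relation
  \<open>has_walsh_integral\<close>, which is stable under almost sure changes and can be subtracted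
  and estimated.\<close>

lemma mild_solution_iff:
  "mild_solution M F W G \<sigma> T u \<longleftrightarrow> predictable_field M F T u \<and>
     (\<forall>t\<in>{0..T}. \<forall>x. has_walsh_integral M F W t (integrand u t x) (u t x))"
proof safe
  assume u: "mild_solution M F W G \<sigma> T u"
  then show p: "predictable_field M F T u" by (simp add: mild_solution_def)
  fix t x assume t: "t \<in> {0..T}"
  have "walsh_integrable M F t (integrand u t x)" "AE \<omega> in M. u t x \<omega> = walsh_integral M F W t (integrand u t x) \<omega>"
    using u t by (auto simp: mild_solution_def)
  then show "has_walsh_integral M F W t (integrand u t x) (u t x)"
    using t by (intro walsh_cong_AE[OF walsh_integral_has pred_section_measurable[OF p t]]) auto
next
  assume p: "predictable_field M F T u" and h: "\<forall>t\<in>{0..T}. \<forall>x. has_walsh_integral M F W t (integrand u t x) (u t x)"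
  show "mild_solution M F W G \<sigma> T u"
    unfolding mild_solution_def
  proof (intro conjI ballI allI p)
    fix t x assume t: "t \<in> {0..T}"
    then have h': "has_walsh_integral M F W t (integrand u t x) (u t x)" using h by blast
    show i: "walsh_integrable M F t (integrand u t x)" using h' by (simp add: has_walsh_integral_iff)
    show "AE \<omega> in M. u t x \<omega> = walsh_integral M F W t (integrand u t x) \<omega>"
      using t by (intro walsh_unique[OF _ h' walsh_integral_has[OF _ i]]) auto
  qed
qed

section \<open>Contraction in the weighted second moment\<close>

text \<open>With the factor 4 of \<open>walsh_diff_bound\<close> and the square of the Lipschitz
  constant, the value 1 / (16 (K^2 + 1)) leaves a contraction factor of at most 1/4.\<close>

definition rate :: real where
  "rate = (SOME l. 0 < l \<and> (\<forall>t\<in>{0..T}. \<forall>x. (\<integral>\<^sup>+p. ennreal (exp (l * fst p) * (G (t - fst p) x (snd p))\<^sup>2) \<partial>strip t)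
     \<le> ennreal (1 / (16 * (K\<^sup>2 + 1)) * exp (l * t))))"

lemma rate: "0 < rate" "t \<in> {0..T} \<Longrightarrow> (\<integral>\<^sup>+p. ennreal (exp (rate * fst p) * (G (t - fst p) x (snd p))\<^sup>2) \<partial>strip t)
     \<le> ennreal (1 / (16 * (K\<^sup>2 + 1)) * exp (rate * t))"
proof -
  have "0 < 1 / (16 * (K\<^sup>2 + 1))" by (simp add: add_nonneg_pos)
  from someI_ex[OF kernel_weighted[OF T this], folded rate_def]
  show "0 < rate" "t \<in> {0..T} \<Longrightarrow> (\<integral>\<^sup>+p. ennreal (exp (rate * fst p) * (G (t - fst p) x (snd p))\<^sup>2) \<partial>strip t)
     \<le> ennreal (1 / (16 * (K\<^sup>2 + 1)) * exp (rate * t))" by blast+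
qed

text \<open>Hypothesis and conclusion bound a squared distance by the same weight, so the step can
  be iterated; the factor 1/4 is the one expected by \<open>L2_limit\<close>.\<close>

lemma contraction:
  assumes u: "predictable_field M F T u" and v: "predictable_field M F T v" and t: "t \<in> {0..T}"
    and I: "has_walsh_integral M F W t (integrand u t x) I" and J: "has_walsh_integral M F W t (integrand v t x) J"
    and c: "0 \<le> c" and uv: "\<And>s y. s \<in> {0..T} \<Longrightarrow> nsq M (\<lambda>\<omega>. u s y \<omega> - v s y \<omega>) \<le> ennreal (c * exp (rate * s))"
  shows "nsq M (\<lambda>\<omega>. I \<omega> - J \<omega>) \<le> ennreal (c / 4 * exp (rate * t))"
proof -
  have t': "0 \<le> t" "t \<le> T" using t by auto
  have "nsq M (\<lambda>\<omega>. I \<omega> - J \<omega>) \<le> 4 * nsq (field_measure M t) (\<lambda>p. uncurried (integrand u t x) p - uncurried (integrand v t x) p)"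
    by (rule walsh_diff_bound[OF t'(1) I J])
  also have "(\<lambda>p. uncurried (integrand u t x) p - uncurried (integrand v t x) p) =
    (\<lambda>p. (\<sigma> (uncurried u p) - \<sigma> (uncurried v p)) * G (t - fst p) x (fst (snd p)))"
    by (simp add: integrand_uncurried fun_eq_iff algebra_simps)
  also have "4 * nsq (field_measure M t) \<dots> \<le> 4 * (ennreal (K\<^sup>2 * c) * (\<integral>\<^sup>+p. ennreal (exp (rate * fst p) * (G (t - fst p) x (snd p))\<^sup>2) \<partial>strip t))"
  proof (rule mult_left_mono[OF field_bound[where g="\<lambda>s y. G (t - s) x y", OF t'(1) _ kernel_strip_measurable]])
    show "(\<lambda>p. \<sigma> (uncurried u p) - \<sigma> (uncurried v p)) \<in> borel_measurable (field_measure M t)"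
      by (intro borel_measurable_diff sigma_field_measurable u v t')
    fix s y assume s: "s \<in> {0..t}"
    then have s': "s \<in> {0..T}" using t by auto
    have "nsq M (\<lambda>\<omega>. \<sigma> (u s y \<omega>) - \<sigma> (v s y \<omega>)) \<le> ennreal (K\<^sup>2) * nsq M (\<lambda>\<omega>. u s y \<omega> - v s y \<omega>)"
      by (rule sigma_diff_nsq[OF pred_section_measurable[OF u s'] pred_section_measurable[OF v s']])
    also have "\<dots> \<le> ennreal (K\<^sup>2) * ennreal (c * exp (rate * s))" by (intro mult_left_mono uv[OF s']) simp
    also have "\<dots> = ennreal (K\<^sup>2 * c * exp (rate * s))" using c by (simp add: ennreal_mult[symmetric] mult.assoc)
    finally show "nsq M (\<lambda>\<omega>. \<sigma> (uncurried u (s, y, \<omega>)) - \<sigma> (uncurried v (s, y, \<omega>))) \<le> ennreal (K\<^sup>2 * c * exp (rate * s))" by simp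
  qed (use c in auto)
  also have "\<dots> \<le> 4 * (ennreal (K\<^sup>2 * c) * ennreal (1 / (16 * (K\<^sup>2 + 1)) * exp (rate * t)))"
    by (intro mult_left_mono rate(2)[OF t]) auto
  also have "\<dots> = ennreal (4 * (K\<^sup>2 * c * (1 / (16 * (K\<^sup>2 + 1)) * exp (rate * t))))"
  proof -
    have "0 \<le> 1 / (16 * (K\<^sup>2 + 1)) * exp (rate * t)" by simp
    moreover have "0 \<le> K\<^sup>2 * c" using c by simp
    ultimately show ?thesis by (simp only: ennreal_mult mult_nonneg_nonneg zero_le_numeral ennreal_numeral)
  qed
  also have "\<dots> \<le> ennreal (c / 4 * exp (rate * t))"
  proof (rule ennreal_leI)
    have pos: "0 < K\<^sup>2 + 1" by (simp add: add_nonneg_pos)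
    have "4 * (K\<^sup>2 * c * (1 / (16 * (K\<^sup>2 + 1)) * exp (rate * t))) = (K\<^sup>2 / (K\<^sup>2 + 1)) * (c / 4 * exp (rate * t))"
      using pos by (simp add: field_simps)
    also have "\<dots> \<le> 1 * (c / 4 * exp (rate * t))" using c pos by (intro mult_right_mono) auto
    finally show "4 * (K\<^sup>2 * c * (1 / (16 * (K\<^sup>2 + 1)) * exp (rate * t))) \<le> c / 4 * exp (rate * t)" by simp
  qed
  finally show ?thesis .
qed

lemma picard_step:
  assumes u: "predictable_field M F T u" and C: "0 \<le> C" "\<And>s y. s \<in> {0..T} \<Longrightarrow> nsq M (u s y) \<le> ennreal C"
  shows "\<exists>u'. predictable_field M F T u' \<and> (\<forall>t\<in>{0..T}. \<forall>x. has_walsh_integral M F W t (integrand u t x) (u' t x))"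
proof -
  define J where "J t x = walsh_integral M F W t (integrand u t x)" for t x
  have hJ: "has_walsh_integral M F W t (integrand u t x) (J t x)" if "t \<in> {0..T}" for t x
    unfolding J_def using that by (intro walsh_integral_has integrand_integrable[OF u C]) auto
  \<comment> \<open>Over the common interval [0, T] the difference of two convolutions is the
    integral of one field, namely \<open>\<sigma> u\<close> times a difference of kernels.\<close>
  have hJT: "has_walsh_integral M F W T (integrand u t x) (J t x)" if "t \<in> {0..T}" for t x
    using that by (intro walsh_extend[OF _ _ hJ[OF that]] integrand_predictable[OF u T_nonneg order_refl]) (auto simp: fund_sol_def)
  define C' where "C' = 2 * (\<sigma> 0)\<^sup>2 + 2 * (K\<^sup>2 * C)"
  have C': "0 \<le> C'" using C by (simp add: C'_def)
  have "\<exists>u'. predictable_field M F T u' \<and> (\<forall>t\<in>{0..T}. \<forall>x. AE \<omega> in M. u' t x \<omega> = J t x \<omega>)"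
  proof (rule pred_version[OF T_nonneg])
    show "J t x \<in> borel_measurable (F t)" if "0 \<le> t" "t \<le> T" for t x
      using that by (intro walsh_F_measurable[OF that(1) hJ]) auto
    fix tn xn :: "nat \<Rightarrow> real" and t x :: real
    assume r: "\<And>n. tn n \<in> {0..T}" "t \<in> {0..T}" and l: "tn \<longlonglongrightarrow> t" "xn \<longlonglongrightarrow> x"
    let ?g = "\<lambda>n s y. G (tn n - s) (xn n) y - G (t - s) x y"
    show "(\<lambda>n. nsq M (\<lambda>\<omega>. J (tn n) (xn n) \<omega> - J t x \<omega>)) \<longlonglongrightarrow> 0"
    proof (rule tendsto_0_scaled[OF _ kernel_L2_tendsto[OF l r]])
      fix n
      have gm: "(\<lambda>p. ?g n (fst p) (snd p)) \<in> borel_measurable (strip T)"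
        by (intro borel_measurable_diff kernel_strip_measurable)
      have "nsq M (\<lambda>\<omega>. J (tn n) (xn n) \<omega> - J t x \<omega>) \<le> 4 * nsq (field_measure M T) (\<lambda>p. uncurried (integrand u (tn n) (xn n)) p - uncurried (integrand u t x) p)"
        by (rule walsh_diff_bound[OF T_nonneg hJT[OF r(1)] hJT[OF r(2)]])
      also have "(\<lambda>p. uncurried (integrand u (tn n) (xn n)) p - uncurried (integrand u t x) p) = (\<lambda>p. \<sigma> (uncurried u p) * ?g n (fst p) (fst (snd p)))"
        by (simp add: integrand_uncurried fun_eq_iff algebra_simps)
      also have "4 * nsq (field_measure M T) \<dots> \<le> 4 * (ennreal C' * (\<integral>\<^sup>+p. ennreal (exp (0 * fst p) * (?g n (fst p) (snd p))\<^sup>2) \<partial>strip T))"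
      proof (rule mult_left_mono[OF field_bound[OF T_nonneg sigma_field_measurable[OF u T_nonneg order_refl] gm C']])
        fix s y assume s: "s \<in> {0..T}"
        from sigma_nsq[OF pred_section_measurable[OF u s] C(1) C(2)[OF s], of y]
        show "nsq M (\<lambda>\<omega>. \<sigma> (uncurried u (s, y, \<omega>))) \<le> ennreal (C' * exp (0 * s))" by (simp add: C'_def)
      qed simp
      also have "\<dots> = ennreal (4 * C') * nsq (strip T) (\<lambda>p. ?g n (fst p) (snd p))"
        using C' by (simp add: nsq_def ennreal_mult mult.assoc)
      finally show "nsq M (\<lambda>\<omega>. J (tn n) (xn n) \<omega> - J t x \<omega>) \<le> ennreal (4 * C') * nsq (strip T) (\<lambda>p. ?g n (fst p) (snd p))" .
    qed (use C' in simp)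
  qed
  then obtain u' where u': "predictable_field M F T u'" "\<And>t x. t \<in> {0..T} \<Longrightarrow> AE \<omega> in M. u' t x \<omega> = J t x \<omega>" by blast
  have "has_walsh_integral M F W t (integrand u t x) (u' t x)" if t: "t \<in> {0..T}" for t x
    by (rule walsh_cong_AE[OF hJ[OF t] pred_section_measurable[OF u'(1) t] u'(2)[OF t]])
  then show ?thesis using u'(1) by blast
qed

section \<open>Moment bounds along the iteration\<close>

text \<open>The constant is the reciprocal of all that a Picard step produces:
  \<open>2 * m - 1\<close> and 4 from \<open>walsh_moment_bound\<close>, another 4 from
  \<open>sum_power_even_le\<close>, and the growth of \<open>\<sigma>\<close>.\<close>

definition moment_rate :: "nat \<Rightarrow> real" where
  "moment_rate m = (SOME l. 0 < l \<and> (\<forall>t\<in>{0..T}. \<forall>x. (\<integral>\<^sup>+p. ennreal (exp (l * fst p) * (G (t - fst p) x (snd p))\<^sup>2) \<partial>strip t)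
     \<le> ennreal (1 / ((2 * real m - 1) * 16 * ((\<sigma> 0)\<^sup>2 + K\<^sup>2)) * exp (l * t))))"

lemma moment_rate:
  assumes "0 < m"
  shows "0 < moment_rate m" "t \<in> {0..T} \<Longrightarrow> (\<integral>\<^sup>+p. ennreal (exp (moment_rate m * fst p) * (G (t - fst p) x (snd p))\<^sup>2) \<partial>strip t)
     \<le> ennreal (1 / ((2 * real m - 1) * 16 * ((\<sigma> 0)\<^sup>2 + K\<^sup>2)) * exp (moment_rate m * t))"
proof -
  have "0 < 2 * real m - 1" using assms by simp
  moreover have "0 < (\<sigma> 0)\<^sup>2 + K\<^sup>2" using K by (simp add: add_nonneg_pos)
  ultimately have "0 < 1 / ((2 * real m - 1) * 16 * ((\<sigma> 0)\<^sup>2 + K\<^sup>2))" by simp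
  from someI_ex[OF kernel_weighted[OF T this], folded moment_rate_def]
  show "0 < moment_rate m" "t \<in> {0..T} \<Longrightarrow> (\<integral>\<^sup>+p. ennreal (exp (moment_rate m * fst p) * (G (t - fst p) x (snd p))\<^sup>2) \<partial>strip t)
     \<le> ennreal (1 / ((2 * real m - 1) * 16 * ((\<sigma> 0)\<^sup>2 + K\<^sup>2)) * exp (moment_rate m * t))" by blast+
qed

text \<open>No constant stands in front of the exponential: the zero field satisfies the bound, and
  a Picard step reproduces it exactly.\<close>

definition moments_le :: "(real \<Rightarrow> real \<Rightarrow> 'w \<Rightarrow> real) \<Rightarrow> nat \<Rightarrow> bool" where
  "moments_le u m \<longleftrightarrow> (\<forall>t\<in>{0..T}. \<forall>x. (\<integral>\<^sup>+\<omega>. ennreal (u t x \<omega> ^ (2 * m)) \<partial>M) \<le> ennreal (exp (moment_rate m * t) ^ m))"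

text \<open>Linear growth splits the moment of \<open>\<sigma> u\<close> into a constant and a
  multiple of the moment of \<open>u\<close>. As the weight is at least 1, the constant is absorbed
  by it, and the choice of \<open>moment_rate\<close> cancels every factor.\<close>

lemma moment_step:
  assumes u: "predictable_field M F T u" and m: "0 < m" and um: "moments_le u m" and t: "t \<in> {0..T}"
    and I: "has_walsh_integral M F W t (integrand u t x) I"
  shows "(\<integral>\<^sup>+\<omega>. ennreal (I \<omega> ^ (2 * m)) \<partial>M) \<le> ennreal (exp (moment_rate m * t) ^ m)"
proof -
  define l where "l = moment_rate m"
  define S where "S = (\<sigma> 0)\<^sup>2 + K\<^sup>2"
  \<comment> \<open>The 4 is the m-th root of the constant in \<open>sum_power_even_le\<close>;
    \<open>S\<close> joins both parts of the growth of \<open>\<sigma>\<close>, by superadditivity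
    of the m-th power.\<close>
  define h where "h p = 4 * S * (exp (l * fst p) * (G (t - fst p) x (snd p))\<^sup>2)" for p :: "real \<times> real"
  define H where "H = 4 * S * (1 / ((2 * real m - 1) * 16 * S) * exp (l * t))"
  have t': "0 \<le> t" "t \<le> T" using t by auto
  have S: "0 < S" using K by (simp add: S_def add_nonneg_pos)
  have m1: "0 < 2 * real m - 1" using m by simp
  have l: "0 < l" using moment_rate(1)[OF m] by (simp add: l_def)
  have em: "(\<lambda>p. exp (l * fst p)) \<in> borel_measurable (strip t)"
  proof -
    have "(\<lambda>(s, y). exp (l * s)) \<in> borel_measurable (borel \<Otimes>\<^sub>M (borel :: real measure))" by measurable
    from strip_lborel_measurable[OF this] show ?thesis .
  qed
  have wm: "(\<lambda>p. exp (l * fst p) * (G (t - fst p) x (snd p))\<^sup>2) \<in> borel_measurable (strip t)"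
    by (intro borel_measurable_times borel_measurable_power em kernel_strip_measurable)
  have "(\<integral>\<^sup>+\<omega>. ennreal (I \<omega> ^ (2 * m)) \<partial>M) \<le> ennreal (((2 * real m - 1) * (4 * H)) ^ m)"
  proof (rule walsh_moment_bound[OF t'(1) I m])
    show "0 \<le> h p" for p using S by (simp add: h_def)
    show "h \<in> borel_measurable (strip t)" unfolding h_def[abs_def] by (intro borel_measurable_times borel_measurable_const wm)
    have "(\<integral>\<^sup>+p. ennreal (h p) \<partial>strip t) = (\<integral>\<^sup>+p. ennreal (4 * S) * ennreal (exp (l * fst p) * (G (t - fst p) x (snd p))\<^sup>2) \<partial>strip t)"
      unfolding h_def using S by (intro nn_integral_cong ennreal_mult) auto
    also have "\<dots> = ennreal (4 * S) * (\<integral>\<^sup>+p. ennreal (exp (l * fst p) * (G (t - fst p) x (snd p))\<^sup>2) \<partial>strip t)"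
      by (intro nn_integral_cmult measurable_compose[OF wm measurable_ennreal])
    also have "\<dots> \<le> ennreal (4 * S) * ennreal (1 / ((2 * real m - 1) * 16 * S) * exp (l * t))"
      using moment_rate(2)[OF m t, of x] by (intro mult_left_mono) (auto simp: l_def S_def)
    also have "\<dots> = ennreal H" unfolding H_def using S m1 by (intro ennreal_mult[symmetric]) auto
    finally show "(\<integral>\<^sup>+p. ennreal (h p) \<partial>strip t) \<le> ennreal H" .
    show "0 \<le> H" using S m1 by (simp add: H_def)
    fix p assume p: "p \<in> space (strip t)"
    then have s: "fst p \<in> {0..T}" "0 \<le> fst p" using t by (auto simp: space_strip)
    let ?u = "u (fst p) (snd p)" and ?g = "G (t - fst p) x (snd p)" and ?e = "exp (l * fst p)"
    have [measurable]: "?u \<in> borel_measurable M" by (rule pred_section_measurable[OF u s(1)])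
    have e1: "1 \<le> ?e" using l s by simp
    have "fibre_moment (2 * m) (uncurried (integrand u t x)) p = (\<integral>\<^sup>+\<omega>. ennreal ((\<sigma> (?u \<omega>) * ?g) ^ (2 * m)) \<partial>M)"
      by (simp add: fibre_moment_def)
    also have "\<dots> \<le> (\<integral>\<^sup>+\<omega>. ennreal ((?g\<^sup>2) ^ m * 4 ^ m * ((\<sigma> 0)\<^sup>2) ^ m) + ennreal ((?g\<^sup>2) ^ m * 4 ^ m * (K\<^sup>2) ^ m) * ennreal (?u \<omega> ^ (2 * m)) \<partial>M)"
    proof (rule nn_integral_mono)
      fix \<omega>
      have "\<sigma> (?u \<omega>) ^ (2 * m) = \<bar>\<sigma> (?u \<omega>)\<bar> ^ (2 * m)" by (simp add: power_even_abs)
      also have "\<dots> \<le> (\<bar>\<sigma> 0\<bar> + K * \<bar>?u \<omega>\<bar>) ^ (2 * m)" by (intro power_mono sigma_growth) simp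
      also have "\<dots> \<le> 4 ^ m * (\<bar>\<sigma> 0\<bar> ^ (2 * m) + (K * \<bar>?u \<omega>\<bar>) ^ (2 * m))" by (rule sum_power_even_le)
      also have "\<dots> = 4 ^ m * ((\<sigma> 0)\<^sup>2) ^ m + 4 ^ m * ((K\<^sup>2) ^ m * ?u \<omega> ^ (2 * m))"
        by (simp add: power_mult_distrib power_mult distrib_left)
      finally have "(?g\<^sup>2) ^ m * \<sigma> (?u \<omega>) ^ (2 * m) \<le> (?g\<^sup>2) ^ m * (4 ^ m * ((\<sigma> 0)\<^sup>2) ^ m + 4 ^ m * ((K\<^sup>2) ^ m * ?u \<omega> ^ (2 * m)))"
        by (intro mult_left_mono) auto
      moreover have "(\<sigma> (?u \<omega>) * ?g) ^ (2 * m) = (?g\<^sup>2) ^ m * \<sigma> (?u \<omega>) ^ (2 * m)"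
        unfolding power_mult_distrib power_mult[of ?g 2 m] by (rule mult.commute)
      ultimately have "(\<sigma> (?u \<omega>) * ?g) ^ (2 * m) \<le> (?g\<^sup>2) ^ m * 4 ^ m * ((\<sigma> 0)\<^sup>2) ^ m + (?g\<^sup>2) ^ m * 4 ^ m * (K\<^sup>2) ^ m * ?u \<omega> ^ (2 * m)"
        by (simp only: distrib_left mult.assoc)
      then have "ennreal ((\<sigma> (?u \<omega>) * ?g) ^ (2 * m)) \<le> ennreal ((?g\<^sup>2) ^ m * 4 ^ m * ((\<sigma> 0)\<^sup>2) ^ m + (?g\<^sup>2) ^ m * 4 ^ m * (K\<^sup>2) ^ m * ?u \<omega> ^ (2 * m))"
        by (rule ennreal_leI)
      also have "\<dots> = ennreal ((?g\<^sup>2) ^ m * 4 ^ m * ((\<sigma> 0)\<^sup>2) ^ m) + ennreal ((?g\<^sup>2) ^ m * 4 ^ m * (K\<^sup>2) ^ m) * ennreal (?u \<omega> ^ (2 * m))"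
        by (subst ennreal_plus) (auto intro!: mult_nonneg_nonneg ennreal_mult simp: zero_le_even_power)
      finally show "ennreal ((\<sigma> (?u \<omega>) * ?g) ^ (2 * m)) \<le> ennreal ((?g\<^sup>2) ^ m * 4 ^ m * ((\<sigma> 0)\<^sup>2) ^ m) + ennreal ((?g\<^sup>2) ^ m * 4 ^ m * (K\<^sup>2) ^ m) * ennreal (?u \<omega> ^ (2 * m))" .
    qed
    also have "\<dots> = ennreal ((?g\<^sup>2) ^ m * 4 ^ m * ((\<sigma> 0)\<^sup>2) ^ m) + ennreal ((?g\<^sup>2) ^ m * 4 ^ m * (K\<^sup>2) ^ m) * (\<integral>\<^sup>+\<omega>. ennreal (?u \<omega> ^ (2 * m)) \<partial>M)"
      by (subst nn_integral_add) (auto simp: nn_integral_cmult emeasure_space_1)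
    also have "\<dots> \<le> ennreal ((?g\<^sup>2) ^ m * 4 ^ m * ((\<sigma> 0)\<^sup>2) ^ m) + ennreal ((?g\<^sup>2) ^ m * 4 ^ m * (K\<^sup>2) ^ m) * ennreal (?e ^ m)"
      using um s(1) unfolding moments_le_def l_def by (intro add_left_mono mult_left_mono) auto
    also have "\<dots> = ennreal ((?g\<^sup>2) ^ m * 4 ^ m * ((\<sigma> 0)\<^sup>2) ^ m + (?g\<^sup>2) ^ m * 4 ^ m * (K\<^sup>2) ^ m * ?e ^ m)"
      by (subst ennreal_plus) (auto intro!: mult_nonneg_nonneg ennreal_mult[symmetric])
    also have "\<dots> \<le> ennreal (h p ^ m)"
    proof (rule ennreal_leI)
      have "(?g\<^sup>2) ^ m * 4 ^ m * ((\<sigma> 0)\<^sup>2) ^ m + (?g\<^sup>2) ^ m * 4 ^ m * (K\<^sup>2) ^ m * ?e ^ m =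
        (?g\<^sup>2) ^ m * 4 ^ m * (((\<sigma> 0)\<^sup>2) ^ m * 1 + (K\<^sup>2) ^ m * ?e ^ m)" by (simp add: distrib_left mult_ac)
      \<comment> \<open>Here the constant part of the growth is put under the weight, by
        \<open>e1\<close>.\<close>
      also have "\<dots> \<le> (?g\<^sup>2) ^ m * 4 ^ m * (((\<sigma> 0)\<^sup>2) ^ m * ?e ^ m + (K\<^sup>2) ^ m * ?e ^ m)"
        using e1 by (intro mult_left_mono add_right_mono one_le_power) auto
      also have "\<dots> = (?g\<^sup>2) ^ m * 4 ^ m * ((((\<sigma> 0)\<^sup>2) ^ m + (K\<^sup>2) ^ m) * ?e ^ m)" by (simp add: distrib_right)
      also have "\<dots> \<le> (?g\<^sup>2) ^ m * 4 ^ m * (S ^ m * ?e ^ m)"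
        unfolding S_def using m by (intro mult_left_mono mult_right_mono power_sum_le) auto
      also have "\<dots> = h p ^ m" by (simp add: h_def power_mult_distrib mult_ac)
      finally show "(?g\<^sup>2) ^ m * 4 ^ m * ((\<sigma> 0)\<^sup>2) ^ m + (?g\<^sup>2) ^ m * 4 ^ m * (K\<^sup>2) ^ m * ?e ^ m \<le> h p ^ m" .
    qed
    finally show "fibre_moment (2 * m) (uncurried (integrand u t x)) p \<le> ennreal (h p ^ m)" .
  qed
  also have "(2 * real m - 1) * (4 * H) = exp (l * t)"
    using S m1 by (simp add: H_def field_simps)
  finally show ?thesis by (simp add: l_def)
qed

lemma nsq_moments:
  assumes "moments_le u 1" "t \<in> {0..T}" shows "nsq M (u t x) \<le> ennreal (exp (moment_rate 1 * T))"
proof -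
  have "nsq M (u t x) \<le> ennreal (exp (moment_rate 1 * t) ^ 1)"
    using assms unfolding moments_le_def nsq_def by fastforce
  also have "\<dots> \<le> ennreal (exp (moment_rate 1 * T))"
    using assms(2) moment_rate(1)[of 1] by (intro ennreal_leI) auto
  finally show ?thesis .
qed

text \<open>A real exponent is reached from an even one through |z|^q \<le> 1 + z^(2m), valid as
  soon as q \<le> 2m.\<close>

lemma even_moments_bounded:
  assumes p: "predictable_field M F T u" and u: "\<And>m. 0 < m \<Longrightarrow> moments_le u m"
  shows "bounded_moments M T u"
  unfolding bounded_moments_def
proof (intro allI impI)
  fix q :: real assume q: "2 \<le> q"
  obtain m :: nat where m: "q \<le> real m" using real_arch_simple by blast
  then have m0: "0 < m" using q by (cases m) auto
  have "(SUP (t, x)\<in>{0..T} \<times> UNIV. \<integral>\<^sup>+\<omega>. ennreal (\<bar>u t x \<omega>\<bar> powr q) \<partial>M) \<le> 1 + ennreal (exp (moment_rate m * T) ^ m)"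
  proof (rule SUP_least, safe)
    fix t x :: real assume t: "t \<in> {0..T}"
    have [measurable]: "u t x \<in> borel_measurable M" by (rule pred_section_measurable[OF p t])
    have "(\<integral>\<^sup>+\<omega>. ennreal (\<bar>u t x \<omega>\<bar> powr q) \<partial>M) \<le> (\<integral>\<^sup>+\<omega>. 1 + ennreal (u t x \<omega> ^ (2 * m)) \<partial>M)"
    proof (rule nn_integral_mono)
      fix \<omega>
      have nn: "0 \<le> u t x \<omega> ^ (2 * m)" by (simp add: zero_le_even_power)
      have "\<bar>u t x \<omega>\<bar> powr q \<le> 1 + u t x \<omega> ^ (2 * m)"
      proof (cases "\<bar>u t x \<omega>\<bar> \<le> 1")
        case True
        then have "\<bar>u t x \<omega>\<bar> powr q \<le> 1 powr q" using q by (intro powr_mono2) auto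
        moreover have "(1 :: real) powr q = 1" by simp
        ultimately show ?thesis using nn by linarith
      next
        case False
        then have "\<bar>u t x \<omega>\<bar> powr q \<le> \<bar>u t x \<omega>\<bar> powr real (2 * m)" using m by (intro powr_mono) auto
        also have "\<dots> = \<bar>u t x \<omega>\<bar> ^ (2 * m)" using False by (intro powr_realpow) auto
        finally show ?thesis by (simp add: power_even_abs)
      qed
      then have "ennreal (\<bar>u t x \<omega>\<bar> powr q) \<le> ennreal (1 + u t x \<omega> ^ (2 * m))" by (rule ennreal_leI)
      then show "ennreal (\<bar>u t x \<omega>\<bar> powr q) \<le> 1 + ennreal (u t x \<omega> ^ (2 * m))" using nn by simp
    qed
    also have "\<dots> = 1 + (\<integral>\<^sup>+\<omega>. ennreal (u t x \<omega> ^ (2 * m)) \<partial>M)"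
      by (subst nn_integral_add) (auto simp: emeasure_space_1)
    also have "\<dots> \<le> 1 + ennreal (exp (moment_rate m * T) ^ m)"
    proof (rule add_left_mono)
      have "(\<integral>\<^sup>+\<omega>. ennreal (u t x \<omega> ^ (2 * m)) \<partial>M) \<le> ennreal (exp (moment_rate m * t) ^ m)"
        using u[OF m0] t unfolding moments_le_def by blast
      also have "\<dots> \<le> ennreal (exp (moment_rate m * T) ^ m)"
        using t moment_rate(1)[OF m0] by (intro ennreal_leI power_mono) auto
      finally show "(\<integral>\<^sup>+\<omega>. ennreal (u t x \<omega> ^ (2 * m)) \<partial>M) \<le> ennreal (exp (moment_rate m * T) ^ m)" .
    qed
    finally show "(\<integral>\<^sup>+\<omega>. ennreal (\<bar>u t x \<omega>\<bar> powr q) \<partial>M) \<le> 1 + ennreal (exp (moment_rate m * T) ^ m)" .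
  qed
  also have "\<dots> < \<infinity>" by simp
  finally show "(SUP (t, x)\<in>{0..T} \<times> UNIV. \<integral>\<^sup>+\<omega>. ennreal (\<bar>u t x \<omega>\<bar> powr q) \<partial>M) < \<infinity>" .
qed

lemma bounded_moments_nsq:
  assumes "bounded_moments M T u"
  obtains C where "0 \<le> C" "\<And>t x. t \<in> {0..T} \<Longrightarrow> nsq M (u t x) \<le> ennreal C"
proof -
  define S where "S = (SUP (t, x)\<in>{0..T} \<times> UNIV. \<integral>\<^sup>+\<omega>. ennreal (\<bar>u t x \<omega>\<bar> powr 2) \<partial>M)"
  have "S < \<infinity>" unfolding S_def by (rule assms[unfolded bounded_moments_def, rule_format]) simp
  then obtain C where C: "S = ennreal C" "0 \<le> C" by (cases S) auto
  have "nsq M (u t x) \<le> ennreal C" if t: "t \<in> {0..T}" for t x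
  proof -
    have "nsq M (u t x) = (\<lambda>(t, x). \<integral>\<^sup>+\<omega>. ennreal (\<bar>u t x \<omega>\<bar> powr 2) \<partial>M) (t, x)"
      unfolding nsq_def by simp
    also have "\<dots> \<le> S" unfolding S_def using t by (intro SUP_upper) auto
    finally show ?thesis using C by simp
  qed
  then show ?thesis using C that by blast
qed

section \<open>Existence and uniqueness\<close>

text \<open>Each Picard step asserts only that some predictable version exists, so the iterates come
  from dependent choice, with the moment bounds as an invariant. Their limit is a fixed point
  because both it and its image lie at a geometrically small distance from the iterates.\<close>

lemma solution_exists: "\<exists>u. mild_solution M F W G \<sigma> T u \<and> bounded_moments M T u"
proof -
  define P where "P u \<longleftrightarrow> predictable_field M F T u \<and> (\<forall>m>0. moments_le u m)" for u
  define Q where "Q u u' \<longleftrightarrow> (\<forall>t\<in>{0..T}. \<forall>x. has_walsh_integral M F W t (integrand u t x) (u' t x))" for u u'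
  have "\<exists>f. \<forall>n. P (f n) \<and> Q (f n) (f (Suc n))"
  proof (rule dependent_nat_choice[where P="\<lambda>_. P" and Q="\<lambda>_. Q"])
    have "(\<lambda>(s, y, \<omega>). 0 :: real) = (\<lambda>_ :: real \<times> real \<times> 'w. 0)" by (simp add: fun_eq_iff)
    then have "P (\<lambda>_ _ _. 0)"
      unfolding P_def moments_le_def predictable_field_def by (auto simp: zero_power)
    then show "\<exists>u. P u" by blast
    fix u and n :: nat assume u: "P u"
    then have pu: "predictable_field M F T u" and m1: "moments_le u 1" by (auto simp: P_def)
    obtain u' where u': "predictable_field M F T u'" "Q u u'"
      using picard_step[OF pu _ nsq_moments[OF m1]] unfolding Q_def by auto
    have "moments_le u' m" if "0 < m" for m
      unfolding moments_le_def using u u'(2) that unfolding P_def Q_def by (blast intro: moment_step)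
    then show "\<exists>u'. P u' \<and> Q u u'" using u' by (auto simp: P_def)
  qed
  then obtain f where f: "\<And>n. P (f n)" "\<And>n. Q (f n) (f (Suc n))" by blast
  have pf: "predictable_field M F T (f n)" and mf: "0 < m \<Longrightarrow> moments_le (f n) m" for n m using f(1) by (auto simp: P_def)
  have wf: "has_walsh_integral M F W t (integrand (f n) t x) (f (Suc n) t x)" if "t \<in> {0..T}" for n t x
    using f(2) that by (auto simp: Q_def)
  have fm: "f n t x \<in> borel_measurable M" if "t \<in> {0..T}" for n t x by (rule pred_section_measurable[OF pf that])
  define B where "B = exp (moment_rate 1 * T)"
  have B: "0 \<le> B" by (simp add: B_def)
  have nb: "nsq M (f n t x) \<le> ennreal B" if "t \<in> {0..T}" for n t x
    unfolding B_def by (rule nsq_moments[OF mf that]) simp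
  have inc: "nsq M (\<lambda>\<omega>. f (Suc n) t x \<omega> - f n t x \<omega>) \<le> ennreal (4 * B * (1/4) ^ n * exp (rate * t))" if t: "t \<in> {0..T}" for n t x
    using t
  proof (induction n arbitrary: t x)
    case 0
    have "nsq M (\<lambda>\<omega>. f (Suc 0) t x \<omega> + - f 0 t x \<omega>) \<le> 2 * nsq M (f (Suc 0) t x) + 2 * nsq M (\<lambda>\<omega>. - f 0 t x \<omega>)"
      using fm[OF 0] by (intro nsq_add) auto
    also have "\<dots> \<le> 2 * ennreal B + 2 * ennreal B" unfolding nsq_uminus by (intro add_mono mult_left_mono nb[OF 0]) auto
    also have "\<dots> = ennreal (4 * B * 1)" using B by (simp add: ennreal_double ennreal_plus[symmetric] del: ennreal_plus)
    also have "\<dots> \<le> ennreal (4 * B * exp (rate * t))" using B 0 rate(1) by (intro ennreal_leI mult_left_mono) auto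
    finally show ?case by simp
  next
    case (Suc n)
    have "nsq M (\<lambda>\<omega>. f (Suc (Suc n)) t x \<omega> - f (Suc n) t x \<omega>) \<le> ennreal (4 * B * (1/4) ^ n / 4 * exp (rate * t))"
      by (rule contraction[OF pf pf Suc.prems wf[OF Suc.prems] wf[OF Suc.prems] _ Suc.IH]) (use B in auto)
    then show ?case by simp
  qed
  \<comment> \<open>The weight is bounded by its value at \<open>T\<close>, since
    \<open>L2_limit\<close> works with a constant at each fixed point.\<close>
  define D where "D = 4 * B * exp (rate * T)"
  have D: "0 \<le> D" using B by (simp add: D_def)
  have incD: "nsq M (\<lambda>\<omega>. f (Suc n) t x \<omega> - f n t x \<omega>) \<le> ennreal (D * (1/4) ^ n)" if t: "t \<in> {0..T}" for n t x
  proof (rule order_trans[OF inc[OF t] ennreal_leI])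
    have "4 * B * (1/4) ^ n * exp (rate * t) \<le> 4 * B * (1/4) ^ n * exp (rate * T)"
      using t B rate(1) by (intro mult_left_mono) auto
    then show "4 * B * (1/4) ^ n * exp (rate * t) \<le> D * (1/4) ^ n" by (simp add: D_def mult_ac)
  qed
  define u where "u t x \<omega> = lim (\<lambda>n. f n t x \<omega>)" for t x \<omega>
  have pu: "predictable_field M F T u"
  proof -
    have "(\<lambda>p. lim (\<lambda>n. (\<lambda>(s, y, \<omega>). f n s y \<omega>) p)) \<in> borel_measurable (predictable_algebra M F T)"
      using pf unfolding predictable_field_def by (intro borel_measurable_lim_metric) auto
    then show ?thesis by (simp add: predictable_field_def u_def split_beta)
  qed
  have um: "u t x \<in> borel_measurable M" if "t \<in> {0..T}" for t x by (rule pred_section_measurable[OF pu that])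
  have uf: "nsq M (\<lambda>\<omega>. u t x \<omega> - f n t x \<omega>) \<le> ennreal (4 * D * (1/4) ^ n)" if t: "t \<in> {0..T}" for n t x
    unfolding u_def by (rule L2_limit_bound[OF fm[OF t] D incD[OF t]])
  have ulim: "AE \<omega> in M. (\<lambda>n. f n t x \<omega>) \<longlonglongrightarrow> u t x \<omega>" if t: "t \<in> {0..T}" for t x
    using L2_limit_AE[OF fm[OF t] D incD[OF t]] by eventually_elim (simp add: u_def convergent_LIMSEQ_iff)
  \<comment> \<open>The bounds are the same for all iterates, so Fatou's lemma gives them to the
    limit.\<close>
  have mu: "moments_le u m" if m: "0 < m" for m
    unfolding moments_le_def
  proof (intro ballI allI)
    fix t x :: real assume t: "t \<in> {0..T}"
    have "(\<integral>\<^sup>+\<omega>. ennreal (u t x \<omega> ^ (2 * m)) \<partial>M) = (\<integral>\<^sup>+\<omega>. liminf (\<lambda>n. ennreal (f n t x \<omega> ^ (2 * m))) \<partial>M)"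
    proof (rule nn_integral_cong_AE)
      show "AE \<omega> in M. ennreal (u t x \<omega> ^ (2 * m)) = liminf (\<lambda>n. ennreal (f n t x \<omega> ^ (2 * m)))"
        using ulim[OF t, of x]
      proof eventually_elim
        case (elim \<omega>)
        then have "(\<lambda>n. ennreal (f n t x \<omega> ^ (2 * m))) \<longlonglongrightarrow> ennreal (u t x \<omega> ^ (2 * m))" by (intro tendsto_intros)
        then show ?case by (rule lim_imp_Liminf[OF trivial_limit_sequentially, symmetric])
      qed
    qed
    also have "\<dots> \<le> liminf (\<lambda>n. \<integral>\<^sup>+\<omega>. ennreal (f n t x \<omega> ^ (2 * m)) \<partial>M)"
      by (intro nn_integral_liminf measurable_compose[OF _ measurable_ennreal] borel_measurable_power fm[OF t])
    also have "\<dots> \<le> liminf (\<lambda>n. ennreal (exp (moment_rate m * t) ^ m))"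
      using mf[OF m] t unfolding moments_le_def by (intro Liminf_mono always_eventually) blast
    also have "\<dots> = ennreal (exp (moment_rate m * t) ^ m)" by (simp add: Liminf_const)
    finally show "(\<integral>\<^sup>+\<omega>. ennreal (u t x \<omega> ^ (2 * m)) \<partial>M) \<le> ennreal (exp (moment_rate m * t) ^ m)" .
  qed
  have "has_walsh_integral M F W t (integrand u t x) (u t x)" if t: "t \<in> {0..T}" for t x
  proof -
    have t0: "0 \<le> t" using t by simp
    let ?I = "walsh_integral M F W t (integrand u t x)"
    have I: "has_walsh_integral M F W t (integrand u t x) ?I"
      by (rule walsh_integral_has[OF t0 integrand_integrable[OF pu exp_ge_zero nsq_moments[OF mu[OF zero_less_one]] t]])
    have Im: "?I \<in> borel_measurable M" by (rule walsh_measurable[OF I])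
    \<comment> \<open>The sequence is constant in \<open>n\<close>; domination by null sequences
      shows that the constant is 0.\<close>
    have "(\<lambda>n :: nat. nsq M (\<lambda>\<omega>. u t x \<omega> - ?I \<omega>)) \<longlonglongrightarrow> 0"
    proof (rule tendsto_0_sandwich[OF _ geometric_ennreal_tendsto_0 geometric_ennreal_tendsto_0])
      fix n
      have "nsq M (\<lambda>\<omega>. u t x \<omega> - ?I \<omega>) \<le> 2 * nsq M (\<lambda>\<omega>. u t x \<omega> - f (Suc n) t x \<omega>) + 2 * nsq M (\<lambda>\<omega>. f (Suc n) t x \<omega> - ?I \<omega>)"
        by (rule nsq_triangle[OF um[OF t] fm[OF t] Im])
      also have "\<dots> \<le> 2 * ennreal ((4 * D * (1/4)) * (1/4) ^ n) + 2 * ennreal ((D * exp (rate * T)) * (1/4) ^ n)"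
      proof (intro add_mono mult_left_mono)
        show "nsq M (\<lambda>\<omega>. u t x \<omega> - f (Suc n) t x \<omega>) \<le> ennreal ((4 * D * (1/4)) * (1/4) ^ n)"
          using uf[OF t, of x "Suc n"] by (simp add: mult_ac)
        have "nsq M (\<lambda>\<omega>. f (Suc n) t x \<omega> - ?I \<omega>) \<le> ennreal (4 * D * (1/4) ^ n / 4 * exp (rate * t))"
        proof (rule contraction[OF pf pu t wf[OF t] I])
          fix s y assume s: "s \<in> {0..T}"
          have "nsq M (\<lambda>\<omega>. f n s y \<omega> - u s y \<omega>) \<le> ennreal (4 * D * (1/4) ^ n * 1)"
            using uf[OF s, of y n] by (simp add: nsq_commute[of M "f n s y"])
          also have "\<dots> \<le> ennreal (4 * D * (1/4) ^ n * exp (rate * s))"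
            using s D rate(1) by (intro ennreal_leI mult_left_mono) auto
          finally show "nsq M (\<lambda>\<omega>. f n s y \<omega> - u s y \<omega>) \<le> ennreal (4 * D * (1/4) ^ n * exp (rate * s))" .
        qed (use D in auto)
        also have "\<dots> \<le> ennreal ((D * exp (rate * T)) * (1/4) ^ n)"
        proof (rule ennreal_leI)
          have "D * (1/4) ^ n * exp (rate * t) \<le> D * (1/4) ^ n * exp (rate * T)" using t D rate(1) by (intro mult_left_mono) auto
          then show "4 * D * (1/4) ^ n / 4 * exp (rate * t) \<le> (D * exp (rate * T)) * (1/4) ^ n" by (simp add: mult_ac)
        qed
        finally show "nsq M (\<lambda>\<omega>. f (Suc n) t x \<omega> - ?I \<omega>) \<le> ennreal ((D * exp (rate * T)) * (1/4) ^ n)" .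
      qed auto
      finally show "nsq M (\<lambda>\<omega>. u t x \<omega> - ?I \<omega>) \<le> 2 * ennreal ((4 * D * (1/4)) * (1/4) ^ n) + 2 * ennreal ((D * exp (rate * T)) * (1/4) ^ n)" .
    qed
    then have "nsq M (\<lambda>\<omega>. u t x \<omega> - ?I \<omega>) = 0" by (simp add: LIMSEQ_const_iff)
    then have "AE \<omega> in M. u t x \<omega> - ?I \<omega> = 0" using um[OF t] Im by (intro nsq_zero_AE) auto
    then have "AE \<omega> in M. u t x \<omega> = ?I \<omega>" by eventually_elim simp
    then show ?thesis by (rule walsh_cong_AE[OF I um[OF t]])
  qed
  then have "mild_solution M F W G \<sigma> T u" unfolding mild_solution_iff using pu by blast
  then show ?thesis using even_moments_bounded[OF pu mu] by blast
qed

text \<open>The moment bound with exponent 2 supplies a finite starting distance. The contraction,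
  applied to the pair of solutions itself, divides this distance by 4 any number of times.\<close>

lemma solution_unique:
  assumes u: "mild_solution M F W G \<sigma> T u" "bounded_moments M T u" and v: "mild_solution M F W G \<sigma> T v" "bounded_moments M T v"
  shows "modification_on M T u v"
proof -
  have pu: "predictable_field M F T u" and pv: "predictable_field M F T v"
    and wu: "\<And>t x. t \<in> {0..T} \<Longrightarrow> has_walsh_integral M F W t (integrand u t x) (u t x)"
    and wv: "\<And>t x. t \<in> {0..T} \<Longrightarrow> has_walsh_integral M F W t (integrand v t x) (v t x)"
    using u(1) v(1) unfolding mild_solution_iff by blast+
  obtain C where C: "0 \<le> C" "\<And>t x. t \<in> {0..T} \<Longrightarrow> nsq M (u t x) \<le> ennreal C" using bounded_moments_nsq[OF u(2)] by blast
  obtain D where D: "0 \<le> D" "\<And>t x. t \<in> {0..T} \<Longrightarrow> nsq M (v t x) \<le> ennreal D" using bounded_moments_nsq[OF v(2)] by blast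
  have um: "u t x \<in> borel_measurable M" "v t x \<in> borel_measurable M" if "t \<in> {0..T}" for t x
    using pred_section_measurable[OF pu that] pred_section_measurable[OF pv that] by auto
  have b: "nsq M (\<lambda>\<omega>. u t x \<omega> - v t x \<omega>) \<le> ennreal ((2 * C + 2 * D) * (1/4) ^ n * exp (rate * t))" if "t \<in> {0..T}" for n t x
    using that
  proof (induction n arbitrary: t x)
    case 0
    have "nsq M (\<lambda>\<omega>. u t x \<omega> + - v t x \<omega>) \<le> 2 * nsq M (u t x) + 2 * nsq M (\<lambda>\<omega>. - v t x \<omega>)"
      using um[OF 0] by (intro nsq_add) auto
    also have "\<dots> \<le> 2 * ennreal C + 2 * ennreal D" unfolding nsq_uminus by (intro add_mono mult_left_mono C(2)[OF 0] D(2)[OF 0]) auto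
    also have "\<dots> = ennreal ((2 * C + 2 * D) * 1)" using C D by (simp add: ennreal_mult)
    also have "\<dots> \<le> ennreal ((2 * C + 2 * D) * exp (rate * t))" using C D 0 rate(1) by (intro ennreal_leI mult_left_mono) auto
    finally show ?case by simp
  next
    case (Suc n)
    have "nsq M (\<lambda>\<omega>. u t x \<omega> - v t x \<omega>) \<le> ennreal ((2 * C + 2 * D) * (1/4) ^ n / 4 * exp (rate * t))"
      by (rule contraction[OF pu pv Suc.prems wu[OF Suc.prems] wv[OF Suc.prems] _ Suc.IH]) (use C D in auto)
    then show ?case by simp
  qed
  show ?thesis
    unfolding modification_on_def
  proof (intro ballI allI)
    fix t x assume t: "t \<in> {0..T}"
    have "(\<lambda>n :: nat. nsq M (\<lambda>\<omega>. u t x \<omega> - v t x \<omega>)) \<longlonglongrightarrow> 0"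
    proof (rule tendsto_0_scaled[OF _ geometric_ennreal_tendsto_0])
      fix n
      show "nsq M (\<lambda>\<omega>. u t x \<omega> - v t x \<omega>) \<le> ennreal 1 * ennreal (((2 * C + 2 * D) * exp (rate * t)) * (1/4) ^ n)"
        using b[OF t, of x n] by (simp add: mult_ac)
    qed simp
    then have "nsq M (\<lambda>\<omega>. u t x \<omega> - v t x \<omega>) = 0" by (simp add: LIMSEQ_const_iff)
    then have "AE \<omega> in M. u t x \<omega> - v t x \<omega> = 0" using um[OF t] by (intro nsq_zero_AE) auto
    then show "AE \<omega> in M. u t x \<omega> = v t x \<omega>" by eventually_elim simp
  qed
qed

end

theorem proposition2p5:
  fixes M :: "'w measure"
    and F :: "real \<Rightarrow> 'w measure"
    and W :: "real \<Rightarrow> real set \<Rightarrow> 'w \<Rightarrow> real"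
    and \<sigma> :: "real \<Rightarrow> real"
    and a1 a2 r1 r2 T :: real
  assumes "a1 > 0" and "a2 > 0" and "r1 > 0" and "r2 > 0"
    and "prob_space M"
    and "usual_conditions M F"
    and "white_noise M W"
    and "\<And>t. t \<ge> 0 \<Longrightarrow> sets (F t) = augmented_noise_sets M W t"
    and "T > 0"
    and "\<exists>K>0. K-lipschitz_on UNIV \<sigma>"
  shows "\<exists>u. mild_solution M F W (fund_sol a1 a2 r1 r2) \<sigma> T u \<and> bounded_moments M T u \<and>
    (\<forall>v. mild_solution M F W (fund_sol a1 a2 r1 r2) \<sigma> T v \<and> bounded_moments M T v
       \<longrightarrow> modification_on M T u v)"
proof -
  obtain K where K: "K > 0" "K-lipschitz_on UNIV \<sigma>" using assms(10) by blast
  interpret walsh_equation M F W a1 a2 r1 r2 \<sigma> T K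
    using assms K by (intro walsh_equation.intro noise_space.intro skew_kernel.intro noise_space_axioms.intro walsh_equation_axioms.intro)
  show ?thesis using solution_exists solution_unique by blast
qed

end
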